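(* Let the data satisfy (C1)-(C5) of the context. Let $(v_0,\dots,v_n)$ be a weak solution of $$\partial_tv_i=\operatorname{div}(v_0\nabla v_i-v_i\nabla v_0)\ (i=1,\dots,n),\qquad v_0=1-\sum_{i=1}^nv_i\quad\text{in }\Omega\times(0,T),$$ and $(u_0,\dots,u_n)$ a weak solution of the perturbed system $$\partial_tu_i-\operatorname{div}(u_0\nabla u_i-u_i\nabla u_0)=R_i\ (i=1,\dots,n),\qquad\sum_{i=0}^nu_i=1\quad\text{in }\Omega\times(0,T),$$ with $R_i\in L^2(0,T;H^1_D(\Omega)')$, with the boundary conditions of the context and initial values $v_i^0$, $u_i^0$ respectively. Assume that $u_i=v_i^D$ on $\Gamma_D$ for all $i$ and that $\nabla u_0\in X(q)$ for some $q>d$. Then for $i=1,\dots,n$ $$\max_{t\in[0,T]}\|u_i-v_i\|_{L^2(\Omega)}^2+\int_0^T\|\sqrt{v_0}\,\nabla(u_i-v_i)\|_{L^2(\Omega)}^2dt\le\Big(2\|u_i^0-v_i^0\|_{L^2(\Omega)}^2+\frac{12}\gamma\|v_0-u_0\|_{L^\infty([0,T]\times\Omega)}^2\|\nabla u_i\|_{L^2([0,T]\times\Omega)}^2$$ $$+\frac{12}\gamma\|\nabla(u_0-v_0)\|_{L^2([0,T]\times\Omega)}^2+\frac{12}\gamma\|R_i\|_{L^2(0,T;H^1_D(\Omega)')}^2\Big)\exp\left(2C_G^{\frac2{1-\theta}}(1+C_{F,2,\Gamma_D}^2)^{\frac\theta{1-\theta}}\frac\mu{\gamma^{\frac{1+\theta}{1-\theta}}}\|\nabla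 u_0\|_{X(q)}^{\frac2{1-\theta}}\right),$$ where $\frac1p+\frac1q=\frac12$, $\theta=\frac d2-\frac dp$ and $\mu=\frac{1-\theta}2\left(\frac1{2(1+\theta)}\right)^{\frac{\theta+1}{\theta-1}}$.
   Context: **Conditions.** (C1) $\Omega\subset\mathbb{R}^d$ ($d\in\{2,3\}$) is an open bounded domain with polygonal boundary; $\Gamma_D,\Gamma_N$ disjoint, $\partial\Omega=\Gamma_D\cup\Gamma_N$, $\Gamma_N$ open, $|\Gamma_D|>0$. (C2) $v_0^0,\dots,v_n^0\in L^\infty(\Omega)\cap H^1(\Omega)$, $v_i^0>0$ for $i\ge1$, $\sum_{i=0}^nv_i^0=1$. (C3) The Dirichlet data $v_i^D$, $i=0,\dots,n$, are constant in time and on connected components of $\Gamma_D$. (C4) $\gamma>0$ and $\gamma<v_0^0(x)\le1$ for all $x\in\Omega$; throughout, $\gamma<v_0(t,x)\le1$ on $[0,T]\times\Omega$ (the paper deduces this from (C4) since $v_0$ solves the diffusion equation). (C5) Equal diffusion coefficients (normalized to $1$) and equal charges (here zero). **Boundary and initial conditions.** $(v_0\nabla v_i-v_i\nabla v_0)\cdot n=0$ on $\Gamma_N$, $v_i=v_i^D$ on $\Gamma_D$, $v_i(\cdot,0)=v_i^0$. For the perturbed solution the Dirichlet condition is as in the claim and any violation of the Neumann condition is included in $R_i$; $u_i(\cdot,0)=u_i^0$. **Weak solutions.** $H^1_D(\Omega)=\{u\in H^1(\Omega):u=0\text{ on }\Gamma_D\}$ with norm $\|\nabla\cdot\|_{L^2(\Omega)}$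 and dual $H^1_D(\Omega)'$. A weak solution has $v_i:(0,T)\times\Omega\to[0,1]$, $\sum_{i=0}^nv_i=1$, $v_i\in L^2(0,T;H^1(\Omega))$ (given the lower bound on $v_0$), $\partial_tv_i\in L^2(0,T;H^1_D(\Omega)')$, and $\int_0^T\langle\partial_tv_i,\phi\rangle dt+\int_0^T\int_\Omega(v_0\nabla v_i-v_i\nabla v_0)\cdot\nabla\phi\,dxdt=0$ for all $\phi\in L^2(0,T;H^1_D(\Omega))$, $i=1,\dots,n$. For the perturbed system the functions $u_i$ have the same regularity in time and space ($u_i\in L^2(0,T;H^1(\Omega))$, $\partial_tu_i\in L^2(0,T;H^1_D(\Omega)')$) and the weak formulation has right-hand side $\int_0^T\langle R_i,\phi\rangle dt$. **Notation.** $X(q)=L^{\frac{2q}{q-d}}(0,T;L^q(\Omega))$. $C_{F,2,\Gamma_D}$: $\|u\|_{L^2(\Omega)}\le C_{F,2,\Gamma_D}\|\nabla u\|_{L^2(\Omega)}$ on $H^1_D(\Omega)$. $C_G$: Gagliardo-Nirenberg constant, $\|u\|_{L^p(\Omega)}\le C_G\|u\|_{H^1(\Omega)}^\theta\|u\|_{L^2(\Omega)}^{1-\theta}$ for $u\in H^1(\Omega)$. *)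

theory Defs
  imports "HOL-Probability.Essential_Supremum"
begin

section \<open>Surface measure\<close>

text \<open>
  Hausdorff measure \<open>H\<^sup>s\<close> for \<open>s > 0\<close>, normalised so that on a \<open>k\<close>-dimensional affine subspace
  \<open>H\<^sup>k\<close> is the \<open>k\<close>-dimensional Lebesgue measure.  The case \<open>s = 0\<close> is not covered (it would need
  \<open>0\<^sup>0 = 1\<close>, whereas \<open>0 powr 0 = 0\<close>).
\<close>

definition hausdorff_delta :: "real \<Rightarrow> real \<Rightarrow> 'a::metric_space set \<Rightarrow> ennreal" where
  "hausdorff_delta s \<delta> A =
     (INF U \<in> {U :: nat \<Rightarrow> 'a set. A \<subseteq> (\<Union>k. U k) \<and> (\<forall>k. bounded (U k) \<and> diameter (U k) \<le> \<delta>)}.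
        \<Sum>k. ennreal (unit_ball_vol s * (diameter (U k) / 2) powr s))"

definition hausdorff_outer :: "real \<Rightarrow> 'a::metric_space set \<Rightarrow> ennreal" where
  "hausdorff_outer s A = (SUP \<delta> \<in> {0<..}. hausdorff_delta s \<delta> A)"

definition hausdorff_measure :: "real \<Rightarrow> 'a::metric_space measure" where
  "hausdorff_measure s = measure_of UNIV (sets borel) (hausdorff_outer s)"

lemma hausdorff_delta_antimono:
  "\<delta> \<le> \<delta>' \<Longrightarrow> hausdorff_delta s \<delta>' A \<le> hausdorff_delta s \<delta> A"
  unfolding hausdorff_delta_def
  by (rule INF_superset_mono) (auto intro: order_trans)

lemma hausdorff_delta_mono: "A \<subseteq> B \<Longrightarrow> hausdorff_delta s \<delta> A \<le> hausdorff_delta s \<delta> B"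
  unfolding hausdorff_delta_def by (rule INF_superset_mono) auto

lemma hausdorff_delta_le_outer: "0 < \<delta> \<Longrightarrow> hausdorff_delta s \<delta> A \<le> hausdorff_outer s A"
  unfolding hausdorff_outer_def by (rule SUP_upper) simp

lemma hausdorff_outer_mono: "A \<subseteq> B \<Longrightarrow> hausdorff_outer s A \<le> hausdorff_outer s B"
  unfolding hausdorff_outer_def by (rule SUP_mono) (auto intro: hausdorff_delta_mono)

lemma hausdorff_outer_empty: "hausdorff_outer s {} = 0"
proof -
  have "hausdorff_delta s \<delta> ({} :: 'a set) = 0" if "\<delta> > 0" for \<delta>
  proof -
    have "hausdorff_delta s \<delta> ({} :: 'a set)
        \<le> (\<Sum>k::nat. ennreal (unit_ball_vol s * (diameter ({} :: 'a set) / 2) powr s))"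
      unfolding hausdorff_delta_def
      by (rule INF_lower2[where i="\<lambda>_. {}"]) (use that in auto)
    then show ?thesis by simp
  qed
  then show ?thesis unfolding hausdorff_outer_def by simp
qed

lemma hausdorff_delta_subadditive:
  "hausdorff_delta s \<delta> (\<Union>i::nat. A i) \<le> (\<Sum>i. hausdorff_delta s \<delta> (A i))"
proof (cases "(\<Sum>i. hausdorff_delta s \<delta> (A i)) = \<infinity>")
  case True
  then show ?thesis by simp
next
  case False
  let ?c = "\<lambda>V. ennreal (unit_ball_vol s * (diameter V / 2) powr s)"
  let ?\<C> = "\<lambda>A. {U :: nat \<Rightarrow> 'a set. A \<subseteq> (\<Union>k. U k) \<and> (\<forall>k. bounded (U k) \<and> diameter (U k) \<le> \<delta>)}"
  show ?thesis
  proof (rule ennreal_le_epsilon)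
    fix e :: real assume e: "0 < e"
    have fin: "hausdorff_delta s \<delta> (A i) < \<infinity>" for i
    proof -
      have "hausdorff_delta s \<delta> (A i) \<le> (\<Sum>i. hausdorff_delta s \<delta> (A i))"
        using sum_le_suminf[of "\<lambda>i. hausdorff_delta s \<delta> (A i)" "{i}"] by simp
      then show ?thesis using False by (auto simp: less_top top_unique)
    qed
    have "\<exists>U \<in> ?\<C> (A i). (\<Sum>k. ?c (U k)) \<le> hausdorff_delta s \<delta> (A i) + ennreal (e * (1/2) ^ Suc i)" for i
    proof -
      have "hausdorff_delta s \<delta> (A i) < hausdorff_delta s \<delta> (A i) + ennreal (e * (1/2) ^ Suc i)"
        using ennreal_add_left_cancel_less[of "hausdorff_delta s \<delta> (A i)" 0 "ennreal (e * (1/2) ^ Suc i)"]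
          fin[of i] e by simp
      then obtain U where "U \<in> ?\<C> (A i)"
          "(\<Sum>k. ?c (U k)) < hausdorff_delta s \<delta> (A i) + ennreal (e * (1/2) ^ Suc i)"
        unfolding hausdorff_delta_def INF_less_iff by blast
      then show ?thesis by (intro bexI[of _ U]) auto
    qed
    then have "\<forall>i. \<exists>U. U \<in> ?\<C> (A i) \<and> (\<Sum>k. ?c (U k)) \<le> hausdorff_delta s \<delta> (A i) + ennreal (e * (1/2) ^ Suc i)"
      by blast
    from choice[OF this] obtain U where U: "\<And>i. U i \<in> ?\<C> (A i)"
      and Ule: "\<And>i. (\<Sum>k. ?c (U i k)) \<le> hausdorff_delta s \<delta> (A i) + ennreal (e * (1/2) ^ Suc i)"
      by blast
    let ?V = "\<lambda>m. U (fst (prod_decode m)) (snd (prod_decode m))"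
    have cov: "(\<Union>i. A i) \<subseteq> (\<Union>m. ?V m)"
    proof
      fix x assume "x \<in> (\<Union>i. A i)"
      then obtain i where "x \<in> A i" by auto
      then obtain k where "x \<in> U i k" using U[of i] by blast
      then have "x \<in> ?V (prod_encode (i, k))" by simp
      then show "x \<in> (\<Union>m. ?V m)" by (rule UN_I[OF UNIV_I])
    qed
    have "bounded (?V m) \<and> diameter (?V m) \<le> \<delta>" for m
      using U[of "fst (prod_decode m)"] by simp
    with cov have "?V \<in> ?\<C> (\<Union>i. A i)" by simp
    then have "hausdorff_delta s \<delta> (\<Union>i. A i) \<le> (\<Sum>m. ?c (?V m))"
      unfolding hausdorff_delta_def by (rule INF_lower)
    also have "\<dots> = (\<Sum>i. \<Sum>k. ?c (U i k))"
    proof -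
      have "(\<Sum>i. ((\<lambda>(i,k). ?c (U i k)) \<circ> prod_decode) i) = (\<Sum>i. \<Sum>k. ?c (U i k))"
        unfolding o_def by (rule suminf_ennreal_2dimen[unfolded o_def]) simp
      moreover have "((\<lambda>(i,k). ?c (U i k)) \<circ> prod_decode) = (\<lambda>m. ?c (?V m))"
        by (simp add: fun_eq_iff case_prod_beta)
      ultimately show ?thesis by simp
    qed
    also have "\<dots> \<le> (\<Sum>i. hausdorff_delta s \<delta> (A i) + ennreal (e * (1/2) ^ Suc i))"
      by (intro suminf_le Ule summableI)
    also have "\<dots> = (\<Sum>i. hausdorff_delta s \<delta> (A i)) + (\<Sum>i. ennreal (e * (1/2) ^ Suc i))"
      by (rule suminf_add[symmetric]) (auto intro: summableI)
    also have "(\<Sum>i. ennreal (e * (1/2) ^ Suc i)) = ennreal e"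
    proof (rule suminf_ennreal_eq)
      show "(\<lambda>i. e * (1/2) ^ Suc i) sums e"
        using sums_mult[OF power_half_series, of e] by simp
    qed (use e in simp)
    finally show "hausdorff_delta s \<delta> (\<Union>i. A i) \<le> (\<Sum>i. hausdorff_delta s \<delta> (A i)) + ennreal e" .
  qed
qed

lemma hausdorff_outer_subadditive:
  "hausdorff_outer s (\<Union>i::nat. A i) \<le> (\<Sum>i. hausdorff_outer s (A i))"
proof -
  have "hausdorff_delta s \<delta> (\<Union>i. A i) \<le> (\<Sum>i. hausdorff_outer s (A i))" if "\<delta> > 0" for \<delta>
    by (rule order_trans[OF hausdorff_delta_subadditive])
       (intro suminf_le summableI hausdorff_delta_le_outer that)
  then show ?thesis unfolding hausdorff_outer_def[of s "\<Union>i. A i"] by (auto intro: SUP_least)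
qed

lemma hausdorff_outer_measure_space:
  "outer_measure_space UNIV (hausdorff_outer s :: 'a::metric_space set \<Rightarrow> ennreal)"
  unfolding outer_measure_space_def positive_def increasing_def countably_subadditive_def
  by (auto simp: hausdorff_outer_empty hausdorff_outer_mono hausdorff_outer_subadditive)

lemma hausdorff_outer_Un_le:
  fixes A B :: "'a::metric_space set"
  shows "hausdorff_outer s (A \<union> B) \<le> hausdorff_outer s A + hausdorff_outer s B"
proof -
  have "subadditive (Pow UNIV) (hausdorff_outer s :: 'a set \<Rightarrow> ennreal)"
    using hausdorff_outer_measure_space[of s, where 'a='a]
    by (intro ring_of_sets.countably_subadditive_subadditive[OF ring_of_sets_Pow])
       (auto simp: outer_measure_space_def)
  moreover have "A \<union> B = A \<union> (B - A)" by blast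
  ultimately have "hausdorff_outer s (A \<union> B) \<le> hausdorff_outer s A + hausdorff_outer s (B - A)"
    unfolding subadditive_def by (metis Diff_disjoint Pow_UNIV UNIV_I)
  also have "\<dots> \<le> hausdorff_outer s A + hausdorff_outer s B"
    by (intro add_left_mono hausdorff_outer_mono) auto
  finally show ?thesis .
qed

lemma hausdorff_outer_metric:
  assumes r: "0 < r" and sep: "\<And>x y. x \<in> A \<Longrightarrow> y \<in> B \<Longrightarrow> r \<le> dist x y"
  shows "hausdorff_outer s A + hausdorff_outer s B \<le> hausdorff_outer s (A \<union> B)"
proof -
  let ?c = "\<lambda>V. ennreal (unit_ball_vol s * (diameter V / 2) powr s)"
  let ?\<C> = "\<lambda>\<delta> A. {U :: nat \<Rightarrow> 'a set. A \<subseteq> (\<Union>k. U k) \<and> (\<forall>k. bounded (U k) \<and> diameter (U k) \<le> \<delta>)}"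
  have small: "hausdorff_delta s \<delta> A + hausdorff_delta s \<delta> B \<le> hausdorff_delta s \<delta> (A \<union> B)"
    if \<delta>: "0 < \<delta>" "\<delta> < r" for \<delta>
  proof (subst (3) hausdorff_delta_def, rule INF_greatest)
    fix U :: "nat \<Rightarrow> 'a set" assume U: "U \<in> ?\<C> \<delta> (A \<union> B)"
    define P where "P C k = (if U k \<inter> C = {} then {} else U k)" for C k
    have P: "hausdorff_delta s \<delta> C \<le> (\<Sum>k. ?c (P C k))" if C: "C \<subseteq> A \<union> B" for C
      unfolding hausdorff_delta_def
    proof (rule INF_lower)
      have "C \<subseteq> (\<Union>k. P C k)"
      proof
        fix x assume "x \<in> C"
        then obtain k where "x \<in> U k" using U C by blast
        then have "x \<in> P C k" using \<open>x \<in> C\<close> unfolding P_def by auto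
        then show "x \<in> (\<Union>k. P C k)" by blast
      qed
      then show "P C \<in> ?\<C> \<delta> C" using U \<delta> unfolding P_def by auto
    qed
    have one: "?c (P A k) + ?c (P B k) \<le> ?c (U k)" for k
    proof -
      have "U k \<inter> A = {} \<or> U k \<inter> B = {}"
      proof (rule ccontr)
        assume "\<not> ?thesis"
        then obtain x y where "x \<in> A" "y \<in> B" "x \<in> U k" "y \<in> U k" by blast
        moreover have "bounded (U k)" "diameter (U k) \<le> \<delta>" using U by auto
        ultimately have "dist x y \<le> \<delta>" by (meson diameter_bounded_bound order_trans)
        with sep[OF \<open>x \<in> A\<close> \<open>y \<in> B\<close>] \<delta> show False by simp
      qed
      then show ?thesis unfolding P_def by auto
    qed
    have "hausdorff_delta s \<delta> A + hausdorff_delta s \<delta> B \<le> (\<Sum>k. ?c (P A k)) + (\<Sum>k. ?c (P B k))"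
      by (intro add_mono P) auto
    also have "\<dots> = (\<Sum>k. ?c (P A k) + ?c (P B k))"
      by (rule suminf_add) (auto intro: summableI)
    also have "\<dots> \<le> (\<Sum>k. ?c (U k))" by (intro suminf_le one summableI)
    finally show "hausdorff_delta s \<delta> A + hausdorff_delta s \<delta> B \<le> (\<Sum>k. ?c (U k))" .
  qed
  have "hausdorff_delta s \<delta> A + hausdorff_delta s \<delta>' B \<le> hausdorff_outer s (A \<union> B)"
    if "0 < \<delta>" "0 < \<delta>'" for \<delta> \<delta>'
  proof -
    define \<epsilon> where "\<epsilon> = min (min \<delta> \<delta>') (r / 2)"
    have \<epsilon>: "0 < \<epsilon>" "\<epsilon> \<le> \<delta>" "\<epsilon> \<le> \<delta>'" "\<epsilon> < r" using that r unfolding \<epsilon>_def by auto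
    have "hausdorff_delta s \<delta> A + hausdorff_delta s \<delta>' B \<le> hausdorff_delta s \<epsilon> A + hausdorff_delta s \<epsilon> B"
      by (intro add_mono hausdorff_delta_antimono \<epsilon>)
    also have "\<dots> \<le> hausdorff_delta s \<epsilon> (A \<union> B)" by (intro small \<epsilon>)
    also have "\<dots> \<le> hausdorff_outer s (A \<union> B)" by (intro hausdorff_delta_le_outer \<epsilon>)
    finally show ?thesis .
  qed
  then have "hausdorff_outer s A + hausdorff_delta s \<delta>' B \<le> hausdorff_outer s (A \<union> B)" if "0 < \<delta>'" for \<delta>'
    unfolding hausdorff_outer_def[of s A] using that
    by (subst ennreal_SUP_add_left[symmetric]) (auto intro!: SUP_least)
  then show ?thesis
    unfolding hausdorff_outer_def[of s B]
    by (subst add.commute, subst ennreal_SUP_add_left[symmetric])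
       (auto intro!: SUP_least simp: add.commute)
qed

lemma closed_in_hausdorff_lambda_system:
  fixes F :: "'a::metric_space set"
  assumes F: "closed F"
  shows "F \<in> lambda_system UNIV UNIV (hausdorff_outer s)"
proof -
  let ?H = "hausdorff_outer s :: 'a set \<Rightarrow> ennreal"
  have "?H (A \<inter> F) + ?H (A - F) \<le> ?H A" if Ffin: "?H A < \<infinity>" and ne: "F \<noteq> {}" for A
  proof -
    define B where "B n = {x \<in> A. 1 / real (Suc n) \<le> infdist x F}" for n
    define D where "D n = {x \<in> A. 1 / real (Suc (Suc n)) \<le> infdist x F \<and> infdist x F < 1 / real (Suc n)}" for n
    have sepB: "?H (A \<inter> F) + ?H (B n) \<le> ?H A" for n
    proof -
      have "?H (A \<inter> F) + ?H (B n) \<le> ?H ((A \<inter> F) \<union> B n)"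
      proof (rule hausdorff_outer_metric)
        fix x y assume "x \<in> A \<inter> F" "y \<in> B n"
        then show "1 / real (Suc n) \<le> dist x y"
          using infdist_le[of x F y] by (auto simp: B_def dist_commute)
      qed simp
      also have "\<dots> \<le> ?H A" by (rule hausdorff_outer_mono) (auto simp: B_def)
      finally show ?thesis .
    qed
    have D_sep: "?H (\<Union>k<m. D (2 * k + j)) + ?H (D (2 * m + j)) \<le> ?H ((\<Union>k<m. D (2 * k + j)) \<union> D (2 * m + j))" for m j
    proof (rule hausdorff_outer_metric)
      let ?r = "1 / real (2 * m + j) - 1 / real (Suc (2 * m + j))"
      show "0 < (if m = 0 then 1 else ?r)" by (auto simp: divide_simps)
      fix x y assume x: "x \<in> (\<Union>k<m. D (2 * k + j))" and y: "y \<in> D (2 * m + j)"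
      then obtain k where k: "k < m" "1 / real (Suc (Suc (2 * k + j))) \<le> infdist x F" by (auto simp: D_def)
      have "1 / real (2 * m + j) \<le> 1 / real (Suc (Suc (2 * k + j)))"
        using k(1) by (intro divide_left_mono) auto
      with k have "1 / real (2 * m + j) \<le> infdist x F" by linarith
      moreover have "infdist y F < 1 / real (Suc (2 * m + j))" using y by (auto simp: D_def)
      moreover have "infdist x F \<le> infdist y F + dist x y" by (rule infdist_triangle)
      ultimately show "(if m = 0 then 1 else ?r) \<le> dist x y" using k by auto
    qed
    have D_sum: "(\<Sum>k<m. ?H (D (2 * k + j))) \<le> ?H (\<Union>k<m. D (2 * k + j))" for m j
    proof (induction m)
      case 0
      then show ?case by (simp add: hausdorff_outer_empty)
    next
      case (Suc m)
      then have "(\<Sum>k<Suc m. ?H (D (2 * k + j))) \<le> ?H (\<Union>k<m. D (2 * k + j)) + ?H (D (2 * m + j))"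
        by (simp add: add_right_mono)
      also note D_sep
      also have "(\<Union>k<m. D (2 * k + j)) \<union> D (2 * m + j) = (\<Union>k<Suc m. D (2 * k + j))"
        by (auto simp: less_Suc_eq)
      finally show ?case .
    qed
    have D_sum': "(\<Sum>k<m. ?H (D (2 * k + j))) \<le> ?H A" for m j
      by (rule order_trans[OF D_sum hausdorff_outer_mono]) (auto simp: D_def)
    have split: "(\<Sum>i<2 * m. f i) = (\<Sum>k<m. f (2 * k + 0)) + (\<Sum>k<m. f (2 * k + 1))"
      for f :: "nat \<Rightarrow> ennreal" and m
      by (induction m) (auto simp: algebra_simps)
    have D_all: "(\<Sum>i<m. ?H (D i)) \<le> ?H A + ?H A" for m
    proof -
      have "(\<Sum>i<m. ?H (D i)) \<le> (\<Sum>i<2 * m. ?H (D i))"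
        by (rule sum_mono2) auto
      also have "\<dots> \<le> ?H A + ?H A"
        unfolding split by (intro add_mono D_sum')
      finally show ?thesis .
    qed
    have Dfin: "(\<Sum>i. ?H (D i)) < \<infinity>"
    proof -
      have "(\<Sum>i. ?H (D i)) \<le> ?H A + ?H A"
        by (rule suminf_le_const[OF summableI D_all])
      also have "\<dots> < \<infinity>" using Ffin by simp
      finally show ?thesis .
    qed
    have tail: "(\<lambda>n. \<Sum>i. ?H (D (i + n))) \<longlonglongrightarrow> 0"
    proof -
      define h where "h i = enn2real (?H (D i))" for i
      have "?H (D i) < \<infinity>" for i
        using sum_le_suminf[of "\<lambda>i. ?H (D i)" "{i}"] Dfin by (auto intro: le_less_trans)
      then have h: "?H (D i) = ennreal (h i)" and h0: "0 \<le> h i" for i by (auto simp: h_def)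
      have sm: "summable h"
        using Dfin h h0 by (intro summable_suminf_not_top) (auto simp: less_top)
      have "(\<lambda>n. \<Sum>i. h (i + n)) \<longlonglongrightarrow> 0" by (rule suminf_exist_split2[OF sm])
      then have "(\<lambda>n. ennreal (\<Sum>i. h (i + n))) \<longlonglongrightarrow> ennreal 0" by (rule tendsto_ennrealI)
      moreover have "(\<Sum>i. ?H (D (i + n))) = ennreal (\<Sum>i. h (i + n))" for n
        unfolding h by (rule suminf_ennreal2) (use h0 sm in \<open>auto simp: summable_iff_shift\<close>)
      ultimately show ?thesis by simp
    qed
    have cover: "A - F \<subseteq> B n \<union> (\<Union>i. D (i + n))" for n
    proof
      fix x assume x: "x \<in> A - F"
      then have pos: "0 < infdist x F"
        using F ne in_closed_iff_infdist_zero[of F x] infdist_nonneg[of x F] by force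
      show "x \<in> B n \<union> (\<Union>i. D (i + n))"
      proof (cases "x \<in> B n")
        case False
        let ?P = "\<lambda>m. 1 / real (Suc m) \<le> infdist x F"
        obtain m where m: "?P m"
          using reals_Archimedean[OF pos] unfolding inverse_eq_divide by (metis less_imp_le)
        define k where "k = (LEAST m. ?P m)"
        have k: "?P k" unfolding k_def by (rule LeastI[of ?P, OF m])
        have kn: "n < k"
        proof (rule ccontr)
          assume "\<not> n < k"
          then have "1 / real (Suc n) \<le> 1 / real (Suc k)" by (intro divide_left_mono) auto
          with k x False show False by (auto simp: B_def)
        qed
        then obtain l where l: "k = Suc (l + n)" by (metis add.commute less_imp_Suc_add)
        have "\<not> ?P (l + n)" using not_less_Least[of "l + n" ?P] l k_def by simp
        then have "x \<in> D (l + n)" using k l x by (auto simp: D_def not_le)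
        then show ?thesis by blast
      qed simp
    qed
    have bound: "?H (A \<inter> F) + ?H (A - F) \<le> ?H A + (\<Sum>i. ?H (D (i + n)))" for n
    proof -
      have "?H (A - F) \<le> ?H (B n) + ?H (\<Union>i. D (i + n))"
        by (rule order_trans[OF hausdorff_outer_mono[OF cover] hausdorff_outer_Un_le])
      also have "\<dots> \<le> ?H (B n) + (\<Sum>i. ?H (D (i + n)))"
        by (intro add_left_mono hausdorff_outer_subadditive)
      finally have "?H (A \<inter> F) + ?H (A - F) \<le> (?H (A \<inter> F) + ?H (B n)) + (\<Sum>i. ?H (D (i + n)))"
        by (simp add: add_left_mono add.assoc)
      also have "\<dots> \<le> ?H A + (\<Sum>i. ?H (D (i + n)))" by (intro add_right_mono sepB)
      finally show ?thesis .
    qed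
    have "(\<lambda>n. ?H A + (\<Sum>i. ?H (D (i + n)))) \<longlonglongrightarrow> ?H A + 0"
      by (intro tendsto_add tail tendsto_const)
    then show ?thesis
      using bound by (intro LIMSEQ_le_const) auto
  qed
  then have "?H (A \<inter> F) + ?H (A - F) \<le> ?H A" for A
    by (cases "F = {}"; cases "?H A = top") (simp_all add: hausdorff_outer_empty less_top)
  moreover have "?H A \<le> ?H (A \<inter> F) + ?H (A - F)" for A
    using hausdorff_outer_Un_le[of s "A \<inter> F" "A - F"] by (simp add: Int_Diff_Un)
  ultimately have "?H (A \<inter> F) + ?H (A - F) = ?H A" for A by (intro antisym)
  then show ?thesis
    unfolding lambda_system_def by (auto simp: Int_commute Diff_eq)
qed

text \<open>The defining set function is countably additive on the Borel sets, so
  \<^const>\<open>measure_of\<close> does not fall back to the zero measure.\<close>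

lemma emeasure_hausdorff_measure:
  fixes A :: "'a::metric_space set"
  assumes "A \<in> sets borel"
  shows "emeasure (hausdorff_measure s) A = hausdorff_outer s A"
proof -
  interpret sigma_algebra "UNIV :: 'a set" "UNIV :: 'a set set"
    using sigma_algebra_Pow[of "UNIV :: 'a set"] by simp
  let ?L = "lambda_system UNIV UNIV (hausdorff_outer s :: 'a set \<Rightarrow> ennreal)"
  have ms: "measure_space UNIV ?L (hausdorff_outer s)"
    by (rule caratheodory_lemma[OF hausdorff_outer_measure_space])
  then have sL: "sigma_algebra UNIV ?L" by (simp add: measure_space_def)
  have "sets borel \<subseteq> ?L"
    unfolding borel_eq_closed
    by (subst sets_measure_of) (auto intro!: sigma_algebra.sigma_sets_subset[OF sL] closed_in_hausdorff_lambda_system)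
  then have "measure_space UNIV (sets (borel :: 'a measure)) (hausdorff_outer s)"
    using measure_down[OF ms] sets.sigma_algebra_axioms[of "borel :: 'a measure"] by simp
  then show ?thesis
    unfolding hausdorff_measure_def using assms
    by (intro emeasure_measure_of_sigma)
       (auto simp: measure_space_def)
qed

lemma sets_hausdorff_measure [simp, measurable_cong]: "sets (hausdorff_measure s) = sets borel"
  unfolding hausdorff_measure_def using sets.sigma_sets_eq[of borel] by simp

section \<open>Domains\<close>

text \<open>Flat (polygonal for \<open>d = 2\<close>, polyhedral for \<open>d = 3\<close>) boundary, made of finitely many
  \<open>(d-1)\<close>-dimensional faces.\<close>

definition polygonal_boundary :: "'a::euclidean_space set \<Rightarrow> bool" where
  "polygonal_boundary \<Omega> \<longleftrightarrow>
     (\<exists>\<F>. finite \<F> \<and> (\<forall>f\<in>\<F>. polytope f \<and> aff_dim f = int DIM('a) - 1) \<and> frontier \<Omega> = \<Union>\<F>)"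

definition mixed_boundary_domain ::
    "'a::euclidean_space set \<Rightarrow> 'a set \<Rightarrow> 'a set \<Rightarrow> bool" where
  "mixed_boundary_domain \<Omega> \<Gamma>\<^sub>D \<Gamma>\<^sub>N \<longleftrightarrow>
     open \<Omega> \<and> connected \<Omega> \<and> bounded \<Omega> \<and> polygonal_boundary \<Omega> \<and>
     \<Gamma>\<^sub>D \<inter> \<Gamma>\<^sub>N = {} \<and> frontier \<Omega> = \<Gamma>\<^sub>D \<union> \<Gamma>\<^sub>N \<and>
     openin (top_of_set (frontier \<Omega>)) \<Gamma>\<^sub>N \<and>
     0 < emeasure (hausdorff_measure (real DIM('a) - 1)) \<Gamma>\<^sub>D"


section \<open>Lebesgue and Bochner spaces\<close>

text \<open>
  Elements of function spaces are represented by functions, not by classes modulo null sets; values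
  outside the set in question are irrelevant.  Norms take values in \<^typ>\<open>ennreal\<close>.
\<close>

definition ennpowr :: "ennreal \<Rightarrow> real \<Rightarrow> ennreal" where
  "ennpowr x r = (if x = \<infinity> then \<infinity> else ennreal (enn2real x powr r))"

definition Lp_norm :: "real \<Rightarrow> 'a::euclidean_space set \<Rightarrow> ('a \<Rightarrow> 'b::real_normed_vector) \<Rightarrow> ennreal" where
  "Lp_norm r \<Omega> f = ennpowr (\<integral>\<^sup>+ x. ennreal (norm (f x) powr r) \<partial>lebesgue_on \<Omega>) (1 / r)"

definition Lp_space :: "real \<Rightarrow> 'a::euclidean_space set \<Rightarrow> ('a \<Rightarrow> 'b::real_normed_vector) set" where
  "Lp_space r \<Omega> = {f \<in> borel_measurable (lebesgue_on \<Omega>). Lp_norm r \<Omega> f < \<infinity>}"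

definition Linf_norm :: "'a::euclidean_space set \<Rightarrow> ('a \<Rightarrow> 'b::real_normed_vector) \<Rightarrow> ennreal" where
  "Linf_norm \<Omega> f = esssup (lebesgue_on \<Omega>) (\<lambda>x. ennreal (norm (f x)))"

definition Linf_space :: "'a::euclidean_space set \<Rightarrow> ('a \<Rightarrow> 'b::real_normed_vector) set" where
  "Linf_space \<Omega> = {f \<in> borel_measurable (lebesgue_on \<Omega>). Linf_norm \<Omega> f < \<infinity>}"

text \<open>
  Bochner spaces \<open>L\<^sup>r(0,T;X)\<close>, where \<open>X\<close> is a space of functions with (semi-)norm \<open>N\<close>.  The Bochner
  integral of the library needs \<open>X\<close> to be a type, whereas here it depends on the domain.
\<close>

definition strongly_measurable ::
    "real \<Rightarrow> 'x::minus set \<Rightarrow> ('x \<Rightarrow> ennreal) \<Rightarrow> (real \<Rightarrow> 'x) \<Rightarrow> bool" where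
  "strongly_measurable T X N f \<longleftrightarrow>
     (\<exists>s. (\<forall>k::nat. simple_function (lebesgue_on {0..T}) (s k) \<and> s k ` {0..T} \<subseteq> X) \<and>
          (AE t in lebesgue_on {0..T}. (\<lambda>k. N (f t - s k t)) \<longlonglongrightarrow> 0))"

definition bochner_norm :: "real \<Rightarrow> real \<Rightarrow> ('x \<Rightarrow> ennreal) \<Rightarrow> (real \<Rightarrow> 'x) \<Rightarrow> ennreal" where
  "bochner_norm r T N f = ennpowr (\<integral>\<^sup>+ t. ennpowr (N (f t)) r \<partial>lebesgue_on {0..T}) (1 / r)"

definition bochner_space ::
    "real \<Rightarrow> real \<Rightarrow> 'x::minus set \<Rightarrow> ('x \<Rightarrow> ennreal) \<Rightarrow> (real \<Rightarrow> 'x) set" where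
  "bochner_space r T X N =
     {f. (AE t in lebesgue_on {0..T}. f t \<in> X) \<and> strongly_measurable T X N f \<and> bochner_norm r T N f < \<infinity>}"


section \<open>Sobolev spaces and traces\<close>

primrec continuously_differentiable :: "nat \<Rightarrow> ('a::euclidean_space \<Rightarrow> real) \<Rightarrow> bool" where
  "continuously_differentiable 0 f \<longleftrightarrow> continuous_on UNIV f"
| "continuously_differentiable (Suc k) f \<longleftrightarrow>
     (\<forall>x. f differentiable (at x)) \<and>
     (\<forall>b\<in>Basis. continuously_differentiable k (\<lambda>x. frechet_derivative f (at x) b))"

definition test_function :: "'a::euclidean_space set \<Rightarrow> ('a \<Rightarrow> real) \<Rightarrow> bool" where
  "test_function \<Omega> \<phi> \<longleftrightarrow>
     (\<forall>k. continuously_differentiable k \<phi>) \<and> compact (closure {x. \<phi> x \<noteq> 0}) \<and> closure {x. \<phi> x \<noteq> 0} \<subseteq> \<Omega>"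

definition has_weak_gradient :: "'a::euclidean_space set \<Rightarrow> ('a \<Rightarrow> real) \<Rightarrow> ('a \<Rightarrow> 'a) \<Rightarrow> bool" where
  "has_weak_gradient \<Omega> u g \<longleftrightarrow>
     (\<forall>\<phi> b. test_function \<Omega> \<phi> \<longrightarrow> b \<in> Basis \<longrightarrow>
        (LINT x|lebesgue_on \<Omega>. u x * frechet_derivative \<phi> (at x) b) =
        - (LINT x|lebesgue_on \<Omega>. (g x \<bullet> b) * \<phi> x))"

definition H1 :: "'a::euclidean_space set \<Rightarrow> ('a \<Rightarrow> real) set" where
  "H1 \<Omega> = {u \<in> Lp_space 2 \<Omega>. \<exists>g \<in> Lp_space 2 \<Omega>. has_weak_gradient \<Omega> u g}"

text \<open>Unique up to null sets for \<open>u \<in> H1 \<Omega>\<close>.\<close>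

definition weak_grad :: "'a::euclidean_space set \<Rightarrow> ('a \<Rightarrow> real) \<Rightarrow> 'a \<Rightarrow> 'a" where
  "weak_grad \<Omega> u = (SOME g. g \<in> Lp_space 2 \<Omega> \<and> has_weak_gradient \<Omega> u g)"

definition H1_norm :: "'a::euclidean_space set \<Rightarrow> ('a \<Rightarrow> real) \<Rightarrow> ennreal" where
  "H1_norm \<Omega> u = ennpowr ((Lp_norm 2 \<Omega> u)\<^sup>2 + (Lp_norm 2 \<Omega> (weak_grad \<Omega> u))\<^sup>2) (1 / 2)"

text \<open>
  The trace of \<open>u \<in> H\<^sup>1(\<Omega>)\<close> on \<open>\<Gamma> \<subseteq> \<partial>\<Omega>\<close> is \<open>g\<close>: the trace operator is the \<open>H\<^sup>1(\<Omega>) \<rightarrow> L\<^sup>2(\<Gamma>)\<close> extension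
  by continuity of the restriction map on \<open>H\<^sup>1(\<Omega>) \<inter> C(closure \<Omega>)\<close>.
\<close>

definition has_trace ::
    "'a::euclidean_space set \<Rightarrow> 'a set \<Rightarrow> ('a \<Rightarrow> real) \<Rightarrow> ('a \<Rightarrow> real) \<Rightarrow> bool" where
  "has_trace \<Omega> \<Gamma> u g \<longleftrightarrow>
     u \<in> H1 \<Omega> \<and> g \<in> borel_measurable (restrict_space borel \<Gamma>) \<and>
     (\<exists>\<phi> :: nat \<Rightarrow> 'a \<Rightarrow> real.
        (\<forall>k. \<phi> k \<in> H1 \<Omega> \<and> continuous_on (closure \<Omega>) (\<phi> k)) \<and>
        (\<lambda>k. H1_norm \<Omega> (\<phi> k - u)) \<longlonglongrightarrow> 0 \<and>
        (\<lambda>k. \<integral>\<^sup>+ x \<in> \<Gamma>. ennreal ((\<phi> k x - g x)\<^sup>2) \<partial>hausdorff_measure (real DIM('a) - 1)) \<longlonglongrightarrow> 0)"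

definition H1D :: "'a::euclidean_space set \<Rightarrow> 'a set \<Rightarrow> ('a \<Rightarrow> real) set" where
  "H1D \<Omega> \<Gamma>\<^sub>D = {u. has_trace \<Omega> \<Gamma>\<^sub>D u (\<lambda>_. 0)}"

definition H1D_norm :: "'a::euclidean_space set \<Rightarrow> ('a \<Rightarrow> real) \<Rightarrow> ennreal" where
  "H1D_norm \<Omega> u = Lp_norm 2 \<Omega> (weak_grad \<Omega> u)"

definition H1D_dual_norm ::
    "'a::euclidean_space set \<Rightarrow> 'a set \<Rightarrow> (('a \<Rightarrow> real) \<Rightarrow> real) \<Rightarrow> ennreal" where
  "H1D_dual_norm \<Omega> \<Gamma>\<^sub>D F = (SUP u \<in> {u \<in> H1D \<Omega> \<Gamma>\<^sub>D. H1D_norm \<Omega> u \<le> 1}. ennreal \<bar>F u\<bar>)"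

definition H1D_dual :: "'a::euclidean_space set \<Rightarrow> 'a set \<Rightarrow> (('a \<Rightarrow> real) \<Rightarrow> real) set" where
  "H1D_dual \<Omega> \<Gamma>\<^sub>D =
     {F. (\<forall>u \<in> H1D \<Omega> \<Gamma>\<^sub>D. \<forall>w \<in> H1D \<Omega> \<Gamma>\<^sub>D. \<forall>a b. F (\<lambda>x. a * u x + b * w x) = a * F u + b * F w) \<and>
         H1D_dual_norm \<Omega> \<Gamma>\<^sub>D F < \<infinity>}"


section \<open>Weak solutions\<close>

abbreviation L2_H1 :: "real \<Rightarrow> 'a::euclidean_space set \<Rightarrow> (real \<Rightarrow> 'a \<Rightarrow> real) set" where
  "L2_H1 T \<Omega> \<equiv> bochner_space 2 T (H1 \<Omega>) (H1_norm \<Omega>)"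

abbreviation L2_H1D ::
    "real \<Rightarrow> 'a::euclidean_space set \<Rightarrow> 'a set \<Rightarrow> (real \<Rightarrow> 'a \<Rightarrow> real) set" where
  "L2_H1D T \<Omega> \<Gamma>\<^sub>D \<equiv> bochner_space 2 T (H1D \<Omega> \<Gamma>\<^sub>D) (H1D_norm \<Omega>)"

abbreviation L2_H1D_dual ::
    "real \<Rightarrow> 'a::euclidean_space set \<Rightarrow> 'a set \<Rightarrow> (real \<Rightarrow> ('a \<Rightarrow> real) \<Rightarrow> real) set" where
  "L2_H1D_dual T \<Omega> \<Gamma>\<^sub>D \<equiv> bochner_space 2 T (H1D_dual \<Omega> \<Gamma>\<^sub>D) (H1D_dual_norm \<Omega> \<Gamma>\<^sub>D)"

text \<open>The norms of \<open>L\<^sup>2([0,T] \<times> \<Omega>)\<close>, identified with \<open>L\<^sup>2(0,T;L\<^sup>2(\<Omega>))\<close>, and of \<open>X(q)\<close>.\<close>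

abbreviation L2_L2_norm ::
    "real \<Rightarrow> 'a::euclidean_space set \<Rightarrow> (real \<Rightarrow> 'a \<Rightarrow> 'b::real_normed_vector) \<Rightarrow> ennreal" where
  "L2_L2_norm T \<Omega> \<equiv> bochner_norm 2 T (Lp_norm 2 \<Omega>)"

definition Xq_norm ::
    "real \<Rightarrow> real \<Rightarrow> 'a::euclidean_space set \<Rightarrow> (real \<Rightarrow> 'a \<Rightarrow> 'a) \<Rightarrow> ennreal" where
  "Xq_norm q T \<Omega> = bochner_norm (2 * q / (q - real DIM('a))) T (Lp_norm q \<Omega>)"

definition Xq_space ::
    "real \<Rightarrow> real \<Rightarrow> 'a::euclidean_space set \<Rightarrow> (real \<Rightarrow> 'a \<Rightarrow> 'a) set" where
  "Xq_space q T \<Omega> = bochner_space (2 * q / (q - real DIM('a))) T (Lp_space q \<Omega>) (Lp_norm q \<Omega>)"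

text \<open>\<open>\<partial>\<^sub>t w = w'\<close> in the distributional sense, \<open>w'\<close> having values in the dual of \<open>H\<^sup>1\<^sub>D(\<Omega>)\<close> and
  \<open>L\<^sup>2(\<Omega>)\<close> being embedded in that dual by its inner product.\<close>

definition has_weak_time_derivative ::
    "real \<Rightarrow> 'a::euclidean_space set \<Rightarrow> 'a set \<Rightarrow> (real \<Rightarrow> 'a \<Rightarrow> real) \<Rightarrow>
     (real \<Rightarrow> ('a \<Rightarrow> real) \<Rightarrow> real) \<Rightarrow> bool" where
  "has_weak_time_derivative T \<Omega> \<Gamma>\<^sub>D w w' \<longleftrightarrow>
     (\<forall>\<psi>. test_function {0<..<T} \<psi> \<longrightarrow> (\<forall>\<phi> \<in> H1D \<Omega> \<Gamma>\<^sub>D.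
        (LINT t|lebesgue_on {0..T}. (LINT x|lebesgue_on \<Omega>. w t x * \<phi> x) * deriv \<psi> t) =
        - (LINT t|lebesgue_on {0..T}. w' t \<phi> * \<psi> t)))"

definition continuous_L2 :: "real \<Rightarrow> 'a::euclidean_space set \<Rightarrow> (real \<Rightarrow> 'a \<Rightarrow> real) \<Rightarrow> bool" where
  "continuous_L2 T \<Omega> w \<longleftrightarrow>
     (\<forall>t\<in>{0..T}. w t \<in> Lp_space 2 \<Omega> \<and>
        ((\<lambda>s. Lp_norm 2 \<Omega> (w s - w t)) \<longlongrightarrow> 0) (at t within {0..T}))"

text \<open>
  Weak solution \<open>(w 0, \<dots>, w n)\<close> of \<open>\<partial>\<^sub>t w i - div (w 0 \<nabla>(w i) - w i \<nabla>(w 0)) = R i\<close> (\<open>1 \<le> i \<le> n\<close>),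
  \<open>\<Sum>w i = 1\<close>, with initial values \<open>wI i\<close>, Dirichlet values \<open>wD i\<close> on \<open>\<Gamma>\<^sub>D\<close> and no-flux condition on the
  rest of the boundary.  The no-flux condition is the natural one: it is encoded by testing with
  functions that vanish on \<open>\<Gamma>\<^sub>D\<close> only.

  By \<open>continuous_L2\<close>, \<open>w i\<close> is the representative in \<open>C([0,T];L\<^sup>2(\<Omega>))\<close>, which exists because of the
  regularity in time and the time-independent Dirichlet data; values at fixed times, in
  particular the initial values, refer to it.  No bounds on \<open>w i\<close> are imposed, so the integrability
  of the flux term is part of the weak formulation; it is automatic when \<open>w\<close> is bounded.
\<close>

definition weak_solution ::
    "real \<Rightarrow> 'a::euclidean_space set \<Rightarrow> 'a set \<Rightarrow> nat \<Rightarrow> (nat \<Rightarrow> 'a \<Rightarrow> real) \<Rightarrow> (nat \<Rightarrow> 'a \<Rightarrow> real) \<Rightarrow>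
     (nat \<Rightarrow> real \<Rightarrow> ('a \<Rightarrow> real) \<Rightarrow> real) \<Rightarrow> (nat \<Rightarrow> real \<Rightarrow> 'a \<Rightarrow> real) \<Rightarrow> bool" where
  "weak_solution T \<Omega> \<Gamma>\<^sub>D n wD wI R w \<longleftrightarrow>
     (\<forall>i\<le>n. (\<lambda>(t, x). w i t x) \<in> borel_measurable (lebesgue_on ({0..T} \<times> \<Omega>)) \<and>
            w i \<in> L2_H1 T \<Omega> \<and> continuous_L2 T \<Omega> (w i) \<and>
            (AE x in lebesgue_on \<Omega>. w i 0 x = wI i x) \<and>
            (AE t in lebesgue_on {0..T}. has_trace \<Omega> \<Gamma>\<^sub>D (w i t) (wD i))) \<and>
     (AE (t, x) in lebesgue_on ({0..T} \<times> \<Omega>). (\<Sum>i\<le>n. w i t x) = 1) \<and>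
     (\<exists>w'. (\<forall>i\<le>n. w' i \<in> L2_H1D_dual T \<Omega> \<Gamma>\<^sub>D \<and> has_weak_time_derivative T \<Omega> \<Gamma>\<^sub>D (w i) (w' i)) \<and>
       (\<forall>i\<in>{1..n}. \<forall>\<phi> \<in> L2_H1D T \<Omega> \<Gamma>\<^sub>D.
          let flux = (\<lambda>t x. w 0 t x *\<^sub>R weak_grad \<Omega> (w i t) x - w i t x *\<^sub>R weak_grad \<Omega> (w 0 t) x)
          in (AE t in lebesgue_on {0..T}.
                integrable (lebesgue_on \<Omega>) (\<lambda>x. flux t x \<bullet> weak_grad \<Omega> (\<phi> t) x)) \<and>
             integrable (lebesgue_on {0..T}) (\<lambda>t. LINT x|lebesgue_on \<Omega>. flux t x \<bullet> weak_grad \<Omega> (\<phi> t) x) \<and>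
             (LINT t|lebesgue_on {0..T}. w' i t (\<phi> t)) +
             (LINT t|lebesgue_on {0..T}. LINT x|lebesgue_on \<Omega>. flux t x \<bullet> weak_grad \<Omega> (\<phi> t) x) =
             (LINT t|lebesgue_on {0..T}. R i t (\<phi> t))))"

end

theory Submission
  imports Defs "HOL-Library.Function_Algebras"
begin

text \<open>
  Let \<open>w = u i - v i\<close>.  It vanishes on the Dirichlet boundary, so it is an admissible test function, and
  the difference of the two fluxes is
  \<open>v 0 \<nabla>w + (u 0 - v 0) \<nabla>(u i) - v i \<nabla>(u 0 - v 0) - w \<nabla>(u 0)\<close>.
  Testing with \<open>w\<close> produces the dissipation \<open>\<integral> v 0 |\<nabla>w|\<^sup>2\<close>.  The second and third terms and \<open>R i\<close> are
  absorbed by Young's inequality with weight \<open>1/4\<close>; the last one is bounded by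
  \<open>\<parallel>w\<parallel>\<^sub>p \<parallel>\<nabla>(u 0)\<parallel>\<^sub>q \<parallel>\<nabla>w\<parallel>\<^sub>2\<close>, hence by Gagliardo-Nirenberg and Young (again with weight \<open>1/4\<close>) by the
  dissipation plus \<open>\<kappa>(t) \<parallel>w\<parallel>\<^sub>2\<^sup>2 / 2\<close>, where \<open>\<kappa>\<close> is a multiple of
  \<open>\<parallel>\<nabla>(u 0)\<parallel>\<^sub>q\<close> to the power \<open>2 / (1 - \<theta>) = 2 q / (q - d)\<close>.
  Gronwall's inequality bounds the maximum of \<open>\<parallel>w\<parallel>\<^sub>2\<^sup>2\<close> and the integrated dissipation separately by
  the same constant, which is the origin of the factor \<open>2\<close> in front of the initial data.

  The chain rule for \<open>\<parallel>w(t)\<parallel>\<^sub>2\<^sup>2\<close> is needed as an inequality only: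
  \<open>\<parallel>w(t)\<parallel>\<^sup>2 - \<parallel>w(t - h)\<parallel>\<^sup>2 \<le> 2 (w(t) - w(t - h), w(t))\<close> is averaged over \<open>t\<close>, divided by \<open>h\<close>, and the right-hand
  side is passed to the limit \<open>h \<rightarrow> 0\<close> by approximating \<open>w\<close> with simple functions in \<open>L\<^sup>2(0,T;H\<^sup>1\<^sub>D)\<close>.
\<close>

section \<open>Smooth functions with compact support\<close>

text \<open>The obstacle is the time regularity. The derivative of w is known only against a fixed
  \<phi> in \<open>H1D\<close> and a test function of time, whereas w itself moves with t. So every
  step is reduced to a real function of t: for fixed \<phi> the scalar product of w(t) with \<phi>
  changes by the integral of \<open>w' t \<phi>\<close>, and a simple function takes finitely many
  values \<phi>, each on a measurable set of times. The interchange of limits rests on the square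
  integrability of the dual norm of \<open>w'\<close>: pairings with a small remainder over the
  windows [t - h, t], divided by h and averaged over t, are small uniformly in h.

  The constants: the two flux terms and \<open>R i\<close> are bounded by one product S b, with S a
  sum of three numbers and b the gradient norm of w. S^2 is at most three times the sum of the
  squares, and absorbing half of the dissipation doubles the 3 to 6/\<gamma>; adding the two
  Gronwall bounds turns this into 12/\<gamma>. In the interpolation term the weight in Young's
  inequality is chosen so that exactly a quarter of the dissipation appears; the numerical factor
  left over is \<mu>.\<close>

lemma continuously_differentiable_SucD:
  "continuously_differentiable (Suc k) f \<Longrightarrow> continuously_differentiable k f"
proof (induction k arbitrary: f)
  case 0
  then show ?case
    by (auto intro!: continuous_at_imp_continuous_on differentiable_imp_continuous_within)
next
  case (Suc k)
  from Suc.prems have d: "\<And>x. f differentiable (at x)"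
    and c: "\<And>b. b \<in> Basis \<Longrightarrow> continuously_differentiable (Suc k) (\<lambda>x. frechet_derivative f (at x) b)"
    by (auto simp del: continuously_differentiable.simps simp: continuously_differentiable.simps(2)[of "Suc k"])
  then show ?case using Suc.IH by (auto)
qed

definition smooth :: "('a::euclidean_space \<Rightarrow> real) \<Rightarrow> bool" where
  "smooth f \<longleftrightarrow> (\<forall>k. continuously_differentiable k f)"

text \<open>Asking for all orders at once makes the notion stable under partial derivatives.
  Conversely, smooth partial derivatives give order \<open>Suc k\<close> for every k, and order 0
  follows by going down one level.\<close>

lemma smooth_unfold:
  "smooth f \<longleftrightarrow> (\<forall>x. f differentiable (at x)) \<and> (\<forall>b\<in>Basis. smooth (\<lambda>x. frechet_derivative f (at x) b))"
  (is "?l \<longleftrightarrow> ?r")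
proof
  show "?l \<Longrightarrow> ?r" unfolding smooth_def by (metis continuously_differentiable.simps(2))
next
  assume r: ?r
  then have "continuously_differentiable (Suc k) f" for k unfolding smooth_def by simp
  then show ?l unfolding smooth_def using continuously_differentiable_SucD by blast
qed

lemma smooth_differentiable: "smooth f \<Longrightarrow> f differentiable (at x)"
  using smooth_unfold by blast

lemma smooth_deriv: "smooth f \<Longrightarrow> b \<in> Basis \<Longrightarrow> smooth (\<lambda>x. frechet_derivative f (at x) b)"
  using smooth_unfold by blast

lemma smooth_continuous: "smooth f \<Longrightarrow> continuous_on A f"
  using smooth_def[of f] continuously_differentiable.simps(1) continuous_on_subset by blast

lemma continuously_differentiable_const: "continuously_differentiable k (\<lambda>x. c)"
proof (induction k arbitrary: c)
  case (Suc k)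
  have "frechet_derivative (\<lambda>x::'a. c) (at x) = (\<lambda>_. 0)" for x
    by (rule frechet_derivative_at[symmetric]) (auto intro: derivative_eq_intros)
  then show ?case using Suc by simp
qed simp

lemma continuously_differentiable_add:
  "continuously_differentiable k f \<Longrightarrow> continuously_differentiable k g \<Longrightarrow>
   continuously_differentiable k (\<lambda>x. f x + g x)"
proof (induction k arbitrary: f g)
  case (Suc k)
  have "frechet_derivative (\<lambda>x. f x + g x) (at x) =
      (\<lambda>h. frechet_derivative f (at x) h + frechet_derivative g (at x) h)" for x
    by (rule frechet_derivative_at[symmetric])
       (use Suc.prems in \<open>auto intro!: has_derivative_add simp: frechet_derivative_works\<close>)
  then show ?case using Suc by simp
qed (auto intro: continuous_intros)

lemma continuously_differentiable_mult:
  "continuously_differentiable k f \<Longrightarrow> continuously_differentiable k g \<Longrightarrow>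
   continuously_differentiable k (\<lambda>x. f x * g x)"
proof (induction k arbitrary: f g)
  case (Suc k)
  have "frechet_derivative (\<lambda>x. f x * g x) (at x) =
      (\<lambda>h. f x * frechet_derivative g (at x) h + frechet_derivative f (at x) h * g x)" for x
    by (rule frechet_derivative_at[symmetric])
       (use Suc.prems in \<open>auto intro!: has_derivative_mult simp: frechet_derivative_works\<close>)
  then show ?case using Suc continuously_differentiable_SucD[OF Suc.prems(1)]
      continuously_differentiable_SucD[OF Suc.prems(2)]
    by (auto intro!: continuously_differentiable_add)
qed (auto intro: continuous_intros)

lemma smooth_const: "smooth (\<lambda>x. c)"
  and smooth_add: "smooth f \<Longrightarrow> smooth g \<Longrightarrow> smooth (\<lambda>x. f x + g x)"
  and smooth_mult: "smooth f \<Longrightarrow> smooth g \<Longrightarrow> smooth (\<lambda>x. f x * g x)"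
  by (auto simp: smooth_def continuously_differentiable_const continuously_differentiable_add
      continuously_differentiable_mult)

lemma smooth_diff: "smooth f \<Longrightarrow> smooth g \<Longrightarrow> smooth (\<lambda>x. f x - g x)"
  using smooth_add[of f "\<lambda>x. (-1) * g x"] smooth_mult[OF smooth_const[of "-1"], of g] by simp

lemma smooth_prod: "(\<And>i. i \<in> I \<Longrightarrow> smooth (f i)) \<Longrightarrow> smooth (\<lambda>x. \<Prod>i\<in>I. f i x)"
  by (induction I rule: infinite_finite_induct) (auto intro: smooth_const smooth_mult)

text \<open>The derivative in direction v is the constant \<alpha> (v \<bullet> c) times the same
  construction applied to the derivative of h. The induction on the order therefore generalises over
  h. With c a basis vector this lifts a function of one variable to a coordinate.\<close>

lemma smooth_compose_affine:
  fixes h :: "real \<Rightarrow> real" and c :: "'a::euclidean_space"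
  assumes "smooth h"
  shows "smooth (\<lambda>x. h (\<alpha> * (x \<bullet> c) + \<beta>))"
proof -
  have "continuously_differentiable k h \<Longrightarrow> continuously_differentiable k (\<lambda>x. h (\<alpha> * (x \<bullet> c) + \<beta>))"
    for k and h :: "real \<Rightarrow> real"
  proof (induction k arbitrary: h)
    case 0
    have h: "continuous_on UNIV h" using 0 by simp
    have "continuous_on UNIV (\<lambda>x. \<alpha> * (x \<bullet> c) + \<beta>)"
      by (intro continuous_intros)
    then show ?case using continuous_on_compose2[OF h] by simp
  next
    case (Suc k)
    have D: "((\<lambda>x. h (\<alpha> * (x \<bullet> c) + \<beta>)) has_derivative
        (\<lambda>v. (\<alpha> * (v \<bullet> c)) * frechet_derivative h (at (\<alpha> * (x \<bullet> c) + \<beta>)) 1)) (at x)" for x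
    proof -
      have "(h has_derivative frechet_derivative h (at (\<alpha> * (x \<bullet> c) + \<beta>))) (at (\<alpha> * (x \<bullet> c) + \<beta>))"
        using Suc.prems by (simp add: frechet_derivative_works)
      moreover from this have "frechet_derivative h (at (\<alpha> * (x \<bullet> c) + \<beta>)) =
          (\<lambda>s. s * frechet_derivative h (at (\<alpha> * (x \<bullet> c) + \<beta>)) 1)"
        using linear_cmul[OF has_derivative_linear, of h _ _ _ 1] by (auto simp: fun_eq_iff)
      ultimately have "(h has_derivative (\<lambda>s. s * frechet_derivative h (at (\<alpha> * (x \<bullet> c) + \<beta>)) 1)) (at (\<alpha> * (x \<bullet> c) + \<beta>))"
        by simp
      then show ?thesis
        by (rule has_derivative_compose[rotated]) (auto intro!: derivative_eq_intros)
    qed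
    then have E: "frechet_derivative (\<lambda>x. h (\<alpha> * (x \<bullet> c) + \<beta>)) (at x) =
        (\<lambda>v. (\<alpha> * (v \<bullet> c)) * frechet_derivative h (at (\<alpha> * (x \<bullet> c) + \<beta>)) 1)" for x
      by (metis frechet_derivative_at)
    have "continuously_differentiable k (\<lambda>x. frechet_derivative h (at x) 1)"
      using Suc.prems by simp
    from Suc.IH[OF this] show ?case
      using D by (auto simp: E differentiable_def intro!: continuously_differentiable_mult continuously_differentiable_const)
  qed
  then show ?thesis using assms by (auto simp: smooth_def)
qed

text \<open>On the reals the only basis vector is 1, so the partial derivative is the ordinary one
  and an order can be peeled off with a known f'.\<close>

lemma smooth_real_unfold:
  fixes f :: "real \<Rightarrow> real"
  assumes "\<And>x. (f has_real_derivative f' x) (at x)"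
  shows "continuously_differentiable (Suc k) f \<longleftrightarrow> continuously_differentiable k f'"
proof -
  have "frechet_derivative f (at x) 1 = f' x" for x
    using frechet_derivative_at[of f "(*) (f' x)" x, symmetric] assms[of x]
    unfolding has_field_derivative_def by simp
  then have "(\<lambda>x. frechet_derivative f (at x) 1) = f'" by auto
  then show ?thesis using assms by (auto simp: differentiable_def has_field_derivative_def)
qed

text \<open>The derivative of a member of this family is a linear combination of two later members, and
  each member is smaller than a multiple of \<open>|x|\<close>; smoothness at \<open>0\<close> follows for all members at once.\<close>

definition flat_exp :: "nat \<Rightarrow> real \<Rightarrow> real" where
  "flat_exp n x = (if x \<le> 0 then 0 else exp (- 1 / x) / x ^ n)"

lemma flat_exp_nonneg: "0 \<le> flat_exp n x"
  by (simp add: flat_exp_def)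

text \<open>The term of index n + 1 in the exponential series at 1/x is a lower bound for exp(1/x);
  taking reciprocals leaves one spare factor x after division by x^n.\<close>

lemma flat_exp_bound: "\<bar>flat_exp n x\<bar> \<le> fact (Suc n) * \<bar>x\<bar>"
proof (cases "x \<le> 0")
  case False
  then have x: "0 < x" by simp
  have "(1 / x) ^ (Suc n) / fact (Suc n) \<le> exp (1 / x)"
  proof -
    have "(1 / x) ^ (Suc n) / fact (Suc n) = (\<Sum>k\<in>{Suc n}. inverse (fact k) * (1 / x) ^ k)"
      by (simp add: field_simps)
    also have "\<dots> \<le> (\<Sum>k. inverse (fact k) * (1 / x) ^ k)"
      by (rule sum_le_suminf) (use x in \<open>auto intro: summable_exp\<close>)
    also have "\<dots> = exp (1 / x)" by (simp add: exp_def)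
    finally show ?thesis .
  qed
  then have "exp (- (1 / x)) \<le> fact (Suc n) * x ^ Suc n"
    using x by (simp add: exp_minus divide_simps power_divide mult.commute)
  then show ?thesis using x by (simp add: flat_exp_def field_simps)
next
  case True
  have "0 \<le> fact (Suc n) * \<bar>x\<bar>" by (intro mult_nonneg_nonneg) auto
  then show ?thesis using True by (simp only: flat_exp_def if_True abs_zero)
qed

lemma flat_exp_deriv:
  "(flat_exp n has_real_derivative (- real n * flat_exp (Suc n) x + flat_exp (Suc (Suc n)) x)) (at x)"
proof -
  consider "x < 0" | "x > 0" | "x = 0" by linarith
  then show ?thesis
  proof cases
    case 1
    have "((\<lambda>_. 0) has_real_derivative 0) (at x)" by simp
    then have "(flat_exp n has_real_derivative 0) (at x)"
      by (rule has_field_derivative_transform_within_open[of _ _ _ "{..<0}"])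
         (use 1 in \<open>auto simp: flat_exp_def\<close>)
    then show ?thesis using 1 by (simp add: flat_exp_def)
  next
    case 2
    have "((\<lambda>x. exp (- 1 / x) / x ^ n) has_real_derivative
       ((exp (- 1 / x) * (1 / x\<^sup>2)) * x ^ n - exp (- 1 / x) * (real n * x ^ (n - 1))) / (x ^ n * x ^ n)) (at x)"
      using 2 by (auto intro!: derivative_eq_intros simp: power2_eq_square divide_simps)
    also have "((exp (- 1 / x) * (1 / x\<^sup>2)) * x ^ n - exp (- 1 / x) * (real n * x ^ (n - 1))) / (x ^ n * x ^ n) =
        - real n * flat_exp (Suc n) x + flat_exp (Suc (Suc n)) x"
      using 2 by (cases n) (auto simp: flat_exp_def field_simps power2_eq_square)
    finally show ?thesis
      by (rule has_field_derivative_transform_within_open[of _ _ _ "{0<..}"])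
         (use 2 in \<open>auto simp: flat_exp_def\<close>)
  next
    case 3
    have "((\<lambda>h. (flat_exp n (0 + h) - flat_exp n 0) / h) \<longlongrightarrow> 0) (at 0)"
    proof (rule Lim_null_comparison[where g="\<lambda>h. fact (Suc (Suc n)) * \<bar>h\<bar>"])
      \<comment> \<open>Dividing by h raises the index by one, so the bound on the next member gives
        the limit 0.\<close>
      have "(flat_exp n (0 + h) - flat_exp n 0) / h = flat_exp (Suc n) h" for h
        by (simp add: flat_exp_def)
      then show "\<forall>\<^sub>F h in at 0. norm ((flat_exp n (0 + h) - flat_exp n 0) / h) \<le> fact (Suc (Suc n)) * \<bar>h\<bar>"
        using flat_exp_bound[of "Suc n"] by simp
      show "((\<lambda>h. fact (Suc (Suc n)) * \<bar>h\<bar>) \<longlongrightarrow> 0) (at (0::real))"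
        by (auto intro!: tendsto_eq_intros)
    qed
    then show ?thesis using 3 by (simp add: DERIV_def flat_exp_def)
  qed
qed

lemma smooth_flat_exp: "smooth (flat_exp n)"
proof -
  have "continuously_differentiable k (flat_exp n)" for k
  proof (induction k arbitrary: n)
    case 0
    show ?case using flat_exp_deriv
      by (auto intro!: continuous_at_imp_continuous_on DERIV_isCont)
  next
    case (Suc k)
    show ?case
      unfolding smooth_real_unfold[OF flat_exp_deriv]
      by (intro continuously_differentiable_add continuously_differentiable_mult
          continuously_differentiable_const Suc)
  qed
  then show ?thesis by (simp add: smooth_def)
qed

lemma flat_exp_le_1: "flat_exp 0 x \<le> 1"
  by (simp add: flat_exp_def)

text \<open>The shift by \<open>1\<close> keeps the support at distance \<open>1/k\<close> from the boundary of the box, so that it is a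
  compact subset of the open box.\<close>

definition box_bump :: "nat \<Rightarrow> 'a::euclidean_space \<Rightarrow> 'a \<Rightarrow> 'a \<Rightarrow> real" where
  "box_bump k a b x =
     (\<Prod>i\<in>Basis. flat_exp 0 (real k * (x \<bullet> i) + (- real k * (a \<bullet> i) - 1)) *
                 flat_exp 0 (- real k * (x \<bullet> i) + (real k * (b \<bullet> i) - 1)))"

lemma smooth_box_bump: "smooth (box_bump k a b)"
  unfolding box_bump_def
  by (intro smooth_prod smooth_mult smooth_compose_affine smooth_flat_exp)

lemma box_bump_bounds: "0 \<le> box_bump k a b x" "box_bump k a b x \<le> 1"
  unfolding box_bump_def
  by (auto intro!: prod_nonneg prod_le_1 mult_nonneg_nonneg flat_exp_nonneg mult_le_one flat_exp_le_1)

text \<open>A nonzero product makes all arguments positive, so every coordinate keeps distance more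
  than 1/k from the faces of the box. At k = 0 the arguments are -1 and the bump vanishes
  identically, which excludes that index and the default value 1/0 = 0.\<close>

lemma box_bump_support:
  assumes "box_bump k a b x \<noteq> 0"
  shows "x \<in> cbox (a + (1 / real k) *\<^sub>R One) (b - (1 / real k) *\<^sub>R One)" and "k \<noteq> 0"
proof -
  have *: "flat_exp 0 (real k * (x \<bullet> i) + (- real k * (a \<bullet> i) - 1)) \<noteq> 0"
     "flat_exp 0 (- real k * (x \<bullet> i) + (real k * (b \<bullet> i) - 1)) \<noteq> 0" if "i \<in> Basis" for i
    using assms that unfolding box_bump_def by (auto simp: prod_zero_iff)
  then have **: "real k * (x \<bullet> i) - real k * (a \<bullet> i) > 1" "real k * (b \<bullet> i) - real k * (x \<bullet> i) > 1"
    if "i \<in> Basis" for i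
    using that by (fastforce simp: flat_exp_def split: if_splits)+
  obtain j :: 'a where j: "j \<in> Basis" using nonempty_Basis by blast
  show "k \<noteq> 0" using **[OF j] by (cases k) auto
  then show "x \<in> cbox (a + (1 / real k) *\<^sub>R One) (b - (1 / real k) *\<^sub>R One)"
    using ** by (fastforce simp: mem_box inner_simps field_simps)
qed

lemma box_bump_support_subset: "k \<noteq> 0 \<Longrightarrow>
  cbox (a + (1 / real k) *\<^sub>R One) (b - (1 / real k) *\<^sub>R One) \<subseteq> box a b"
proof
  fix x assume k: "k \<noteq> 0" and x: "x \<in> cbox (a + (1 / real k) *\<^sub>R One) (b - (1 / real k) *\<^sub>R One)"
  have "a \<bullet> i < x \<bullet> i \<and> x \<bullet> i < b \<bullet> i" if "i \<in> Basis" for i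
  proof -
    have "a \<bullet> i + 1 / real k \<le> x \<bullet> i" "x \<bullet> i \<le> b \<bullet> i - 1 / real k"
      using x that by (auto simp: mem_box inner_simps)
    moreover have "1 / real k > 0" using k by simp
    ultimately show ?thesis by linarith
  qed
  then show "x \<in> box a b" by (simp add: mem_box)
qed

text \<open>At a point of the open box all arguments tend to infinity with k, and
  \<open>flat_exp 0\<close> tends to 1 there.\<close>

lemma box_bump_tendsto:
  assumes "x \<in> box a b"
  shows "(\<lambda>k. box_bump k a b x) \<longlonglongrightarrow> 1"
proof -
  have *: "(\<lambda>k. flat_exp 0 (real k * d - 1)) \<longlonglongrightarrow> 1" if "d > 0" for d
  proof -
    have lim: "filterlim (\<lambda>k. real k * d - 1) at_top sequentially"
    proof -
      have "filterlim (\<lambda>k. (-1) + real k * d) at_top sequentially"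
        by (intro filterlim_tendsto_add_at_top[OF tendsto_const]
            filterlim_at_top_mult_tendsto_pos[OF tendsto_const that] filterlim_real_sequentially)
      then show ?thesis by (simp add: algebra_simps)
    qed
    have "(\<lambda>k. exp (- 1 / (real k * d - 1))) \<longlonglongrightarrow> exp 0"
      by (intro tendsto_exp real_tendsto_divide_at_top[OF tendsto_const lim])
    then show ?thesis
      unfolding exp_zero
    proof (rule Lim_transform_eventually)
      have "\<forall>\<^sub>F k in sequentially. real k * d - 1 > 0"
        using lim unfolding filterlim_at_top_dense by blast
      then show "\<forall>\<^sub>F k in sequentially. exp (- 1 / (real k * d - 1)) = flat_exp 0 (real k * d - 1)"
        by eventually_elim (simp add: flat_exp_def)
    qed
  qed
  have "(\<lambda>k. \<Prod>i\<in>Basis. flat_exp 0 (real k * ((x - a) \<bullet> i) - 1) * flat_exp 0 (real k * ((b - x) \<bullet> i) - 1))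
     \<longlonglongrightarrow> (\<Prod>i\<in>(Basis::'a set). 1 * 1)"
    by (intro tendsto_prod tendsto_mult *) (use assms in \<open>auto simp: mem_box inner_simps\<close>)
  then show ?thesis unfolding box_bump_def by (simp add: inner_simps algebra_simps)
qed

text \<open>For values in [0,1] this is a smooth substitute for the maximum: it stays in [0,1],
  dominates each \<open>f j\<close> with j < m, and vanishes where all of them do.\<close>

lemma smooth_finite_sup:
  "(\<And>j. smooth (f j)) \<Longrightarrow> smooth (\<lambda>x. 1 - (\<Prod>j<(m::nat). 1 - f j x))"
  by (intro smooth_diff smooth_const smooth_prod)

lemma test_functionI:
  assumes "smooth \<phi>" "compact K" "K \<subseteq> \<Omega>" "\<And>x. \<phi> x \<noteq> 0 \<Longrightarrow> x \<in> K"
  shows "test_function \<Omega> \<phi>"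
proof -
  have "closure {x. \<phi> x \<noteq> 0} \<subseteq> K"
    using assms by (intro closure_minimal compact_imp_closed) auto
  moreover from this have "compact (closure {x. \<phi> x \<noteq> 0})"
    using assms(2) by (meson closed_closure compact_Int_closed compact_eq_bounded_closed bounded_subset)
  ultimately show ?thesis using assms by (auto simp: test_function_def smooth_def)
qed

text \<open>U is a countable union of open boxes. The m-th function joins the bumps of index m on
  the first m boxes, so that the number of boxes and the sharpness of the bumps grow together, while
  each support lies in a finite union of closed boxes inside U.\<close>

lemma open_indicator_test_functions:
  fixes U :: "'a::euclidean_space set"
  assumes "open U"
  obtains \<phi> where "\<And>m::nat. test_function U (\<phi> m)" "\<And>m x. \<bar>\<phi> m x\<bar> \<le> 1"
    "\<And>x. (\<lambda>m. \<phi> m x) \<longlonglongrightarrow> indicator U x"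
proof -
  obtain D where D: "countable D" "D \<subseteq> Pow U" "\<And>X. X \<in> D \<Longrightarrow> \<exists>a b. X = box a b" "\<Union>D = U"
    using open_countable_Union_open_box[OF assms] by metis
  show ?thesis
  proof (cases "D = {}")
    case True
    then have "U = {}" using D by auto
    moreover have "test_function U (\<lambda>_. 0)" by (rule test_functionI[of _ "{}"]) (auto intro: smooth_const)
    ultimately show ?thesis using that[of "\<lambda>_ _. 0"] by simp
  next
    case False
    have "\<forall>X\<in>D. \<exists>a b. X = box a b" using D(3) by blast
    then obtain A B where AB: "\<And>X. X \<in> D \<Longrightarrow> X = box (A X) (B X)" by metis
    define a where "a j = A (from_nat_into D j)" for j
    define b where "b j = B (from_nat_into D j)" for j
    have ab: "box (a j) (b j) \<in> D" for j
      using AB[OF from_nat_into[OF False]] from_nat_into[OF False, of j] by (simp add: a_def b_def)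
    have U: "U = (\<Union>j. box (a j) (b j))"
    proof
      show "U \<subseteq> (\<Union>j. box (a j) (b j))"
      proof
        fix x assume "x \<in> U"
        then obtain X where X: "X \<in> D" "x \<in> X" using D by auto
        then have "X = from_nat_into D (to_nat_on D X)" using D by simp
        then have "x \<in> box (a (to_nat_on D X)) (b (to_nat_on D X))"
          using X AB[OF X(1)] by (simp add: a_def b_def)
        then show "x \<in> (\<Union>j. box (a j) (b j))" by blast
      qed
    qed (use ab D in blast)
    define \<phi> where "\<phi> m x = 1 - (\<Prod>j<m. 1 - box_bump m (a j) (b j) x)" for m x
    have pr: "0 \<le> (\<Prod>j<m. 1 - box_bump m (a j) (b j) x)" "(\<Prod>j<m. 1 - box_bump m (a j) (b j) x) \<le> 1" for m x
      using box_bump_bounds by (auto intro!: prod_nonneg prod_le_1)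
    show ?thesis
    proof (rule that[of \<phi>])
      fix m
      show "test_function U (\<phi> m)"
      proof (rule test_functionI)
        show "smooth (\<phi> m)" unfolding \<phi>_def by (intro smooth_finite_sup smooth_box_bump)
        let ?K = "\<Union>j<m. cbox (a j + (1 / real m) *\<^sub>R One) (b j - (1 / real m) *\<^sub>R One)"
        show "compact ?K" by (intro compact_UN) auto
        have "cbox (a j + (1 / real m) *\<^sub>R One) (b j - (1 / real m) *\<^sub>R One) \<subseteq> U" if "j < m" for j
          using box_bump_support_subset[of m "a j" "b j"] that U by auto
        then show "?K \<subseteq> U" by blast
        show "x \<in> ?K" if "\<phi> m x \<noteq> 0" for x
        proof (rule ccontr)
          assume "x \<notin> ?K"
          then have "box_bump m (a j) (b j) x = 0" if "j < m" for j
            using box_bump_support(1)[of m "a j" "b j" x] that by blast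
          then show False using that by (simp add: \<phi>_def)
        qed
      qed
      show "\<bar>\<phi> m x\<bar> \<le> 1" for x using pr[where m=m and x=x] unfolding \<phi>_def by linarith
    next
      fix x
      show "(\<lambda>m. \<phi> m x) \<longlonglongrightarrow> indicator U x"
      proof (cases "x \<in> U")
        case True
        then obtain j where j: "x \<in> box (a j) (b j)" using U by auto
        \<comment> \<open>Once m exceeds j, the single factor of the box containing x bounds the
          whole product, and it tends to 0.\<close>
        have "(\<lambda>m. \<Prod>j<m. 1 - box_bump m (a j) (b j) x) \<longlonglongrightarrow> 0"
        proof (rule tendsto_sandwich[where f="\<lambda>_. 0" and h="\<lambda>m. 1 - box_bump m (a j) (b j) x"])
          show "\<forall>\<^sub>F m in sequentially. (\<Prod>j<m. 1 - box_bump m (a j) (b j) x) \<le> 1 - box_bump m (a j) (b j) x"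
            using eventually_gt_at_top[of j]
          proof eventually_elim
            case (elim m)
            have "(\<Prod>j<m. 1 - box_bump m (a j) (b j) x) =
               (1 - box_bump m (a j) (b j) x) * (\<Prod>j\<in>{..<m} - {j}. 1 - box_bump m (a j) (b j) x)"
              using elim by (intro prod.remove) auto
            also have "\<dots> \<le> (1 - box_bump m (a j) (b j) x) * 1"
              using box_bump_bounds by (intro mult_left_mono prod_le_1) auto
            finally show ?case by simp
          qed
          show "(\<lambda>m. 1 - box_bump m (a j) (b j) x) \<longlonglongrightarrow> 0"
            using tendsto_diff[OF tendsto_const box_bump_tendsto[OF j], of 1] by simp
        qed (use pr in auto)
        from tendsto_diff[OF tendsto_const this, of 1] show ?thesis using True by (simp add: \<phi>_def)
      next
        case False
        then have z: "box_bump m (a j) (b j) x = 0" for m j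
          using box_bump_support[of m "a j" "b j" x] box_bump_support_subset[of m "a j" "b j"] U by blast
        show ?thesis using False by (simp add: \<phi>_def z)
      qed
    qed
  qed
qed

section \<open>The fundamental lemma of the calculus of variations\<close>

text \<open>Test functions converge boundedly to the indicator of any open set, so f integrates to 0
  over all open sets. The positive and negative parts of f then define finite measures that agree on
  the intersection-stable family of open sets, hence on all Borel sets, and their densities coincide
  almost everywhere.\<close>

lemma fundamental_lemma:
  fixes f :: "'a::euclidean_space \<Rightarrow> real"
  assumes \<Omega>: "open \<Omega>" and f: "integrable (lebesgue_on \<Omega>) f"
    and z: "\<And>\<phi>. test_function \<Omega> \<phi> \<Longrightarrow> (LINT x|lebesgue_on \<Omega>. f x * \<phi> x) = 0"
  shows "AE x in lebesgue_on \<Omega>. f x = 0"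
proof -
  have \<Omega>s: "\<Omega> \<inter> space lebesgue \<in> sets lebesgue" using \<Omega> by simp
  define F where "F x = indicator \<Omega> x * f x" for x
  have F: "integrable lebesgue F"
    using f integrable_restrict_space[OF \<Omega>s, of f] unfolding F_def[abs_def] by simp
  then have Fm[measurable]: "F \<in> borel_measurable lebesgue" by (rule borel_measurable_integrable)
  \<comment> \<open>Open sets generate only the Borel sets, while f is measurable for the
    completion; the uniqueness argument is run on a Borel version.\<close>
  obtain G where G[measurable]: "G \<in> borel_measurable lborel" and FG: "AE x in lborel. F x = G x"
    using completion_ex_borel_measurable_real[OF Fm] by blast
  have FG': "AE x in lebesgue. F x = G x" using FG by (rule AE_completion)
  have GL[measurable]: "G \<in> borel_measurable lebesgue" using G by (rule measurable_completion)
  have Gi: "integrable lborel G"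
    using integrable_cong_AE[OF Fm GL FG'] F integrable_completion[OF G] by simp
  have open0: "(LINT x|lborel. G x * indicator U x) = 0" if "open U" for U
  proof -
    \<comment> \<open>F vanishes off \<Omega>, so U may be cut down to a set on which test functions
      of \<Omega> are available.\<close>
    have UO: "open (U \<inter> \<Omega>)" using that \<Omega> by (rule open_Int)
    obtain \<phi> where \<phi>: "\<And>m::nat. test_function (U \<inter> \<Omega>) (\<phi> m)" "\<And>m x. \<bar>\<phi> m x\<bar> \<le> 1"
        "\<And>x. (\<lambda>m. \<phi> m x) \<longlonglongrightarrow> indicator (U \<inter> \<Omega>) x"
      by (rule open_indicator_test_functions[OF UO]) blast
    have \<phi>m[measurable]: "\<phi> m \<in> borel_measurable lebesgue" for m
    proof -
      have "continuous_on UNIV (\<phi> m)"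
        using \<phi>(1)[of m] smooth_continuous[of "\<phi> m"] by (auto simp: test_function_def smooth_def)
      then show ?thesis by (simp add: borel_measurable_continuous_onI measurable_completion)
    qed
    have "test_function \<Omega> (\<phi> m)" for m using \<phi>(1)[of m] by (auto simp: test_function_def)
    from z[OF this] have zero: "(LINT x|lebesgue. F x * \<phi> m x) = 0" for m
      by (simp add: F_def integral_restrict_space[OF \<Omega>s] mult.assoc)
    have "(\<lambda>m. LINT x|lebesgue. F x * \<phi> m x) \<longlonglongrightarrow> (LINT x|lebesgue. F x * indicator (U \<inter> \<Omega>) x)"
    proof (rule integral_dominated_convergence[where w="\<lambda>x. \<bar>F x\<bar>"])
      show "integrable lebesgue (\<lambda>x. \<bar>F x\<bar>)" using F by simp
      show "AE x in lebesgue. (\<lambda>m. F x * \<phi> m x) \<longlonglongrightarrow> F x * indicator (U \<inter> \<Omega>) x"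
        by (intro AE_I2 tendsto_mult tendsto_const \<phi>)
      show "AE x in lebesgue. norm (F x * \<phi> m x) \<le> \<bar>F x\<bar>" for m
        using \<phi>(2) by (intro AE_I2) (auto simp: abs_mult intro!: mult_left_le)
      have "U \<inter> \<Omega> \<in> sets lebesgue" using that \<Omega> by simp
      then show "(\<lambda>x. F x * indicator (U \<inter> \<Omega>) x) \<in> borel_measurable lebesgue" by measurable
    qed measurable
    then have "(LINT x|lebesgue. F x * indicator (U \<inter> \<Omega>) x) = 0"
      using zero by (simp add: LIMSEQ_const_iff)
    also have "(LINT x|lebesgue. F x * indicator (U \<inter> \<Omega>) x) = (LINT x|lebesgue. F x * indicator U x)"
      by (rule Bochner_Integration.integral_cong) (auto simp: F_def indicator_def)
    also have "\<dots> = (LINT x|lebesgue. G x * indicator U x)"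
    proof (rule integral_cong_AE)
      have U: "U \<in> sets lebesgue" using that by simp
      then show "(\<lambda>x. F x * indicator U x) \<in> borel_measurable lebesgue"
        "(\<lambda>x. G x * indicator U x) \<in> borel_measurable lebesgue" by measurable
      show "AE x in lebesgue. F x * indicator U x = G x * indicator U x" using FG' by auto
    qed
    also have "\<dots> = (LINT x|lborel. G x * indicator U x)"
    proof (rule integral_completion)
      have [measurable]: "U \<in> sets borel" using that by simp
      show "(\<lambda>x. G x * indicator U x) \<in> borel_measurable lborel" by measurable
    qed
    finally show ?thesis .
  qed
  \<comment> \<open>\<open>ennreal\<close> cuts off negative values, so these densities are the
    positive and the negative part of G.\<close>
  let ?P = "density lborel (\<lambda>x. ennreal (G x))" and ?N = "density lborel (\<lambda>x. ennreal (- G x))"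
  have fin: "(\<integral>\<^sup>+x. ennreal (G x) \<partial>lborel) \<noteq> \<infinity>" "(\<integral>\<^sup>+x. ennreal (- G x) \<partial>lborel) \<noteq> \<infinity>"
    using Gi by (auto simp: real_integrable_def)
  have "?P = ?N"
  proof (rule measure_eqI_generator_eq[where E="{S. open S}" and \<Omega>=UNIV and A="\<lambda>_. UNIV"])
    show "emeasure ?P U = emeasure ?N U" if "U \<in> {S. open S}" for U
    proof -
      have U[measurable]: "U \<in> sets borel" using that by simp
      have i: "integrable lborel (\<lambda>x. G x * indicator U x)"
        using integrable_real_mult_indicator[OF _ Gi, of U] by simp
      have e: "emeasure ?P U = (\<integral>\<^sup>+x. ennreal (G x * indicator U x) \<partial>lborel)"
          "emeasure ?N U = (\<integral>\<^sup>+x. ennreal (- (G x * indicator U x)) \<partial>lborel)"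
        by (auto simp: emeasure_density indicator_def intro!: nn_integral_cong)
      have "enn2real (emeasure ?P U) - enn2real (emeasure ?N U) = 0"
        using open0[of U] that real_lebesgue_integral_def[OF i] by (simp add: e)
      moreover have "emeasure ?P U \<noteq> \<infinity>" "emeasure ?N U \<noteq> \<infinity>"
        using i unfolding e by (auto simp: real_integrable_def)
      ultimately show ?thesis
        by (cases "emeasure ?P U"; cases "emeasure ?N U") auto
    qed
    show "sets ?P = sigma_sets UNIV {S. open S}" "sets ?N = sigma_sets UNIV {S. open S}"
      by (simp_all add: borel_def)
    show "emeasure ?P UNIV \<noteq> \<infinity>" using fin by (simp add: emeasure_density)
  qed (auto simp: Int_stable_def)
  then have "AE x in lborel. ennreal (G x) = ennreal (- G x)"
    using finite_density_unique[of "\<lambda>x. ennreal (G x)" lborel "\<lambda>x. ennreal (- G x)"] fin by simp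
  moreover have "ennreal a = ennreal (- a) \<Longrightarrow> a = 0" for a :: real
    by (metis antisym ennreal_eq_0_iff linear neg_le_0_iff_le)
  ultimately have "AE x in lborel. G x = 0" by auto
  then have "AE x in lebesgue. G x = 0" by (rule AE_completion)
  with FG' have "AE x in lebesgue. x \<in> \<Omega> \<longrightarrow> f x = 0" by eventually_elim (auto simp: F_def)
  then show ?thesis using AE_restrict_space_iff[OF \<Omega>s] by simp
qed

section \<open>Lebesgue norms\<close>

lemma ennpowr_ennreal: "0 \<le> x \<Longrightarrow> ennpowr (ennreal x) r = ennreal (x powr r)"
  by (simp add: ennpowr_def)

lemma ennpowr_top [simp]: "ennpowr top r = top"
  by (simp add: ennpowr_def)

lemma ennpowr_eq_top_iff [simp]: "ennpowr x r = top \<longleftrightarrow> x = top"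
  by (simp add: ennpowr_def)

lemma ennpowr_mono: "x \<le> y \<Longrightarrow> 0 \<le> r \<Longrightarrow> ennpowr x r \<le> ennpowr y r"
  unfolding ennpowr_def
  by (auto simp: top_unique less_top intro!: ennreal_leI powr_mono2 enn2real_mono)

lemma ennpowr_ennpowr_inverse:
  assumes "r \<noteq> 0"
  shows "ennpowr (ennpowr x (1 / r)) r = x" "ennpowr (ennpowr x r) (1 / r) = x"
  using assms by (cases x; simp add: ennpowr_ennreal powr_powr)+

lemma ennreal_top_square [simp]: "top\<^sup>2 = (top :: ennreal)"
  by (simp add: power2_eq_square)

lemma ennpowr_two: "ennpowr x 2 = x\<^sup>2"
  by (cases x) (auto simp: ennpowr_ennreal powr_numeral ennreal_power)

lemma ennpowr_half_square: "(ennpowr x (1 / 2))\<^sup>2 = x"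
  using ennpowr_ennpowr_inverse(1)[of 2 x] by (simp add: ennpowr_two)

lemma ennpowr_Lp_norm:
  "r \<noteq> 0 \<Longrightarrow> ennpowr (Lp_norm r \<Omega> f) r = (\<integral>\<^sup>+ x. ennreal (norm (f x) powr r) \<partial>lebesgue_on \<Omega>)"
  by (simp add: Lp_norm_def ennpowr_ennpowr_inverse)

lemma Lp_norm_2_square:
  "(Lp_norm 2 \<Omega> f)\<^sup>2 = (\<integral>\<^sup>+ x. ennreal ((norm (f x))\<^sup>2) \<partial>lebesgue_on \<Omega>)"
  using ennpowr_Lp_norm[of 2 \<Omega> f] by (simp add: ennpowr_two)

lemma Lp_norm_le_iff:
  assumes "0 < r" "0 \<le> C"
  shows "Lp_norm r \<Omega> f \<le> ennreal C \<longleftrightarrow>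
    (\<integral>\<^sup>+ x. ennreal (norm (f x) powr r) \<partial>lebesgue_on \<Omega>) \<le> ennreal (C powr r)"
proof
  assume "Lp_norm r \<Omega> f \<le> ennreal C"
  from ennpowr_mono[OF this, of r]
  show "(\<integral>\<^sup>+ x. ennreal (norm (f x) powr r) \<partial>lebesgue_on \<Omega>) \<le> ennreal (C powr r)"
    using assms by (simp add: ennpowr_Lp_norm ennpowr_ennreal)
next
  assume "(\<integral>\<^sup>+ x. ennreal (norm (f x) powr r) \<partial>lebesgue_on \<Omega>) \<le> ennreal (C powr r)"
  from ennpowr_mono[OF this, of "1 / r"]
  show "Lp_norm r \<Omega> f \<le> ennreal C"
    using assms by (simp add: Lp_norm_def ennpowr_ennreal powr_powr)
qed

lemma Lp_norm_cong_AE: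
  assumes "AE x in lebesgue_on \<Omega>. norm (f x) = norm (g x)"
  shows "Lp_norm r \<Omega> f = Lp_norm r \<Omega> g"
proof -
  have "(\<integral>\<^sup>+ x. ennreal (norm (f x) powr r) \<partial>lebesgue_on \<Omega>) = (\<integral>\<^sup>+ x. ennreal (norm (g x) powr r) \<partial>lebesgue_on \<Omega>)"
    by (rule nn_integral_cong_AE) (use assms in auto)
  then show ?thesis by (simp add: Lp_norm_def)
qed

lemma Lp_norm_zero [simp]: "r \<noteq> 0 \<Longrightarrow> Lp_norm r \<Omega> (\<lambda>x. 0) = 0"
  using ennpowr_ennreal[of 0] by (simp add: Lp_norm_def)

lemma Lp_norm_eq_0_iff:
  fixes f :: "'a::euclidean_space \<Rightarrow> 'b::euclidean_space"
  assumes "0 < r" "f \<in> borel_measurable (lebesgue_on \<Omega>)"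
  shows "Lp_norm r \<Omega> f = 0 \<longleftrightarrow> (AE x in lebesgue_on \<Omega>. f x = 0)"
proof -
  have "Lp_norm r \<Omega> f = 0 \<longleftrightarrow> (\<integral>\<^sup>+ x. ennreal (norm (f x) powr r) \<partial>lebesgue_on \<Omega>) = 0"
    using Lp_norm_le_iff[of r 0 \<Omega> f] assms by simp
  also have "\<dots> \<longleftrightarrow> (AE x in lebesgue_on \<Omega>. f x = 0)"
    using assms by (subst nn_integral_0_iff_AE) (auto simp: ennreal_eq_0_iff powr_nonneg_iff)
  finally show ?thesis .
qed

lemma Lp_norm_scale:
  fixes f :: "'a::euclidean_space \<Rightarrow> 'b::euclidean_space"
  assumes "0 < r" "f \<in> borel_measurable (lebesgue_on \<Omega>)"
  shows "Lp_norm r \<Omega> (\<lambda>x. c *\<^sub>R f x) = ennreal \<bar>c\<bar> * Lp_norm r \<Omega> f"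
proof -
  let ?I = "\<integral>\<^sup>+ x. ennreal (norm (f x) powr r) \<partial>lebesgue_on \<Omega>"
  have "(\<integral>\<^sup>+ x. ennreal (norm (c *\<^sub>R f x) powr r) \<partial>lebesgue_on \<Omega>) = ennreal (\<bar>c\<bar> powr r) * ?I"
    using assms by (subst nn_integral_cmult[symmetric]) (auto simp: powr_mult ennreal_mult)
  \<comment> \<open>\<open>ennpowr\<close> computes only on finite values. In the remaining cases
    both sides are 0 for c = 0 and infinite otherwise.\<close>
  then show ?thesis
  proof (cases "c = 0 \<or> ?I = top")
    case False
    then obtain I where "?I = ennreal I" "0 \<le> I" by (cases ?I) auto
    then show ?thesis
      using \<open>_ = ennreal (\<bar>c\<bar> powr r) * ?I\<close> assms
      by (simp add: Lp_norm_def ennpowr_ennreal powr_mult powr_powr flip: ennreal_mult)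
  next
    case True
    then show ?thesis
      using \<open>_ = ennreal (\<bar>c\<bar> powr r) * ?I\<close> assms
      using ennpowr_ennreal[of 0 "1 / r"]
      by (cases "c = 0") (auto simp: Lp_norm_def ennreal_mult_top powr_nonneg_iff)
  qed
qed

text \<open>The library has convexity of \<open>x powr r\<close> on the open half-line only.\<close>

lemma powr_convex_comb:
  fixes x y l r :: real
  assumes "0 \<le> x" "0 \<le> y" "0 \<le> l" "l \<le> 1" "1 \<le> r"
  shows "(l * x + (1 - l) * y) powr r \<le> l * x powr r + (1 - l) * y powr r"
proof -
  have le: "c powr r \<le> c" if "0 \<le> c" "c \<le> 1" for c :: real
    using powr_mono'[of 1 r c] that assms by simp
  consider "x = 0" | "y = 0" | "x > 0" "y > 0" using assms by linarith
  then show ?thesis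
  proof cases
    case 1
    then show ?thesis using assms le[of "1 - l"] by (auto simp: powr_mult intro!: mult_right_mono)
  next
    case 2
    then show ?thesis using assms le[of l] by (auto simp: powr_mult intro!: mult_right_mono)
  next
    case 3
    then show ?thesis
      using convex_onD[OF powr_convex[OF assms(5)], of "1 - l" x y] assms by (simp add: algebra_simps)
  qed
qed

text \<open>With A and B the two norms, f + g is the convex combination, with weights A/(A+B) and
  B/(A+B), of (A+B)/A f and (A+B)/B g, both of norm A + B. Convexity of the power, integrated, gives
  the bound. Norms equal to 0 are treated apart because the functions are divided by them.\<close>

lemma Lp_norm_triangle:
  fixes f g :: "'a::euclidean_space \<Rightarrow> 'b::euclidean_space"
  assumes r: "1 \<le> r" and [measurable]: "f \<in> borel_measurable (lebesgue_on \<Omega>)" "g \<in> borel_measurable (lebesgue_on \<Omega>)"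
  shows "Lp_norm r \<Omega> (\<lambda>x. f x + g x) \<le> Lp_norm r \<Omega> f + Lp_norm r \<Omega> g"
proof -
  consider "Lp_norm r \<Omega> f = 0" | "Lp_norm r \<Omega> g = 0" | "Lp_norm r \<Omega> f = top \<or> Lp_norm r \<Omega> g = top"
    | A B where "Lp_norm r \<Omega> f = ennreal A" "Lp_norm r \<Omega> g = ennreal B" "0 < A" "0 < B"
    by (cases "Lp_norm r \<Omega> f"; cases "Lp_norm r \<Omega> g") (auto simp: less_le)
  then show ?thesis
  proof cases
    case 1
    then have "AE x in lebesgue_on \<Omega>. f x = 0" using r by (subst (asm) Lp_norm_eq_0_iff) auto
    then have "Lp_norm r \<Omega> (\<lambda>x. f x + g x) = Lp_norm r \<Omega> g" by (intro Lp_norm_cong_AE) auto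
    then show ?thesis by simp
  next
    case 2
    then have "AE x in lebesgue_on \<Omega>. g x = 0" using r by (subst (asm) Lp_norm_eq_0_iff) auto
    then have "Lp_norm r \<Omega> (\<lambda>x. f x + g x) = Lp_norm r \<Omega> f" by (intro Lp_norm_cong_AE) auto
    then show ?thesis by simp
  next
    case 3
    then show ?thesis by auto
  next
    case (4 A B)
    define l where "l = A / (A + B)"
    have AB: "0 < A + B" using 4 by simp
    have l1: "1 - l = B / (A + B)" using AB by (simp add: l_def field_simps)
    have l: "0 \<le> l" "l \<le> 1" "l * ((A + B) / A) = 1" "(1 - l) * ((A + B) / B) = 1"
      using 4 AB unfolding l1 by (auto simp: l_def)
    have pt: "norm (f x + g x) powr r \<le>
        l * ((A + B) / A) powr r * norm (f x) powr r + (1 - l) * ((A + B) / B) powr r * norm (g x) powr r" for x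
    proof -
      have "norm (f x + g x) powr r \<le> (norm (f x) + norm (g x)) powr r"
        using r by (intro powr_mono2 norm_triangle_ineq) auto
      also have "norm (f x) + norm (g x) = l * ((A + B) / A * norm (f x)) + (1 - l) * ((A + B) / B * norm (g x))"
        using l(3,4) by (simp only: mult.assoc[symmetric])
      also have "(\<dots>) powr r \<le> l * ((A + B) / A * norm (f x)) powr r + (1 - l) * ((A + B) / B * norm (g x)) powr r"
        using 4 l r by (intro powr_convex_comb) auto
      also have "\<dots> = l * ((A + B) / A) powr r * norm (f x) powr r + (1 - l) * ((A + B) / B) powr r * norm (g x) powr r"
        using 4 by (simp add: powr_mult del: times_divide_eq_left times_divide_eq_right)
      finally show ?thesis .
    qed
    have *: "(\<integral>\<^sup>+ x. ennreal (norm (f x) powr r) \<partial>lebesgue_on \<Omega>) \<le> ennreal (A powr r)"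
            "(\<integral>\<^sup>+ x. ennreal (norm (g x) powr r) \<partial>lebesgue_on \<Omega>) \<le> ennreal (B powr r)"
      using 4 r by (subst Lp_norm_le_iff[symmetric]; simp)+
    have "(\<integral>\<^sup>+ x. ennreal (norm (f x + g x) powr r) \<partial>lebesgue_on \<Omega>) \<le>
       (\<integral>\<^sup>+ x. ennreal (l * ((A + B) / A) powr r) * ennreal (norm (f x) powr r)
          + ennreal ((1 - l) * ((A + B) / B) powr r) * ennreal (norm (g x) powr r) \<partial>lebesgue_on \<Omega>)"
      using pt l by (intro nn_integral_mono) (simp flip: ennreal_mult ennreal_plus)
    also have "\<dots> = ennreal (l * ((A + B) / A) powr r) * (\<integral>\<^sup>+ x. ennreal (norm (f x) powr r) \<partial>lebesgue_on \<Omega>)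
       + ennreal ((1 - l) * ((A + B) / B) powr r) * (\<integral>\<^sup>+ x. ennreal (norm (g x) powr r) \<partial>lebesgue_on \<Omega>)"
      by (simp add: nn_integral_add nn_integral_cmult)
    also have "\<dots> \<le> ennreal (l * ((A + B) / A) powr r) * ennreal (A powr r)
       + ennreal ((1 - l) * ((A + B) / B) powr r) * ennreal (B powr r)"
      by (intro add_mono mult_left_mono *) auto
    also have "\<dots> = ennreal (l * (((A + B) / A) powr r * A powr r) + (1 - l) * (((A + B) / B) powr r * B powr r))"
      using l by (simp add: mult.assoc flip: ennreal_mult ennreal_plus)
    also have "((A + B) / A) powr r * A powr r = (A + B) powr r"
      using 4 by (simp flip: powr_mult)
    also have "((A + B) / B) powr r * B powr r = (A + B) powr r"
      using 4 by (simp flip: powr_mult)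
    finally have "(\<integral>\<^sup>+ x. ennreal (norm (f x + g x) powr r) \<partial>lebesgue_on \<Omega>) \<le> ennreal ((A + B) powr r)"
      by (simp add: algebra_simps)
    then have "Lp_norm r \<Omega> (\<lambda>x. f x + g x) \<le> ennreal (A + B)"
      using 4 r by (subst Lp_norm_le_iff) auto
    then show ?thesis using 4 by simp
  qed
qed

lemma ennreal_power2_le_imp_le:
  fixes a b :: ennreal
  assumes "a\<^sup>2 \<le> b\<^sup>2" shows "a \<le> b"
  using assms
  by (cases a; cases b) (auto simp: ennreal_power power2_le_iff_abs_le top_unique)

lemma nn_integral_Cauchy_Schwarz:
  fixes f :: "'a::euclidean_space \<Rightarrow> 'b::euclidean_space" and g :: "'a \<Rightarrow> 'c::euclidean_space"
  assumes "f \<in> borel_measurable (lebesgue_on \<Omega>)" "g \<in> borel_measurable (lebesgue_on \<Omega>)"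
  shows "(\<integral>\<^sup>+ x. ennreal (norm (f x) * norm (g x)) \<partial>lebesgue_on \<Omega>) \<le> Lp_norm 2 \<Omega> f * Lp_norm 2 \<Omega> g"
proof (rule ennreal_power2_le_imp_le)
  show "(\<integral>\<^sup>+ x. ennreal (norm (f x) * norm (g x)) \<partial>lebesgue_on \<Omega>)\<^sup>2 \<le> (Lp_norm 2 \<Omega> f * Lp_norm 2 \<Omega> g)\<^sup>2"
    using Cauchy_Schwarz_nn_integral[of "\<lambda>x. ennreal (norm (f x))" "lebesgue_on \<Omega>" "\<lambda>x. ennreal (norm (g x))"] assms
    by (simp add: power_mult_distrib Lp_norm_2_square ennreal_power ennreal_mult)
qed

text \<open>Hoelder's inequality with three exponents: Young's inequality for the conjugate
  exponents p/2 and q/2 is applied to the squares of |w|/A and |g|/B, where A and B are the norms,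
  and integrated. The two resulting terms sum to 2 (1/p + 1/q) = 1.\<close>

lemma Lp_norm_mult_le:
  fixes w :: "'a::euclidean_space \<Rightarrow> real" and g :: "'a \<Rightarrow> 'b::euclidean_space"
  assumes pq: "2 < p" "2 < q" "1 / p + 1 / q = 1 / 2"
    and [measurable]: "w \<in> borel_measurable (lebesgue_on \<Omega>)" "g \<in> borel_measurable (lebesgue_on \<Omega>)"
    and fin: "Lp_norm p \<Omega> w < top" "Lp_norm q \<Omega> g < top"
  shows "Lp_norm 2 \<Omega> (\<lambda>x. w x *\<^sub>R g x) \<le> Lp_norm p \<Omega> w * Lp_norm q \<Omega> g"
proof -
  consider "Lp_norm p \<Omega> w = 0" | "Lp_norm q \<Omega> g = 0"
    | A B where "Lp_norm p \<Omega> w = ennreal A" "Lp_norm q \<Omega> g = ennreal B" "0 < A" "0 < B"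
    using fin by (cases "Lp_norm p \<Omega> w"; cases "Lp_norm q \<Omega> g") (auto simp: less_le)
  then show ?thesis
  proof cases
    case 1
    then have "AE x in lebesgue_on \<Omega>. w x = 0" using pq by (subst (asm) Lp_norm_eq_0_iff) auto
    then have "Lp_norm 2 \<Omega> (\<lambda>x. w x *\<^sub>R g x) = 0"
      by (subst Lp_norm_eq_0_iff) auto
    then show ?thesis by simp
  next
    case 2
    then have "AE x in lebesgue_on \<Omega>. g x = 0" using pq by (subst (asm) Lp_norm_eq_0_iff) auto
    then have "Lp_norm 2 \<Omega> (\<lambda>x. w x *\<^sub>R g x) = 0"
      by (subst Lp_norm_eq_0_iff) auto
    then show ?thesis by simp
  next
    case (3 A B)
    have pt: "(norm (w x *\<^sub>R g x)) powr 2 \<le>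
       (A * B)\<^sup>2 * (2 / p) / A powr p * norm (w x) powr p + (A * B)\<^sup>2 * (2 / q) / B powr q * norm (g x) powr q" for x
    proof -
      have "(norm (w x) / A) powr 2 * (norm (g x) / B) powr 2 \<le>
         ((norm (w x) / A) powr 2) powr (p / 2) / (p / 2) + ((norm (g x) / B) powr 2) powr (q / 2) / (q / 2)"
        by (rule Youngs_inequality) (use pq in \<open>auto simp: field_simps\<close>)
      also have "\<dots> = (2 / p) / A powr p * norm (w x) powr p + (2 / q) / B powr q * norm (g x) powr q"
        using 3 pq by (simp add: powr_powr powr_divide mult.commute del: powr_numeral)
      finally have "(A * B)\<^sup>2 * ((norm (w x) / A) powr 2 * (norm (g x) / B) powr 2) \<le>
        (A * B)\<^sup>2 * ((2 / p) / A powr p * norm (w x) powr p + (2 / q) / B powr q * norm (g x) powr q)"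
        by (rule mult_left_mono) simp
      moreover have "(A * B)\<^sup>2 * ((norm (w x) / A) powr 2 * (norm (g x) / B) powr 2) = norm (w x *\<^sub>R g x) powr 2"
        using 3 by (simp add: powr_numeral power_mult_distrib power_divide)
      ultimately show ?thesis by (simp add: distrib_left)
    qed
    have *: "(\<integral>\<^sup>+ x. ennreal (norm (w x) powr p) \<partial>lebesgue_on \<Omega>) \<le> ennreal (A powr p)"
            "(\<integral>\<^sup>+ x. ennreal (norm (g x) powr q) \<partial>lebesgue_on \<Omega>) \<le> ennreal (B powr q)"
      using 3 pq by (subst Lp_norm_le_iff[symmetric]; simp)+
    let ?a = "(A * B)\<^sup>2 * (2 / p) / A powr p" and ?b = "(A * B)\<^sup>2 * (2 / q) / B powr q"
    have ab: "0 \<le> ?a" "0 \<le> ?b" using pq 3 by auto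
    have "(\<integral>\<^sup>+ x. ennreal (norm (w x *\<^sub>R g x) powr 2) \<partial>lebesgue_on \<Omega>) \<le>
       (\<integral>\<^sup>+ x. ennreal ?a * ennreal (norm (w x) powr p) + ennreal ?b * ennreal (norm (g x) powr q) \<partial>lebesgue_on \<Omega>)"
    proof (rule nn_integral_mono)
      fix x
      show "ennreal (norm (w x *\<^sub>R g x) powr 2) \<le> ennreal ?a * ennreal (norm (w x) powr p) + ennreal ?b * ennreal (norm (g x) powr q)"
        using ennreal_leI[OF pt[of x]] ab
        by (simp add: ennreal_mult' ennreal_plus del: times_divide_eq_left times_divide_eq_right divide_divide_eq_left)
    qed
    also have "\<dots> = ennreal ?a * (\<integral>\<^sup>+ x. ennreal (norm (w x) powr p) \<partial>lebesgue_on \<Omega>)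
       + ennreal ?b * (\<integral>\<^sup>+ x. ennreal (norm (g x) powr q) \<partial>lebesgue_on \<Omega>)"
      by (simp add: nn_integral_add nn_integral_cmult)
    also have "\<dots> \<le> ennreal ?a * ennreal (A powr p) + ennreal ?b * ennreal (B powr q)"
      by (intro add_mono mult_left_mono *) auto
    also have "\<dots> = ennreal (?a * A powr p + ?b * B powr q)"
      using ab by (simp add: ennreal_mult' ennreal_plus del: times_divide_eq_left times_divide_eq_right divide_divide_eq_left)
    also have "?a * A powr p + ?b * B powr q = (A * B)\<^sup>2 * (2 * (1 / p + 1 / q))"
      using 3 by (simp add: field_simps)
    also have "\<dots> = (A * B) powr 2" using 3 pq by (simp add: powr_numeral)
    finally have "Lp_norm 2 \<Omega> (\<lambda>x. w x *\<^sub>R g x) \<le> ennreal (A * B)"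
      using 3 by (subst Lp_norm_le_iff) auto
    then show ?thesis using 3 by (simp add: ennreal_mult)
  qed
qed

section \<open>Linear combinations in Lp and the inner product of L2\<close>

lemma Lp_space_lincomb:
  fixes f g :: "'a::euclidean_space \<Rightarrow> 'b::euclidean_space"
  assumes r: "1 \<le> r" and f: "f \<in> Lp_space r \<Omega>" and g: "g \<in> Lp_space r \<Omega>"
  shows "(\<lambda>x. a *\<^sub>R f x + b *\<^sub>R g x) \<in> Lp_space r \<Omega>"
    and "Lp_norm r \<Omega> (\<lambda>x. a *\<^sub>R f x + b *\<^sub>R g x) \<le> ennreal \<bar>a\<bar> * Lp_norm r \<Omega> f + ennreal \<bar>b\<bar> * Lp_norm r \<Omega> g"
proof -
  have [measurable]: "f \<in> borel_measurable (lebesgue_on \<Omega>)" "g \<in> borel_measurable (lebesgue_on \<Omega>)"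
    using f g by (auto simp: Lp_space_def)
  have "Lp_norm r \<Omega> (\<lambda>x. a *\<^sub>R f x + b *\<^sub>R g x) \<le> Lp_norm r \<Omega> (\<lambda>x. a *\<^sub>R f x) + Lp_norm r \<Omega> (\<lambda>x. b *\<^sub>R g x)"
    by (rule Lp_norm_triangle[OF r]) measurable
  also have "\<dots> = ennreal \<bar>a\<bar> * Lp_norm r \<Omega> f + ennreal \<bar>b\<bar> * Lp_norm r \<Omega> g"
    using r by (simp add: Lp_norm_scale)
  finally show *: "Lp_norm r \<Omega> (\<lambda>x. a *\<^sub>R f x + b *\<^sub>R g x) \<le> ennreal \<bar>a\<bar> * Lp_norm r \<Omega> f + ennreal \<bar>b\<bar> * Lp_norm r \<Omega> g" .
  have "ennreal \<bar>a\<bar> * Lp_norm r \<Omega> f + ennreal \<bar>b\<bar> * Lp_norm r \<Omega> g < top"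
    using f g by (auto simp: Lp_space_def ennreal_mult_less_top)
  from le_less_trans[OF * this] show "(\<lambda>x. a *\<^sub>R f x + b *\<^sub>R g x) \<in> Lp_space r \<Omega>"
    by (simp add: Lp_space_def)
qed

text \<open>Specialising statements on a u + b w to the coefficients 1 and -1 yields the pointwise
  difference, the operation in which the abstract theory of seminorms below is phrased.\<close>

lemma lincomb_diff: "(\<lambda>x. 1 * u x + - 1 * w x) = u - (w :: 'a \<Rightarrow> real)"
  by (rule ext) simp

lemma Lp_space_diff:
  fixes f g :: "'a::euclidean_space \<Rightarrow> 'b::euclidean_space"
  assumes "1 \<le> r" "f \<in> Lp_space r \<Omega>" "g \<in> Lp_space r \<Omega>"
  shows "f - g \<in> Lp_space r \<Omega>" and "Lp_norm r \<Omega> (f - g) \<le> Lp_norm r \<Omega> f + Lp_norm r \<Omega> g"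
  using Lp_space_lincomb[OF assms, of 1 "-1"] by (simp_all add: fun_diff_def)

lemma Lp_space_2_iff:
  "f \<in> Lp_space 2 \<Omega> \<longleftrightarrow> f \<in> borel_measurable (lebesgue_on \<Omega>) \<and>
     (\<integral>\<^sup>+ x. ennreal ((norm (f x))\<^sup>2) \<partial>lebesgue_on \<Omega>) < top"
proof -
  have "Lp_norm 2 \<Omega> f < top \<longleftrightarrow> (Lp_norm 2 \<Omega> f)\<^sup>2 < top"
    by (cases "Lp_norm 2 \<Omega> f") (auto simp: ennreal_power)
  then show ?thesis by (simp add: Lp_space_def Lp_norm_2_square)
qed

lemma Lp_space_measurable: "f \<in> Lp_space r \<Omega> \<Longrightarrow> f \<in> borel_measurable (lebesgue_on \<Omega>)"
  by (simp add: Lp_space_def)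

lemma Lp_space_0: "0 < r \<Longrightarrow> (0 :: 'a::euclidean_space \<Rightarrow> 'b::real_normed_vector) \<in> Lp_space r \<Omega>"
  by (simp add: Lp_space_def zero_fun_def)

lemma L2_inner_integrable:
  fixes f g :: "'a::euclidean_space \<Rightarrow> 'b::euclidean_space"
  assumes "f \<in> Lp_space 2 \<Omega>" "g \<in> Lp_space 2 \<Omega>"
  shows "integrable (lebesgue_on \<Omega>) (\<lambda>x. f x \<bullet> g x)"
    and "ennreal \<bar>LINT x|lebesgue_on \<Omega>. f x \<bullet> g x\<bar> \<le> Lp_norm 2 \<Omega> f * Lp_norm 2 \<Omega> g"
    and "integrable (lebesgue_on \<Omega>) (\<lambda>x. norm (f x) * norm (g x))"
proof -
  have [measurable]: "f \<in> borel_measurable (lebesgue_on \<Omega>)" "g \<in> borel_measurable (lebesgue_on \<Omega>)"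
    using assms by (auto simp: Lp_space_def)
  have le: "(\<integral>\<^sup>+ x. ennreal (norm (f x) * norm (g x)) \<partial>lebesgue_on \<Omega>) \<le> Lp_norm 2 \<Omega> f * Lp_norm 2 \<Omega> g"
    by (rule nn_integral_Cauchy_Schwarz) measurable
  also have fin: "Lp_norm 2 \<Omega> f * Lp_norm 2 \<Omega> g < top"
    using assms by (auto simp: Lp_space_def ennreal_mult_less_top)
  finally show i: "integrable (lebesgue_on \<Omega>) (\<lambda>x. norm (f x) * norm (g x))"
    by (intro integrableI_nonneg) auto
  show ii: "integrable (lebesgue_on \<Omega>) (\<lambda>x. f x \<bullet> g x)"
    by (rule Bochner_Integration.integrable_bound[OF i]) (auto simp: Cauchy_Schwarz_ineq2)
  have "\<bar>LINT x|lebesgue_on \<Omega>. f x \<bullet> g x\<bar> \<le> (LINT x|lebesgue_on \<Omega>. norm (f x) * norm (g x))"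
    by (rule order_trans[OF integral_abs_bound])
       (intro integral_mono i integrable_abs ii Cauchy_Schwarz_ineq2)
  also have "ennreal \<dots> = (\<integral>\<^sup>+ x. ennreal (norm (f x) * norm (g x)) \<partial>lebesgue_on \<Omega>)"
    by (rule nn_integral_eq_integral[symmetric]) (use i in auto)
  finally show "ennreal \<bar>LINT x|lebesgue_on \<Omega>. f x \<bullet> g x\<bar> \<le> Lp_norm 2 \<Omega> f * Lp_norm 2 \<Omega> g"
    using le by (meson ennreal_leI order_trans)
qed

lemma L2_norm_square_integral:
  fixes f :: "'a::euclidean_space \<Rightarrow> 'b::euclidean_space"
  assumes "f \<in> Lp_space 2 \<Omega>"
  shows "(Lp_norm 2 \<Omega> f)\<^sup>2 = ennreal (LINT x|lebesgue_on \<Omega>. f x \<bullet> f x)"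
  unfolding Lp_norm_2_square
  using L2_inner_integrable[OF assms assms]
  by (subst nn_integral_eq_integral) (auto simp: power2_norm_eq_inner)

section \<open>Weak gradients, traces and dual spaces\<close>

locale bounded_domain =
  fixes \<Omega> :: "'a::euclidean_space set"
  assumes open_domain: "open \<Omega>" and bounded_domain: "bounded \<Omega>"
begin

lemma finite_measure_domain: "finite_measure (lebesgue_on \<Omega>)"
  by (rule finite_measure_lebesgue_on) (simp add: lmeasurable_open open_domain bounded_domain)

lemma bounded_Lp_space:
  fixes f :: "'a \<Rightarrow> 'b::euclidean_space"
  assumes [measurable]: "f \<in> borel_measurable (lebesgue_on \<Omega>)" and "\<And>x. norm (f x) \<le> B"
  shows "f \<in> Lp_space 2 \<Omega>"
proof -
  interpret finite_measure "lebesgue_on \<Omega>" by (rule finite_measure_domain)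
  have "(\<integral>\<^sup>+ x. ennreal ((norm (f x))\<^sup>2) \<partial>lebesgue_on \<Omega>) \<le> (\<integral>\<^sup>+ x. ennreal (B\<^sup>2) \<partial>lebesgue_on \<Omega>)"
    using assms(2) by (intro nn_integral_mono ennreal_leI power_mono) auto
  also have "\<dots> < top"
    using emeasure_finite[of \<Omega>] by (simp add: ennreal_mult_eq_top_iff less_top[symmetric])
  finally show ?thesis by (simp add: Lp_space_2_iff)
qed

text \<open>Continuity and compact support give boundedness, which suffices because \<Omega> has
  finite measure. Off the closed support \<phi> vanishes on an open set, hence so do its
  derivatives.\<close>

lemma test_function_L2:
  assumes "test_function \<Omega> \<phi>"
  shows "\<phi> \<in> Lp_space 2 \<Omega>" and "b \<in> Basis \<Longrightarrow> (\<lambda>x. frechet_derivative \<phi> (at x) b) \<in> Lp_space 2 \<Omega>"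
proof -
  have s: "smooth \<phi>" using assms by (simp add: test_function_def smooth_def)
  have K: "compact (closure {x. \<phi> x \<noteq> 0})" using assms by (simp add: test_function_def)
  have *: "h \<in> Lp_space 2 \<Omega>" if c: "continuous_on UNIV h" and z: "\<And>x. x \<notin> closure {x. \<phi> x \<noteq> 0} \<Longrightarrow> h x = 0"
    for h :: "'a \<Rightarrow> real"
  proof -
    have "compact (h ` closure {x. \<phi> x \<noteq> 0})"
      using K c continuous_on_subset by (intro compact_continuous_image) blast+
    then obtain B where B: "\<And>x. x \<in> closure {x. \<phi> x \<noteq> 0} \<Longrightarrow> norm (h x) \<le> B"
      using compact_imp_bounded by (fastforce simp: bounded_iff)
    have "norm (h x) \<le> max B 0" for x
      using B[of x] z[of x] by (cases "x \<in> closure {x. \<phi> x \<noteq> 0}") auto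
    moreover have "h \<in> borel_measurable (lebesgue_on \<Omega>)"
      using c by (intro measurable_restrict_space1 measurable_completion) (simp add: borel_measurable_continuous_onI)
    ultimately show ?thesis using bounded_Lp_space by blast
  qed
  show "\<phi> \<in> Lp_space 2 \<Omega>"
    by (rule *) (use smooth_continuous[OF s] closure_subset[of "{x. \<phi> x \<noteq> 0}"] in auto)
  assume b: "b \<in> Basis"
  show "(\<lambda>x. frechet_derivative \<phi> (at x) b) \<in> Lp_space 2 \<Omega>"
  proof (rule *)
    show "continuous_on UNIV (\<lambda>x. frechet_derivative \<phi> (at x) b)"
      by (intro smooth_continuous smooth_deriv s b)
    fix x assume x: "x \<notin> closure {x. \<phi> x \<noteq> 0}"
    have "((\<lambda>_. 0) has_derivative (\<lambda>_. 0)) (at x)" by simp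
    then have "(\<phi> has_derivative (\<lambda>_. 0)) (at x)"
    proof (rule has_derivative_transform_within_open[OF _ open_Compl[OF closed_closure[of "{x. \<phi> x \<noteq> 0}"]]])
      show "0 = \<phi> y" if "y \<in> - closure {x. \<phi> x \<noteq> 0}" for y
        using that closure_subset[of "{x. \<phi> x \<noteq> 0}"] by auto
    qed (use x in auto)
    then show "frechet_derivative \<phi> (at x) b = 0" by (metis frechet_derivative_at)
  qed
qed

text \<open>Cauchy-Schwarz against the constant 1, which is square integrable on a bounded
  domain.\<close>

lemma L2_integrable: 
  fixes f :: "'a \<Rightarrow> 'b::euclidean_space"
  assumes "f \<in> Lp_space 2 \<Omega>" shows "integrable (lebesgue_on \<Omega>) f"
proof -
  have o: "(\<lambda>_. 1 :: real) \<in> Lp_space 2 \<Omega>" by (rule bounded_Lp_space[of _ 1]) auto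
  have n: "(\<lambda>x. norm (f x)) \<in> Lp_space 2 \<Omega>" using assms unfolding Lp_space_2_iff by auto
  have "integrable (lebesgue_on \<Omega>) (\<lambda>x. norm (f x))"
    using L2_inner_integrable(3)[OF n o] by (simp only: real_norm_def abs_norm_cancel abs_one mult_1_right)
  then show ?thesis using Lp_space_measurable[OF assms] by (rule integrable_norm_cancel)
qed

lemma L2_component: 
  fixes g :: "'a \<Rightarrow> 'b::euclidean_space"
  assumes "g \<in> Lp_space 2 \<Omega>" "b \<in> Basis" shows "(\<lambda>x. g x \<bullet> b) \<in> Lp_space 2 \<Omega>"
proof -
  have [measurable]: "g \<in> borel_measurable (lebesgue_on \<Omega>)" using assms by (simp add: Lp_space_def)
  have "(\<integral>\<^sup>+ x. ennreal ((norm (g x \<bullet> b))\<^sup>2) \<partial>lebesgue_on \<Omega>) \<le> (\<integral>\<^sup>+ x. ennreal ((norm (g x))\<^sup>2) \<partial>lebesgue_on \<Omega>)"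
    using assms(2) by (intro nn_integral_mono ennreal_leI power_mono) (auto simp: Basis_le_norm)
  also have "\<dots> < top" using assms by (simp add: Lp_space_2_iff)
  finally show ?thesis by (simp add: Lp_space_2_iff)
qed

lemma L2_mult_integrable:
  fixes f g :: "'a \<Rightarrow> real"
  assumes "f \<in> Lp_space 2 \<Omega>" "g \<in> Lp_space 2 \<Omega>"
  shows "integrable (lebesgue_on \<Omega>) (\<lambda>x. f x * g x)"
  using L2_inner_integrable(1)[OF assms] by simp

lemma has_weak_gradient_lincomb:
  assumes "u \<in> Lp_space 2 \<Omega>" "w \<in> Lp_space 2 \<Omega>" "g \<in> Lp_space 2 \<Omega>" "h \<in> Lp_space 2 \<Omega>"
    and "has_weak_gradient \<Omega> u g" "has_weak_gradient \<Omega> w h"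
  shows "has_weak_gradient \<Omega> (\<lambda>x. a * u x + b * w x) (\<lambda>x. a *\<^sub>R g x + b *\<^sub>R h x)"
  unfolding has_weak_gradient_def
proof (intro allI impI)
  fix \<phi> e assume \<phi>: "test_function \<Omega> \<phi>" and e: "(e::'a) \<in> Basis"
  note t = test_function_L2[OF \<phi>] 
  let ?d = "\<lambda>x. frechet_derivative \<phi> (at x) e"
  have i: "integrable (lebesgue_on \<Omega>) (\<lambda>x. u x * ?d x)" "integrable (lebesgue_on \<Omega>) (\<lambda>x. w x * ?d x)"
    "integrable (lebesgue_on \<Omega>) (\<lambda>x. (g x \<bullet> e) * \<phi> x)" "integrable (lebesgue_on \<Omega>) (\<lambda>x. (h x \<bullet> e) * \<phi> x)"
    by (intro L2_mult_integrable assms t L2_component e)+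
  have "(LINT x|lebesgue_on \<Omega>. (a * u x + b * w x) * ?d x) = 
      (LINT x|lebesgue_on \<Omega>. a * (u x * ?d x) + b * (w x * ?d x))"
    by (simp add: algebra_simps)
  also have "\<dots> = a * (LINT x|lebesgue_on \<Omega>. u x * ?d x) + b * (LINT x|lebesgue_on \<Omega>. w x * ?d x)"
    using i by simp
  also have "\<dots> = - (a * (LINT x|lebesgue_on \<Omega>. (g x \<bullet> e) * \<phi> x) + b * (LINT x|lebesgue_on \<Omega>. (h x \<bullet> e) * \<phi> x))"
    using assms(5,6) \<phi> e unfolding has_weak_gradient_def by simp
  also have "\<dots> = - (LINT x|lebesgue_on \<Omega>. a * ((g x \<bullet> e) * \<phi> x) + b * ((h x \<bullet> e) * \<phi> x))"
    using i by simp
  also have "\<dots> = - (LINT x|lebesgue_on \<Omega>. ((a *\<^sub>R g x + b *\<^sub>R h x) \<bullet> e) * \<phi> x)"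
    by (simp add: algebra_simps inner_simps)
  finally show "(LINT x|lebesgue_on \<Omega>. (a * u x + b * w x) * ?d x) =
     - (LINT x|lebesgue_on \<Omega>. ((a *\<^sub>R g x + b *\<^sub>R h x) \<bullet> e) * \<phi> x)" .
qed

text \<open>Each component of g - h is orthogonal to all test functions, so the fundamental lemma
  applies.\<close>

lemma has_weak_gradient_unique:
  assumes "g \<in> Lp_space 2 \<Omega>" "h \<in> Lp_space 2 \<Omega>" "has_weak_gradient \<Omega> u g" "has_weak_gradient \<Omega> u h"
  shows "AE x in lebesgue_on \<Omega>. g x = h x"
proof -
  have "AE x in lebesgue_on \<Omega>. (g x - h x) \<bullet> e = 0" if e: "e \<in> Basis" for e
  proof (rule fundamental_lemma[OF open_domain])
    have "g - h \<in> Lp_space 2 \<Omega>" using Lp_space_diff(1)[of 2 g \<Omega> h] assms by simp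
    then have "(\<lambda>x. (g x - h x) \<bullet> e) \<in> Lp_space 2 \<Omega>" using L2_component[of "g - h" e] e by simp
    then show "integrable (lebesgue_on \<Omega>) (\<lambda>x. (g x - h x) \<bullet> e)" by (rule L2_integrable)
    fix \<phi> assume \<phi>: "test_function \<Omega> \<phi>"
    have i: "integrable (lebesgue_on \<Omega>) (\<lambda>x. (g x \<bullet> e) * \<phi> x)" "integrable (lebesgue_on \<Omega>) (\<lambda>x. (h x \<bullet> e) * \<phi> x)"
      by (intro L2_mult_integrable assms test_function_L2[OF \<phi>] L2_component e)+
    have "(LINT x|lebesgue_on \<Omega>. (g x \<bullet> e) * \<phi> x) = (LINT x|lebesgue_on \<Omega>. (h x \<bullet> e) * \<phi> x)"
      using assms(3)[unfolded has_weak_gradient_def, rule_format, OF \<phi> e]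
        assms(4)[unfolded has_weak_gradient_def, rule_format, OF \<phi> e] by simp
    then show "(LINT x|lebesgue_on \<Omega>. (g x - h x) \<bullet> e * \<phi> x) = 0"
      using i by (simp add: inner_simps left_diff_distrib)
  qed
  then have "AE x in lebesgue_on \<Omega>. \<forall>e\<in>Basis. (g x - h x) \<bullet> e = 0"
    by (intro AE_finite_allI) auto
  then show ?thesis by eventually_elim (simp add: euclidean_eq_iff[of "g _"] inner_simps)
qed

lemma weak_grad:
  assumes "u \<in> H1 \<Omega>"
  shows "weak_grad \<Omega> u \<in> Lp_space 2 \<Omega>" "has_weak_gradient \<Omega> u (weak_grad \<Omega> u)"
proof -
  have "\<exists>g. g \<in> Lp_space 2 \<Omega> \<and> has_weak_gradient \<Omega> u g" using assms unfolding H1_def by blast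
  from someI_ex[OF this] show "weak_grad \<Omega> u \<in> Lp_space 2 \<Omega>" "has_weak_gradient \<Omega> u (weak_grad \<Omega> u)"
    unfolding weak_grad_def by blast+
qed

lemma H1_L2: "u \<in> H1 \<Omega> \<Longrightarrow> u \<in> Lp_space 2 \<Omega>"
  by (simp add: H1_def)

text \<open>\<open>weak_grad\<close> is a choice among representatives, so its linearity holds only
  up to null sets; it follows from the uniqueness of weak gradients.\<close>

lemma H1_lincomb:
  assumes "u \<in> H1 \<Omega>" "w \<in> H1 \<Omega>"
  shows "(\<lambda>x. a * u x + b * w x) \<in> H1 \<Omega>"
    and "AE x in lebesgue_on \<Omega>. weak_grad \<Omega> (\<lambda>x. a * u x + b * w x) x = a *\<^sub>R weak_grad \<Omega> u x + b *\<^sub>R weak_grad \<Omega> w x"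
proof -
  have g: "has_weak_gradient \<Omega> (\<lambda>x. a * u x + b * w x) (\<lambda>x. a *\<^sub>R weak_grad \<Omega> u x + b *\<^sub>R weak_grad \<Omega> w x)"
    by (intro has_weak_gradient_lincomb H1_L2 weak_grad assms)
  have l: "(\<lambda>x. a *\<^sub>R weak_grad \<Omega> u x + b *\<^sub>R weak_grad \<Omega> w x) \<in> Lp_space 2 \<Omega>"
    by (intro Lp_space_lincomb weak_grad assms) simp
  have "(\<lambda>x. a * u x + b * w x) \<in> Lp_space 2 \<Omega>"
    using Lp_space_lincomb(1)[of 2 u \<Omega> w a b] H1_L2 assms by simp
  with g l show h: "(\<lambda>x. a * u x + b * w x) \<in> H1 \<Omega>" unfolding H1_def by blast
  show "AE x in lebesgue_on \<Omega>. weak_grad \<Omega> (\<lambda>x. a * u x + b * w x) x = a *\<^sub>R weak_grad \<Omega> u x + b *\<^sub>R weak_grad \<Omega> w x"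
    by (rule has_weak_gradient_unique[OF weak_grad(1)[OF h] l weak_grad(2)[OF h] g])
qed

lemma H1_diff:
  assumes "u \<in> H1 \<Omega>" "w \<in> H1 \<Omega>"
  shows "u - w \<in> H1 \<Omega>"
    and "AE x in lebesgue_on \<Omega>. weak_grad \<Omega> (u - w) x = weak_grad \<Omega> u x - weak_grad \<Omega> w x"
proof -
  note l = H1_lincomb[OF assms, of 1 "-1", unfolded lincomb_diff]
  show "u - w \<in> H1 \<Omega>" by (rule l)
  from l(2) show "AE x in lebesgue_on \<Omega>. weak_grad \<Omega> (u - w) x = weak_grad \<Omega> u x - weak_grad \<Omega> w x"
    by eventually_elim simp
qed

lemma H1_0: "0 \<in> H1 \<Omega>" and weak_grad_0: "AE x in lebesgue_on \<Omega>. weak_grad \<Omega> 0 x = 0"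
proof -
  have g: "has_weak_gradient \<Omega> 0 0" by (simp add: has_weak_gradient_def)
  moreover have "(0 :: 'a \<Rightarrow> real) \<in> Lp_space 2 \<Omega>" "(0 :: 'a \<Rightarrow> 'a) \<in> Lp_space 2 \<Omega>"
    by (rule Lp_space_0, simp)+
  ultimately show h: "0 \<in> H1 \<Omega>" unfolding H1_def by blast
  show "AE x in lebesgue_on \<Omega>. weak_grad \<Omega> 0 x = 0"
    using has_weak_gradient_unique[OF weak_grad(1)[OF h] Lp_space_0 weak_grad(2)[OF h] g] by simp
qed

lemma H1D_norm_finite: "u \<in> H1 \<Omega> \<Longrightarrow> H1D_norm \<Omega> u < top"
  using weak_grad(1)[of u] by (simp add: H1D_norm_def Lp_space_def)

lemma Lp_norm_H1_finite: "u \<in> H1 \<Omega> \<Longrightarrow> Lp_norm 2 \<Omega> u < top"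
  by (simp add: H1_def Lp_space_def)

lemma H1D_norm_lincomb:
  assumes "u \<in> H1 \<Omega>" "w \<in> H1 \<Omega>"
  shows "H1D_norm \<Omega> (\<lambda>x. a * u x + b * w x) \<le> ennreal \<bar>a\<bar> * H1D_norm \<Omega> u + ennreal \<bar>b\<bar> * H1D_norm \<Omega> w"
proof -
  have "H1D_norm \<Omega> (\<lambda>x. a * u x + b * w x) = Lp_norm 2 \<Omega> (\<lambda>x. a *\<^sub>R weak_grad \<Omega> u x + b *\<^sub>R weak_grad \<Omega> w x)"
    unfolding H1D_norm_def
    by (rule Lp_norm_cong_AE) (use H1_lincomb(2)[OF assms, of a b] in \<open>eventually_elim, simp\<close>)
  also have "\<dots> \<le> ennreal \<bar>a\<bar> * H1D_norm \<Omega> u + ennreal \<bar>b\<bar> * H1D_norm \<Omega> w"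
    unfolding H1D_norm_def by (intro Lp_space_lincomb weak_grad assms) simp
  finally show ?thesis .
qed

lemma H1_norm_eq:
  assumes "u \<in> H1 \<Omega>"
  shows "H1_norm \<Omega> u = ennreal (sqrt ((enn2real (Lp_norm 2 \<Omega> u))\<^sup>2 + (enn2real (H1D_norm \<Omega> u))\<^sup>2))"
proof -
  obtain a where a: "Lp_norm 2 \<Omega> u = ennreal a" "0 \<le> a" using Lp_norm_H1_finite[OF assms] by (cases "Lp_norm 2 \<Omega> u") auto
  obtain b where b: "Lp_norm 2 \<Omega> (weak_grad \<Omega> u) = ennreal b" "0 \<le> b"
    using H1D_norm_finite[OF assms] by (cases "Lp_norm 2 \<Omega> (weak_grad \<Omega> u)") (auto simp: H1D_norm_def)
  show ?thesis
    using a b by (simp add: H1_norm_def H1D_norm_def ennreal_power ennpowr_ennreal powr_half_sqrt flip: ennreal_plus)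
qed

lemma H1_norm_bounds:
  assumes "u \<in> H1 \<Omega>"
  shows "H1D_norm \<Omega> u \<le> H1_norm \<Omega> u" "Lp_norm 2 \<Omega> u \<le> H1_norm \<Omega> u" "H1_norm \<Omega> u < top"
proof -
  obtain a where a: "Lp_norm 2 \<Omega> u = ennreal a" "0 \<le> a" using Lp_norm_H1_finite[OF assms] by (cases "Lp_norm 2 \<Omega> u") auto
  obtain b where b: "H1D_norm \<Omega> u = ennreal b" "0 \<le> b"
    using H1D_norm_finite[OF assms] by (cases "H1D_norm \<Omega> u") auto
  show "H1D_norm \<Omega> u \<le> H1_norm \<Omega> u" "Lp_norm 2 \<Omega> u \<le> H1_norm \<Omega> u" "H1_norm \<Omega> u < top"
    unfolding H1_norm_eq[OF assms] using a b by (auto intro!: ennreal_leI real_le_rsqrt)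
qed

text \<open>The norm is the Euclidean length of the pair formed by the L2 norm and the gradient
  norm. Both entries are subadditive, and the triangle inequality in the plane does the
  rest.\<close>

lemma H1_norm_lincomb:
  assumes "u \<in> H1 \<Omega>" "w \<in> H1 \<Omega>"
  shows "H1_norm \<Omega> (\<lambda>x. a * u x + b * w x) \<le> ennreal \<bar>a\<bar> * H1_norm \<Omega> u + ennreal \<bar>b\<bar> * H1_norm \<Omega> w"
proof -
  define l where "l v = enn2real (Lp_norm 2 \<Omega> v)" for v :: "'a \<Rightarrow> real"
  define d where "d v = enn2real (H1D_norm \<Omega> v)" for v :: "'a \<Rightarrow> real"
  have nn: "0 \<le> l v" "0 \<le> d v" for v by (simp_all add: l_def d_def)
  have l: "Lp_norm 2 \<Omega> v = ennreal (l v)" "H1D_norm \<Omega> v = ennreal (d v)" if "v \<in> H1 \<Omega>" for v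
    using Lp_norm_H1_finite[OF that] H1D_norm_finite[OF that] by (auto simp: l_def d_def)
  let ?c = "\<lambda>x. a * u x + b * w x"
  have c: "?c \<in> H1 \<Omega>" by (rule H1_lincomb[OF assms])
  have "Lp_norm 2 \<Omega> ?c \<le> ennreal \<bar>a\<bar> * Lp_norm 2 \<Omega> u + ennreal \<bar>b\<bar> * Lp_norm 2 \<Omega> w"
    using Lp_space_lincomb(2)[of 2 u \<Omega> w a b] H1_L2 assms by simp
  then have L: "l ?c \<le> \<bar>a\<bar> * l u + \<bar>b\<bar> * l w"
    using nn by (simp add: l[OF assms(1)] l[OF assms(2)] l[OF c] flip: ennreal_mult ennreal_plus)
  have D: "d ?c \<le> \<bar>a\<bar> * d u + \<bar>b\<bar> * d w"
    using H1D_norm_lincomb[OF assms, of a b] nn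
    by (simp add: l[OF assms(1)] l[OF assms(2)] l[OF c] flip: ennreal_mult ennreal_plus)
  have "sqrt ((l ?c)\<^sup>2 + (d ?c)\<^sup>2) \<le> sqrt ((\<bar>a\<bar> * l u + \<bar>b\<bar> * l w)\<^sup>2 + (\<bar>a\<bar> * d u + \<bar>b\<bar> * d w)\<^sup>2)"
    using L D nn by (intro real_sqrt_le_mono add_mono power_mono) auto
  also have "\<dots> \<le> sqrt ((\<bar>a\<bar> * l u)\<^sup>2 + (\<bar>a\<bar> * d u)\<^sup>2) + sqrt ((\<bar>b\<bar> * l w)\<^sup>2 + (\<bar>b\<bar> * d w)\<^sup>2)"
    by (rule real_sqrt_sum_squares_triangle_ineq)
  also have "\<dots> = \<bar>a\<bar> * sqrt ((l u)\<^sup>2 + (d u)\<^sup>2) + \<bar>b\<bar> * sqrt ((l w)\<^sup>2 + (d w)\<^sup>2)"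
    by (simp add: power_mult_distrib real_sqrt_mult flip: distrib_left)
  finally show ?thesis
    unfolding H1_norm_eq[OF c] H1_norm_eq[OF assms(1)] H1_norm_eq[OF assms(2)]
    by (simp add: l_def d_def flip: ennreal_mult ennreal_plus)
qed

end

section \<open>Traces, functions vanishing on the Dirichlet boundary, and their dual\<close>

locale dirichlet_domain = bounded_domain \<Omega> for \<Omega> :: "'a::euclidean_space set" +
  fixes \<Gamma> :: "'a set"
  assumes borel_boundary: "\<Gamma> \<in> sets borel" and boundary_subset: "\<Gamma> \<subseteq> closure \<Omega>"
begin

text \<open>The approximating sequences are combined linearly. The boundary error uses (s + t)^2
  \<le> 2 s^2 + 2 t^2; its integrand is measurable because \<Gamma> is Borel and lies in
  \<open>closure \<Omega>\<close>, where the approximants are continuous.\<close>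

lemma has_trace_lincomb:
  assumes u: "has_trace \<Omega> \<Gamma> u g" and w: "has_trace \<Omega> \<Gamma> w h"
  shows "has_trace \<Omega> \<Gamma> (\<lambda>x. a * u x + b * w x) (\<lambda>x. a * g x + b * h x)"
proof -
  let ?H = "hausdorff_measure (real DIM('a) - 1) :: 'a measure"
  obtain \<phi> where \<phi>: "\<And>k. \<phi> k \<in> H1 \<Omega>" "\<And>k. continuous_on (closure \<Omega>) (\<phi> k)"
      "(\<lambda>k. H1_norm \<Omega> (\<phi> k - u)) \<longlonglongrightarrow> 0"
      "(\<lambda>k. \<integral>\<^sup>+ x \<in> \<Gamma>. ennreal ((\<phi> k x - g x)\<^sup>2) \<partial>?H) \<longlonglongrightarrow> 0"
    using u unfolding has_trace_def by blast
  obtain \<psi> where \<psi>: "\<And>k. \<psi> k \<in> H1 \<Omega>" "\<And>k. continuous_on (closure \<Omega>) (\<psi> k)"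
      "(\<lambda>k. H1_norm \<Omega> (\<psi> k - w)) \<longlonglongrightarrow> 0"
      "(\<lambda>k. \<integral>\<^sup>+ x \<in> \<Gamma>. ennreal ((\<psi> k x - h x)\<^sup>2) \<partial>?H) \<longlonglongrightarrow> 0"
    using w unfolding has_trace_def by blast
  have uw: "u \<in> H1 \<Omega>" "w \<in> H1 \<Omega>" and gh: "g \<in> borel_measurable (restrict_space borel \<Gamma>)"
      "h \<in> borel_measurable (restrict_space borel \<Gamma>)"
    using u w by (auto simp: has_trace_def)
  let ?\<chi> = "\<lambda>k x. a * \<phi> k x + b * \<psi> k x"
  have m: "(\<lambda>x. ennreal ((f x - e x)\<^sup>2) * indicator \<Gamma> x) \<in> borel_measurable ?H"
    if "continuous_on (closure \<Omega>) f" "e \<in> borel_measurable (restrict_space borel \<Gamma>)" for f e :: "'a \<Rightarrow> real"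
  proof -
    have "f \<in> borel_measurable (restrict_space borel \<Gamma>)"
      using continuous_on_subset[OF that(1) boundary_subset] by (rule borel_measurable_continuous_on_restrict)
    then have "(\<lambda>x. ennreal ((f x - e x)\<^sup>2)) \<in> borel_measurable (restrict_space borel \<Gamma>)"
      using that(2) by measurable
    then have "(\<lambda>x. ennreal ((f x - e x)\<^sup>2) * indicator \<Gamma> x) \<in> borel_measurable borel"
      using borel_boundary by (subst (asm) borel_measurable_restrict_space_iff_ennreal) auto
    then show ?thesis by (simp cong: measurable_cong_sets)
  qed
  show ?thesis unfolding has_trace_def
  proof (intro conjI exI[of _ ?\<chi>] allI)
    show "(\<lambda>x. a * u x + b * w x) \<in> H1 \<Omega>" by (rule H1_lincomb[OF uw])
    show "(\<lambda>x. a * g x + b * h x) \<in> borel_measurable (restrict_space borel \<Gamma>)" using gh by measurable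
    show "?\<chi> k \<in> H1 \<Omega>" "continuous_on (closure \<Omega>) (?\<chi> k)" for k
      using \<phi> \<psi> H1_lincomb by (auto intro!: continuous_intros)
    show "(\<lambda>k. H1_norm \<Omega> (?\<chi> k - (\<lambda>x. a * u x + b * w x))) \<longlonglongrightarrow> 0"
    proof (rule tendsto_sandwich[where f="\<lambda>_. 0"])
      have "H1_norm \<Omega> (?\<chi> k - (\<lambda>x. a * u x + b * w x)) \<le>
          ennreal \<bar>a\<bar> * H1_norm \<Omega> (\<phi> k - u) + ennreal \<bar>b\<bar> * H1_norm \<Omega> (\<psi> k - w)" for k
        using H1_norm_lincomb[OF H1_diff(1)[OF \<phi>(1) uw(1)] H1_diff(1)[OF \<psi>(1) uw(2)], of a k b k]
        by (simp add: fun_diff_def algebra_simps)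
      then show "\<forall>\<^sub>F k in sequentially. H1_norm \<Omega> (?\<chi> k - (\<lambda>x. a * u x + b * w x)) \<le>
          ennreal \<bar>a\<bar> * H1_norm \<Omega> (\<phi> k - u) + ennreal \<bar>b\<bar> * H1_norm \<Omega> (\<psi> k - w)" by simp
      have "(\<lambda>k. ennreal \<bar>a\<bar> * H1_norm \<Omega> (\<phi> k - u) + ennreal \<bar>b\<bar> * H1_norm \<Omega> (\<psi> k - w)) \<longlonglongrightarrow>
         ennreal \<bar>a\<bar> * 0 + ennreal \<bar>b\<bar> * 0"
        by (intro tendsto_add ennreal_tendsto_cmult \<phi> \<psi>) auto
      then show "(\<lambda>k. ennreal \<bar>a\<bar> * H1_norm \<Omega> (\<phi> k - u) + ennreal \<bar>b\<bar> * H1_norm \<Omega> (\<psi> k - w)) \<longlonglongrightarrow> 0" by simp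
    qed auto
    show "(\<lambda>k. \<integral>\<^sup>+ x \<in> \<Gamma>. ennreal ((?\<chi> k x - (a * g x + b * h x))\<^sup>2) \<partial>?H) \<longlonglongrightarrow> 0"
    proof (rule tendsto_sandwich[where f="\<lambda>_. 0"])
      let ?B = "\<lambda>k. ennreal (2 * a\<^sup>2) * (\<integral>\<^sup>+ x \<in> \<Gamma>. ennreal ((\<phi> k x - g x)\<^sup>2) \<partial>?H) +
         ennreal (2 * b\<^sup>2) * (\<integral>\<^sup>+ x \<in> \<Gamma>. ennreal ((\<psi> k x - h x)\<^sup>2) \<partial>?H)"
      have "(\<integral>\<^sup>+ x \<in> \<Gamma>. ennreal ((?\<chi> k x - (a * g x + b * h x))\<^sup>2) \<partial>?H) \<le> ?B k" for k
      proof -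
        note m1 = m[OF \<phi>(2)[of k] gh(1)] and m2 = m[OF \<psi>(2)[of k] gh(2)]
        have pt: "(?\<chi> k x - (a * g x + b * h x))\<^sup>2 \<le> 2 * a\<^sup>2 * (\<phi> k x - g x)\<^sup>2 + 2 * b\<^sup>2 * (\<psi> k x - h x)\<^sup>2" for x
          using sum_squares_ge_zero[of "a * (\<phi> k x - g x) - b * (\<psi> k x - h x)" 0]
          by (simp add: power2_eq_square algebra_simps)
        have "(\<integral>\<^sup>+ x \<in> \<Gamma>. ennreal ((?\<chi> k x - (a * g x + b * h x))\<^sup>2) \<partial>?H) \<le>
          (\<integral>\<^sup>+ x. ennreal (2 * a\<^sup>2) * (ennreal ((\<phi> k x - g x)\<^sup>2) * indicator \<Gamma> x) +
                  ennreal (2 * b\<^sup>2) * (ennreal ((\<psi> k x - h x)\<^sup>2) * indicator \<Gamma> x) \<partial>?H)"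
        proof (rule nn_integral_mono)
          fix x
          show "ennreal ((?\<chi> k x - (a * g x + b * h x))\<^sup>2) * indicator \<Gamma> x \<le>
            ennreal (2 * a\<^sup>2) * (ennreal ((\<phi> k x - g x)\<^sup>2) * indicator \<Gamma> x) +
                  ennreal (2 * b\<^sup>2) * (ennreal ((\<psi> k x - h x)\<^sup>2) * indicator \<Gamma> x)"
            using ennreal_leI[OF pt[of x]] by (cases "x \<in> \<Gamma>") (simp_all flip: ennreal_mult ennreal_plus)
        qed
        also have "\<dots> = ?B k" using m1 m2 by (simp add: nn_integral_add nn_integral_cmult)
        finally show ?thesis .
      qed
      then show "\<forall>\<^sub>F k in sequentially. (\<integral>\<^sup>+ x \<in> \<Gamma>. ennreal ((?\<chi> k x - (a * g x + b * h x))\<^sup>2) \<partial>?H) \<le> ?B k" by simp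
      have "?B \<longlonglongrightarrow> ennreal (2 * a\<^sup>2) * 0 + ennreal (2 * b\<^sup>2) * 0"
        by (intro tendsto_add ennreal_tendsto_cmult \<phi> \<psi>) auto
      then show "?B \<longlonglongrightarrow> 0" by simp
    qed auto
  qed
qed

text \<open>This is where equal Dirichlet data enter: they make the difference of two solutions an
  admissible test function.\<close>

lemma has_trace_diff:
  "has_trace \<Omega> \<Gamma> u g \<Longrightarrow> has_trace \<Omega> \<Gamma> w g \<Longrightarrow> u - w \<in> H1D \<Omega> \<Gamma>"
  using has_trace_lincomb[of u g w g 1 "-1", unfolded lincomb_diff] by (simp add: H1D_def zero_fun_def)

lemma H1D_H1: "u \<in> H1D \<Omega> \<Gamma> \<Longrightarrow> u \<in> H1 \<Omega>"
  by (simp add: H1D_def has_trace_def)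

lemma H1D_0: "0 \<in> H1D \<Omega> \<Gamma>"
proof -
  have "H1_norm \<Omega> 0 = 0"
  proof -
    have "H1D_norm \<Omega> 0 = Lp_norm 2 \<Omega> (\<lambda>_. 0 :: 'a)"
      unfolding H1D_norm_def by (rule Lp_norm_cong_AE) (use weak_grad_0 in auto)
    then show ?thesis using H1_norm_eq[OF H1_0] by (simp add: zero_fun_def)
  qed
  then show ?thesis unfolding H1D_def has_trace_def
    using H1_0 by (auto intro!: exI[of _ "\<lambda>_. 0"] simp: zero_fun_def)
qed

lemma H1D_lincomb:
  "u \<in> H1D \<Omega> \<Gamma> \<Longrightarrow> w \<in> H1D \<Omega> \<Gamma> \<Longrightarrow> (\<lambda>x. a * u x + b * w x) \<in> H1D \<Omega> \<Gamma>"
  using has_trace_lincomb[of u "\<lambda>_. 0" w "\<lambda>_. 0" a b] by (simp add: H1D_def)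

lemma H1D_dual_lincomb:
  "F \<in> H1D_dual \<Omega> \<Gamma> \<Longrightarrow> u \<in> H1D \<Omega> \<Gamma> \<Longrightarrow> w \<in> H1D \<Omega> \<Gamma> \<Longrightarrow> F (\<lambda>x. a * u x + b * w x) = a * F u + b * F w"
  unfolding H1D_dual_def by blast

lemma H1D_dual_diff:
  "F \<in> H1D_dual \<Omega> \<Gamma> \<Longrightarrow> u \<in> H1D \<Omega> \<Gamma> \<Longrightarrow> w \<in> H1D \<Omega> \<Gamma> \<Longrightarrow> F (u - w) = F u - F w"
  using H1D_dual_lincomb[of F u w 1 "-1", unfolded lincomb_diff] by simp

lemma H1D_dual_0: "F \<in> H1D_dual \<Omega> \<Gamma> \<Longrightarrow> F 0 = 0"
  using H1D_dual_diff[of F 0 0] H1D_0 by simp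

text \<open>Homogeneity reduces the bound to the unit ball of the definition. Scaling is expressed
  as c u + 0 u because linearity in \<open>H1D_dual\<close> is stated for combinations of two
  functions.\<close>

lemma H1D_dual_bound:
  assumes F: "F \<in> H1D_dual \<Omega> \<Gamma>" and u: "u \<in> H1D \<Omega> \<Gamma>"
  shows "\<bar>F u\<bar> \<le> enn2real (H1D_dual_norm \<Omega> \<Gamma> F) * enn2real (H1D_norm \<Omega> u)"
proof -
  define A where "A = enn2real (H1D_dual_norm \<Omega> \<Gamma> F)"
  define b where "b = enn2real (H1D_norm \<Omega> u)"
  have A: "H1D_dual_norm \<Omega> \<Gamma> F = ennreal A" "0 \<le> A"
  proof -
    have "H1D_dual_norm \<Omega> \<Gamma> F < top" using F unfolding H1D_dual_def infinity_ennreal_def by blast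
    then show "H1D_dual_norm \<Omega> \<Gamma> F = ennreal A" "0 \<le> A" by (simp_all add: A_def)
  qed
  have b: "H1D_norm \<Omega> u = ennreal b" "0 \<le> b" using H1D_norm_finite[OF H1D_H1[OF u]] by (auto simp: b_def)
  have le: "\<bar>c * F u\<bar> \<le> A" if "\<bar>c\<bar> * b \<le> 1" for c
  proof -
    have c: "(\<lambda>x. c * u x + 0 * u x) \<in> H1D \<Omega> \<Gamma>" by (rule H1D_lincomb[OF u u])
    have "H1D_norm \<Omega> (\<lambda>x. c * u x + 0 * u x) \<le> ennreal (\<bar>c\<bar> * b)"
      using H1D_norm_lincomb[OF H1D_H1[OF u] H1D_H1[OF u], of c 0] b by (simp add: ennreal_mult)
    also have "\<dots> \<le> 1" using that by simp
    finally have "ennreal \<bar>F (\<lambda>x. c * u x + 0 * u x)\<bar> \<le> H1D_dual_norm \<Omega> \<Gamma> F"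
      unfolding H1D_dual_norm_def using c by (intro SUP_upper) auto
    then show ?thesis using A H1D_dual_lincomb[OF F u u, of c 0] by simp
  qed
  show ?thesis
  proof (cases "b = 0")
    case True
    have "\<bar>F u\<bar> \<le> 0"
    proof (rule ccontr)
      assume "\<not> \<bar>F u\<bar> \<le> 0"
      \<comment> \<open>Every multiple of u has gradient norm 0, so F would be unbounded on the unit
        ball; this multiple yields A + 1 \<le> A.\<close>
      then show False using le[of "(A + 1) / \<bar>F u\<bar>"] True A by (simp add: abs_mult)
    qed
    then show ?thesis by simp
  next
    case False
    then have pos: "0 < b" using b by simp
    then have "\<bar>1 / b * F u\<bar> \<le> A" by (intro le) simp
    then have "\<bar>F u\<bar> / b \<le> A" using pos by (simp add: abs_mult)
    then have "\<bar>F u\<bar> \<le> A * b" using pos by (simp only: pos_divide_le_eq)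
    then show ?thesis by (simp only: A_def b_def)
  qed
qed

text \<open>A finite norm is part of membership in the dual, so the norm estimate is proved
  first.\<close>

lemma H1D_dual_space_diff:
  assumes "F \<in> H1D_dual \<Omega> \<Gamma>" "G \<in> H1D_dual \<Omega> \<Gamma>"
  shows "F - G \<in> H1D_dual \<Omega> \<Gamma>" "H1D_dual_norm \<Omega> \<Gamma> (F - G) \<le> H1D_dual_norm \<Omega> \<Gamma> F + H1D_dual_norm \<Omega> \<Gamma> G"
proof -
  show *: "H1D_dual_norm \<Omega> \<Gamma> (F - G) \<le> H1D_dual_norm \<Omega> \<Gamma> F + H1D_dual_norm \<Omega> \<Gamma> G"
    unfolding H1D_dual_norm_def[of _ _ "F - G"]
  proof (rule SUP_least)
    fix u assume u: "u \<in> {u \<in> H1D \<Omega> \<Gamma>. H1D_norm \<Omega> u \<le> 1}"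
    have "ennreal \<bar>(F - G) u\<bar> \<le> ennreal \<bar>F u\<bar> + ennreal \<bar>G u\<bar>"
      by (simp flip: ennreal_plus)
    also have "\<dots> \<le> H1D_dual_norm \<Omega> \<Gamma> F + H1D_dual_norm \<Omega> \<Gamma> G"
      unfolding H1D_dual_norm_def by (intro add_mono SUP_upper u)
    finally show "ennreal \<bar>(F - G) u\<bar> \<le> H1D_dual_norm \<Omega> \<Gamma> F + H1D_dual_norm \<Omega> \<Gamma> G" .
  qed
  have "H1D_dual_norm \<Omega> \<Gamma> F < top" "H1D_dual_norm \<Omega> \<Gamma> G < top"
    using assms unfolding H1D_dual_def infinity_ennreal_def by blast+
  then have "H1D_dual_norm \<Omega> \<Gamma> F + H1D_dual_norm \<Omega> \<Gamma> G < top" by simp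
  with * have "H1D_dual_norm \<Omega> \<Gamma> (F - G) < top" by (rule le_less_trans)
  moreover have "(F - G) (\<lambda>x. a * u x + b * w x) = a * (F - G) u + b * (F - G) w"
    if "u \<in> H1D \<Omega> \<Gamma>" "w \<in> H1D \<Omega> \<Gamma>" for u w a b
    by (simp only: fun_diff_def H1D_dual_lincomb[OF assms(1) that] H1D_dual_lincomb[OF assms(2) that])
       (simp add: algebra_simps)
  ultimately show "F - G \<in> H1D_dual \<Omega> \<Gamma>" unfolding H1D_dual_def mem_Collect_eq infinity_ennreal_def by blast
qed

lemma H1D_dual_zero: "0 \<in> H1D_dual \<Omega> \<Gamma>" "H1D_dual_norm \<Omega> \<Gamma> 0 = 0"
proof -
  have "H1D_dual_norm \<Omega> \<Gamma> 0 \<le> 0" unfolding H1D_dual_norm_def by (rule SUP_least) simp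
  then show "H1D_dual_norm \<Omega> \<Gamma> 0 = 0" by simp
  then show "0 \<in> H1D_dual \<Omega> \<Gamma>" unfolding H1D_dual_def mem_Collect_eq by simp
qed

end

section \<open>Bochner spaces\<close>

text \<open>Lebesgue measure is complete, so values on a null set do not affect measurability;
  extension by 0 transfers this to the subset S.\<close>

lemma borel_measurable_lebesgue_on_cong_AE:
  fixes f g :: "'a::euclidean_space \<Rightarrow> real"
  assumes S: "S \<in> sets lebesgue" and f: "f \<in> borel_measurable (lebesgue_on S)"
    and eq: "AE x in lebesgue_on S. f x = g x"
  shows "g \<in> borel_measurable (lebesgue_on S)"
proof -
  have S': "S \<inter> space lebesgue \<in> sets lebesgue" using S by simp
  have "(\<lambda>x. indicator S x *\<^sub>R f x) \<in> borel_measurable lebesgue"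
    using f by (simp add: borel_measurable_restrict_space_iff[OF S'])
  moreover have "AE x in lebesgue. x \<in> S \<longrightarrow> f x = g x"
    using eq by (simp add: AE_restrict_space_iff[OF S'])
  then have "AE x in lebesgue. indicator S x *\<^sub>R f x = indicator S x *\<^sub>R g x"
    by eventually_elim (auto simp: indicator_def)
  ultimately have "(\<lambda>x. indicator S x *\<^sub>R g x) \<in> borel_measurable lebesgue"
    by (rule borel_measurable_AE)
  then show ?thesis by (simp add: borel_measurable_restrict_space_iff[OF S'])
qed

text \<open>\<open>lim\<close> is a total measurable function and agrees with f wherever the
  sequence converges to f.\<close>

lemma borel_measurable_lebesgue_on_AE_limit:
  fixes f :: "'a::euclidean_space \<Rightarrow> real"
  assumes S: "S \<in> sets lebesgue" and [measurable]: "\<And>k. g k \<in> borel_measurable (lebesgue_on S)"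
    and lim: "AE x in lebesgue_on S. (\<lambda>k. g k x) \<longlonglongrightarrow> f x"
  shows "f \<in> borel_measurable (lebesgue_on S)"
proof (rule borel_measurable_lebesgue_on_cong_AE[OF S])
  show "(\<lambda>x. lim (\<lambda>k. g k x)) \<in> borel_measurable (lebesgue_on S)" by measurable
  show "AE x in lebesgue_on S. lim (\<lambda>k. g k x) = f x"
    using lim by eventually_elim (rule limI)
qed

text \<open>A simple function has finitely many values, so h may be arbitrary. This makes norms and
  pairings measurable on spaces of functions for which no \<sigma>-algebra is fixed.\<close>

lemma simple_function_real_measurable: 
  "simple_function M s \<Longrightarrow> (\<lambda>t. (h (s t) :: real)) \<in> borel_measurable M"
  using simple_function_compose1[of M s h] by (rule borel_measurable_simple_function)

lemma tendsto_0_bound: "(\<And>k::nat. \<bar>f k\<bar> \<le> g k) \<Longrightarrow> g \<longlonglongrightarrow> (0::real) \<Longrightarrow> f \<longlonglongrightarrow> 0"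
  by (rule Lim_null_comparison) auto

lemma enn2real_tendsto_0_bound:
  "(\<And>k::nat. enn2real (f k) \<le> g k) \<Longrightarrow> g \<longlonglongrightarrow> (0::real) \<Longrightarrow> (\<lambda>k. enn2real (f k)) \<longlonglongrightarrow> 0"
  by (rule tendsto_0_bound) auto

text \<open>The common core of \<open>Lp_space\<close>, \<open>H1\<close>, \<open>H1D\<close> and
  \<open>H1D_dual\<close>: sets of plain functions with pointwise subtraction and a seminorm that
  depends on the domain. The general facts on Bochner spaces are proved once here.\<close>

locale seminormed =
  fixes X :: "'x::ab_group_add set" and N :: "'x \<Rightarrow> ennreal"
  assumes zero: "0 \<in> X" and N_zero: "N 0 = 0"
    and diff: "x \<in> X \<Longrightarrow> y \<in> X \<Longrightarrow> x - y \<in> X"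
    and N_diff: "x \<in> X \<Longrightarrow> y \<in> X \<Longrightarrow> N (x - y) \<le> N x + N y"
    and N_finite: "x \<in> X \<Longrightarrow> N x < top"
begin

abbreviation n :: "'x \<Rightarrow> real" where "n x \<equiv> enn2real (N x)"

lemma N_eq: "x \<in> X \<Longrightarrow> N x = ennreal (n x)"
  using N_finite by simp

lemma n_diff: "x \<in> X \<Longrightarrow> y \<in> X \<Longrightarrow> n (x - y) \<le> n x + n y"
  using enn2real_mono[OF N_diff[of x y]] N_finite[of x] N_finite[of y] by (simp add: enn2real_plus)

text \<open>Symmetry comes from subadditivity under differences, since y - x = 0 - (x - y).\<close>

lemma n_commute: "x \<in> X \<Longrightarrow> y \<in> X \<Longrightarrow> n (x - y) = n (y - x)"
  using n_diff[of 0 "x - y"] n_diff[of 0 "y - x"] zero N_zero diff[of x y] diff[of y x] by simp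

lemma n_triangle: "x \<in> X \<Longrightarrow> y \<in> X \<Longrightarrow> z \<in> X \<Longrightarrow> n (x - z) \<le> n (x - y) + n (y - z)"
  using n_diff[of "x - y" "z - y"] n_commute[of z y] diff[of x y] diff[of z y] by simp

lemma n_le: "x \<in> X \<Longrightarrow> y \<in> X \<Longrightarrow> n x \<le> n (x - y) + n y"
  using n_triangle[of x y 0] zero by simp

lemma n_abs_diff: "x \<in> X \<Longrightarrow> y \<in> X \<Longrightarrow> \<bar>n x - n y\<bar> \<le> n (x - y)"
  using n_le[of x y] n_le[of y x] n_commute[of x y] by simp

lemma N_tendsto_iff:
  assumes "x \<in> X" "\<And>k. y k \<in> X"
  shows "(\<lambda>k. N (x - y k)) \<longlonglongrightarrow> 0 \<longleftrightarrow> (\<lambda>k. n (x - y k)) \<longlonglongrightarrow> 0"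
proof
  assume "(\<lambda>k. N (x - y k)) \<longlonglongrightarrow> 0"
  then have "(\<lambda>k. N (x - y k)) \<longlonglongrightarrow> ennreal 0" by simp
  from tendsto_enn2real[OF this] show "(\<lambda>k. n (x - y k)) \<longlonglongrightarrow> 0" by simp
next
  assume "(\<lambda>k. n (x - y k)) \<longlonglongrightarrow> 0"
  from tendsto_ennrealI[OF this] show "(\<lambda>k. N (x - y k)) \<longlonglongrightarrow> 0"
    using assms by (simp add: N_eq[symmetric] diff)
qed

lemma n_tendsto:
  assumes "x \<in> X" "\<And>k. y k \<in> X" "(\<lambda>k. n (x - y k)) \<longlonglongrightarrow> 0"
  shows "(\<lambda>k. n (y k)) \<longlonglongrightarrow> n x"
proof -
  have "(\<lambda>k. n (y k) - n x) \<longlonglongrightarrow> 0"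
    by (rule Lim_null_comparison[OF _ assms(3)])
       (use n_abs_diff[OF assms(1,2)] in \<open>simp add: abs_minus_commute\<close>)
  then show ?thesis by (simp add: LIM_zero_cancel)
qed

lemma strongly_measurableE:
  assumes "strongly_measurable T X N f" "AE t in lebesgue_on {0..T}. f t \<in> X"
  obtains s where "\<And>k::nat. simple_function (lebesgue_on {0..T}) (s k)"
    "\<And>k t. t \<in> {0..T} \<Longrightarrow> s k t \<in> X"
    "AE t in lebesgue_on {0..T}. (\<lambda>k. n (f t - s k t)) \<longlonglongrightarrow> 0"
proof -
  obtain s where s: "\<And>k::nat. simple_function (lebesgue_on {0..T}) (s k)" "\<And>k. s k ` {0..T} \<subseteq> X"
      "AE t in lebesgue_on {0..T}. (\<lambda>k. N (f t - s k t)) \<longlonglongrightarrow> 0"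
    using assms(1) unfolding strongly_measurable_def by blast
  show ?thesis
  proof (rule that[of s])
    show sX: "s k t \<in> X" if "t \<in> {0..T}" for k t using s(2)[of k] that by blast
    from s(3) assms(2) AE_space[of "lebesgue_on {0..T}"]
    show "AE t in lebesgue_on {0..T}. (\<lambda>k. n (f t - s k t)) \<longlonglongrightarrow> 0"
      by eventually_elim (use sX in \<open>simp add: N_tendsto_iff\<close>)
  qed (rule s(1))
qed

lemma strongly_measurableI:
  assumes "\<And>k::nat. simple_function (lebesgue_on {0..T}) (s k)"
    "\<And>k t. t \<in> {0..T} \<Longrightarrow> s k t \<in> X" "AE t in lebesgue_on {0..T}. f t \<in> X"
    "AE t in lebesgue_on {0..T}. (\<lambda>k. n (f t - s k t)) \<longlonglongrightarrow> 0"
  shows "strongly_measurable T X N f"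
  unfolding strongly_measurable_def
proof (intro exI[of _ s] conjI allI)
  from assms(3,4) AE_space[of "lebesgue_on {0..T}"]
  show "AE t in lebesgue_on {0..T}. (\<lambda>k. N (f t - s k t)) \<longlonglongrightarrow> 0"
    by eventually_elim (use assms(2) in \<open>simp add: N_tendsto_iff\<close>)
qed (use assms in auto)

lemma measurable_n:
  assumes "strongly_measurable T X N f" "AE t in lebesgue_on {0..T}. f t \<in> X"
  shows "(\<lambda>t. n (f t)) \<in> borel_measurable (lebesgue_on {0..T})"
proof -
  obtain s where s: "\<And>k::nat. simple_function (lebesgue_on {0..T}) (s k)"
    "\<And>k t. t \<in> {0..T} \<Longrightarrow> s k t \<in> X"
    "AE t in lebesgue_on {0..T}. (\<lambda>k. n (f t - s k t)) \<longlonglongrightarrow> 0"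
    using strongly_measurableE[OF assms] by blast
  show ?thesis
  proof (rule borel_measurable_lebesgue_on_AE_limit)
    show "(\<lambda>t. n (s k t)) \<in> borel_measurable (lebesgue_on {0..T})" for k
      by (rule simple_function_real_measurable[OF s(1)])
    from s(3) assms(2) AE_space[of "lebesgue_on {0..T}"]
    show "AE t in lebesgue_on {0..T}. (\<lambda>k. n (s k t)) \<longlonglongrightarrow> n (f t)"
      by eventually_elim (use s(2) in \<open>auto intro: n_tendsto\<close>)
  qed simp
qed

lemma strongly_measurable_diff:
  assumes f: "strongly_measurable T X N f" "AE t in lebesgue_on {0..T}. f t \<in> X"
    and g: "strongly_measurable T X N g" "AE t in lebesgue_on {0..T}. g t \<in> X"
  shows "strongly_measurable T X N (\<lambda>t. f t - g t)"
proof -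
  obtain s where s: "\<And>k::nat. simple_function (lebesgue_on {0..T}) (s k)"
    "\<And>k t. t \<in> {0..T} \<Longrightarrow> s k t \<in> X"
    "AE t in lebesgue_on {0..T}. (\<lambda>k. n (f t - s k t)) \<longlonglongrightarrow> 0"
    using strongly_measurableE[OF f] by blast
  obtain r where r: "\<And>k::nat. simple_function (lebesgue_on {0..T}) (r k)"
    "\<And>k t. t \<in> {0..T} \<Longrightarrow> r k t \<in> X"
    "AE t in lebesgue_on {0..T}. (\<lambda>k. n (g t - r k t)) \<longlonglongrightarrow> 0"
    using strongly_measurableE[OF g] by blast
  show ?thesis
  proof (rule strongly_measurableI)
    show "simple_function (lebesgue_on {0..T}) (\<lambda>t. s k t - r k t)" for k
      by (rule simple_function_compose2[OF s(1) r(1)])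
    show "s k t - r k t \<in> X" if "t \<in> {0..T}" for k t using s(2) r(2) that diff by blast
    show "AE t in lebesgue_on {0..T}. f t - g t \<in> X" using f(2) g(2) by eventually_elim (rule diff)
    from s(3) r(3) f(2) g(2) AE_space[of "lebesgue_on {0..T}"]
    show "AE t in lebesgue_on {0..T}. (\<lambda>k. n (f t - g t - (s k t - r k t))) \<longlonglongrightarrow> 0"
    proof eventually_elim
      case (elim t)
      have e: "f t - g t - (s k t - r k t) = (f t - s k t) - (g t - r k t)" for k by simp
      have "n (f t - g t - (s k t - r k t)) \<le> n (f t - s k t) + n (g t - r k t)" for k
        unfolding e using elim s(2) r(2) by (intro n_diff diff) auto
      moreover have "(\<lambda>k. n (f t - s k t) + n (g t - r k t)) \<longlonglongrightarrow> 0"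
        using tendsto_add[OF elim(1,2)] by simp
      ultimately show ?case by (rule enn2real_tendsto_0_bound)
    qed
  qed
qed

lemma simple_function_restrict:
  assumes "simple_function M s" "Measurable.pred M P"
  shows "simple_function M (\<lambda>t. if P t then s t else 0)"
  by (rule simple_function_If) (use assms in \<open>auto simp: pred_def\<close>)

text \<open>A cut-off in time acts on the approximating simple functions in the same way. It serves
  to turn a test function on [0,T] into one that vanishes after a given time s.\<close>

lemma strongly_measurable_restrict:
  assumes f: "strongly_measurable T X N f" "AE t in lebesgue_on {0..T}. f t \<in> X"
    and P: "Measurable.pred (lebesgue_on {0..T}) P"
  shows "strongly_measurable T X N (\<lambda>t. if P t then f t else 0)"
proof -
  obtain s where s: "\<And>k::nat. simple_function (lebesgue_on {0..T}) (s k)"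
    "\<And>k t. t \<in> {0..T} \<Longrightarrow> s k t \<in> X"
    "AE t in lebesgue_on {0..T}. (\<lambda>k. n (f t - s k t)) \<longlonglongrightarrow> 0"
    using strongly_measurableE[OF f] by blast
  show ?thesis
  proof (rule strongly_measurableI)
    show "simple_function (lebesgue_on {0..T}) (\<lambda>t. if P t then s k t else 0)" for k
      by (rule simple_function_restrict[OF s(1) P])
    show "(if P t then s k t else 0) \<in> X" if "t \<in> {0..T}" for k t using s(2) that zero by auto
    show "AE t in lebesgue_on {0..T}. (if P t then f t else 0) \<in> X" using f(2) by eventually_elim (auto simp: zero)
    from s(3) show "AE t in lebesgue_on {0..T}. (\<lambda>k. n ((if P t then f t else 0) - (if P t then s k t else 0))) \<longlonglongrightarrow> 0"
      by eventually_elim (auto simp: N_zero)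
  qed
qed

text \<open>Each value of an approximating simple function is replaced by an almost nearest point of \<open>Y\<close>;
  this at most doubles the distance to \<open>f t \<in> Y\<close>, and \<open>Y\<close> need not be closed.\<close>

lemma strongly_measurable_subspace:
  assumes f: "strongly_measurable T X N f" and Y: "Y \<subseteq> X" "Y \<noteq> {}"
    and fY: "AE t in lebesgue_on {0..T}. f t \<in> Y"
  shows "strongly_measurable T Y N f"
proof -
  have fX: "AE t in lebesgue_on {0..T}. f t \<in> X" using fY by eventually_elim (use Y in blast)
  obtain s where s: "\<And>k::nat. simple_function (lebesgue_on {0..T}) (s k)"
    "\<And>k t. t \<in> {0..T} \<Longrightarrow> s k t \<in> X"
    "AE t in lebesgue_on {0..T}. (\<lambda>k. n (f t - s k t)) \<longlonglongrightarrow> 0"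
    using strongly_measurableE[OF f fX] by blast
  have "\<exists>y\<in>Y. \<forall>z\<in>Y. n (x - y) \<le> n (x - z) + 1 / real (Suc k)" for x k
  proof -
    have bdd: "bdd_below ((\<lambda>z. n (x - z)) ` Y)" by (rule bdd_belowI[of _ 0]) auto
    obtain v where v: "v \<in> (\<lambda>z. n (x - z)) ` Y" "v < (INF z\<in>Y. n (x - z)) + 1 / real (Suc k)"
      using cInf_lessD[of "(\<lambda>z. n (x - z)) ` Y" "(INF z\<in>Y. n (x - z)) + 1 / real (Suc k)"] Y by auto
    then obtain y where y: "y \<in> Y" "n (x - y) < (INF z\<in>Y. n (x - z)) + 1 / real (Suc k)" by auto
    have "(INF z\<in>Y. n (x - z)) \<le> n (x - z)" if "z \<in> Y" for z by (rule cINF_lower[OF bdd that])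
    with y show ?thesis by (intro bexI[of _ y]) (auto intro: less_imp_le order_trans)
  qed
  then obtain p where p: "\<And>x k. p x k \<in> Y" "\<And>x k z. z \<in> Y \<Longrightarrow> n (x - p x k) \<le> n (x - z) + 1 / real (Suc k)"
    by metis
  show ?thesis unfolding strongly_measurable_def
  proof (intro exI[of _ "\<lambda>k t. p (s k t) k"] conjI allI)
    show "simple_function (lebesgue_on {0..T}) (\<lambda>t. p (s k t) k)" for k
      by (rule simple_function_compose1[OF s(1)])
    show "(\<lambda>t. p (s k t) k) ` {0..T} \<subseteq> Y" for k using p by auto
    from s(3) fY AE_space[of "lebesgue_on {0..T}"]
    show "AE t in lebesgue_on {0..T}. (\<lambda>k. N (f t - p (s k t) k)) \<longlonglongrightarrow> 0"
    proof eventually_elim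
      case (elim t)
      have X: "f t \<in> X" "s k t \<in> X" "p (s k t) k \<in> X" for k using elim Y p s(2) by auto
      have "n (f t - p (s k t) k) \<le> 2 * n (f t - s k t) + 1 / real (Suc k)" for k
        using n_triangle[OF X(1,2,3), of k k] p(2)[OF elim(2), of "s k t" k] n_commute[OF X(1,2), of k] by linarith
      moreover have "(\<lambda>k. 2 * n (f t - s k t) + 1 / real (Suc k)) \<longlonglongrightarrow> 0"
        using tendsto_add[OF tendsto_mult_left[OF elim(1), of 2] LIMSEQ_Suc[OF lim_1_over_n]] by simp
      ultimately have "(\<lambda>k. n (f t - p (s k t) k)) \<longlonglongrightarrow> 0"
        by (rule enn2real_tendsto_0_bound)
      then show ?case using X by (subst N_tendsto_iff) auto
    qed
  qed
qed

text \<open>With exponent 2 the powers of extended reals cancel, so membership and norm become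
  statements on a real integral.\<close>

lemma bochner_2_iff:
  "f \<in> bochner_space 2 T X N \<longleftrightarrow> (AE t in lebesgue_on {0..T}. f t \<in> X) \<and> strongly_measurable T X N f \<and>
     integrable (lebesgue_on {0..T}) (\<lambda>t. (n (f t))\<^sup>2)"
  and bochner_norm_2_square:
  "f \<in> bochner_space 2 T X N \<Longrightarrow> (bochner_norm 2 T N f)\<^sup>2 = ennreal (LINT t|lebesgue_on {0..T}. (n (f t))\<^sup>2)"
proof -
  have e: "(bochner_norm 2 T N f)\<^sup>2 = (\<integral>\<^sup>+ t. ennreal ((n (f t))\<^sup>2) \<partial>lebesgue_on {0..T})"
    if "AE t in lebesgue_on {0..T}. f t \<in> X"
    unfolding bochner_norm_def ennpowr_half_square ennpowr_two
    by (rule nn_integral_cong_AE) (use that in \<open>eventually_elim, metis N_eq ennreal_power enn2real_nonneg\<close>)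
  have f: "bochner_norm 2 T N f < top \<longleftrightarrow> (bochner_norm 2 T N f)\<^sup>2 < top"
    by (cases "bochner_norm 2 T N f") (auto simp: ennreal_power)
  show *: "f \<in> bochner_space 2 T X N \<longleftrightarrow> (AE t in lebesgue_on {0..T}. f t \<in> X) \<and> strongly_measurable T X N f \<and>
     integrable (lebesgue_on {0..T}) (\<lambda>t. (n (f t))\<^sup>2)"
    using e f measurable_n[of T f] by (auto simp: bochner_space_def integrable_iff_bounded)
  assume f: "f \<in> bochner_space 2 T X N"
  then show "(bochner_norm 2 T N f)\<^sup>2 = ennreal (LINT t|lebesgue_on {0..T}. (n (f t))\<^sup>2)"
    using e * by (subst nn_integral_eq_integral[symmetric]) auto
qed

text \<open>Almost everywhere convergence is upgraded to convergence in the mean by dominated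
  convergence; the majorant comes from truncating the simple functions.\<close>

lemma bochner_2_approx:
  assumes "f \<in> bochner_space 2 T X N"
  obtains s where "\<And>k::nat. simple_function (lebesgue_on {0..T}) (s k)"
    "\<And>k t. t \<in> {0..T} \<Longrightarrow> s k t \<in> X"
    "\<And>k. integrable (lebesgue_on {0..T}) (\<lambda>t. (n (f t - s k t))\<^sup>2)"
    "(\<lambda>k. LINT t|lebesgue_on {0..T}. (n (f t - s k t))\<^sup>2) \<longlonglongrightarrow> 0"
proof -
  let ?M = "lebesgue_on {0..T}"
  have f: "AE t in ?M. f t \<in> X" "strongly_measurable T X N f" "integrable ?M (\<lambda>t. (n (f t))\<^sup>2)"
    using assms by (auto simp: bochner_2_iff)
  obtain s where s: "\<And>k::nat. simple_function ?M (s k)" "\<And>k t. t \<in> {0..T} \<Longrightarrow> s k t \<in> X"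
    "AE t in ?M. (\<lambda>k. n (f t - s k t)) \<longlonglongrightarrow> 0"
    using strongly_measurableE[OF f(2,1)] by blast
  \<comment> \<open>The truncation ensures n (f t - r k t) \<le> 3 n (f t). If n (f t) > 0, then n
    (s k t) is eventually below 2 n (f t) and it no longer acts.\<close>
  define r where "r k t = (if n (s k t) \<le> 2 * n (f t) then s k t else 0)" for k t
  have r: "simple_function ?M (r k)" for k
  proof -
    have [measurable]: "(\<lambda>t. n (f t)) \<in> borel_measurable ?M" "(\<lambda>t. n (s k t)) \<in> borel_measurable ?M"
      by (rule measurable_n f simple_function_real_measurable s)+
    show ?thesis unfolding r_def[abs_def] by (rule simple_function_restrict[OF s(1)]) measurable
  qed
  have rX: "r k t \<in> X" if "t \<in> {0..T}" for k t using s(2) that zero by (auto simp: r_def)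
  have m: "(\<lambda>t. n (f t - r k t)) \<in> borel_measurable ?M" for k
  proof (rule measurable_n)
    have "AE t in ?M. r k t \<in> X" using AE_space[of ?M] by eventually_elim (use rX in auto)
    moreover have "strongly_measurable T X N (r k)"
      by (rule strongly_measurableI[of _ "\<lambda>_. r k"]) (use r rX calculation N_zero in auto)
    ultimately show "strongly_measurable T X N (\<lambda>t. f t - r k t)"
      by (intro strongly_measurable_diff f)
    show "AE t in ?M. f t - r k t \<in> X"
      using f(1) \<open>AE t in ?M. r k t \<in> X\<close> by eventually_elim (rule diff)
  qed
  have bd: "AE t in ?M. n (f t - r k t) \<le> 3 * n (f t)" for k
    using f(1) AE_space[of ?M]
  proof eventually_elim
    case (elim t)
    have "n (r k t) \<le> 2 * n (f t)" by (auto simp: r_def N_zero)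
    then show ?case using n_diff[OF elim(1) rX, of t k] elim by simp
  qed
  have bd2: "AE t in ?M. norm ((n (f t - r k t))\<^sup>2) \<le> 9 * (n (f t))\<^sup>2" for k
    using bd[of k]
  proof eventually_elim
    case (elim t)
    then have "(n (f t - r k t))\<^sup>2 \<le> (3 * n (f t))\<^sup>2" by (intro power_mono) auto
    then show ?case by (simp add: power_mult_distrib)
  qed
  have lim: "AE t in ?M. (\<lambda>k. (n (f t - r k t))\<^sup>2) \<longlonglongrightarrow> 0"
    using s(3) f(1) AE_space[of ?M]
  proof eventually_elim
    case (elim t)
    have nt: "(\<lambda>k. n (s k t)) \<longlonglongrightarrow> n (f t)" using elim s(2) by (intro n_tendsto) auto
    have "(\<lambda>k. n (f t - r k t)) \<longlonglongrightarrow> 0"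
    proof (cases "n (f t) = 0")
      case True
      \<comment> \<open>Here the truncation may act for infinitely many k, but every value kept has
        seminorm 0, so the error vanishes for each k.\<close>
      have "n (f t - r k t) = 0" for k
      proof -
        have "n (r k t) \<le> 2 * n (f t)" by (auto simp: r_def N_zero)
        then have "n (f t - r k t) \<le> 0" using n_diff[OF elim(2) rX, of t k] elim(3) True by simp
        then show ?thesis by (meson antisym enn2real_nonneg)
      qed
      then show ?thesis by simp
    next
      case False
      then have "0 < n (f t)" using enn2real_nonneg[of "N (f t)"] by linarith
      then have "n (f t) < 2 * n (f t)" by linarith
      from order_tendstoD(2)[OF nt this] have "\<forall>\<^sub>F k in sequentially. n (f t - s k t) = n (f t - r k t)"
        by eventually_elim (simp add: r_def)
      from Lim_transform_eventually[OF elim(1) this] show ?thesis .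
    qed
    from tendsto_power[OF this, of 2] show ?case by simp
  qed
  show ?thesis
  proof (rule that[of r])
    show "integrable ?M (\<lambda>t. (n (f t - r k t))\<^sup>2)" for k
      by (rule Bochner_Integration.integrable_bound[of _ "\<lambda>t. 9 * (n (f t))\<^sup>2"])
         (use f(3) m bd2 in auto)
    have "(\<lambda>k. LINT t|?M. (n (f t - r k t))\<^sup>2) \<longlonglongrightarrow> (LINT t|?M. 0)"
      by (rule integral_dominated_convergence[where w="\<lambda>t. 9 * (n (f t))\<^sup>2"])
         (use f(3) m bd2 lim in auto)
    then show "(\<lambda>k. LINT t|?M. (n (f t - r k t))\<^sup>2) \<longlonglongrightarrow> 0" by simp
  qed (use r rX in auto)
qed

text \<open>The same simple functions converge in the weaker norm; this passes from the full norm of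
  \<open>H1\<close> to the gradient norm.\<close>

lemma strongly_measurable_weaker_norm:
  assumes "strongly_measurable T X N f" "AE t in lebesgue_on {0..T}. f t \<in> X"
    and "\<And>x. x \<in> X \<Longrightarrow> N' x \<le> N x"
  shows "strongly_measurable T X N' f"
proof -
  obtain s where s: "\<And>k::nat. simple_function (lebesgue_on {0..T}) (s k)" "\<And>k. s k ` {0..T} \<subseteq> X"
      "AE t in lebesgue_on {0..T}. (\<lambda>k. N (f t - s k t)) \<longlonglongrightarrow> 0"
    using assms(1) unfolding strongly_measurable_def by blast
  from s(3) assms(2) AE_space[of "lebesgue_on {0..T}"]
  have "AE t in lebesgue_on {0..T}. (\<lambda>k. N' (f t - s k t)) \<longlonglongrightarrow> 0"
  proof eventually_elim
    case (elim t)
    have "N' (f t - s k t) \<le> N (f t - s k t)" for k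
      using assms(3) diff elim s(2) by (metis image_subset_iff space_lebesgue_on)
    then show ?case by (intro tendsto_sandwich[OF _ _ tendsto_const elim(1)]) auto
  qed
  with s(1,2) show ?thesis unfolding strongly_measurable_def by blast
qed

end

section \<open>The concrete spaces as seminormed sets\<close>

lemma seminormed_Lp:
  "1 \<le> r \<Longrightarrow> seminormed (Lp_space r \<Omega> :: ('a::euclidean_space \<Rightarrow> 'b::euclidean_space) set) (Lp_norm r \<Omega>)"
proof
  assume r: "1 \<le> r"
  show "Lp_norm r \<Omega> f < top" if "f \<in> Lp_space r \<Omega>" for f :: "'a \<Rightarrow> 'b"
    using that by (simp add: Lp_space_def)
  show "Lp_norm r \<Omega> (0 :: 'a \<Rightarrow> 'b) = 0" unfolding zero_fun_def using r by simp
  show "(0 :: 'a \<Rightarrow> 'b) \<in> Lp_space r \<Omega>" by (rule Lp_space_0) (use r in simp)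
qed (rule Lp_space_diff; assumption)+

context bounded_domain
begin

lemma H1D_norm_0: "H1D_norm \<Omega> 0 = 0"
proof -
  have "H1D_norm \<Omega> 0 = Lp_norm 2 \<Omega> (\<lambda>_. 0 :: 'a)"
    unfolding H1D_norm_def by (rule Lp_norm_cong_AE) (use weak_grad_0 in auto)
  then show ?thesis by simp
qed

lemma H1_norm_0: "H1_norm \<Omega> 0 = 0"
proof -
  have "Lp_norm 2 \<Omega> (0 :: 'a \<Rightarrow> real) = 0" unfolding zero_fun_def by simp
  then show ?thesis using H1_norm_eq[OF H1_0] H1D_norm_0 by simp
qed

lemma seminormed_H1: "seminormed (H1 \<Omega>) (H1_norm \<Omega>)"
proof
  show "H1_norm \<Omega> (u - w) \<le> H1_norm \<Omega> u + H1_norm \<Omega> w" if "u \<in> H1 \<Omega>" "w \<in> H1 \<Omega>" for u w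
    using H1_norm_lincomb[OF that, of 1 "-1", unfolded lincomb_diff] by simp
qed (auto simp: H1_0 H1_norm_0 H1_diff H1_norm_bounds)

lemma H1D_norm_diff: "u \<in> H1 \<Omega> \<Longrightarrow> w \<in> H1 \<Omega> \<Longrightarrow> H1D_norm \<Omega> (u - w) \<le> H1D_norm \<Omega> u + H1D_norm \<Omega> w"
  using H1D_norm_lincomb[of u w 1 "-1", unfolded lincomb_diff] by simp

text \<open>On \<open>H1\<close> the gradient norm is only a seminorm. With it, \<open>H1D\<close>
  becomes a subset of a space carrying the same norm, the setting of
  \<open>strongly_measurable_subspace\<close>.\<close>

lemma seminormed_H1_grad: "seminormed (H1 \<Omega>) (H1D_norm \<Omega>)"
  by unfold_locales (auto simp: H1_0 H1D_norm_0 H1_diff H1D_norm_diff H1D_norm_finite)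

end

context dirichlet_domain
begin

lemma H1D_diff: "u \<in> H1D \<Omega> \<Gamma> \<Longrightarrow> w \<in> H1D \<Omega> \<Gamma> \<Longrightarrow> u - w \<in> H1D \<Omega> \<Gamma>"
  using H1D_lincomb[of u w 1 "-1", unfolded lincomb_diff] by simp

lemma seminormed_H1D: "seminormed (H1D \<Omega> \<Gamma>) (H1D_norm \<Omega>)"
  by unfold_locales (auto simp: H1D_0 H1D_norm_0 H1D_diff H1D_norm_diff H1D_H1 H1D_norm_finite)

lemma seminormed_H1D_dual: "seminormed (H1D_dual \<Omega> \<Gamma>) (H1D_dual_norm \<Omega> \<Gamma>)"
proof
  show "H1D_dual_norm \<Omega> \<Gamma> F < top" if "F \<in> H1D_dual \<Omega> \<Gamma>" for F
    using that unfolding H1D_dual_def infinity_ennreal_def by blast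
qed (rule H1D_dual_zero H1D_dual_space_diff; assumption?)+

abbreviation grad_norm :: "('a \<Rightarrow> real) \<Rightarrow> real" where
  "grad_norm u \<equiv> enn2real (H1D_norm \<Omega> u)"

abbreviation dual_norm :: "(('a \<Rightarrow> real) \<Rightarrow> real) \<Rightarrow> real" where
  "dual_norm F \<equiv> enn2real (H1D_dual_norm \<Omega> \<Gamma> F)"

text \<open>Measurability comes from pairings of simple functions, through F u - s r = (F - s) u + s
  (u - r). Convergence of each factor in its own norm suffices, since the norms of s k t converge
  and so stay bounded.\<close>

lemma dual_pairing:
  assumes F: "F \<in> L2_H1D_dual T \<Omega> \<Gamma>" and u: "u \<in> L2_H1D T \<Omega> \<Gamma>"
  shows "integrable (lebesgue_on {0..T}) (\<lambda>t. F t (u t))"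
    and "AE t in lebesgue_on {0..T}. \<bar>F t (u t)\<bar> \<le> dual_norm (F t) * grad_norm (u t)"
proof -
  let ?M = "lebesgue_on {0..T}"
  interpret U: seminormed "H1D \<Omega> \<Gamma>" "H1D_norm \<Omega>" by (rule seminormed_H1D)
  interpret D: seminormed "H1D_dual \<Omega> \<Gamma>" "H1D_dual_norm \<Omega> \<Gamma>" by (rule seminormed_H1D_dual)
  have F': "AE t in ?M. F t \<in> H1D_dual \<Omega> \<Gamma>" "strongly_measurable T (H1D_dual \<Omega> \<Gamma>) (H1D_dual_norm \<Omega> \<Gamma>) F"
     "integrable ?M (\<lambda>t. (dual_norm (F t))\<^sup>2)"
    using F by (auto simp: D.bochner_2_iff)
  have u': "AE t in ?M. u t \<in> H1D \<Omega> \<Gamma>" "strongly_measurable T (H1D \<Omega> \<Gamma>) (H1D_norm \<Omega>) u"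
     "integrable ?M (\<lambda>t. (grad_norm (u t))\<^sup>2)"
    using u by (auto simp: U.bochner_2_iff)
  show bd: "AE t in ?M. \<bar>F t (u t)\<bar> \<le> dual_norm (F t) * grad_norm (u t)"
    using F'(1) u'(1) by eventually_elim (rule H1D_dual_bound)
  obtain s where s: "\<And>k::nat. simple_function ?M (s k)" "\<And>k t. t \<in> {0..T} \<Longrightarrow> s k t \<in> H1D_dual \<Omega> \<Gamma>"
    "AE t in ?M. (\<lambda>k. dual_norm (F t - s k t)) \<longlonglongrightarrow> 0"
    using D.strongly_measurableE[OF F'(2,1)] by blast
  obtain r where r: "\<And>k::nat. simple_function ?M (r k)" "\<And>k t. t \<in> {0..T} \<Longrightarrow> r k t \<in> H1D \<Omega> \<Gamma>"
    "AE t in ?M. (\<lambda>k. grad_norm (u t - r k t)) \<longlonglongrightarrow> 0"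
    using U.strongly_measurableE[OF u'(2,1)] by blast
  have m[measurable]: "(\<lambda>t. F t (u t)) \<in> borel_measurable ?M"
  proof (rule borel_measurable_lebesgue_on_AE_limit)
    show "(\<lambda>t. s k t (r k t)) \<in> borel_measurable ?M" for k
      using simple_function_real_measurable[OF simple_function_Pair[OF s(1) r(1)], of "\<lambda>(a, b). a b"] by simp
    from s(3) r(3) F'(1) u'(1) AE_space[of ?M]
    show "AE t in ?M. (\<lambda>k. s k t (r k t)) \<longlonglongrightarrow> F t (u t)"
    proof eventually_elim
      case (elim t)
      have mem: "s k t \<in> H1D_dual \<Omega> \<Gamma>" "r k t \<in> H1D \<Omega> \<Gamma>" for k using elim s(2) r(2) by auto
      have "\<bar>s k t (r k t) - F t (u t)\<bar> \<le>
          dual_norm (F t - s k t) * grad_norm (u t) + dual_norm (s k t) * grad_norm (u t - r k t)" for k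
      proof -
        have "\<bar>s k t (r k t) - F t (u t)\<bar> \<le> \<bar>(F t - s k t) (u t)\<bar> + \<bar>s k t (u t - r k t)\<bar>"
          by (simp add: H1D_dual_diff[OF mem(1) elim(4) mem(2)])
        also have "\<dots> \<le> dual_norm (F t - s k t) * grad_norm (u t) + dual_norm (s k t) * grad_norm (u t - r k t)"
          by (intro add_mono H1D_dual_bound D.diff U.diff elim mem)
        finally show ?thesis .
      qed
      moreover have "(\<lambda>k. dual_norm (F t - s k t) * grad_norm (u t) + dual_norm (s k t) * grad_norm (u t - r k t))
         \<longlonglongrightarrow> 0 * grad_norm (u t) + dual_norm (F t) * 0"
        by (intro tendsto_add tendsto_mult tendsto_const elim(1,2) D.n_tendsto elim(3) mem)
      then have "(\<lambda>k. dual_norm (F t - s k t) * grad_norm (u t) + dual_norm (s k t) * grad_norm (u t - r k t)) \<longlonglongrightarrow> 0"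
        by simp
      ultimately have "(\<lambda>k. s k t (r k t) - F t (u t)) \<longlonglongrightarrow> 0"
        by (rule tendsto_0_bound)
      then show ?case by (simp add: LIM_zero_cancel)
    qed
  qed simp
  show "integrable ?M (\<lambda>t. F t (u t))"
  proof (rule Bochner_Integration.integrable_bound[of _ "\<lambda>t. (dual_norm (F t))\<^sup>2 + (grad_norm (u t))\<^sup>2"])
    show "AE t in ?M. norm (F t (u t)) \<le> norm ((dual_norm (F t))\<^sup>2 + (grad_norm (u t))\<^sup>2)"
      using bd
    proof eventually_elim
      case (elim t)
      have "dual_norm (F t) * grad_norm (u t) \<le> (dual_norm (F t))\<^sup>2 + (grad_norm (u t))\<^sup>2"
        using sum_squares_bound[of "dual_norm (F t)" "grad_norm (u t)"]
          zero_le_power2[of "dual_norm (F t)"] zero_le_power2[of "grad_norm (u t)"] by linarith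
      with elim show ?case by simp
    qed
  qed (use F'(3) u'(3) m in auto)
qed

end

section \<open>Averages of difference quotients\<close>

text \<open>An interchange of limits: the approximation is uniform in k, while Y and y may depend on
  e. Below, k indexes the time step, and Y arises from finitely many sets or from a simple
  function.\<close>

lemma tendsto_approximation:
  fixes X :: "nat \<Rightarrow> real"
  assumes "\<And>e. 0 < e \<Longrightarrow> \<exists>Y y. Y \<longlonglongrightarrow> y \<and> (\<forall>k. \<bar>X k - Y k\<bar> \<le> e) \<and> \<bar>x - y\<bar> \<le> e"
  shows "X \<longlonglongrightarrow> x"
proof (rule LIMSEQ_I)
  fix r :: real assume "0 < r"
  then obtain Y y where Y: "Y \<longlonglongrightarrow> y" "\<And>k. \<bar>X k - Y k\<bar> \<le> r / 4" "\<bar>x - y\<bar> \<le> r / 4"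
    using assms[of "r / 4"] by auto
  obtain m where m: "\<And>k. m \<le> k \<Longrightarrow> norm (Y k - y) < r / 4"
    using LIMSEQ_D[OF Y(1), of "r / 4"] \<open>0 < r\<close> by auto
  have "norm (X k - x) < r" if "m \<le> k" for k
    using m[OF that] Y(2)[of k] Y(3) \<open>0 < r\<close> unfolding real_norm_def by linarith
  then show "\<exists>m. \<forall>k\<ge>m. norm (X k - x) < r" by blast
qed

lemma continuous_on_shift:
  assumes "continuous_on {0..T} g" "0 \<le> h" "h \<le> a" "b \<le> T"
  shows "continuous_on {a..b} (\<lambda>t::real. g (t - h))"
  by (rule continuous_on_compose2[OF assms(1)]) (use assms in \<open>auto intro!: continuous_intros\<close>)

lemma integral_subinterval_diff:
  fixes g :: "real \<Rightarrow> real"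
  assumes "integrable (lebesgue_on {0..T}) g" "0 \<le> r" "r \<le> t" "t \<le> T"
  shows "(LINT x|lebesgue_on {r..t}. g x) = (LINT x|lebesgue_on {0..t}. g x) - (LINT x|lebesgue_on {0..r}. g x)"
proof -
  have "integrable (lebesgue_on {0..t}) g" by (rule integrable_subinterval[OF assms(1)]) (use assms in auto)
  from integral_combine[OF this assms(2,3)] show ?thesis by simp
qed

text \<open>After translation of the second integral both sides are combinations of the primitive of
  g at a, b, a - h and b - h, so the identity holds even when h exceeds b - a.\<close>

lemma integral_shift_difference:
  fixes g :: "real \<Rightarrow> real"
  assumes g: "continuous_on {0..T} g" and h: "0 \<le> h" "h \<le> a" "a \<le> b" "b \<le> T"
  shows "(LINT t|lebesgue_on {a..b}. g t - g (t - h)) =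
     (LINT t|lebesgue_on {b - h..b}. g t) - (LINT t|lebesgue_on {a - h..a}. g t)"
proof -
  have gi: "integrable (lebesgue_on {0..T}) g" using g by (rule continuous_imp_integrable_real)
  have c: "continuous_on {a..b} g" "continuous_on {a..b} (\<lambda>t. g (t - h))" "continuous_on {a - h..b - h} g"
    using continuous_on_shift[OF g] h by (auto intro: continuous_on_subset[OF g])
  have "(LINT t|lebesgue_on {a..b}. g t - g (t - h)) =
      (LINT t|lebesgue_on {a..b}. g t) - (LINT t|lebesgue_on {a..b}. g (t - h))"
    by (intro Bochner_Integration.integral_diff continuous_imp_integrable_real c)
  also have "(LINT t|lebesgue_on {a..b}. g (t - h)) = integral {a..b} (\<lambda>t. g (t - h))"
    by (intro lebesgue_integral_eq_integral continuous_imp_integrable_real c) simp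
  also have "\<dots> = integral {a - h..b - h} g"
    using integral_shift_real_ivl[of "a - h" "- h" "b - h" g] by simp
  also have "\<dots> = (LINT t|lebesgue_on {a - h..b - h}. g t)"
    by (intro lebesgue_integral_eq_integral[symmetric] continuous_imp_integrable_real c) simp
  finally show ?thesis
    using h integral_subinterval_diff[OF gi, of a b] integral_subinterval_diff[OF gi, of "a - h" "b - h"]
      integral_subinterval_diff[OF gi, of "b - h" b] integral_subinterval_diff[OF gi, of "a - h" a] by simp
qed

text \<open>This is the difference quotient at b, along b - h, of the primitive of g. The derivative
  is taken within [0,T] because b = T is allowed.\<close>

lemma left_average_tendsto:
  fixes g :: "real \<Rightarrow> real"
  assumes g: "continuous_on {0..T} g" and b: "b \<le> T"
    and h: "\<And>k::nat. 0 < h k" "\<And>k. h k \<le> b" "h \<longlonglongrightarrow> 0"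
  shows "(\<lambda>k. (LINT t|lebesgue_on {b - h k..b}. g t) / h k) \<longlonglongrightarrow> g b"
proof -
  have b0: "0 \<le> b" using h(1,2)[of 0] by linarith
  have gi: "integrable (lebesgue_on {0..T}) g" using g by (rule continuous_imp_integrable_real)
  define G where "G x = integral {0..x} g" for x
  have eq: "(LINT t|lebesgue_on {b - h k..b}. g t) = G b - G (b - h k)" for k
  proof -
    have "(LINT t|lebesgue_on {0..x}. g t) = G x" if "x \<le> T" for x
      unfolding G_def using that
      by (intro lebesgue_integral_eq_integral continuous_imp_integrable_real continuous_on_subset[OF g]) auto
    then show ?thesis
      using integral_subinterval_diff[OF gi, of "b - h k" b] h(1,2)[of k] b by simp
  qed
  have "(G has_real_derivative g b) (at b within {0..T})"
    unfolding G_def by (rule integral_has_real_derivative[OF g]) (use b b0 in auto)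
  then have D: "((\<lambda>y. (G y - G b) / (y - b)) \<longlongrightarrow> g b) (at b within {0..T})"
    by (simp add: has_field_derivative_iff)
  have "filterlim (\<lambda>k. b - h k) (at b within {0..T}) sequentially"
    unfolding filterlim_at
  proof
    have "b - h k \<in> {0..T} \<and> b - h k \<noteq> b" for k using h(1,2)[of k] b by auto
    then show "\<forall>\<^sub>F k in sequentially. b - h k \<in> {0..T} \<and> b - h k \<noteq> b" by simp
    show "(\<lambda>k. b - h k) \<longlonglongrightarrow> b" using tendsto_diff[OF tendsto_const h(3), of b] by simp
  qed
  from filterlim_compose[OF D this]
  have "(\<lambda>k. (G (b - h k) - G b) / (b - h k - b)) \<longlonglongrightarrow> g b" .
  moreover have "(G (b - h k) - G b) / (b - h k - b) = (LINT t|lebesgue_on {b - h k..b}. g t) / h k" for k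
    using h(1)[of k] by (simp add: eq divide_simps)
  ultimately show ?thesis by simp
qed

text \<open>The averaged difference quotient converges although g is merely continuous: everything
  but two boundary windows of length h cancels.\<close>

lemma average_difference_tendsto:
  fixes g :: "real \<Rightarrow> real"
  assumes g: "continuous_on {0..T} g" and b: "a \<le> b" "b \<le> T"
    and h: "\<And>k::nat. 0 < h k" "\<And>k. h k \<le> a" "h \<longlonglongrightarrow> 0"
  shows "(\<lambda>k. (LINT t|lebesgue_on {a..b}. g t - g (t - h k)) / h k) \<longlonglongrightarrow> g b - g a"
proof -
  have hb: "h k \<le> b" for k using h(2)[of k] b by simp
  have "(\<lambda>k. (LINT t|lebesgue_on {b - h k..b}. g t) / h k - (LINT t|lebesgue_on {a - h k..a}. g t) / h k) \<longlonglongrightarrow> g b - g a"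
    by (intro tendsto_diff left_average_tendsto[OF g]) (use b h hb in auto)
  moreover have "(LINT t|lebesgue_on {a..b}. g t - g (t - h k)) =
     (LINT t|lebesgue_on {b - h k..b}. g t) - (LINT t|lebesgue_on {a - h k..a}. g t)" for k
    by (rule integral_shift_difference[OF g]) (use b h less_imp_le[OF h(1)] in auto)
  ultimately show ?thesis by (simp add: diff_divide_distrib)
qed

lemma integral_interval_const:
  "a \<le> b \<Longrightarrow> (LINT t|lebesgue_on {a..b::real}. c) = (b - a) * (c :: real)"
  by (simp add: measure_restrict_space)

text \<open>For a nondecreasing G only the window at b counts, where G is at most G T; the window at
  a contributes with a favourable sign. After division by h the bound no longer depends on h, which
  is the source of uniformity below.\<close>

lemma integral_mono_difference_le:
  fixes G :: "real \<Rightarrow> real"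
  assumes G: "continuous_on {0..T} G" "\<And>s t. 0 \<le> s \<Longrightarrow> s \<le> t \<Longrightarrow> t \<le> T \<Longrightarrow> G s \<le> G t" "0 \<le> G 0"
    and h: "0 \<le> h" "h \<le> a" "a \<le> b" "b \<le> T"
  shows "(LINT t|lebesgue_on {a..b}. G t - G (t - h)) \<le> h * G T"
proof -
  have "(LINT t|lebesgue_on {b - h..b}. G t) \<le> (LINT t|lebesgue_on {b - h..b}. G T)"
    by (intro integral_mono continuous_imp_integrable_real continuous_on_subset[OF G(1)])
       (use h G(2) in auto)
  also have "\<dots> = (b - (b - h)) * G T" by (rule integral_interval_const) (use h in simp)
  finally have "(LINT t|lebesgue_on {b - h..b}. G t) \<le> h * G T" by simp
  moreover have "0 \<le> (LINT t|lebesgue_on {a - h..a}. G t)"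
    by (rule integral_nonneg_AE, rule AE_I2) (use h G(2)[of 0] G(3) in \<open>auto intro: order_trans[of 0 "G 0"]\<close>)
  ultimately show ?thesis using integral_shift_difference[OF G(1) h] by simp
qed

lemma abs_le_young: "0 < \<delta> \<Longrightarrow> \<bar>x\<bar> \<le> \<delta> / 2 * x\<^sup>2 + 1 / (2 * \<delta>)" for x \<delta> :: real
proof -
  assume d: "0 < \<delta>"
  have "0 \<le> (\<delta> * \<bar>x\<bar> - 1)\<^sup>2" by simp
  then have "2 * \<delta> * \<bar>x\<bar> \<le> \<delta>\<^sup>2 * x\<^sup>2 + 1" by (simp add: power2_eq_square algebra_simps abs_mult_self_eq)
  then show ?thesis using d by (simp add: field_simps power2_eq_square)
qed

lemma mult_le_young:
  fixes x y \<delta> :: real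
  assumes "0 < \<delta>" shows "x * y \<le> \<delta> / 2 * x\<^sup>2 + y\<^sup>2 / (2 * \<delta>)"
proof -
  have "0 \<le> (\<delta> * x - y)\<^sup>2" by simp
  then have "2 * \<delta> * (x * y) \<le> \<delta>\<^sup>2 * x\<^sup>2 + y\<^sup>2" by (simp add: power2_eq_square algebra_simps)
  then show ?thesis using assms by (simp add: field_simps power2_eq_square)
qed

lemma indefinite_integral_properties:
  fixes f :: "real \<Rightarrow> real"
  assumes f: "integrable (lebesgue_on {0..T}) f" and nn: "\<And>t. 0 \<le> f t" and T: "0 \<le> T"
  defines "G \<equiv> \<lambda>t. LINT x|lebesgue_on {0..t}. f x"
  shows "continuous_on {0..T} G" "\<And>s t. 0 \<le> s \<Longrightarrow> s \<le> t \<Longrightarrow> t \<le> T \<Longrightarrow> G s \<le> G t" "G 0 = 0"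
proof -
  show "continuous_on {0..T} G"
    unfolding G_def by (rule indefinite_integral_continuous_real[OF f])
  show "G s \<le> G t" if "0 \<le> s" "s \<le> t" "t \<le> T" for s t
    using integral_subinterval_diff[OF f that] nn integral_nonneg_AE[of f "lebesgue_on {s..t}"] by (simp add: G_def)
  show "G 0 = 0"
    using integral_subinterval_diff[OF f, of 0 0] T by (simp add: G_def)
qed

text \<open>A Dynkin argument in place of Lebesgue differentiation.  The passage to countable disjoint unions
  needs smallness on sets of small measure uniformly in \<open>h\<close>, which Young's inequality provides
  because \<open>f\<close> is square integrable.\<close>

lemma average_indicator_tendsto:
  fixes W f :: "real \<Rightarrow> real"
  assumes W: "continuous_on {0..T} W"
    and f: "integrable (lebesgue_on {0..T}) f" and f2: "integrable (lebesgue_on {0..T}) (\<lambda>t. (f t)\<^sup>2)"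
    and Wf: "\<And>r t. 0 \<le> r \<Longrightarrow> r \<le> t \<Longrightarrow> t \<le> T \<Longrightarrow> W t - W r = (LINT x|lebesgue_on {r..t}. f x)"
    and ab: "0 < a" "a \<le> b" "b \<le> T"
    and h: "\<And>k::nat. 0 < h k" "\<And>k. h k \<le> a" "h \<longlonglongrightarrow> 0"
    and A: "A \<in> sets borel"
  shows "(\<lambda>k. (LINT t|lebesgue_on {a..b}. indicator A t * (W t - W (t - h k))) / h k)
     \<longlonglongrightarrow> (LINT t|lebesgue_on {a..b}. indicator A t * f t)"
proof -
  let ?M = "lebesgue_on {a..b}"
  have T0: "0 \<le> T" using ab by simp
  define D where "D A k = (LINT t|?M. indicator A t * (W t - W (t - h k))) / h k" for A k
  define F where "F A = (LINT t|?M. indicator A t * f t)" for A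
  define m where "m A = (LINT t|?M. indicator A t :: real)" for A
  define G where "G t = (LINT x|lebesgue_on {0..t}. (f x)\<^sup>2)" for t
  note Gp = indefinite_integral_properties[OF f2 _ T0, folded G_def, simplified]
  have sub: "integrable (lebesgue_on {r..t}) f" "integrable (lebesgue_on {r..t}) (\<lambda>t. (f t)\<^sup>2)"
    if "0 \<le> r" "t \<le> T" for r t
    using that by (auto intro: integrable_subinterval[OF f] integrable_subinterval[OF f2])
  have Kc: "continuous_on {a..b} (\<lambda>t. W t - W (t - h k))" for k
    using continuous_on_shift[OF W, of "h k" a b] h(1,2)[of k] ab
    by (auto intro!: continuous_intros continuous_on_subset[OF W])
  have Ki: "integrable ?M (\<lambda>t. W t - W (t - h k))" for k
    using Kc by (rule continuous_imp_integrable_real)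
  have ms[measurable]: "(indicator A :: real \<Rightarrow> real) \<in> borel_measurable ?M" if "A \<in> sets borel" for A
    using that by (intro measurable_restrict_space1 measurable_completion) simp
  have ind: "integrable ?M (\<lambda>t. indicator A t * g t)" if "A \<in> sets borel" "integrable ?M g" for A and g :: "real \<Rightarrow> real"
    by (rule Bochner_Integration.integrable_bound[OF that(2)])
       (use borel_measurable_times[OF ms[OF that(1)] borel_measurable_integrable[OF that(2)]] in \<open>auto simp: indicator_def\<close>)
  have mi: "integrable ?M (indicator A :: real \<Rightarrow> real)" if "A \<in> sets borel" for A
    using ind[OF that, of "\<lambda>_. 1"] continuous_imp_integrable_real[of a b "\<lambda>_. 1::real"] by simp
  \<comment> \<open>Young's inequality under the integral over [t - h, t] trades |f| for f^2, whose
    integral is an increment of G, at the price of the window length over 2 \<delta>.\<close>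
  have Kb: "\<bar>W t - W (t - h k)\<bar> \<le> \<delta> / 2 * (G t - G (t - h k)) + h k / (2 * \<delta>)"
    if "t \<in> {a..b}" "0 < \<delta>" for t k \<delta>
  proof -
    have t: "0 \<le> t - h k" "t - h k \<le> t" "t \<le> T" using that h(1,2)[of k] ab by auto
    have "\<bar>W t - W (t - h k)\<bar> \<le> (LINT x|lebesgue_on {t - h k..t}. \<bar>f x\<bar>)"
      unfolding Wf[OF t] by (rule integral_abs_bound)
    also have "\<dots> \<le> (LINT x|lebesgue_on {t - h k..t}. \<delta> / 2 * (f x)\<^sup>2 + 1 / (2 * \<delta>))"
      using that t by (intro integral_mono abs_le_young integrable_abs Bochner_Integration.integrable_add
        integrable_mult_right sub continuous_imp_integrable_real) (auto intro: continuous_intros)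
    also have "\<dots> = \<delta> / 2 * (LINT x|lebesgue_on {t - h k..t}. (f x)\<^sup>2) + (LINT x|lebesgue_on {t - h k..t}. 1 / (2 * \<delta>))"
      using t sub(2)[of "t - h k" t] continuous_imp_integrable_real[of "t - h k" t "\<lambda>_. 1 / (2 * \<delta>)"]
      by (subst Bochner_Integration.integral_add) auto
    also have "\<dots> = \<delta> / 2 * (G t - G (t - h k)) + h k / (2 * \<delta>)"
      using integral_subinterval_diff[OF f2 t] integral_interval_const[OF t(2), of "1 / (2 * \<delta>)"]
      by (simp only: G_def) (simp add: field_simps)
    finally show ?thesis .
  qed
  have Gi: "integrable ?M (\<lambda>t. G t - G (t - h k))" for k
    using continuous_on_shift[OF Gp(1), of "h k" a b] h(1,2)[of k] ab
    by (intro continuous_imp_integrable_real) (auto intro!: continuous_intros continuous_on_subset[OF Gp(1)])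
  have Gint: "(LINT t|?M. G t - G (t - h k)) \<le> h k * G T" for k
    by (rule integral_mono_difference_le[OF Gp(1,2)]) (use Gp h ab less_imp_le[OF h(1)] in auto)
  \<comment> \<open>Integration over t makes the first term proportional to h as well. So h cancels,
    and the bound depends on A only through its measure in [a,b].\<close>
  have Db: "\<bar>D A k\<bar> \<le> \<delta> / 2 * G T + m A / (2 * \<delta>)" if A: "A \<in> sets borel" and \<delta>: "0 < \<delta>" for A k \<delta>
  proof -
    have "\<bar>LINT t|?M. indicator A t * (W t - W (t - h k))\<bar> \<le>
        (LINT t|?M. \<bar>indicator A t * (W t - W (t - h k))\<bar>)"
      by (rule integral_abs_bound)
    also have "\<dots> \<le> (LINT t|?M. \<delta> / 2 * (G t - G (t - h k)) + h k / (2 * \<delta>) * indicator A t)"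
    proof (intro integral_mono integrable_abs ind A Ki Bochner_Integration.integrable_add integrable_mult_right Gi mi)
      fix t assume t: "t \<in> space ?M"
      then have "G (t - h k) \<le> G t" using h(1,2)[of k] ab by (intro Gp(2)) auto
      then show "\<bar>indicator A t * (W t - W (t - h k))\<bar> \<le> \<delta> / 2 * (G t - G (t - h k)) + h k / (2 * \<delta>) * indicator A t"
        using Kb[of t \<delta> k] t \<delta> by (auto simp: indicator_def)
    qed
    also have "\<dots> = \<delta> / 2 * (LINT t|?M. G t - G (t - h k)) + h k / (2 * \<delta>) * m A"
      using Gi mi[OF A] unfolding m_def by (subst Bochner_Integration.integral_add) auto
    also have "\<dots> \<le> \<delta> / 2 * (h k * G T) + h k / (2 * \<delta>) * m A"
      using Gint[of k] \<delta> by (intro add_right_mono mult_left_mono) auto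
    also have "\<dots> = h k * (\<delta> / 2 * G T + m A / (2 * \<delta>))" by (simp add: algebra_simps)
    finally show ?thesis using h(1)[of k] by (simp add: D_def field_simps)
  qed
  have Fb: "\<bar>F A\<bar> \<le> \<delta> / 2 * G T + m A / (2 * \<delta>)" if A: "A \<in> sets borel" and \<delta>: "0 < \<delta>" for A \<delta>
  proof -
    have "\<bar>F A\<bar> \<le> (LINT t|?M. \<bar>indicator A t * f t\<bar>)" unfolding F_def by (rule integral_abs_bound)
    also have "\<dots> \<le> (LINT t|?M. \<delta> / 2 * (f t)\<^sup>2 + 1 / (2 * \<delta>) * indicator A t)"
    proof (intro integral_mono integrable_abs ind A Bochner_Integration.integrable_add integrable_mult_right mi sub)
      fix t
      show "\<bar>indicator A t * f t\<bar> \<le> \<delta> / 2 * (f t)\<^sup>2 + 1 / (2 * \<delta>) * indicator A t"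
        using abs_le_young[OF \<delta>, of "f t"] \<delta> by (auto simp: indicator_def)
    qed (use ab in auto)
    also have "\<dots> = \<delta> / 2 * (LINT t|?M. (f t)\<^sup>2) + m A / (2 * \<delta>)"
      using sub(2)[of a b] ab mi[OF A] unfolding m_def by (subst Bochner_Integration.integral_add) auto
    also have "(LINT t|?M. (f t)\<^sup>2) \<le> G T"
    proof -
      have "0 \<le> G a" "G b \<le> G T" using Gp(2)[of 0 a] Gp(2)[of b T] Gp(3) ab by auto
      moreover have "(LINT t|?M. (f t)\<^sup>2) = G b - G a"
        using integral_subinterval_diff[OF f2, of a b] ab by (simp add: G_def)
      ultimately show ?thesis by linarith
    qed
    finally show ?thesis using \<delta> by simp
  qed
  have "D A \<longlonglongrightarrow> F A" using A
  proof (induction rule: borel_set_induct)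
    case empty
    then show ?case by (simp add: D_def F_def)
  next
    case (interval c d)
    \<comment> \<open>The interval is clipped to [a,b]. Its left end stays at least a, which leaves
      room for the backward shift.\<close>
    define c' where "c' = max a c"
    define d' where "d' = min b d"
    have red: "(LINT t|?M. indicator {c..d} t * g t) = (LINT t|lebesgue_on {c'..d'}. g t)" for g :: "real \<Rightarrow> real"
    proof -
      have "(LINT t|?M. indicator {c..d} t * g t) = (LINT t|lebesgue. indicator {a..b} t * (indicator {c..d} t * g t))"
        by (simp add: integral_restrict_space)
      also have "\<dots> = (LINT t|lebesgue. indicator {c'..d'} t * g t)"
        by (rule Bochner_Integration.integral_cong) (auto simp: indicator_def c'_def d'_def)
      finally show ?thesis by (simp add: integral_restrict_space)
    qed
    show ?case
    proof (cases "c' \<le> d'")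
      case True
      have *: "0 < c'" "d' \<le> T" "h k \<le> c'" for k using ab h(2)[of k] by (auto simp: c'_def d'_def)
      have "(\<lambda>k. (LINT t|lebesgue_on {c'..d'}. W t - W (t - h k)) / h k) \<longlonglongrightarrow> W d' - W c'"
        by (rule average_difference_tendsto[OF W True]) (use * h in auto)
      also have "W d' - W c' = (LINT t|lebesgue_on {c'..d'}. f t)" using * True by (intro Wf) auto
      finally show ?thesis by (simp add: D_def F_def red)
    next
      case False
      then have "{c'..d'} = {}" by simp
      then show ?thesis by (simp add: D_def F_def red)
    qed
  next
    case (compl A)
    have i: "indicator (- A) t = 1 - (indicator A t :: real)" for t by (simp add: indicator_def)
    \<comment> \<open>A complement is reduced to the whole interval [a,b], where continuity of W
      alone gives the limit.\<close>
    have "(\<lambda>k. (LINT t|?M. W t - W (t - h k)) / h k) \<longlonglongrightarrow> W b - W a"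
      by (rule average_difference_tendsto[OF W]) (use ab h in auto)
    also have "W b - W a = (LINT t|?M. f t)" using ab by (intro Wf) auto
    finally have "(\<lambda>k. (LINT t|?M. W t - W (t - h k)) / h k - D A k) \<longlonglongrightarrow> (LINT t|?M. f t) - F A"
      by (intro tendsto_diff compl)
    moreover have "(LINT t|?M. W t - W (t - h k)) / h k - D A k = D (- A) k" for k
      using Ki[of k] ind[OF compl(1) Ki[of k]]
      by (simp add: D_def i left_diff_distrib flip: diff_divide_distrib)
    moreover have "(LINT t|?M. f t) - F A = F (- A)"
      using sub(1)[of a b] ab ind[OF compl(1) sub(1)[of a b]]
      by (simp add: F_def i left_diff_distrib)
    ultimately show ?case by simp
  next
    case (union A)
    define U where "U = (\<Union>i. A i)"
    \<comment> \<open>For finite unions the limits of the induction hypothesis are added up; the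
      rest U - S n has small measure, and there \<open>Db\<close> and \<open>Fb\<close>
      apply.\<close>
    define S where "S n = (\<Union>i<n. A i)" for n
    have [measurable]: "U \<in> sets borel" "S n \<in> sets borel" "U - S n \<in> sets borel" for n
      using union(2) by (auto simp: U_def S_def)
    have indS: "indicator (S n) t = (\<Sum>i<n. indicator (A i) t :: real)" for n t
      unfolding S_def using union(1)
      by (subst indicator_UN_disjoint) (auto simp: disjoint_family_on_def)
    have DS: "D (S n) k = (\<Sum>i<n. D (A i) k)" for n k
      unfolding D_def indS sum_distrib_right
      by (subst Bochner_Integration.integral_sum) (auto intro!: ind union Ki simp: sum_divide_distrib)
    have FS: "F (S n) = (\<Sum>i<n. F (A i))" for n
      unfolding F_def indS sum_distrib_right
      by (subst Bochner_Integration.integral_sum) (use ab in \<open>auto intro!: ind union sub\<close>)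
    have SU: "S n \<subseteq> U" for n by (auto simp: S_def U_def)
    have split: "indicator U t = indicator (S n) t + (indicator (U - S n) t :: real)" for n t
      using SU[of n] by (auto simp: indicator_def)
    have DU: "D U k = D (S n) k + D (U - S n) k" for n k
      unfolding D_def split[of _ n] distrib_right
      by (subst Bochner_Integration.integral_add) (auto intro!: ind Ki simp: add_divide_distrib)
    have FU: "F U = F (S n) + F (U - S n)" for n
      unfolding F_def split[of _ n] distrib_right
      by (subst Bochner_Integration.integral_add) (use ab in \<open>auto intro!: ind sub\<close>)
    have "(\<lambda>n. m (U - S n)) \<longlonglongrightarrow> (LINT t|?M. 0)" unfolding m_def
    proof (rule integral_dominated_convergence[where w="\<lambda>_. 1"])
      show "AE t in ?M. (\<lambda>n. indicator (U - S n) t :: real) \<longlonglongrightarrow> 0"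
      proof (rule AE_I2)
        fix t
        show "(\<lambda>n. indicator (U - S n) t :: real) \<longlonglongrightarrow> 0"
        proof (cases "t \<in> U")
          case True
          then obtain i where i: "t \<in> A i" by (auto simp: U_def)
          have "\<forall>\<^sub>F n in sequentially. indicator (U - S n) t = (0 :: real)"
            using eventually_gt_at_top[of i] by eventually_elim (use i in \<open>auto simp: S_def indicator_def\<close>)
          then show ?thesis by (rule tendsto_eventually)
        qed simp
      qed
      show "integrable ?M (\<lambda>_. 1::real)" by (intro continuous_imp_integrable_real continuous_intros)
    qed (auto simp: indicator_def intro!: ms)
    then have mlim: "(\<lambda>n. m (U - S n)) \<longlonglongrightarrow> 0" by simp
    have "D U \<longlonglongrightarrow> F U"
    proof (rule tendsto_approximation)
      fix e :: real assume e: "0 < e"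
      \<comment> \<open>\<delta> is fixed first and makes the term with G T at most e/2. Then n is
        taken so large that the measure of the rest is below \<delta> e, which makes the other term
        at most e/2.\<close>
      define \<delta> where "\<delta> = e / (\<bar>G T\<bar> + 1)"
      have \<delta>: "0 < \<delta>" using e by (simp add: \<delta>_def)
      have "\<delta> / 2 * G T \<le> e / 2"
      proof -
        have "\<delta> * G T \<le> \<delta> * (\<bar>G T\<bar> + 1)" using \<delta> by (intro mult_left_mono) auto
        also have "\<dots> = e" by (simp add: \<delta>_def)
        finally show ?thesis by simp
      qed
      moreover have "\<forall>\<^sub>F n in sequentially. m (U - S n) < \<delta> * e"
        using order_tendstoD(2)[OF mlim, of "\<delta> * e"] \<delta> e by simp
      then obtain n where n: "m (U - S n) < \<delta> * e" by (auto simp: eventually_sequentially)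
      then have "m (U - S n) / (2 * \<delta>) \<le> e / 2" using \<delta> by (simp add: field_simps)
      ultimately have "\<delta> / 2 * G T + m (U - S n) / (2 * \<delta>) \<le> e" by linarith
      then have "\<bar>D U k - D (S n) k\<bar> \<le> e" "\<bar>F U - F (S n)\<bar> \<le> e" for k
        using Db[of "U - S n" \<delta> k] Fb[of "U - S n" \<delta>] \<delta> DU[of k n] FU[of n] by (auto intro: order_trans)
      moreover have "D (S n) \<longlonglongrightarrow> F (S n)"
        unfolding DS FS by (intro tendsto_sum union)
      ultimately show "\<exists>Y y. Y \<longlonglongrightarrow> y \<and> (\<forall>k. \<bar>D U k - Y k\<bar> \<le> e) \<and> \<bar>F U - y\<bar> \<le> e" by blast
    qed
    then show ?case by (simp add: U_def)
  qed
  then show ?thesis by (simp add: D_def[abs_def] F_def)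
qed

section \<open>Weak time derivatives\<close>

lemma smooth_of_deriv:
  fixes f :: "real \<Rightarrow> real"
  assumes "\<And>x. (f has_real_derivative f' x) (at x)" "smooth f'"
  shows "smooth f"
  using assms(2) smooth_real_unfold[OF assms(1)] continuously_differentiable_SucD unfolding smooth_def by blast

definition unit_bump :: "real \<Rightarrow> real" where
  "unit_bump x = flat_exp 0 x * flat_exp 0 (1 - x)"

text \<open>The integration starts at -1, to the left of the support of \<open>unit_bump\<close> in
  [0,1], so that every x \<ge> 0 lies in the interior of a range of integration and the fundamental
  theorem yields a two-sided derivative even at 0.\<close>

definition smooth_step :: "real \<Rightarrow> real" where
  "smooth_step x = integral {-1..x} unit_bump / integral {-1..1} unit_bump"

lemma smooth_unit_bump: "smooth unit_bump"
  using smooth_mult[OF smooth_flat_exp[of 0]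
    smooth_compose_affine[OF smooth_flat_exp[of 0], where \<alpha>="-1" and c="1::real" and \<beta>=1]]
  unfolding unit_bump_def[abs_def] by simp

lemma unit_bump_nonneg: "0 \<le> unit_bump x"
  by (simp add: unit_bump_def flat_exp_nonneg)

lemma unit_bump_outside: "x \<le> 0 \<or> 1 \<le> x \<Longrightarrow> unit_bump x = 0"
  by (auto simp: unit_bump_def flat_exp_def)

lemma unit_bump_integral_pos: "0 < integral {-1..1} unit_bump"
proof -
  have c: "continuous_on {-1..1} unit_bump" by (rule smooth_continuous[OF smooth_unit_bump])
  have "integral {-1..1} unit_bump \<noteq> 0"
  proof
    assume "integral {-1..1} unit_bump = 0"
    then have "\<forall>x\<in>{-1..1}. unit_bump x = 0"
      using integral_eq_0_iff[OF c] unit_bump_nonneg by simp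
    then have "unit_bump (1 / 2) = 0" by simp
    then show False by (simp add: unit_bump_def flat_exp_def)
  qed
  moreover have "0 \<le> integral {-1..1} unit_bump"
    by (intro integral_nonneg integrable_continuous_real c) (simp add: unit_bump_nonneg)
  ultimately show ?thesis by simp
qed

lemma smooth_step_0: "x \<le> 0 \<Longrightarrow> smooth_step x = 0"
proof -
  assume x: "x \<le> 0"
  have "integral {-1..x} unit_bump = integral {-1..x} (\<lambda>_. 0)"
    by (rule Henstock_Kurzweil_Integration.integral_cong) (use x unit_bump_outside in auto)
  then show ?thesis by (simp add: smooth_step_def)
qed

lemma smooth_step_1: "1 \<le> x \<Longrightarrow> smooth_step x = 1"
proof -
  assume x: "1 \<le> x"
  have "integral {1..x} unit_bump = integral {1..x} (\<lambda>_. 0)"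
    by (rule Henstock_Kurzweil_Integration.integral_cong) (use unit_bump_outside in auto)
  moreover have "integral {-1..1} unit_bump + integral {1..x} unit_bump = integral {-1..x} unit_bump"
    by (rule Henstock_Kurzweil_Integration.integral_combine)
       (use x in \<open>auto intro!: integrable_continuous_real smooth_continuous smooth_unit_bump\<close>)
  ultimately show ?thesis using unit_bump_integral_pos by (simp add: smooth_step_def)
qed

lemma smooth_step_deriv:
  "(smooth_step has_real_derivative unit_bump x / integral {-1..1} unit_bump) (at x)"
proof (cases "x < 0")
  case True
  have "((\<lambda>_. 0) has_real_derivative 0) (at x)" by simp
  then have "(smooth_step has_real_derivative 0) (at x)"
    by (rule has_field_derivative_transform_within_open[of _ _ _ "{..<0}"])
       (use True smooth_step_0 in auto)
  then show ?thesis using True unit_bump_outside[of x] by simp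
next
  case False
  have "((\<lambda>x. integral {-1..x} unit_bump) has_real_derivative unit_bump x) (at x within {-1..x + 1})"
    by (rule integral_has_real_derivative) (use False in \<open>auto intro: smooth_continuous smooth_unit_bump\<close>)
  moreover have "at x within {-1..x + 1} = at x" using False by (intro at_within_Icc_at) auto
  ultimately show ?thesis unfolding smooth_step_def[abs_def]
    by (auto intro!: DERIV_cdivide)
qed

lemma smooth_smooth_step: "smooth smooth_step"
  by (rule smooth_of_deriv[OF smooth_step_deriv])
     (use smooth_mult[OF smooth_const smooth_unit_bump, of "1 / integral {-1..1} unit_bump"] in simp)

lemma smooth_step_bounds: "0 \<le> smooth_step x" "smooth_step x \<le> 1"
proof -
  have mono: "smooth_step x \<le> smooth_step y" if "x \<le> y" for x y
    by (rule DERIV_nonneg_imp_nondecreasing[OF that])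
       (use smooth_step_deriv unit_bump_nonneg unit_bump_integral_pos in \<open>blast intro: divide_nonneg_pos\<close>)
  show "0 \<le> smooth_step x" using mono[of "min x 0" x] smooth_step_0[of "min x 0"] by simp
  show "smooth_step x \<le> 1" using mono[of x "max x 1"] smooth_step_1[of "max x 1"] by simp
qed

text \<open>The kernel is the derivative of the rescaled step at r: nonnegative, concentrated on (r,
  r + 1/k), and of mass 1 once 1/k < T - r. Continuity of f at r then gives the limit.\<close>

lemma smooth_step_kernel_tendsto:
  fixes f :: "real \<Rightarrow> real"
  assumes f: "continuous_on {0..T} f" and r: "0 < r" "r < T"
  shows "(\<lambda>k. LINT x|lebesgue_on {0..T}. f x * (real k * (unit_bump (real k * (x - r)) / integral {-1..1} unit_bump)))
     \<longlonglongrightarrow> f r"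
proof (rule LIMSEQ_I)
  fix e :: real assume e: "0 < e"
  define K where "K k x = real k * (unit_bump (real k * (x - r)) / integral {-1..1} unit_bump)" for k x
  have K0: "0 \<le> K k x" for k x
    using unit_bump_nonneg unit_bump_integral_pos by (simp add: K_def)
  have Kc: "continuous_on {0..T} (K k)" for k
    unfolding K_def using unit_bump_integral_pos
    by (intro continuous_intros continuous_on_compose2[OF smooth_continuous[OF smooth_unit_bump, of UNIV]]) auto
  have fK: "integrable (lebesgue_on {0..T}) (\<lambda>x. f x * K k x)" "integrable (lebesgue_on {0..T}) (K k)" for k
    by (intro continuous_imp_integrable_real continuous_on_mult f Kc)+
  have "isCont f r" using f r by (simp add: continuous_on_interior)
  then obtain d where d: "0 < d" "\<And>x. \<bar>x - r\<bar> < d \<Longrightarrow> \<bar>f x - f r\<bar> < e / 2"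
    using e unfolding continuous_at_eps_delta by (metis dist_real_def half_gt_zero)
  \<comment> \<open>This index serves two purposes: 1/k < d for the continuity of f, and 1/k < T - r
    for the full mass of the kernel.\<close>
  obtain k0 :: nat where k0: "1 / (min d (T - r)) < real k0" using reals_Archimedean2 by blast
  have "norm ((LINT x|lebesgue_on {0..T}. f x * K k x) - f r) < e" if k: "k0 \<le> k" for k
  proof -
    have m: "0 < min d (T - r)" using d r by simp
    then have kp: "0 < real k" using k0 k by (smt (verit) divide_pos_pos of_nat_mono)
    have "1 / (min d (T - r)) < real k" using k0 k by (simp add: less_le_trans)
    moreover have "1 / real k < x" if "0 < x" "1 / x < real k" for x
      using that kp by (simp add: field_simps)
    ultimately have *: "1 / real k < min d (T - r)" using m by blast
    have "(K k has_integral smooth_step (real k * (T - r)) - smooth_step (real k * (0 - r))) {0..T}"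
    proof (rule fundamental_theorem_of_calculus)
      fix x
      have "((\<lambda>x. smooth_step (real k * (x - r))) has_real_derivative K k x) (at x within {0..T})"
        unfolding K_def
        by (rule DERIV_chain2[where g="\<lambda>x. real k * (x - r)" and Db="real k", THEN DERIV_cong])
           (auto intro!: smooth_step_deriv derivative_eq_intros)
      then show "((\<lambda>x. smooth_step (real k * (x - r))) has_vector_derivative K k x) (at x within {0..T})"
        by (rule has_real_derivative_iff_has_vector_derivative[THEN iffD1])
    qed (use r in simp)
    moreover have "smooth_step (real k * (T - r)) = 1"
      using * kp by (intro smooth_step_1) (simp add: field_simps)
    moreover have "smooth_step (real k * (0 - r)) = 0"
      using r by (intro smooth_step_0) (simp add: mult_nonneg_nonpos)
    ultimately have "integral {0..T} (K k) = 1" by (simp add: integral_unique)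
    then have K1: "(LINT x|lebesgue_on {0..T}. K k x) = 1"
      using lebesgue_integral_eq_integral[OF fK(2)] by simp
    have "(LINT x|lebesgue_on {0..T}. f x * K k x) - f r = (LINT x|lebesgue_on {0..T}. f x * K k x - f r * K k x)"
      using fK K1 by simp
    also have "\<bar>\<dots>\<bar> \<le> (LINT x|lebesgue_on {0..T}. \<bar>f x * K k x - f r * K k x\<bar>)"
      by (rule integral_abs_bound)
    also have "\<dots> \<le> (LINT x|lebesgue_on {0..T}. e / 2 * K k x)"
    proof (intro integral_mono integrable_abs Bochner_Integration.integrable_diff fK integrable_mult_right)
      fix x
      show "\<bar>f x * K k x - f r * K k x\<bar> \<le> e / 2 * K k x"
      proof (cases "K k x = 0")
        case False
        then have "\<not> (real k * (x - r) \<le> 0 \<or> 1 \<le> real k * (x - r))"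
          using unit_bump_outside by (auto simp: K_def)
        then have "0 < x - r" "x - r < 1 / real k" using kp by (auto simp: field_simps mult_le_0_iff)
        then have "\<bar>x - r\<bar> < d" using * by simp
        then have "\<bar>f x - f r\<bar> \<le> e / 2" using d(2)[of x] by simp
        then have "\<bar>f x - f r\<bar> * K k x \<le> e / 2 * K k x" using K0 by (intro mult_right_mono)
        then show ?thesis using K0[of k x] by (simp add: abs_mult flip: left_diff_distrib)
      qed simp
    qed
    also have "\<dots> = e / 2" using K1 by simp
    finally show ?thesis using e by simp
  qed
  then show "\<exists>m. \<forall>k\<ge>m. norm ((LINT x|lebesgue_on {0..T}. f x * (real k * (unit_bump (real k * (x - r)) / integral {-1..1} unit_bump))) - f r) < e"
    unfolding K_def by blast
qed

text \<open>The test function rises from 0 to 1 just after r and falls back just after t. Its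
  derivative is a difference of two approximate identities, and it converges to the indicator of
  (r,t], which turns the weak identity into the integrated one.\<close>

lemma du_Bois_Reymond_interior:
  fixes f g :: "real \<Rightarrow> real"
  assumes f: "continuous_on {0..T} f" and g: "integrable (lebesgue_on {0..T}) g"
    and weak: "\<And>\<psi>. test_function {0<..<T} \<psi> \<Longrightarrow>
      (LINT t|lebesgue_on {0..T}. f t * deriv \<psi> t) = - (LINT t|lebesgue_on {0..T}. g t * \<psi> t)"
    and rt: "0 < r" "r \<le> t" "t < T"
  shows "f t - f r = (LINT x|lebesgue_on {r..t}. g x)"
proof -
  let ?c = "integral {-1..1} unit_bump"
  let ?M = "lebesgue_on {0..T}"
  define \<psi> where "\<psi> k x = smooth_step (real k * (x - r)) - smooth_step (real k * (x - t))" for k x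
  define K where "K s k x = real k * (unit_bump (real k * (x - s)) / ?c)" for s k x
  have step_d: "((\<lambda>x. smooth_step (real k * (x - s))) has_real_derivative K s k x) (at x)" for s k x
    unfolding K_def
    by (rule DERIV_chain2[where g="\<lambda>x. real k * (x - s)" and Db="real k", THEN DERIV_cong])
       (auto intro!: smooth_step_deriv derivative_eq_intros)
  then have \<psi>d: "deriv (\<psi> k) x = K r k x - K t k x" for k x
    unfolding \<psi>_def by (intro DERIV_imp_deriv DERIV_diff)
  have smooth: "smooth (\<lambda>x. smooth_step (real k * (x - s)))" for s k
    using smooth_compose_affine[OF smooth_smooth_step, of "real k" "1::real" "- real k * s"] by (simp add: algebra_simps)
  then have \<psi>s: "smooth (\<psi> k)" for k unfolding \<psi>_def by (intro smooth_diff)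
  have Kc: "continuous_on {0..T} (K s k)" for s k
    unfolding K_def using unit_bump_integral_pos
    by (intro continuous_intros continuous_on_compose2[OF smooth_continuous[OF smooth_unit_bump, of UNIV]]) auto
  have fK: "integrable ?M (\<lambda>x. f x * K s k x)" for s k
    by (intro continuous_imp_integrable_real continuous_on_mult f Kc)
  have "(\<lambda>k. (LINT x|?M. f x * K r k x) - (LINT x|?M. f x * K t k x)) \<longlonglongrightarrow> f r - f t"
    unfolding K_def by (intro tendsto_diff smooth_step_kernel_tendsto[OF f]) (use rt in auto)
  then have lim1: "(\<lambda>k. LINT x|?M. f x * deriv (\<psi> k) x) \<longlonglongrightarrow> f r - f t"
    using fK by (simp add: \<psi>d right_diff_distrib)
  have \<psi>lim: "(\<lambda>k. \<psi> k x) \<longlonglongrightarrow> indicator {r<..t} x" for x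
  proof -
    have one: "(\<lambda>k. smooth_step (real k * (x - s))) \<longlonglongrightarrow> (if x \<le> s then 0 else 1)" for s
    proof (cases "x \<le> s")
      case True
      then have "smooth_step (real k * (x - s)) = 0" for k by (intro smooth_step_0) (simp add: mult_nonneg_nonpos)
      then show ?thesis using True by simp
    next
      case False
      obtain k0 :: nat where k0: "1 / (x - s) < real k0" using reals_Archimedean2 by blast
      have "\<forall>\<^sub>F k in sequentially. smooth_step (real k * (x - s)) = 1"
        using eventually_ge_at_top[of k0]
      proof eventually_elim
        case (elim k)
        then have "1 / (x - s) < real k" using k0 by (simp add: less_le_trans)
        then show ?case using False by (intro smooth_step_1) (simp add: field_simps)
      qed
      then show ?thesis using False by (simp add: tendsto_eventually)
    qed
    have "(\<lambda>k. \<psi> k x) \<longlonglongrightarrow> (if x \<le> r then 0 else 1) - (if x \<le> t then 0 else 1)"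
      unfolding \<psi>_def by (intro tendsto_diff one)
    also have "(if x \<le> r then 0 else 1) - (if x \<le> t then 0 else 1) = (indicator {r<..t} x :: real)"
      using rt by (auto simp: indicator_def)
    finally show ?thesis .
  qed
  have \<psi>b: "\<bar>\<psi> k x\<bar> \<le> 1" for k x
    using smooth_step_bounds[of "real k * (x - r)"] smooth_step_bounds[of "real k * (x - t)"]
    unfolding \<psi>_def by linarith
  have [measurable]: "\<psi> k \<in> borel_measurable ?M" for k
    using smooth_continuous[OF \<psi>s, of UNIV k]
    by (intro measurable_restrict_space1 measurable_completion) (simp add: borel_measurable_continuous_onI)
  have [measurable]: "g \<in> borel_measurable ?M" using g by simp
  have im[measurable]: "(indicator {r<..t} :: real \<Rightarrow> real) \<in> borel_measurable ?M"
    by (intro measurable_restrict_space1 measurable_completion) simp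
  have lim2: "(\<lambda>k. LINT x|?M. g x * \<psi> k x) \<longlonglongrightarrow> (LINT x|?M. g x * indicator {r<..t} x)"
  proof (rule integral_dominated_convergence[where w="\<lambda>x. \<bar>g x\<bar>"])
    show "AE x in ?M. (\<lambda>k. g x * \<psi> k x) \<longlonglongrightarrow> g x * indicator {r<..t} x"
      by (intro AE_I2 tendsto_mult tendsto_const \<psi>lim)
    show "AE x in ?M. norm (g x * \<psi> k x) \<le> \<bar>g x\<bar>" for k
      using \<psi>b by (intro AE_I2) (auto simp: abs_mult intro!: mult_left_le)
  qed (use g in auto)
  \<comment> \<open>From this index on the support, contained in [r, t + 1/k], lies inside (0,T), as
    required of a test function.\<close>
  obtain k0 :: nat where k0: "1 / (T - t) < real k0" using reals_Archimedean2 by blast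
  have "\<forall>\<^sub>F k in sequentially. (LINT x|?M. f x * deriv (\<psi> k) x) = - (LINT x|?M. g x * \<psi> k x)"
    using eventually_ge_at_top[of k0]
  proof eventually_elim
    case (elim k)
    have kT: "1 / (T - t) < real k" using k0 elim by (simp add: less_le_trans)
    moreover have "0 < 1 / (T - t)" using rt by simp
    ultimately have kp: "0 < real k" by linarith
    have *: "1 / real k < T - t" using kT kp rt by (simp add: field_simps)
    show ?case
    proof (rule weak, rule test_functionI)
      show "smooth (\<psi> k)" by (rule \<psi>s)
      show "compact {r..t + 1 / real k}" by simp
      show "{r..t + 1 / real k} \<subseteq> {0<..<T}" using rt * by auto
      fix x assume x: "\<psi> k x \<noteq> 0"
      show "x \<in> {r..t + 1 / real k}"
      proof (rule ccontr)
        assume "x \<notin> {r..t + 1 / real k}"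
        then consider "x < r" | "t + 1 / real k < x" by fastforce
        then show False
        proof cases
          case 1
          then have "smooth_step (real k * (x - r)) = 0" "smooth_step (real k * (x - t)) = 0"
            using rt by (auto intro!: smooth_step_0 simp: mult_nonneg_nonpos)
          then show False using x by (simp add: \<psi>_def)
        next
          case 2
          then have "1 \<le> real k * (x - t)" using kp by (simp add: field_simps)
          moreover have "real k * (x - t) \<le> real k * (x - r)" using rt by (intro mult_left_mono) auto
          ultimately have "smooth_step (real k * (x - r)) = 1" "smooth_step (real k * (x - t)) = 1"
            by (auto intro!: smooth_step_1)
          then show False using x by (simp add: \<psi>_def)
        qed
      qed
    qed
  qed
  from tendsto_cong[OF this] lim1 have "(\<lambda>k. - (LINT x|?M. g x * \<psi> k x)) \<longlonglongrightarrow> f r - f t" by simp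
  from LIMSEQ_unique[OF this tendsto_minus[OF lim2]]
  have "f t - f r = (LINT x|?M. g x * indicator {r<..t} x)" by simp
  also have "\<dots> = (LINT x|lebesgue. indicator {r..t} x * g x)"
  proof -
    have "(LINT x|?M. g x * indicator {r<..t} x) = (LINT x|lebesgue. indicator {0..T} x * (g x * indicator {r<..t} x))"
      by (simp add: integral_restrict_space)
    also have "\<dots> = (LINT x|lebesgue. indicator {r<..t} x * (indicator {0..T} x * g x))"
      by (simp add: mult_ac)
    also have "\<dots> = (LINT x|lebesgue. indicator {r..t} x * (indicator {0..T} x * g x))"
    proof (rule integral_cong_AE)
      have [measurable]: "(\<lambda>x. indicator {0..T} x * g x) \<in> borel_measurable lebesgue"
        using \<open>g \<in> borel_measurable ?M\<close> by (subst (asm) borel_measurable_restrict_space_iff) auto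
      have [measurable]: "{r<..t} \<in> sets lebesgue" "{r..t} \<in> sets lebesgue" by auto
      show "(\<lambda>x. indicator {r<..t} x * (indicator {0..T} x * g x)) \<in> borel_measurable lebesgue"
        "(\<lambda>x. indicator {r..t} x * (indicator {0..T} x * g x)) \<in> borel_measurable lebesgue" by measurable
      have "AE x in lebesgue. x \<noteq> r" by (rule AE_completion, rule AE_lborel_singleton)
      then show "AE x in lebesgue. indicator {r<..t} x * (indicator {0..T} x * g x) = indicator {r..t} x * (indicator {0..T} x * g x)"
        by eventually_elim (auto simp: indicator_def)
    qed
    also have "\<dots> = (LINT x|lebesgue. indicator {r..t} x * g x)"
      by (rule Bochner_Integration.integral_cong) (use rt in \<open>auto simp: indicator_def\<close>)
    finally show ?thesis .
  qed
  finally show ?thesis by (simp add: integral_restrict_space)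
qed

text \<open>f minus the primitive of g is constant on the open interval, and continuity carries this
  to the endpoints, which supports of test functions do not reach.\<close>

lemma du_Bois_Reymond:
  fixes f g :: "real \<Rightarrow> real"
  assumes f: "continuous_on {0..T} f" and g: "integrable (lebesgue_on {0..T}) g" and T: "0 < T"
    and weak: "\<And>\<psi>. test_function {0<..<T} \<psi> \<Longrightarrow>
      (LINT t|lebesgue_on {0..T}. f t * deriv \<psi> t) = - (LINT t|lebesgue_on {0..T}. g t * \<psi> t)"
    and rt: "0 \<le> r" "r \<le> t" "t \<le> T"
  shows "f t - f r = (LINT x|lebesgue_on {r..t}. g x)"
proof -
  define J where "J x = f x - (LINT s|lebesgue_on {0..x}. g s)" for x
  have J: "continuous_on {0..T} J" unfolding J_def
    by (intro continuous_intros f indefinite_integral_continuous_real g)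
  have le: "J s = J x" if "0 < x" "x \<le> s" "s < T" for x s
    using du_Bois_Reymond_interior[OF f g weak that] integral_subinterval_diff[OF g, of x s] that
    by (simp add: J_def)
  have mid: "J x = J (T / 2)" if "x \<in> {0<..<T}" for x
    using le[of x "T / 2"] le[of "T / 2" x] that by (cases "x \<le> T / 2") auto
  have cl: "closure {0<..<T} = {0..T}" using T by simp
  have "J x = J (T / 2)" if "x \<in> {0..T}" for x
    by (rule continuous_constant_on_closure[of "{0<..<T}" J, unfolded cl, OF J mid that])
  from this[of t] this[of r] have "J t = J r" using rt by simp
  then show ?thesis using integral_subinterval_diff[OF g rt] by (simp add: J_def)
qed

section \<open>Gronwall's inequality\<close>

text \<open>\<kappa> is merely integrable, so the integral form is used. The bound is stated for the
  whole right-hand side at time T and not just for y: it later controls both y and the integrated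
  dissipation.\<close>

lemma Gronwall:
  fixes \<kappa> y :: "real \<Rightarrow> real"
  assumes \<kappa>: "integrable (lebesgue_on {0..T}) \<kappa>" "\<And>t. 0 \<le> \<kappa> t"
    and y: "continuous_on {0..T} y" "\<And>t. 0 \<le> y t" and c: "0 \<le> c" and T: "0 \<le> T"
    and le: "\<And>s. 0 \<le> s \<Longrightarrow> s \<le> T \<Longrightarrow> y s \<le> c + (LINT t|lebesgue_on {0..s}. \<kappa> t * y t)"
  shows "c + (LINT t|lebesgue_on {0..T}. \<kappa> t * y t) \<le> c * exp (LINT t|lebesgue_on {0..T}. \<kappa> t)"
proof -
  obtain B where "\<forall>x\<in>y ` {0..T}. norm x \<le> B"
    using compact_imp_bounded[OF compact_continuous_image[OF y(1) compact_Icc]] unfolding bounded_iff by blast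
  then have B: "y t \<le> B" if "t \<in> {0..T}" for t
    using that by (auto simp: abs_le_iff)
  have \<kappa>y: "integrable (lebesgue_on {0..T}) (\<lambda>t. \<kappa> t * y t)"
  proof (rule Bochner_Integration.integrable_bound)
    show "integrable (lebesgue_on {0..T}) (\<lambda>t. \<kappa> t * B)" using \<kappa> by simp
    show "(\<lambda>t. \<kappa> t * y t) \<in> borel_measurable (lebesgue_on {0..T})"
      using \<kappa>(1) continuous_imp_integrable_real[OF y(1)] by (intro borel_measurable_times) auto
    show "AE t in lebesgue_on {0..T}. norm (\<kappa> t * y t) \<le> norm (\<kappa> t * B)"
    proof (rule AE_I2)
      fix t assume "t \<in> space (lebesgue_on {0..T})"
      then have "\<kappa> t * y t \<le> \<kappa> t * B" using B \<kappa>(2) by (intro mult_left_mono) auto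
      then show "norm (\<kappa> t * y t) \<le> norm (\<kappa> t * B)" using \<kappa>(2) y(2) by simp
    qed
  qed
  define K where "K s = (LINT t|lebesgue_on {0..s}. \<kappa> t)" for s
  define H where "H s = c + (LINT t|lebesgue_on {0..s}. \<kappa> t * y t)" for s
  note Kp = indefinite_integral_properties[OF \<kappa> T, folded K_def]
  have nn: "0 \<le> \<kappa> t * y t" for t using \<kappa> y by simp
  note Hp = indefinite_integral_properties[OF \<kappa>y nn T]
  have Hmono: "H s \<le> H t" if "0 \<le> s" "s \<le> t" "t \<le> T" for s t using Hp(2)[OF that] by (simp add: H_def)
  have H0: "H 0 = c" using Hp(3) by (simp add: H_def)
  \<comment> \<open>Since H is nondecreasing and dominates y, it obeys a discrete Gronwall step: H t
    (1 - (K t - K s)) \<le> H s.\<close>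
  have step: "H t - H s \<le> H t * (K t - K s)" if st: "0 \<le> s" "s \<le> t" "t \<le> T" for s t
  proof -
    have "H t - H s = (LINT x|lebesgue_on {s..t}. \<kappa> x * y x)"
      using integral_subinterval_diff[OF \<kappa>y st] by (simp add: H_def)
    also have "\<dots> \<le> (LINT x|lebesgue_on {s..t}. \<kappa> x * H t)"
    proof (rule integral_mono)
      show "integrable (lebesgue_on {s..t}) (\<lambda>x. \<kappa> x * y x)"
        by (rule integrable_subinterval[OF \<kappa>y]) (use st in auto)
      show "integrable (lebesgue_on {s..t}) (\<lambda>x. \<kappa> x * H t)"
        by (rule integrable_mult_left, rule integrable_subinterval[OF \<kappa>(1)]) (use st in auto)
      fix x assume x: "x \<in> space (lebesgue_on {s..t})"
      then have "y x \<le> H x" using le[of x] st by (simp add: H_def)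
      also have "\<dots> \<le> H t" using x st by (intro Hmono) auto
      finally show "\<kappa> x * y x \<le> \<kappa> x * H t" using \<kappa>(2) by (intro mult_left_mono)
    qed
    also have "\<dots> = H t * (K t - K s)"
      using integral_subinterval_diff[OF \<kappa>(1) st] by (simp add: K_def)
    finally show ?thesis .
  qed
  have KT: "0 \<le> K T" using Kp(2)[of 0 T] Kp(3) T by simp
  \<comment> \<open>Cutting \<open>[0,T]\<close> into \<open>m\<close> pieces on which \<open>K\<close> grows by equal amounts avoids differentiating the
    merely absolutely continuous function \<open>exp (- K)\<close>.\<close>
  have bound: "H T * (1 + (- K T) / real m) ^ m \<le> c" if m: "K T < real m" for m
  proof (cases "K T = 0")
    case True
    then show ?thesis using step[of 0 T] Kp(3) T H0 by simp
  next
    case False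
    then have KT: "0 < K T" using KT by simp
    then have m0: "0 < real m" using m by linarith
    \<comment> \<open>As m exceeds K T, this \<delta> is below 1, and inequalities may be multiplied
      by powers of 1 - \<delta>.\<close>
    define \<delta> where "\<delta> = K T / real m"
    have \<delta>: "0 < \<delta>" "\<delta> < 1" using KT m m0 by (auto simp: \<delta>_def)
    have "\<exists>t\<in>{0..T}. K t = real j * \<delta>" if "j \<le> m" for j
    proof -
      have "real j * \<delta> \<le> real m * \<delta>" using that \<delta> by (intro mult_right_mono) auto
      also have "\<dots> = K T" using m0 by (simp add: \<delta>_def)
      finally have "real j * \<delta> \<le> K T" .
      then show ?thesis using IVT'[of K 0 "real j * \<delta>" T] Kp(1,3) T \<delta> by auto
    qed
    then have "\<forall>j\<in>{..m}. \<exists>t. t \<in> {0..T} \<and> K t = real j * \<delta>" by blast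
    then obtain \<tau> where \<tau>: "\<And>j. j \<le> m \<Longrightarrow> \<tau> j \<in> {0..T}" "\<And>j. j \<le> m \<Longrightarrow> K (\<tau> j) = real j * \<delta>"
      by (metis atMost_iff)
    have ind: "H (\<tau> j) * (1 - \<delta>) ^ j \<le> c" if "j \<le> m" for j
      using that
    proof (induction j)
      case 0
      then show ?case using step[of 0 "\<tau> 0"] \<tau>[of 0] Kp(3) H0 by simp
    next
      case (Suc j)
      have ord: "\<tau> j \<le> \<tau> (Suc j)"
      proof (rule ccontr)
        assume "\<not> \<tau> j \<le> \<tau> (Suc j)"
        then have "K (\<tau> (Suc j)) \<le> K (\<tau> j)" using \<tau>(1)[of j] \<tau>(1)[of "Suc j"] Suc.prems by (intro Kp(2)) auto
        then show False using \<tau>(2)[of j] \<tau>(2)[of "Suc j"] Suc.prems \<delta> by simp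
      qed
      have "H (\<tau> (Suc j)) - H (\<tau> j) \<le> H (\<tau> (Suc j)) * \<delta>"
        using step[OF _ ord] \<tau>(1)[of j] \<tau>(1)[of "Suc j"] \<tau>(2)[of j] \<tau>(2)[of "Suc j"] Suc.prems
        by (simp add: algebra_simps)
      then have "H (\<tau> (Suc j)) * (1 - \<delta>) \<le> H (\<tau> j)" by (simp add: algebra_simps)
      then have "H (\<tau> (Suc j)) * (1 - \<delta>) * (1 - \<delta>) ^ j \<le> H (\<tau> j) * (1 - \<delta>) ^ j"
        using \<delta> by (intro mult_right_mono) auto
      also have "\<dots> \<le> c" using Suc by simp
      finally show ?case by (simp add: mult.assoc)
    qed
    \<comment> \<open>The last point \<tau> m may lie before T, but K is constant from there on, so
      H does not grow.\<close>
    have "K (\<tau> m) = K T" using \<tau>(2)[of m] m0 by (simp add: \<delta>_def)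
    then have "H T \<le> H (\<tau> m)" using step[of "\<tau> m" T] \<tau>(1)[of m] by simp
    then have "H T * (1 - \<delta>) ^ m \<le> H (\<tau> m) * (1 - \<delta>) ^ m" using \<delta> by (intro mult_right_mono) auto
    also have "\<dots> \<le> c" using ind by simp
    finally show ?thesis by (simp add: \<delta>_def)
  qed
  have "(\<lambda>m. H T * (1 + (- K T) / real m) ^ m) \<longlonglongrightarrow> H T * exp (- K T)"
    by (intro tendsto_mult tendsto_const tendsto_exp_limit_sequentially)
  moreover obtain m0 :: nat where "K T < real m0" using reals_Archimedean2 by blast
  then have "\<forall>m\<ge>m0. H T * (1 + (- K T) / real m) ^ m \<le> c"
    using bound by (meson less_le_trans of_nat_mono)
  ultimately have "H T * exp (- K T) \<le> c" by (intro LIMSEQ_le_const2) auto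
  then have "H T \<le> c * exp (K T)" by (simp add: exp_minus field_simps)
  then show ?thesis by (simp add: H_def K_def)
qed

section \<open>The energy inequality\<close>

text \<open>The level sets of a simple function on \<open>lebesgue_on\<close> are Lebesgue sets, so
  the Borel case is extended by changing A on a null set.\<close>

lemma average_indicator_tendsto_lebesgue:
  fixes W f :: "real \<Rightarrow> real"
  assumes W: "continuous_on {0..T} W"
    and f: "integrable (lebesgue_on {0..T}) f" and f2: "integrable (lebesgue_on {0..T}) (\<lambda>t. (f t)\<^sup>2)"
    and Wf: "\<And>r t. 0 \<le> r \<Longrightarrow> r \<le> t \<Longrightarrow> t \<le> T \<Longrightarrow> W t - W r = (LINT x|lebesgue_on {r..t}. f x)"
    and ab: "0 < a" "a \<le> b" "b \<le> T"
    and h: "\<And>k::nat. 0 < h k" "\<And>k. h k \<le> a" "h \<longlonglongrightarrow> 0"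
    and A: "A \<in> sets lebesgue"
  shows "(\<lambda>k. (LINT t|lebesgue_on {a..b}. indicator A t * (W t - W (t - h k))) / h k)
     \<longlonglongrightarrow> (LINT t|lebesgue_on {a..b}. indicator A t * f t)"
    and "\<And>k. integrable (lebesgue_on {a..b}) (\<lambda>t. indicator A t * (W t - W (t - h k)))"
    and "integrable (lebesgue_on {a..b}) (\<lambda>t. indicator A t * f t)"
proof -
  let ?M = "lebesgue_on {a..b}"
  have ind: "integrable ?M (\<lambda>t. indicator A t * g t)" if "integrable ?M g" for g :: "real \<Rightarrow> real"
  proof (rule Bochner_Integration.integrable_bound[OF that])
    have [measurable]: "(indicator A :: real \<Rightarrow> real) \<in> borel_measurable ?M"
      using A by (intro measurable_restrict_space1) simp
    have [measurable]: "g \<in> borel_measurable ?M" using that by simp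
    show "(\<lambda>t. indicator A t * g t) \<in> borel_measurable ?M" by measurable
  qed (auto simp: indicator_def)
  have Ki: "integrable ?M (\<lambda>t. W t - W (t - h k))" for k
    using continuous_on_shift[OF W, of "h k" a b] h(1,2)[of k] ab
    by (intro continuous_imp_integrable_real) (auto intro!: continuous_intros continuous_on_subset[OF W])
  show i1: "integrable ?M (\<lambda>t. indicator A t * (W t - W (t - h k)))" for k by (rule ind[OF Ki])
  have fi: "integrable ?M f" by (rule integrable_subinterval[OF f]) (use ab in auto)
  then show i2: "integrable ?M (\<lambda>t. indicator A t * f t)" by (rule ind)
  have "(indicator A :: real \<Rightarrow> real) \<in> borel_measurable lebesgue" using A by simp
  from completion_ex_borel_measurable_real[OF this]
  obtain g where g: "g \<in> borel_measurable lborel" "AE x in lborel. indicator A x = (g x :: real)" by blast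
  \<comment> \<open>The Borel version g of the indicator may take other values on a null set; its
    level set at 1 is a Borel set that agrees with A almost everywhere.\<close>
  define B where "B = g -` {1}"
  have B: "B \<in> sets borel" using measurable_sets[OF g(1), of "{1}"] by (simp add: B_def)
  have "AE x in lborel. indicator A x = (indicator B x :: real)"
    using g(2)
  proof eventually_elim
    case (elim x)
    then have "g x = 1 \<longleftrightarrow> x \<in> A" by (cases "x \<in> A") auto
    then show ?case by (simp add: B_def indicator_def)
  qed
  then have "AE x in lebesgue. indicator A x = (indicator B x :: real)" by (rule AE_completion)
  then have AB: "AE x in ?M. indicator A x = (indicator B x :: real)"
    by (simp add: AE_restrict_space_iff) (auto elim: eventually_mono)
  have eq: "(LINT t|?M. indicator A t * k t) = (LINT t|?M. indicator B t * k t)" if "integrable ?M k" for k :: "real \<Rightarrow> real"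
  proof (rule integral_cong_AE)
    show "(\<lambda>t. indicator A t * k t) \<in> borel_measurable ?M" using ind[OF that] by simp
    have [measurable]: "(indicator B :: real \<Rightarrow> real) \<in> borel_measurable ?M"
      using B by (intro measurable_restrict_space1 measurable_completion) simp
    have [measurable]: "k \<in> borel_measurable ?M" using that by simp
    show "(\<lambda>t. indicator B t * k t) \<in> borel_measurable ?M" by measurable
    show "AE t in ?M. indicator A t * k t = indicator B t * k t" using AB by eventually_elim simp
  qed
  show "(\<lambda>k. (LINT t|?M. indicator A t * (W t - W (t - h k))) / h k) \<longlonglongrightarrow> (LINT t|?M. indicator A t * f t)"
    unfolding eq[OF Ki] eq[OF fi]
    by (rule average_indicator_tendsto[OF W f f2 Wf ab h B])
qed

context seminormed
begin

lemma simple_in_bochner_2: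
  assumes s: "simple_function (lebesgue_on {0..T}) s" "\<And>t. t \<in> {0..T} \<Longrightarrow> s t \<in> X"
  shows "s \<in> bochner_space 2 T X N"
  unfolding bochner_2_iff
proof (intro conjI)
  interpret finite_measure "lebesgue_on {0..T}" by (rule finite_measure_lebesgue_on) simp
  show sX: "AE t in lebesgue_on {0..T}. s t \<in> X" using s(2) by (intro AE_I2) simp
  show "strongly_measurable T X N s"
    by (rule strongly_measurableI[of _ "\<lambda>_. s"]) (use s sX N_zero in auto)
  have "finite (s ` {0..T})" using simple_functionD(1)[OF s(1)] by simp
  then have "finite ((\<lambda>x. (n x)\<^sup>2) ` s ` {0..T})" by simp
  then obtain B where B: "\<And>t. t \<in> {0..T} \<Longrightarrow> (n (s t))\<^sup>2 \<le> B"
    using bdd_above_finite unfolding bdd_above_def by (metis (no_types, lifting) image_eqI)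
  show "integrable (lebesgue_on {0..T}) (\<lambda>t. (n (s t))\<^sup>2)"
  proof (rule integrable_const_bound[of _ B])
    show "AE t in lebesgue_on {0..T}. norm ((n (s t))\<^sup>2) \<le> B" using B by (intro AE_I2) simp
    show "(\<lambda>t. (n (s t))\<^sup>2) \<in> borel_measurable (lebesgue_on {0..T})"
      by (rule simple_function_real_measurable[OF s(1)])
  qed
qed

end

section \<open>Continuity in time of L2 inner products\<close>

context bounded_domain
begin

definition ip :: "('a \<Rightarrow> real) \<Rightarrow> ('a \<Rightarrow> real) \<Rightarrow> real" where
  "ip u v = (LINT x|lebesgue_on \<Omega>. u x * v x)"

abbreviation l2 :: "('a \<Rightarrow> real) \<Rightarrow> real" where
  "l2 u \<equiv> enn2real (Lp_norm 2 \<Omega> u)"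

lemma ip_commute: "ip u v = ip v u"
  by (simp add: ip_def mult.commute)

lemma ip_diff_left:
  "u \<in> Lp_space 2 \<Omega> \<Longrightarrow> v \<in> Lp_space 2 \<Omega> \<Longrightarrow> z \<in> Lp_space 2 \<Omega> \<Longrightarrow> ip (u - v) z = ip u z - ip v z"
  using L2_mult_integrable[of u z] L2_mult_integrable[of v z]
  by (simp add: ip_def left_diff_distrib)

lemma ip_diff_right:
  "u \<in> Lp_space 2 \<Omega> \<Longrightarrow> v \<in> Lp_space 2 \<Omega> \<Longrightarrow> z \<in> Lp_space 2 \<Omega> \<Longrightarrow> ip z (u - v) = ip z u - ip z v"
  using ip_diff_left[of u v z] by (simp add: ip_commute)

lemma ip_bound:
  assumes "u \<in> Lp_space 2 \<Omega>" "v \<in> Lp_space 2 \<Omega>"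
  shows "\<bar>ip u v\<bar> \<le> l2 u * l2 v"
proof -
  have "ennreal \<bar>ip u v\<bar> \<le> Lp_norm 2 \<Omega> u * Lp_norm 2 \<Omega> v"
    using L2_inner_integrable(2)[OF assms] by (simp add: ip_def)
  moreover have "Lp_norm 2 \<Omega> u * Lp_norm 2 \<Omega> v < top"
    using assms by (auto simp: Lp_space_def ennreal_mult_less_top)
  ultimately have "enn2real (ennreal \<bar>ip u v\<bar>) \<le> enn2real (Lp_norm 2 \<Omega> u * Lp_norm 2 \<Omega> v)"
    by (rule enn2real_mono)
  then show ?thesis by (simp add: enn2real_mult)
qed

lemma ip_self: "0 \<le> ip u u"
  by (simp add: ip_def)

lemma Lp_norm_2_square_ip: "u \<in> Lp_space 2 \<Omega> \<Longrightarrow> (Lp_norm 2 \<Omega> u)\<^sup>2 = ennreal (ip u u)"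
  using L2_norm_square_integral[of u \<Omega>] by (simp add: ip_def)

text \<open>Joint continuity is what is called for, because inner products of w(s - h) with w(s)
  occur, in which both factors move.\<close>

lemma ip_tendsto:
  assumes u: "u \<in> Lp_space 2 \<Omega>" "\<forall>\<^sub>F s in F. us s \<in> Lp_space 2 \<Omega>" "((\<lambda>s. l2 (us s - u)) \<longlongrightarrow> 0) F"
    and v: "v \<in> Lp_space 2 \<Omega>" "\<forall>\<^sub>F s in F. vs s \<in> Lp_space 2 \<Omega>" "((\<lambda>s. l2 (vs s - v)) \<longlongrightarrow> 0) F"
  shows "((\<lambda>s. ip (us s) (vs s)) \<longlongrightarrow> ip u v) F"
proof -
  interpret L: seminormed "Lp_space 2 \<Omega> :: ('a \<Rightarrow> real) set" "Lp_norm 2 \<Omega>" by (rule seminormed_Lp) simp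
  let ?g = "\<lambda>s. l2 (us s - u) * (l2 (vs s - v) + l2 v) + l2 u * l2 (vs s - v)"
  have "((\<lambda>s. ip (us s) (vs s) - ip u v) \<longlongrightarrow> 0) F"
  proof (rule Lim_null_comparison)
    show "\<forall>\<^sub>F s in F. norm (ip (us s) (vs s) - ip u v) \<le> ?g s"
      using u(2) v(2)
    proof eventually_elim
      case (elim s)
      have "ip (us s) (vs s) - ip u v = ip (us s - u) (vs s) + ip u (vs s - v)"
        using u(1) v(1) elim by (simp add: ip_diff_left ip_diff_right)
      also have "\<bar>\<dots>\<bar> \<le> l2 (us s - u) * l2 (vs s) + l2 u * l2 (vs s - v)"
        using ip_bound[of "us s - u" "vs s"] ip_bound[of u "vs s - v"] u(1) v(1) elim L.diff by (smt (verit))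
      also have "\<dots> \<le> ?g s"
        using L.n_le[of "vs s" v] v(1) elim by (intro add_right_mono mult_left_mono) auto
      finally show ?case by simp
    qed
    have "(?g \<longlongrightarrow> 0 * (0 + l2 v) + l2 u * 0) F" by (intro tendsto_intros u(3) v(3))
    then show "(?g \<longlongrightarrow> 0) F" by simp
  qed
  then show ?thesis by (simp add: LIM_zero_cancel)
qed

lemma continuous_L2D:
  assumes "continuous_L2 T \<Omega> w" "t \<in> {0..T}"
  shows "w t \<in> Lp_space 2 \<Omega>" "((\<lambda>s. l2 (w s - w t)) \<longlongrightarrow> 0) (at t within {0..T})"
proof -
  show "w t \<in> Lp_space 2 \<Omega>" using assms by (simp add: continuous_L2_def)
  have "((\<lambda>s. Lp_norm 2 \<Omega> (w s - w t)) \<longlongrightarrow> ennreal 0) (at t within {0..T})"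
    using assms by (simp add: continuous_L2_def)
  from tendsto_enn2real[OF this] show "((\<lambda>s. l2 (w s - w t)) \<longlongrightarrow> 0) (at t within {0..T})" by simp
qed

text \<open>The bound h \<le> a keeps the shifted argument in [0,T]; the case h = 0 is the
  continuity of the squared norm.\<close>

lemma continuous_on_ip_shift:
  assumes w: "continuous_L2 T \<Omega> w" and h: "0 \<le> h" "h \<le> a" "b \<le> T"
  shows "continuous_on {a..b} (\<lambda>t. ip (w (t - h)) (w t))"
  unfolding continuous_on_def
proof
  fix t assume t: "t \<in> {a..b}"
  have L: "s - h \<in> {0..T}" "s \<in> {0..T}" if "s \<in> {a..b}" for s using that h by auto
  have ev: "\<forall>\<^sub>F s in at t within {a..b}. s \<in> {a..b} \<and> s \<noteq> t" by (simp add: eventually_at_filter)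
  have lim0: "((\<lambda>s. l2 (w s - w t)) \<longlongrightarrow> 0) (at t within {a..b})"
    using continuous_L2D(2)[OF w L(2)[OF t]] by (rule tendsto_within_subset) (use L in auto)
  have "filterlim (\<lambda>s. s - h) (at (t - h) within {0..T}) (at t within {a..b})"
    unfolding filterlim_at
  proof
    show "\<forall>\<^sub>F s in at t within {a..b}. s - h \<in> {0..T} \<and> s - h \<noteq> t - h"
      using ev by eventually_elim (use L in auto)
    show "((\<lambda>s. s - h) \<longlongrightarrow> t - h) (at t within {a..b})" by (intro tendsto_intros)
  qed
  from filterlim_compose[OF continuous_L2D(2)[OF w L(1)[OF t]] this]
  have lim1: "((\<lambda>s. l2 (w (s - h) - w (t - h))) \<longlongrightarrow> 0) (at t within {a..b})" .
  show "((\<lambda>s. ip (w (s - h)) (w s)) \<longlongrightarrow> ip (w (t - h)) (w t)) (at t within {a..b})"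
  proof (rule ip_tendsto[OF _ _ lim1 _ _ lim0])
    show "w (t - h) \<in> Lp_space 2 \<Omega>" "w t \<in> Lp_space 2 \<Omega>" using continuous_L2D(1)[OF w] L t by auto
    show "\<forall>\<^sub>F s in at t within {a..b}. w (s - h) \<in> Lp_space 2 \<Omega>" "\<forall>\<^sub>F s in at t within {a..b}. w s \<in> Lp_space 2 \<Omega>"
      using ev by (eventually_elim, use continuous_L2D(1)[OF w] L in blast)+
  qed
qed

lemma continuous_on_ip_self:
  assumes w: "continuous_L2 T \<Omega> w"
  shows "continuous_on {0..T} (\<lambda>t. ip (w t) (w t))"
  using continuous_on_ip_shift[OF w, of 0 0 T] by simp

lemma continuous_on_ip_const:
  assumes w: "continuous_L2 T \<Omega> w" and \<phi>: "\<phi> \<in> Lp_space 2 \<Omega>"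
  shows "continuous_on {0..T} (\<lambda>t. ip (w t) \<phi>)"
  unfolding continuous_on_def
proof
  fix t assume t: "t \<in> {0..T}"
  have z: "l2 (\<phi> - \<phi>) = 0" by (simp add: zero_fun_def)
  have ev: "\<forall>\<^sub>F s in at t within {0..T}. s \<in> {0..T}" by (simp add: eventually_at_filter)
  show "((\<lambda>s. ip (w s) \<phi>) \<longlongrightarrow> ip (w t) \<phi>) (at t within {0..T})"
  proof (rule ip_tendsto[OF _ _ continuous_L2D(2)[OF w t] \<phi>])
    show "w t \<in> Lp_space 2 \<Omega>" by (rule continuous_L2D(1)[OF w t])
    show "\<forall>\<^sub>F s in at t within {0..T}. w s \<in> Lp_space 2 \<Omega>"
      using ev by eventually_elim (rule continuous_L2D(1)[OF w])
  qed (use \<phi> z in simp_all)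
qed

end

section \<open>The chain rule as an inequality\<close>

context dirichlet_domain
begin

lemma H1D_L2: "u \<in> H1D \<Omega> \<Gamma> \<Longrightarrow> u \<in> Lp_space 2 \<Omega>"
  using H1D_H1 H1_L2 by blast

lemma const_in_L2_H1D: "\<phi> \<in> H1D \<Omega> \<Gamma> \<Longrightarrow> (\<lambda>_. \<phi>) \<in> L2_H1D T \<Omega> \<Gamma>"
  by (rule seminormed.simple_in_bochner_2[OF seminormed_H1D]) auto

text \<open>Supplies, for each fixed \<phi>, the square integrability that the averaging lemma
  demands of the derivative.\<close>

lemma dual_apply_square_integrable:
  assumes F: "F \<in> L2_H1D_dual T \<Omega> \<Gamma>" and \<phi>: "\<phi> \<in> H1D \<Omega> \<Gamma>"
  shows "integrable (lebesgue_on {0..T}) (\<lambda>t. (F t \<phi>)\<^sup>2)"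
proof (rule Bochner_Integration.integrable_bound)
  interpret D: seminormed "H1D_dual \<Omega> \<Gamma>" "H1D_dual_norm \<Omega> \<Gamma>" by (rule seminormed_H1D_dual)
  have "integrable (lebesgue_on {0..T}) (\<lambda>t. (dual_norm (F t))\<^sup>2)" using F by (simp add: D.bochner_2_iff)
  then show "integrable (lebesgue_on {0..T}) (\<lambda>t. (dual_norm (F t))\<^sup>2 * (grad_norm \<phi>)\<^sup>2)" by simp
  note p = dual_pairing[OF F const_in_L2_H1D[OF \<phi>]]
  show "(\<lambda>t. (F t \<phi>)\<^sup>2) \<in> borel_measurable (lebesgue_on {0..T})"
    using borel_measurable_integrable[OF p(1)] by measurable
  show "AE t in lebesgue_on {0..T}. norm ((F t \<phi>)\<^sup>2) \<le> norm ((dual_norm (F t))\<^sup>2 * (grad_norm \<phi>)\<^sup>2)"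
    using p(2)
  proof eventually_elim
    case (elim t)
    then have "\<bar>F t \<phi>\<bar>\<^sup>2 \<le> (dual_norm (F t) * grad_norm \<phi>)\<^sup>2" by (intro power_mono) auto
    then show ?case by (simp add: power_mult_distrib)
  qed
qed

text \<open>For fixed \<phi> the distributional derivative becomes an integral identity between any
  two times. Continuity in L2 gives the values at single times a meaning.\<close>

lemma weak_time_derivative_integral:
  assumes T: "0 < T" and w: "continuous_L2 T \<Omega> w" and w': "w' \<in> L2_H1D_dual T \<Omega> \<Gamma>"
    and d: "has_weak_time_derivative T \<Omega> \<Gamma> w w'" and \<phi>: "\<phi> \<in> H1D \<Omega> \<Gamma>"
    and rt: "0 \<le> r" "r \<le> t" "t \<le> T"
  shows "ip (w t) \<phi> - ip (w r) \<phi> = (LINT s|lebesgue_on {r..t}. w' s \<phi>)"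
proof (rule du_Bois_Reymond[OF _ _ T _ rt])
  show "continuous_on {0..T} (\<lambda>t. ip (w t) \<phi>)" by (rule continuous_on_ip_const[OF w H1D_L2[OF \<phi>]])
  show "integrable (lebesgue_on {0..T}) (\<lambda>s. w' s \<phi>)" by (rule dual_pairing(1)[OF w' const_in_L2_H1D[OF \<phi>]])
  show "(LINT t|lebesgue_on {0..T}. ip (w t) \<phi> * deriv \<psi> t) = - (LINT t|lebesgue_on {0..T}. w' t \<phi> * \<psi> t)"
    if "test_function {0<..<T} \<psi>" for \<psi>
    using d that \<phi> unfolding has_weak_time_derivative_def ip_def by blast
qed

text \<open>If the second factor w(t) is replaced by a simple function s, the integral splits over
  the finitely many values \<phi> of s, each on its own set of times, and the averaging lemma
  applies. The error pairs w(t) - w(t - h) with w(t) - s(t); by Young's inequality, after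
  integration and division by h, it is at most \<delta> G(T)/2 plus the squared distance of w and s
  over 2 \<delta>, for every h.\<close>

lemma average_pairing_tendsto:
  assumes T: "0 < T" and w: "continuous_L2 T \<Omega> w" and wV: "w \<in> L2_H1D T \<Omega> \<Gamma>"
    and w': "w' \<in> L2_H1D_dual T \<Omega> \<Gamma>" and d: "has_weak_time_derivative T \<Omega> \<Gamma> w w'"
    and ab: "0 < a" "a \<le> b" "b \<le> T"
    and h: "\<And>k::nat. 0 < h k" "\<And>k. h k \<le> a" "h \<longlonglongrightarrow> 0"
  shows "(\<lambda>k. (LINT t|lebesgue_on {a..b}. ip (w t - w (t - h k)) (w t)) / h k)
     \<longlonglongrightarrow> (LINT t|lebesgue_on {a..b}. w' t (w t))"
proof (rule tendsto_approximation)
  fix e :: real assume e: "0 < e"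
  let ?M = "lebesgue_on {a..b}" and ?MT = "lebesgue_on {0..T}"
  interpret U: seminormed "H1D \<Omega> \<Gamma>" "H1D_norm \<Omega>" by (rule seminormed_H1D)
  interpret D: seminormed "H1D_dual \<Omega> \<Gamma>" "H1D_dual_norm \<Omega> \<Gamma>" by (rule seminormed_H1D_dual)
  interpret L: seminormed "Lp_space 2 \<Omega> :: ('a \<Rightarrow> real) set" "Lp_norm 2 \<Omega>" by (rule seminormed_Lp) simp
  have T0: "0 \<le> T" using T by simp
  have dn: "integrable ?MT (\<lambda>t. (dual_norm (w' t))\<^sup>2)" using w' by (simp add: D.bochner_2_iff)
  have AE_sub: "AE t in ?M. P t" if "AE t in ?MT. P t" for P
    using that ab by (simp add: AE_restrict_space_iff) (auto elim!: eventually_mono)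
  define G where "G t = (LINT s|lebesgue_on {0..t}. (dual_norm (w' s))\<^sup>2)" for t
  note Gp = indefinite_integral_properties[OF dn _ T0, folded G_def, simplified]
  have G0: "0 \<le> G T" using Gp(2)[of 0 T] Gp(3) T0 by simp
  \<comment> \<open>\<delta> is fixed first; the simple function is chosen afterwards with squared
    distance below \<delta> e. Both parts of the error are then at most e/2.\<close>
  define \<delta> where "\<delta> = e / (G T + 1)"
  have \<delta>: "0 < \<delta>" using e G0 by (simp add: \<delta>_def)
  have \<delta>G: "\<delta> / 2 * G T \<le> e / 2"
  proof -
    have "\<delta> * G T \<le> \<delta> * (G T + 1)" using \<delta> by (intro mult_left_mono) auto
    also have "\<dots> = e" using G0 by (simp add: \<delta>_def)
    finally show ?thesis by simp
  qed
  obtain S where S: "\<And>k::nat. simple_function ?MT (S k)" "\<And>k t. t \<in> {0..T} \<Longrightarrow> S k t \<in> H1D \<Omega> \<Gamma>"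
    "\<And>k. integrable ?MT (\<lambda>t. (grad_norm (w t - S k t))\<^sup>2)"
    "(\<lambda>k. LINT t|?MT. (grad_norm (w t - S k t))\<^sup>2) \<longlonglongrightarrow> 0"
    using U.bochner_2_approx[OF wV] by blast
  have "\<forall>\<^sub>F k in sequentially. (LINT t|?MT. (grad_norm (w t - S k t))\<^sup>2) < \<delta> * e"
    using order_tendstoD(2)[OF S(4), of "\<delta> * e"] \<delta> e by simp
  then obtain m where m: "(LINT t|?MT. (grad_norm (w t - S m t))\<^sup>2) < \<delta> * e"
    by (auto simp: eventually_sequentially)
  define s where "s = S m"
  have s: "simple_function ?MT s" "\<And>t. t \<in> {0..T} \<Longrightarrow> s t \<in> H1D \<Omega> \<Gamma>"
    using S by (simp_all add: s_def)
  have sV: "s \<in> L2_H1D T \<Omega> \<Gamma>" by (rule U.simple_in_bochner_2[OF s])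
  define n2 where "n2 t = (grad_norm (w t - s t))\<^sup>2" for t
  have n2i: "integrable ?MT n2" and n2e: "(LINT t|?MT. n2 t) / (2 * \<delta>) \<le> e / 2"
    using S(3)[of m] m \<delta> by (simp_all add: n2_def[abs_def] s_def field_simps)
  have n2i': "integrable ?M n2" by (rule integrable_subinterval[OF n2i]) (use ab in auto)
  have n2le: "(LINT t|?M. n2 t) \<le> (LINT t|?MT. n2 t)"
  proof -
    have "(LINT t|?M. n2 t) = (LINT t|lebesgue_on {0..b}. n2 t) - (LINT t|lebesgue_on {0..a}. n2 t)"
      by (rule integral_subinterval_diff[OF n2i]) (use ab in auto)
    moreover have "0 \<le> (LINT t|lebesgue_on {0..a}. n2 t)" by (simp add: n2_def)
    moreover have "(LINT t|lebesgue_on {0..b}. n2 t) \<le> (LINT t|?MT. n2 t)"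
      by (rule indefinite_integral_properties(2)[OF n2i _ T0]) (use ab in \<open>auto simp: n2_def\<close>)
    ultimately show ?thesis by linarith
  qed
  have wL: "w t \<in> Lp_space 2 \<Omega>" if "t \<in> {0..T}" for t using continuous_L2D(1)[OF w that] .
  have wH: "AE t in ?MT. w t \<in> H1D \<Omega> \<Gamma>" using wV by (simp add: U.bochner_2_iff)
  have w'H: "AE t in ?MT. w' t \<in> H1D_dual \<Omega> \<Gamma>" using w' by (simp add: D.bochner_2_iff)
  let ?R = "s ` {0..T}"
  have fin: "finite ?R" using simple_functionD(1)[OF s(1)] by simp
  define A where "A \<phi> = s -` {\<phi>} \<inter> {0..T}" for \<phi>
  have A: "A \<phi> \<in> sets lebesgue" for \<phi>
    using simple_functionD(2)[OF s(1), of "{\<phi>}"] by (simp add: A_def sets_restrict_space_iff)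
  \<comment> \<open>Exactly one level set contains t, so any quantity depending on s t is a finite
    sum over the values.\<close>
  have expand: "q (s t) = (\<Sum>\<phi>\<in>?R. indicator (A \<phi>) t * q \<phi>)" if "t \<in> {0..T}" for q :: "('a \<Rightarrow> real) \<Rightarrow> real" and t
  proof -
    have "(\<Sum>\<phi>\<in>?R. indicator (A \<phi>) t * q \<phi>) = (\<Sum>\<phi>\<in>?R. if \<phi> = s t then q \<phi> else 0)"
      by (rule sum.cong) (use that in \<open>auto simp: A_def indicator_def\<close>)
    also have "\<dots> = q (s t)" using fin that by (subst sum.delta) auto
    finally show ?thesis by simp
  qed
  have RH: "\<phi> \<in> H1D \<Omega> \<Gamma>" if "\<phi> \<in> ?R" for \<phi> using s(2) that by auto
  define Y where "Y k = (LINT t|?M. ip (w t - w (t - h k)) (s t)) / h k" for k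
  define y where "y = (LINT t|?M. w' t (s t))"
  have mem: "t \<in> {0..T}" "t - h k \<in> {0..T}" if "t \<in> {a..b}" for t k using that ab h(1,2)[of k] by auto
  have avg: "(\<lambda>k. (LINT t|?M. indicator (A \<phi>) t * (ip (w t) \<phi> - ip (w (t - h k)) \<phi>)) / h k)
      \<longlonglongrightarrow> (LINT t|?M. indicator (A \<phi>) t * w' t \<phi>)"
    "\<And>k. integrable ?M (\<lambda>t. indicator (A \<phi>) t * (ip (w t) \<phi> - ip (w (t - h k)) \<phi>))"
    "integrable ?M (\<lambda>t. indicator (A \<phi>) t * w' t \<phi>)"
    if "\<phi> \<in> ?R" for \<phi>
    using average_indicator_tendsto_lebesgue[OF continuous_on_ip_const[OF w H1D_L2[OF RH[OF that]]]
        dual_pairing(1)[OF w' const_in_L2_H1D[OF RH[OF that]]]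
        dual_apply_square_integrable[OF w' RH[OF that]]
        weak_time_derivative_integral[OF T w w' d RH[OF that]] ab h A[of \<phi>]] by auto
  have ip_s: "ip (w t - w (t - h k)) (s t) = (\<Sum>\<phi>\<in>?R. indicator (A \<phi>) t * (ip (w t) \<phi> - ip (w (t - h k)) \<phi>))"
    if t: "t \<in> {a..b}" for t k
  proof -
    have "ip (w t - w (t - h k)) (s t) = ip (w t) (s t) - ip (w (t - h k)) (s t)"
      using mem[OF t] s(2) by (intro ip_diff_left wL H1D_L2) auto
    also have "\<dots> = (\<Sum>\<phi>\<in>?R. indicator (A \<phi>) t * (ip (w t) \<phi> - ip (w (t - h k)) \<phi>))"
      using expand[OF mem(1)[OF t], of "\<lambda>\<phi>. ip (w t) \<phi> - ip (w (t - h k)) \<phi>"] by simp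
    finally show ?thesis .
  qed
  have Yeq: "Y k = (\<Sum>\<phi>\<in>?R. (LINT t|?M. indicator (A \<phi>) t * (ip (w t) \<phi> - ip (w (t - h k)) \<phi>)) / h k)" for k
  proof -
    have "(LINT t|?M. ip (w t - w (t - h k)) (s t)) =
      (LINT t|?M. (\<Sum>\<phi>\<in>?R. indicator (A \<phi>) t * (ip (w t) \<phi> - ip (w (t - h k)) \<phi>)))"
      by (rule Bochner_Integration.integral_cong) (use ip_s in auto)
    also have "\<dots> = (\<Sum>\<phi>\<in>?R. LINT t|?M. indicator (A \<phi>) t * (ip (w t) \<phi> - ip (w (t - h k)) \<phi>))"
      by (rule Bochner_Integration.integral_sum) (rule avg(2))
    finally show ?thesis by (simp add: Y_def sum_divide_distrib)
  qed
  have yeq: "y = (\<Sum>\<phi>\<in>?R. LINT t|?M. indicator (A \<phi>) t * w' t \<phi>)"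
  proof -
    have "y = (LINT t|?M. (\<Sum>\<phi>\<in>?R. indicator (A \<phi>) t * w' t \<phi>))" unfolding y_def
      by (rule Bochner_Integration.integral_cong) (use expand mem in auto)
    also have "\<dots> = (\<Sum>\<phi>\<in>?R. LINT t|?M. indicator (A \<phi>) t * w' t \<phi>)"
      by (rule Bochner_Integration.integral_sum) (rule avg(3))
    finally show ?thesis .
  qed
  have "Y \<longlonglongrightarrow> y" unfolding Yeq yeq by (intro tendsto_sum avg)
  moreover have "\<bar>(LINT t|?M. ip (w t - w (t - h k)) (w t)) / h k - Y k\<bar> \<le> e" for k
  proof -
    have i1: "integrable ?M (\<lambda>t. ip (w t - w (t - h k)) (w t))"
    proof -
      have "integrable ?M (\<lambda>t. ip (w t) (w t) - ip (w (t - h k)) (w t))"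
        using continuous_on_ip_shift[OF w, of "h k" a b] h(1,2)[of k] ab
        by (intro continuous_imp_integrable_real)
           (auto intro!: continuous_intros continuous_on_subset[OF continuous_on_ip_self[OF w]])
      then show ?thesis
        by (rule Bochner_Integration.integrable_cong[THEN iffD1, rotated -1]) (use mem wL ip_diff_left in auto)
    qed
    have i2: "integrable ?M (\<lambda>t. ip (w t - w (t - h k)) (s t))"
    proof -
      have "integrable ?M (\<lambda>t. \<Sum>\<phi>\<in>?R. indicator (A \<phi>) t * (ip (w t) \<phi> - ip (w (t - h k)) \<phi>))"
        by (rule Bochner_Integration.integrable_sum) (rule avg(2))
      then show ?thesis
        by (rule Bochner_Integration.integrable_cong[THEN iffD1, rotated -1]) (use ip_s in auto)
    qed
    have Gi: "integrable ?M (\<lambda>t. G t - G (t - h k))"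
      using continuous_on_shift[OF Gp(1), of "h k" a b] h(1,2)[of k] ab
      by (intro continuous_imp_integrable_real) (auto intro!: continuous_intros continuous_on_subset[OF Gp(1)])
    \<comment> \<open>The remainder z = w t - s t is frozen at time t. For fixed z the increment of
      the scalar product over the window is an integral of \<open>w'\<close> applied to z, although
      z comes from a moving function.\<close>
    have pt: "AE t in ?M. \<bar>ip (w t - w (t - h k)) (w t) - ip (w t - w (t - h k)) (s t)\<bar> \<le>
        \<delta> / 2 * (G t - G (t - h k)) + h k / (2 * \<delta>) * n2 t"
      using AE_sub[OF wH] AE_space[of ?M]
    proof eventually_elim
      case (elim t)
      then have t: "t \<in> {a..b}" by simp
      have rt: "0 \<le> t - h k" "t - h k \<le> t" "t \<le> T" using mem[OF t] h(1)[of k] by auto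
      define z where "z = w t - s t"
      have z: "z \<in> H1D \<Omega> \<Gamma>" unfolding z_def using elim(1) s(2) mem[OF t] by (intro H1D_diff) auto
      have sub: "integrable (lebesgue_on {t - h k..t}) (\<lambda>s. w' s z)"
          "integrable (lebesgue_on {t - h k..t}) (\<lambda>s. (dual_norm (w' s))\<^sup>2)"
        by (rule integrable_subinterval[OF dual_pairing(1)[OF w' const_in_L2_H1D[OF z]]]
            integrable_subinterval[OF dn]; use rt in auto)+
      have "ip (w t - w (t - h k)) (w t) - ip (w t - w (t - h k)) (s t) = ip (w t - w (t - h k)) z"
        unfolding z_def using mem[OF t] s(2) wL H1D_L2 L.diff by (intro ip_diff_right[symmetric]) auto
      also have "\<dots> = ip (w t) z - ip (w (t - h k)) z"
        using mem[OF t] z by (intro ip_diff_left wL H1D_L2) auto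
      also have "\<dots> = (LINT s|lebesgue_on {t - h k..t}. w' s z)"
        by (rule weak_time_derivative_integral[OF T w w' d z rt])
      also have "\<bar>\<dots>\<bar> \<le> (LINT s|lebesgue_on {t - h k..t}. \<bar>w' s z\<bar>)" by (rule integral_abs_bound)
      also have "\<dots> \<le> (LINT s|lebesgue_on {t - h k..t}. \<delta> / 2 * (dual_norm (w' s))\<^sup>2 + (grad_norm z)\<^sup>2 / (2 * \<delta>))"
      proof (rule integral_mono_AE)
        show "integrable (lebesgue_on {t - h k..t}) (\<lambda>s. \<bar>w' s z\<bar>)" using sub by simp
        show "integrable (lebesgue_on {t - h k..t}) (\<lambda>s. \<delta> / 2 * (dual_norm (w' s))\<^sup>2 + (grad_norm z)\<^sup>2 / (2 * \<delta>))"
          using sub(2) continuous_imp_integrable_real[of "t - h k" t "\<lambda>_. (grad_norm z)\<^sup>2 / (2 * \<delta>)"] by auto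
        have "AE s in lebesgue_on {t - h k..t}. w' s \<in> H1D_dual \<Omega> \<Gamma>"
          using w'H rt by (simp add: AE_restrict_space_iff) (auto elim!: eventually_mono)
        then show "AE s in lebesgue_on {t - h k..t}. \<bar>w' s z\<bar> \<le> \<delta> / 2 * (dual_norm (w' s))\<^sup>2 + (grad_norm z)\<^sup>2 / (2 * \<delta>)"
          by eventually_elim (rule order_trans[OF H1D_dual_bound[OF _ z] mult_le_young[OF \<delta>]])
      qed
      also have "\<dots> = \<delta> / 2 * (LINT s|lebesgue_on {t - h k..t}. (dual_norm (w' s))\<^sup>2)
          + (LINT s|lebesgue_on {t - h k..t}. (grad_norm z)\<^sup>2 / (2 * \<delta>))"
        using sub(2) continuous_imp_integrable_real[of "t - h k" t "\<lambda>_. (grad_norm z)\<^sup>2 / (2 * \<delta>)"]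
        by (subst Bochner_Integration.integral_add) auto
      also have "(LINT s|lebesgue_on {t - h k..t}. (dual_norm (w' s))\<^sup>2) = G t - G (t - h k)"
        using integral_subinterval_diff[OF dn rt] by (simp only: G_def)
      also have "(LINT s|lebesgue_on {t - h k..t}. (grad_norm z)\<^sup>2 / (2 * \<delta>)) = (t - (t - h k)) * ((grad_norm z)\<^sup>2 / (2 * \<delta>))"
        by (rule integral_interval_const[OF rt(2)])
      also have "(t - (t - h k)) * ((grad_norm z)\<^sup>2 / (2 * \<delta>)) = h k / (2 * \<delta>) * n2 t"
        by (simp add: n2_def z_def)
      finally show ?case .
    qed
    have "\<bar>(LINT t|?M. ip (w t - w (t - h k)) (w t)) - (LINT t|?M. ip (w t - w (t - h k)) (s t))\<bar> =
       \<bar>LINT t|?M. ip (w t - w (t - h k)) (w t) - ip (w t - w (t - h k)) (s t)\<bar>"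
      using i1 i2 by simp
    also have "\<dots> \<le> (LINT t|?M. \<bar>ip (w t - w (t - h k)) (w t) - ip (w t - w (t - h k)) (s t)\<bar>)"
      by (rule integral_abs_bound)
    also have "\<dots> \<le> (LINT t|?M. \<delta> / 2 * (G t - G (t - h k)) + h k / (2 * \<delta>) * n2 t)"
      by (rule integral_mono_AE) (use i1 i2 Gi n2i' pt in auto)
    also have "\<dots> = \<delta> / 2 * (LINT t|?M. G t - G (t - h k)) + h k / (2 * \<delta>) * (LINT t|?M. n2 t)"
      using Gi n2i' by (subst Bochner_Integration.integral_add) auto
    also have "\<dots> \<le> \<delta> / 2 * (h k * G T) + h k / (2 * \<delta>) * (LINT t|?MT. n2 t)"
    proof (intro add_mono mult_left_mono n2le)
      show "(LINT t|?M. G t - G (t - h k)) \<le> h k * G T"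
        by (rule integral_mono_difference_le[OF Gp(1,2)]) (use Gp h ab less_imp_le[OF h(1)] in auto)
    qed (use \<delta> less_imp_le[OF h(1)[of k]] in auto)
    also have "\<dots> = h k * (\<delta> / 2 * G T + (LINT t|?MT. n2 t) / (2 * \<delta>))" by (simp add: algebra_simps)
    also have "\<dots> \<le> h k * e" using \<delta>G n2e h(1)[of k] by (intro mult_left_mono) auto
    finally have "\<bar>(LINT t|?M. ip (w t - w (t - h k)) (w t)) - (LINT t|?M. ip (w t - w (t - h k)) (s t))\<bar> / h k \<le> e"
      using h(1)[of k] by (simp add: pos_divide_le_eq mult.commute)
    then show ?thesis using h(1)[of k] by (simp add: Y_def flip: diff_divide_distrib)
  qed
  moreover have "\<bar>(LINT t|?M. w' t (w t)) - y\<bar> \<le> e"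
  proof -
    have i: "integrable ?M (\<lambda>t. w' t (w t))" "integrable ?M (\<lambda>t. w' t (s t))"
        "integrable ?M (\<lambda>t. (dual_norm (w' t))\<^sup>2)"
      by (rule integrable_subinterval[OF dual_pairing(1)[OF w' wV]] integrable_subinterval[OF dual_pairing(1)[OF w' sV]]
          integrable_subinterval[OF dn]; use ab in auto)+
    have "\<bar>(LINT t|?M. w' t (w t)) - y\<bar> = \<bar>LINT t|?M. w' t (w t) - w' t (s t)\<bar>" unfolding y_def using i by simp
    also have "\<dots> \<le> (LINT t|?M. \<bar>w' t (w t) - w' t (s t)\<bar>)" by (rule integral_abs_bound)
    also have "\<dots> \<le> (LINT t|?M. \<delta> / 2 * (dual_norm (w' t))\<^sup>2 + n2 t / (2 * \<delta>))"
    proof (rule integral_mono_AE)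
      show "AE t in ?M. \<bar>w' t (w t) - w' t (s t)\<bar> \<le> \<delta> / 2 * (dual_norm (w' t))\<^sup>2 + n2 t / (2 * \<delta>)"
        using AE_sub[OF wH] AE_sub[OF w'H] AE_space[of ?M]
      proof eventually_elim
        case (elim t)
        have st: "s t \<in> H1D \<Omega> \<Gamma>" using elim(3) s(2) mem by simp
        have "\<bar>w' t (w t) - w' t (s t)\<bar> = \<bar>w' t (w t - s t)\<bar>" using H1D_dual_diff[OF elim(2,1) st] by simp
        also have "\<dots> \<le> \<delta> / 2 * (dual_norm (w' t))\<^sup>2 + n2 t / (2 * \<delta>)"
          unfolding n2_def
          by (rule order_trans[OF H1D_dual_bound[OF elim(2) H1D_diff[OF elim(1) st]] mult_le_young[OF \<delta>]])
        finally show ?case .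
      qed
    qed (use i n2i' in auto)
    also have "\<dots> = \<delta> / 2 * (LINT t|?M. (dual_norm (w' t))\<^sup>2) + (LINT t|?M. n2 t) / (2 * \<delta>)"
      using i n2i' by (subst Bochner_Integration.integral_add) auto
    also have "\<dots> \<le> \<delta> / 2 * G T + (LINT t|?MT. n2 t) / (2 * \<delta>)"
    proof (intro add_mono mult_left_mono divide_right_mono n2le)
      have "0 \<le> G a" "G b \<le> G T" using Gp(2)[of 0 a] Gp(2)[of b T] Gp(3) ab by auto
      moreover have "(LINT t|?M. (dual_norm (w' t))\<^sup>2) = G b - G a"
        using integral_subinterval_diff[OF dn, of a b] ab by (simp add: G_def)
      ultimately show "(LINT t|?M. (dual_norm (w' t))\<^sup>2) \<le> G T" by linarith
    qed (use \<delta> in auto)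
    also have "\<dots> \<le> e" using \<delta>G n2e by linarith
    finally show ?thesis .
  qed
  ultimately show "\<exists>Y y. Y \<longlonglongrightarrow> y \<and> (\<forall>k. \<bar>(LINT t|?M. ip (w t - w (t - h k)) (w t)) / h k - Y k\<bar> \<le> e) \<and>
      \<bar>(LINT t|?M. w' t (w t)) - y\<bar> \<le> e" by blast
qed

text \<open>The averages need room for the backward shift, so the inequality is first proved between
  two times 0 < a \<le> b; continuity in a then reaches the initial time.\<close>

lemma energy_inequality:
  assumes T: "0 < T" and w: "continuous_L2 T \<Omega> w" and wV: "w \<in> L2_H1D T \<Omega> \<Gamma>"
    and w': "w' \<in> L2_H1D_dual T \<Omega> \<Gamma>" and d: "has_weak_time_derivative T \<Omega> \<Gamma> w w'"
    and s: "0 \<le> s" "s \<le> T"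
  shows "ip (w s) (w s) - ip (w 0) (w 0) \<le> 2 * (LINT t|lebesgue_on {0..s}. w' t (w t))"
proof -
  define y where "y t = ip (w t) (w t)" for t
  define J where "J t = (LINT r|lebesgue_on {0..t}. w' r (w r))" for t
  note pi = dual_pairing(1)[OF w' wV]
  have yc: "continuous_on {0..T} y" unfolding y_def by (rule continuous_on_ip_self[OF w])
  have Jc: "continuous_on {0..T} J" unfolding J_def by (rule indefinite_integral_continuous_real[OF pi])
  have wL: "w t \<in> Lp_space 2 \<Omega>" if "t \<in> {0..T}" for t using continuous_L2D(1)[OF w that] .
  have pos: "0 \<le> 2 * (J b - J a) - (y b - y a)" if ab: "0 < a" "a \<le> b" "b \<le> T" for a b
  proof -
    let ?M = "lebesgue_on {a..b}"
    \<comment> \<open>This sequence tends to 0 and never exceeds a, so t - h k stays in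
      [0,T].\<close>
    define h where "h k = a / real (Suc k)" for k
    have h: "0 < h k" "h k \<le> a" "h \<longlonglongrightarrow> 0" for k
    proof -
      show "0 < h k" "h k \<le> a" using ab by (auto simp: h_def field_simps)
      show "h \<longlonglongrightarrow> 0" unfolding h_def using tendsto_mult[OF tendsto_const LIMSEQ_Suc[OF lim_1_over_n], of a] by simp
    qed
    have mem: "t \<in> {0..T}" "t - h k \<in> {0..T}" if "t \<in> {a..b}" for t k using that ab h(1,2)[of k] by auto
    have "(LINT t|?M. y t - y (t - h k)) / h k \<le> 2 * ((LINT t|?M. ip (w t - w (t - h k)) (w t)) / h k)" for k
    proof -
      have c: "continuous_on {a..b} (\<lambda>t. ip (w t) (w t) - ip (w (t - h k)) (w t))"
        using continuous_on_ip_shift[OF w, of "h k" a b] h(1,2)[of k] ab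
        by (auto intro!: continuous_intros continuous_on_subset[OF continuous_on_ip_self[OF w]])
      have e: "ip (w t - w (t - h k)) (w t) = ip (w t) (w t) - ip (w (t - h k)) (w t)" if "t \<in> {a..b}" for t
        using mem[OF that] by (intro ip_diff_left wL)
      have "(LINT t|?M. y t - y (t - h k)) \<le> (LINT t|?M. 2 * (ip (w t) (w t) - ip (w (t - h k)) (w t)))"
      proof (rule integral_mono)
        show "integrable ?M (\<lambda>t. y t - y (t - h k))"
          using continuous_on_shift[OF yc, of "h k" a b] h(1,2)[of k] ab
          by (intro continuous_imp_integrable_real) (auto intro!: continuous_intros continuous_on_subset[OF yc])
        show "integrable ?M (\<lambda>t. 2 * (ip (w t) (w t) - ip (w (t - h k)) (w t)))"
          by (intro integrable_mult_right continuous_imp_integrable_real c)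
        fix t assume "t \<in> space ?M"
        then have t: "t \<in> {a..b}" by simp
        note wt = wL[OF mem(1)[OF t]] wL[OF mem(2)[OF t, of k]]
        have "0 \<le> ip (w t - w (t - h k)) (w t - w (t - h k))" by (rule ip_self)
        also have "\<dots> = ip (w t) (w t) - ip (w (t - h k)) (w t) - (ip (w t) (w (t - h k)) - ip (w (t - h k)) (w (t - h k)))"
          using wt Lp_space_diff(1)[OF _ wt] by (simp add: ip_diff_left ip_diff_right)
        finally show "y t - y (t - h k) \<le> 2 * (ip (w t) (w t) - ip (w (t - h k)) (w t))"
          by (simp add: y_def ip_commute[of "w t" "w (t - h k)"])
      qed
      also have "\<dots> = 2 * (LINT t|?M. ip (w t) (w t) - ip (w (t - h k)) (w t))"
        by (rule integral_mult_right_zero)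
      also have "(LINT t|?M. ip (w t) (w t) - ip (w (t - h k)) (w t)) = (LINT t|?M. ip (w t - w (t - h k)) (w t))"
        by (rule Bochner_Integration.integral_cong) (use e in auto)
      finally have "(LINT t|?M. y t - y (t - h k)) / h k \<le> 2 * (LINT t|?M. ip (w t - w (t - h k)) (w t)) / h k"
        using h(1)[of k] by (intro divide_right_mono) auto
      then show ?thesis by simp
    qed
    moreover have "(\<lambda>k. (LINT t|?M. y t - y (t - h k)) / h k) \<longlonglongrightarrow> y b - y a"
      by (rule average_difference_tendsto[OF yc ab(2,3) h])
    moreover have "(\<lambda>k. 2 * ((LINT t|?M. ip (w t - w (t - h k)) (w t)) / h k)) \<longlonglongrightarrow> 2 * (LINT t|?M. w' t (w t))"
      by (intro tendsto_mult tendsto_const average_pairing_tendsto[OF T w wV w' d ab h])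
    ultimately have "y b - y a \<le> 2 * (LINT t|?M. w' t (w t))" by (intro LIMSEQ_le) auto
    moreover have "(LINT t|?M. w' t (w t)) = J b - J a"
      using integral_subinterval_diff[OF pi, of a b] ab by (simp add: J_def)
    ultimately show ?thesis by simp
  qed
  have J0: "J 0 = 0" using integral_subinterval_diff[OF pi, of 0 0] T by (simp add: J_def)
  have "y s - y 0 \<le> 2 * J s"
  proof (cases "s = 0")
    case False
    then have s0: "0 < s" using s by simp
    have cl: "closure {0<..<s} = {0..s}" using s0 by simp
    have "continuous_on (closure {0<..<s}) (\<lambda>a. 2 * (J s - J a) - (y s - y a))"
      unfolding cl using s by (auto intro!: continuous_intros continuous_on_subset[OF Jc] continuous_on_subset[OF yc])
    then have "0 \<le> 2 * (J s - J 0) - (y s - y 0)"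
      by (rule continuous_ge_on_closure) (use cl s0 s pos in auto)
    then show ?thesis using J0 by simp
  qed (use J0 in simp)
  then show ?thesis by (simp add: y_def J_def)
qed

end

section \<open>The difference of two solutions\<close>

text \<open>Turns bounds on the space-time cylinder into bounds in space for almost every time.
  Lebesgue measure on a product is not the product of the completions, so the exceptional null set
  is first moved to \<open>lborel\<close>, where Fubini's theorem applies.\<close>

lemma AE_lebesgue_on_Times:
  fixes A :: "'a::euclidean_space set" and B :: "'b::euclidean_space set"
  assumes A: "A \<in> sets borel" and B: "B \<in> sets borel"
    and P: "AE (x, y) in lebesgue_on (A \<times> B). P x y"
  shows "AE x in lebesgue_on A. AE y in lebesgue_on B. P x y"
proof -
  have AB: "A \<times> B \<in> sets lebesgue"
    using A B by (intro sets_completionI_sets) (simp add: lborel_prod[symmetric] del: lborel_prod)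
  have "AE z in lebesgue. z \<in> A \<times> B \<longrightarrow> (case z of (x, y) \<Rightarrow> P x y)"
    using P AB by (simp add: AE_restrict_space_iff)
  then have "AE z in lborel. z \<in> A \<times> B \<longrightarrow> (case z of (x, y) \<Rightarrow> P x y)"
    by (simp add: AE_completion_iff)
  then have "AE z in lborel \<Otimes>\<^sub>M lborel. z \<in> A \<times> B \<longrightarrow> (case z of (x, y) \<Rightarrow> P x y)"
    unfolding lborel_prod .
  from lborel_pair.AE_pair[OF this] have "AE x in lborel. AE y in lborel. x \<in> A \<and> y \<in> B \<longrightarrow> P x y" by simp
  then have "AE x in lebesgue. AE y in lebesgue. x \<in> A \<and> y \<in> B \<longrightarrow> P x y"
    by (simp add: AE_completion_iff)
  then have "AE x in lebesgue. x \<in> A \<longrightarrow> (AE y in lebesgue. y \<in> B \<longrightarrow> P x y)"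
    by eventually_elim auto
  then show ?thesis using A B by (simp add: AE_restrict_space_iff)
qed

lemma integrable_mult_continuous:
  fixes f g :: "real \<Rightarrow> real"
  assumes f: "integrable (lebesgue_on {0..T}) f" and g: "continuous_on {0..T} g"
  shows "integrable (lebesgue_on {0..T}) (\<lambda>t. f t * g t)"
proof -
  obtain B where "\<forall>x\<in>g ` {0..T}. norm x \<le> B"
    using compact_imp_bounded[OF compact_continuous_image[OF g compact_Icc]] unfolding bounded_iff by blast
  then have B: "\<bar>g t\<bar> \<le> B" if "t \<in> {0..T}" for t using that by auto
  show ?thesis
  proof (rule Bochner_Integration.integrable_bound)
    show "integrable (lebesgue_on {0..T}) (\<lambda>t. f t * B)" using f by simp
    show "(\<lambda>t. f t * g t) \<in> borel_measurable (lebesgue_on {0..T})"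
      using f continuous_imp_integrable_real[OF g] by (intro borel_measurable_times) auto
    show "AE t in lebesgue_on {0..T}. norm (f t * g t) \<le> norm (f t * B)"
    proof (rule AE_I2)
      fix t assume "t \<in> space (lebesgue_on {0..T})"
      then have "\<bar>g t\<bar> \<le> \<bar>B\<bar>" using B[of t] by simp
      then show "norm (f t * g t) \<le> norm (f t * B)" by (simp add: abs_mult mult_left_mono)
    qed
  qed
qed

lemma smooth_deriv_continuous:
  fixes f :: "real \<Rightarrow> real"
  assumes "smooth f" shows "continuous_on A (deriv f)"
proof -
  have "frechet_derivative f (at x) 1 = deriv f x" for x
  proof -
    have "(f has_real_derivative deriv f x) (at x)"
      using smooth_differentiable[OF assms] by (simp add: DERIV_deriv_iff_real_differentiable)
    then have "(f has_derivative (*) (deriv f x)) (at x)" by (simp add: has_field_derivative_def)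
    from frechet_derivative_at[OF this] show ?thesis by (metis mult_1_right)
  qed
  then show ?thesis using smooth_continuous[OF smooth_deriv[OF assms, of 1], of A] by simp
qed

section \<open>Differences, cut-offs and powers in Bochner spaces\<close>

context seminormed
begin

lemma bochner_2_diff:
  assumes f: "f \<in> bochner_space 2 T X N" and g: "g \<in> bochner_space 2 T X N"
  shows "(\<lambda>t. f t - g t) \<in> bochner_space 2 T X N"
proof -
  have f': "AE t in lebesgue_on {0..T}. f t \<in> X" "strongly_measurable T X N f"
      "integrable (lebesgue_on {0..T}) (\<lambda>t. (n (f t))\<^sup>2)"
    and g': "AE t in lebesgue_on {0..T}. g t \<in> X" "strongly_measurable T X N g"
      "integrable (lebesgue_on {0..T}) (\<lambda>t. (n (g t))\<^sup>2)"
    using f g by (auto simp: bochner_2_iff)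
  have X: "AE t in lebesgue_on {0..T}. f t - g t \<in> X" using f'(1) g'(1) by eventually_elim (rule diff)
  have m: "strongly_measurable T X N (\<lambda>t. f t - g t)" by (intro strongly_measurable_diff f' g')
  have "integrable (lebesgue_on {0..T}) (\<lambda>t. (n (f t - g t))\<^sup>2)"
  proof (rule Bochner_Integration.integrable_bound)
    show "integrable (lebesgue_on {0..T}) (\<lambda>t. 2 * (n (f t))\<^sup>2 + 2 * (n (g t))\<^sup>2)" using f' g' by simp
    show "(\<lambda>t. (n (f t - g t))\<^sup>2) \<in> borel_measurable (lebesgue_on {0..T})"
      using measurable_n[OF m X] by simp
    show "AE t in lebesgue_on {0..T}. norm ((n (f t - g t))\<^sup>2) \<le> norm (2 * (n (f t))\<^sup>2 + 2 * (n (g t))\<^sup>2)"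
      using f'(1) g'(1)
    proof eventually_elim
      case (elim t)
      have "(n (f t - g t))\<^sup>2 \<le> (n (f t) + n (g t))\<^sup>2" using n_diff[OF elim] by (intro power_mono) auto
      also have "\<dots> \<le> 2 * (n (f t))\<^sup>2 + 2 * (n (g t))\<^sup>2"
        using sum_squares_bound[of "n (f t)" "n (g t)"] by (simp add: power2_sum)
      finally show ?case by simp
    qed
  qed
  with X m show ?thesis by (simp add: bochner_2_iff)
qed

lemma bochner_2_restrict:
  assumes f: "f \<in> bochner_space 2 T X N" and P: "Measurable.pred (lebesgue_on {0..T}) P"
  shows "(\<lambda>t. if P t then f t else 0) \<in> bochner_space 2 T X N"
proof -
  have f': "AE t in lebesgue_on {0..T}. f t \<in> X" "strongly_measurable T X N f"
      "integrable (lebesgue_on {0..T}) (\<lambda>t. (n (f t))\<^sup>2)"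
    using f by (auto simp: bochner_2_iff)
  have X: "AE t in lebesgue_on {0..T}. (if P t then f t else 0) \<in> X" using f'(1) by eventually_elim (simp add: zero)
  have m: "strongly_measurable T X N (\<lambda>t. if P t then f t else 0)" by (intro strongly_measurable_restrict f' P)
  have "integrable (lebesgue_on {0..T}) (\<lambda>t. (n (if P t then f t else 0))\<^sup>2)"
    by (rule Bochner_Integration.integrable_bound[OF f'(3)])
       (use measurable_n[OF m X] N_zero in auto)
  with X m show ?thesis by (simp add: bochner_2_iff)
qed

text \<open>Turns a power of a Bochner norm into a real integral; with the exponent of X(q) this
  makes the coefficient in Gronwall's inequality integrable.\<close>

lemma bochner_powr:
  assumes r: "0 < r" and f: "f \<in> bochner_space r T X N"
  shows "integrable (lebesgue_on {0..T}) (\<lambda>t. n (f t) powr r)"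
    and "(LINT t|lebesgue_on {0..T}. n (f t) powr r) = enn2real (bochner_norm r T N f) powr r"
proof -
  let ?I = "\<integral>\<^sup>+ t. ennpowr (N (f t)) r \<partial>lebesgue_on {0..T}"
  have f': "AE t in lebesgue_on {0..T}. f t \<in> X" "strongly_measurable T X N f" "bochner_norm r T N f < top"
    using f by (auto simp: bochner_space_def)
  have e: "?I = (\<integral>\<^sup>+ t. ennreal (n (f t) powr r) \<partial>lebesgue_on {0..T})"
    by (rule nn_integral_cong_AE) (use f'(1) N_finite in \<open>auto elim!: eventually_mono simp: ennpowr_def less_top[symmetric]\<close>)
  have fin: "?I < top" using f'(3) by (simp add: bochner_norm_def less_top[symmetric])
  have m: "(\<lambda>t. n (f t) powr r) \<in> borel_measurable (lebesgue_on {0..T})" using measurable_n[OF f'(2,1)] by simp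
  show i: "integrable (lebesgue_on {0..T}) (\<lambda>t. n (f t) powr r)"
    using m fin e by (intro integrableI_nonneg) auto
  have I: "?I = ennreal (LINT t|lebesgue_on {0..T}. n (f t) powr r)"
    unfolding e by (rule nn_integral_eq_integral[OF i]) auto
  have "0 \<le> (LINT t|lebesgue_on {0..T}. n (f t) powr r)" by simp
  then show "(LINT t|lebesgue_on {0..T}. n (f t) powr r) = enn2real (bochner_norm r T N f) powr r"
    unfolding bochner_norm_def I using r by (simp add: ennpowr_ennreal powr_powr)
qed

end

context dirichlet_domain
begin

lemma L2_H1_grad: "f \<in> L2_H1 T \<Omega> \<Longrightarrow> f \<in> bochner_space 2 T (H1 \<Omega>) (H1D_norm \<Omega>)"
proof -
  assume f: "f \<in> L2_H1 T \<Omega>"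
  interpret H: seminormed "H1 \<Omega>" "H1_norm \<Omega>" by (rule seminormed_H1)
  interpret G: seminormed "H1 \<Omega>" "H1D_norm \<Omega>" by (rule seminormed_H1_grad)
  have f': "AE t in lebesgue_on {0..T}. f t \<in> H1 \<Omega>" "strongly_measurable T (H1 \<Omega>) (H1_norm \<Omega>) f"
      "integrable (lebesgue_on {0..T}) (\<lambda>t. (H.n (f t))\<^sup>2)"
    using f by (auto simp: H.bochner_2_iff)
  have m: "strongly_measurable T (H1 \<Omega>) (H1D_norm \<Omega>) f"
    by (rule H.strongly_measurable_weaker_norm[OF f'(2,1)]) (rule H1_norm_bounds(1))
  have "integrable (lebesgue_on {0..T}) (\<lambda>t. (grad_norm (f t))\<^sup>2)"
  proof (rule Bochner_Integration.integrable_bound[OF f'(3)])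
    show "(\<lambda>t. (grad_norm (f t))\<^sup>2) \<in> borel_measurable (lebesgue_on {0..T})"
      using G.measurable_n[OF m f'(1)] by simp
    show "AE t in lebesgue_on {0..T}. norm ((grad_norm (f t))\<^sup>2) \<le> norm ((H.n (f t))\<^sup>2)"
      using f'(1)
    proof eventually_elim
      case (elim t)
      have "grad_norm (f t) \<le> H.n (f t)" using H1_norm_bounds[OF elim] by (intro enn2real_mono)
      then show ?case by (simp add: power_mono)
    qed
  qed
  with f'(1) m show ?thesis by (simp add: G.bochner_2_iff)
qed

text \<open>The difference has values in \<open>H1D\<close>, but its simple approximants are only
  known to lie in \<open>H1\<close>. Passing to the subspace repairs this, so that the difference
  may serve as test function.\<close>

lemma L2_H1_diff_L2_H1D:
  assumes f: "f \<in> L2_H1 T \<Omega>" "g \<in> L2_H1 T \<Omega>" and D: "AE t in lebesgue_on {0..T}. f t - g t \<in> H1D \<Omega> \<Gamma>"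
  shows "(\<lambda>t. f t - g t) \<in> L2_H1D T \<Omega> \<Gamma>"
proof -
  interpret G: seminormed "H1 \<Omega>" "H1D_norm \<Omega>" by (rule seminormed_H1_grad)
  interpret U: seminormed "H1D \<Omega> \<Gamma>" "H1D_norm \<Omega>" by (rule seminormed_H1D)
  have "(\<lambda>t. f t - g t) \<in> bochner_space 2 T (H1 \<Omega>) (H1D_norm \<Omega>)"
    by (intro G.bochner_2_diff L2_H1_grad f)
  then have h: "strongly_measurable T (H1 \<Omega>) (H1D_norm \<Omega>) (\<lambda>t. f t - g t)"
    "integrable (lebesgue_on {0..T}) (\<lambda>t. (grad_norm (f t - g t))\<^sup>2)"
    by (auto simp: G.bochner_2_iff)
  have "strongly_measurable T (H1D \<Omega> \<Gamma>) (H1D_norm \<Omega>) (\<lambda>t. f t - g t)"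
    by (rule G.strongly_measurable_subspace[OF h(1) _ _ D]) (use H1D_H1 H1D_0 in auto)
  with D h(2) show ?thesis by (simp add: U.bochner_2_iff)
qed

lemma continuous_L2_diff:
  assumes u: "continuous_L2 T \<Omega> u" and v: "continuous_L2 T \<Omega> v"
  shows "continuous_L2 T \<Omega> (\<lambda>t. u t - v t)"
  unfolding continuous_L2_def
proof (intro ballI conjI)
  interpret L: seminormed "Lp_space 2 \<Omega> :: ('a \<Rightarrow> real) set" "Lp_norm 2 \<Omega>" by (rule seminormed_Lp) simp
  fix t assume t: "t \<in> {0..T}"
  have uL: "u s \<in> Lp_space 2 \<Omega>" "v s \<in> Lp_space 2 \<Omega>" if "s \<in> {0..T}" for s
    using continuous_L2D(1)[OF u that] continuous_L2D(1)[OF v that] .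
  show "u t - v t \<in> Lp_space 2 \<Omega>" using uL[OF t] by (intro L.diff)
  have "((\<lambda>s. Lp_norm 2 \<Omega> (u s - u t) + Lp_norm 2 \<Omega> (v s - v t)) \<longlongrightarrow> 0 + 0) (at t within {0..T})"
    using u v t by (intro tendsto_add) (auto simp: continuous_L2_def)
  then have lim: "((\<lambda>s. Lp_norm 2 \<Omega> (u s - u t) + Lp_norm 2 \<Omega> (v s - v t)) \<longlongrightarrow> 0) (at t within {0..T})" by simp
  have "\<forall>\<^sub>F s in at t within {0..T}. s \<in> {0..T}" by (simp add: eventually_at_filter)
  then have "\<forall>\<^sub>F s in at t within {0..T}. Lp_norm 2 \<Omega> (u s - v s - (u t - v t)) \<le> Lp_norm 2 \<Omega> (u s - u t) + Lp_norm 2 \<Omega> (v s - v t)"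
  proof eventually_elim
    case (elim s)
    have "u s - v s - (u t - v t) = (u s - u t) - (v s - v t)" by simp
    then show ?case using L.N_diff[OF L.diff L.diff] uL[OF elim] uL[OF t] by metis
  qed
  then show "((\<lambda>s. Lp_norm 2 \<Omega> (u s - v s - (u t - v t))) \<longlongrightarrow> 0) (at t within {0..T})"
    by (intro tendsto_sandwich[OF _ _ tendsto_const lim]) auto
qed

text \<open>Linearity of the integral holds only for integrable terms, since otherwise it has the
  default value 0. Continuity in L2 and the dual bounds supply the integrability.\<close>

lemma has_weak_time_derivative_diff:
  assumes u: "continuous_L2 T \<Omega> u" "u' \<in> L2_H1D_dual T \<Omega> \<Gamma>" "has_weak_time_derivative T \<Omega> \<Gamma> u u'"
    and v: "continuous_L2 T \<Omega> v" "v' \<in> L2_H1D_dual T \<Omega> \<Gamma>" "has_weak_time_derivative T \<Omega> \<Gamma> v v'"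
  shows "has_weak_time_derivative T \<Omega> \<Gamma> (\<lambda>t. u t - v t) (\<lambda>t. u' t - v' t)"
  unfolding has_weak_time_derivative_def
proof (intro allI impI ballI)
  fix \<psi> \<phi> assume \<psi>: "test_function {0<..<T} \<psi>" and \<phi>: "\<phi> \<in> H1D \<Omega> \<Gamma>"
  let ?M = "lebesgue_on {0..T}"
  have sm: "smooth \<psi>" using \<psi> by (simp add: test_function_def smooth_def)
  note c = smooth_continuous[OF sm, of "{0..T}"] smooth_deriv_continuous[OF sm, of "{0..T}"]
  note wk = u(3)[unfolded has_weak_time_derivative_def, rule_format, OF \<psi> \<phi>, folded ip_def]
    v(3)[unfolded has_weak_time_derivative_def, rule_format, OF \<psi> \<phi>, folded ip_def]
  have i: "integrable ?M (\<lambda>t. ip (u t) \<phi> * deriv \<psi> t)" "integrable ?M (\<lambda>t. ip (v t) \<phi> * deriv \<psi> t)"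
    by (intro integrable_mult_continuous c continuous_imp_integrable_real continuous_on_ip_const u v H1D_L2 \<phi>)+
  have j: "integrable ?M (\<lambda>t. u' t \<phi> * \<psi> t)" "integrable ?M (\<lambda>t. v' t \<phi> * \<psi> t)"
    by (intro integrable_mult_continuous c dual_pairing(1)[OF _ const_in_L2_H1D] u v \<phi>)+
  have "(LINT t|?M. ip (u t - v t) \<phi> * deriv \<psi> t) = (LINT t|?M. ip (u t) \<phi> * deriv \<psi> t - ip (v t) \<phi> * deriv \<psi> t)"
  proof (rule Bochner_Integration.integral_cong[OF refl])
    fix t assume "t \<in> space ?M"
    then have "ip (u t - v t) \<phi> = ip (u t) \<phi> - ip (v t) \<phi>"
      using continuous_L2D(1)[OF u(1)] continuous_L2D(1)[OF v(1)] H1D_L2[OF \<phi>] by (intro ip_diff_left) auto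
    then show "ip (u t - v t) \<phi> * deriv \<psi> t = ip (u t) \<phi> * deriv \<psi> t - ip (v t) \<phi> * deriv \<psi> t"
      by (simp only: left_diff_distrib)
  qed
  also have "\<dots> = - ((LINT t|?M. u' t \<phi> * \<psi> t) - (LINT t|?M. v' t \<phi> * \<psi> t))"
    using i wk by simp
  also have "\<dots> = - (LINT t|?M. (u' t - v' t) \<phi> * \<psi> t)"
    using j by (simp add: left_diff_distrib)
  finally show "(LINT t|?M. (LINT x|lebesgue_on \<Omega>. (u t - v t) x * \<phi> x) * deriv \<psi> t) = - (LINT t|?M. (u' t - v' t) \<phi> * \<psi> t)"
    unfolding ip_def .
qed

end

text \<open>Young's inequality with exponents 2/(1+\<theta>) and 2/(1-\<theta>), applied to l
  g^(1+\<theta>) and a h^(1-\<theta>)/l. The weight l is tuned to make the first term g^2/4, and the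
  coefficient of the second is then \<mu> a^(2/(1-\<theta>)).\<close>

lemma young_interpolation:
  fixes a g h \<theta> :: real
  assumes \<theta>: "0 < \<theta>" "\<theta> < 1" and nn: "0 \<le> a" "0 \<le> g" "0 \<le> h"
  shows "a * g powr (1 + \<theta>) * h powr (1 - \<theta>) \<le>
    g\<^sup>2 / 4 + (1 - \<theta>) / 2 * (1 / (2 * (1 + \<theta>))) powr ((\<theta> + 1) / (\<theta> - 1)) * a powr (2 / (1 - \<theta>)) * h\<^sup>2"
proof -
  \<comment> \<open>With l^(2/(1+\<theta>)) = \<beta> the first term is \<beta> (1+\<theta>)/2 g^2,
    which is g^2/4 for exactly this value.\<close>
  define \<beta> where "\<beta> = 1 / (2 * (1 + \<theta>))"
  have \<beta>: "0 < \<beta>" using \<theta> by (simp add: \<beta>_def)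
  define l where "l = \<beta> powr ((1 + \<theta>) / 2)"
  have l: "0 < l" using \<beta> by (simp add: l_def)
  have "(l * g powr (1 + \<theta>)) * (a * h powr (1 - \<theta>) / l) \<le>
     (l * g powr (1 + \<theta>)) powr (2 / (1 + \<theta>)) / (2 / (1 + \<theta>)) + (a * h powr (1 - \<theta>) / l) powr (2 / (1 - \<theta>)) / (2 / (1 - \<theta>))"
    by (rule Youngs_inequality) (use \<theta> nn l in \<open>auto simp: field_simps\<close>)
  moreover have "(l * g powr (1 + \<theta>)) * (a * h powr (1 - \<theta>) / l) = a * g powr (1 + \<theta>) * h powr (1 - \<theta>)"
    using l by simp
  moreover have "(l * g powr (1 + \<theta>)) powr (2 / (1 + \<theta>)) / (2 / (1 + \<theta>)) = g\<^sup>2 / 4"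
  proof -
    have "(l * g powr (1 + \<theta>)) powr (2 / (1 + \<theta>)) = \<beta> powr ((1 + \<theta>) / 2 * (2 / (1 + \<theta>))) * g powr ((1 + \<theta>) * (2 / (1 + \<theta>)))"
      using l by (simp add: powr_mult powr_powr l_def)
    also have "(1 + \<theta>) / 2 * (2 / (1 + \<theta>)) = 1" using \<theta> by simp
    also have "(1 + \<theta>) * (2 / (1 + \<theta>)) = 2" using \<theta> by (simp add: field_simps)
    also have "\<beta> powr 1 * g powr 2 = \<beta> * g\<^sup>2" using \<beta> nn by (simp add: powr_numeral)
    finally show ?thesis using \<theta> by (simp add: \<beta>_def field_simps)
  qed
  moreover have "(a * h powr (1 - \<theta>) / l) powr (2 / (1 - \<theta>)) / (2 / (1 - \<theta>)) =
    (1 - \<theta>) / 2 * \<beta> powr ((\<theta> + 1) / (\<theta> - 1)) * a powr (2 / (1 - \<theta>)) * h\<^sup>2"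
  proof -
    have "(a * h powr (1 - \<theta>) / l) powr (2 / (1 - \<theta>)) =
       a powr (2 / (1 - \<theta>)) * h powr ((1 - \<theta>) * (2 / (1 - \<theta>))) / \<beta> powr ((1 + \<theta>) / 2 * (2 / (1 - \<theta>)))"
      using l nn by (simp add: powr_mult powr_divide powr_powr l_def)
    also have "(1 - \<theta>) * (2 / (1 - \<theta>)) = 2" using \<theta> by (simp add: field_simps)
    also have "h powr 2 = h\<^sup>2" using nn by (simp add: powr_numeral)
    also have "1 / \<beta> powr ((1 + \<theta>) / 2 * (2 / (1 - \<theta>))) = \<beta> powr ((\<theta> + 1) / (\<theta> - 1))"
    proof -
      have "(\<theta> + 1) / (\<theta> - 1) = - ((1 + \<theta>) / 2 * (2 / (1 - \<theta>)))"
        using \<theta> by (simp add: field_simps)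
      then show ?thesis by (simp add: powr_minus_divide)
    qed
    then have "a powr (2 / (1 - \<theta>)) * h\<^sup>2 / \<beta> powr ((1 + \<theta>) / 2 * (2 / (1 - \<theta>))) =
       a powr (2 / (1 - \<theta>)) * h\<^sup>2 * \<beta> powr ((\<theta> + 1) / (\<theta> - 1))"
      by (metis times_divide_eq_right mult_1_right)
    finally show ?thesis by (simp add: mult_ac)
  qed
  ultimately show ?thesis unfolding \<beta>_def by linarith
qed

section \<open>Estimates at a fixed time\<close>

context dirichlet_domain
begin

lemma L2_norm_mult_integral:
  fixes f g :: "'a \<Rightarrow> 'b::euclidean_space"
  assumes "f \<in> Lp_space 2 \<Omega>" "g \<in> Lp_space 2 \<Omega>"
  shows "(LINT x|lebesgue_on \<Omega>. norm (f x) * norm (g x)) \<le> enn2real (Lp_norm 2 \<Omega> f) * enn2real (Lp_norm 2 \<Omega> g)"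
proof -
  have [measurable]: "f \<in> borel_measurable (lebesgue_on \<Omega>)" "g \<in> borel_measurable (lebesgue_on \<Omega>)"
    using assms by (auto simp: Lp_space_def)
  have "ennreal (LINT x|lebesgue_on \<Omega>. norm (f x) * norm (g x)) = (\<integral>\<^sup>+ x. ennreal (norm (f x) * norm (g x)) \<partial>lebesgue_on \<Omega>)"
    by (rule nn_integral_eq_integral[symmetric]) (use L2_inner_integrable(3)[OF assms] in auto)
  also have "\<dots> \<le> Lp_norm 2 \<Omega> f * Lp_norm 2 \<Omega> g" by (rule nn_integral_Cauchy_Schwarz) measurable
  finally have "ennreal (LINT x|lebesgue_on \<Omega>. norm (f x) * norm (g x)) \<le> Lp_norm 2 \<Omega> f * Lp_norm 2 \<Omega> g" .
  moreover have "Lp_norm 2 \<Omega> f * Lp_norm 2 \<Omega> g < top"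
    using assms by (auto simp: Lp_space_def ennreal_mult_less_top)
  ultimately have "enn2real (ennreal (LINT x|lebesgue_on \<Omega>. norm (f x) * norm (g x))) \<le> enn2real (Lp_norm 2 \<Omega> f * Lp_norm 2 \<Omega> g)"
    by (rule enn2real_mono)
  moreover have "0 \<le> (LINT x|lebesgue_on \<Omega>. norm (f x) * norm (g x))" by simp
  ultimately show ?thesis by (simp add: enn2real_mult)
qed

lemma l2_square: "u \<in> Lp_space 2 \<Omega> \<Longrightarrow> (l2 u)\<^sup>2 = ip u u"
proof -
  assume "u \<in> Lp_space 2 \<Omega>"
  then have "enn2real ((Lp_norm 2 \<Omega> u)\<^sup>2) = enn2real (ennreal (ip u u))" by (simp add: Lp_norm_2_square_ip)
  then show ?thesis by (simp add: power2_eq_square enn2real_mult ip_self)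
qed

definition flux :: "('a \<Rightarrow> real) \<Rightarrow> ('a \<Rightarrow> real) \<Rightarrow> 'a \<Rightarrow> 'a" where
  "flux w0 wi x = w0 x *\<^sub>R weak_grad \<Omega> wi x - wi x *\<^sub>R weak_grad \<Omega> w0 x"

definition flux_form :: "('a \<Rightarrow> real) \<Rightarrow> ('a \<Rightarrow> real) \<Rightarrow> ('a \<Rightarrow> real) \<Rightarrow> real" where
  "flux_form w0 wi \<phi> = (LINT x|lebesgue_on \<Omega>. flux w0 wi x \<bullet> weak_grad \<Omega> \<phi> x)"

text \<open>Friedrichs' inequality bounds the full norm in the Gagliardo-Nirenberg estimate by
  sqrt(1 + CF^2) times the gradient norm; the power \<theta> of this produces the factor (1 +
  CF^2)^(\<theta>/2).\<close>

lemma Lp_norm_interpolation: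
  assumes W: "w \<in> H1D \<Omega> \<Gamma>" and \<theta>: "0 < \<theta>" "\<theta> < 1"
    and CF: "0 < CF" "Lp_norm 2 \<Omega> w \<le> ennreal CF * Lp_norm 2 \<Omega> (weak_grad \<Omega> w)"
    and CG: "0 < CG" "Lp_norm p \<Omega> w \<le> ennreal CG * ennpowr (H1_norm \<Omega> w) \<theta> * ennpowr (Lp_norm 2 \<Omega> w) (1 - \<theta>)"
  shows "Lp_norm p \<Omega> w \<le> ennreal (CG * ((1 + CF\<^sup>2) powr (\<theta> / 2) * grad_norm w powr \<theta>) * l2 w powr (1 - \<theta>))"
proof -
  have H: "w \<in> H1 \<Omega>" by (rule H1D_H1[OF W])
  have l: "Lp_norm 2 \<Omega> w = ennreal (l2 w)" using Lp_norm_H1_finite[OF H] by simp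
  have b: "H1D_norm \<Omega> w = ennreal (grad_norm w)" using H1D_norm_finite[OF H] by simp
  have "ennreal (l2 w) \<le> ennreal CF * ennreal (grad_norm w)"
    using CF(2) l b by (simp add: H1D_norm_def)
  then have lb: "l2 w \<le> CF * grad_norm w" using CF(1) by (simp flip: ennreal_mult)
  let ?h = "sqrt ((l2 w)\<^sup>2 + (grad_norm w)\<^sup>2)"
  have h: "H1_norm \<Omega> w = ennreal ?h" by (rule H1_norm_eq[OF H])
  have "(l2 w)\<^sup>2 \<le> (CF * grad_norm w)\<^sup>2" using lb by (intro power_mono) auto
  then have "(l2 w)\<^sup>2 + (grad_norm w)\<^sup>2 \<le> (1 + CF\<^sup>2) * (grad_norm w)\<^sup>2"
    by (simp add: power_mult_distrib algebra_simps)
  then have "?h \<le> sqrt ((1 + CF\<^sup>2) * (grad_norm w)\<^sup>2)" by (rule real_sqrt_le_mono)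
  also have "\<dots> = sqrt (1 + CF\<^sup>2) * grad_norm w" by (simp add: real_sqrt_mult)
  finally have "?h powr \<theta> \<le> (sqrt (1 + CF\<^sup>2) * grad_norm w) powr \<theta>"
    using \<theta> by (intro powr_mono2) auto
  also have "\<dots> = (1 + CF\<^sup>2) powr (\<theta> / 2) * grad_norm w powr \<theta>"
    by (simp add: powr_mult powr_powr flip: powr_half_sqrt)
  finally have hle: "?h powr \<theta> \<le> (1 + CF\<^sup>2) powr (\<theta> / 2) * grad_norm w powr \<theta>" .
  have "ennpowr (H1_norm \<Omega> w) \<theta> = ennreal (?h powr \<theta>)" unfolding h by (simp add: ennpowr_ennreal)
  moreover have "ennpowr (Lp_norm 2 \<Omega> w) (1 - \<theta>) = ennreal (l2 w powr (1 - \<theta>))"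
    using Lp_norm_H1_finite[OF H] by (simp add: ennpowr_def)
  ultimately have "Lp_norm p \<Omega> w \<le> ennreal CG * ennreal (?h powr \<theta>) * ennreal (l2 w powr (1 - \<theta>))"
    using CG(2) by simp
  also have "\<dots> = ennreal (CG * ?h powr \<theta> * l2 w powr (1 - \<theta>))"
    using CG(1) by (simp add: ennreal_mult')
  finally have "Lp_norm p \<Omega> w \<le> ennreal (CG * ?h powr \<theta> * l2 w powr (1 - \<theta>))" .
  also have "\<dots> \<le> ennreal (CG * ((1 + CF\<^sup>2) powr (\<theta> / 2) * grad_norm w powr \<theta>) * l2 w powr (1 - \<theta>))"
    using hle CG(1) by (intro ennreal_leI mult_right_mono mult_left_mono) auto
  finally show ?thesis .
qed

text \<open>Here g is the dissipation at one time. The bracket in the last line is what, with F the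
  perturbation and after testing both equations and integrating in time, becomes the integral of the
  derivative of w paired with w, which the energy inequality bounds from below.\<close>

lemma spatial_estimate:
  fixes ui u0 vi v0 :: "'a \<Rightarrow> real"
  assumes H: "ui \<in> H1 \<Omega>" "u0 \<in> H1 \<Omega>" "vi \<in> H1 \<Omega>" "v0 \<in> H1 \<Omega>" and W: "ui - vi \<in> H1D \<Omega> \<Gamma>"
    and \<gamma>: "0 < \<gamma>" and v0: "AE x in lebesgue_on \<Omega>. \<gamma> < v0 x \<and> v0 x \<le> 1"
    and vi: "AE x in lebesgue_on \<Omega>. 0 \<le> vi x \<and> vi x \<le> 1"
    and K: "0 \<le> K" "AE x in lebesgue_on \<Omega>. \<bar>v0 x - u0 x\<bar> * norm (weak_grad \<Omega> ui x) \<le> K * norm (weak_grad \<Omega> ui x)"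
    and pq: "2 < p" "2 < q" "1 / p + 1 / q = 1 / 2" and \<theta>: "0 < \<theta>" "\<theta> < 1"
    and gq: "weak_grad \<Omega> u0 \<in> Lp_space q \<Omega>"
    and CF: "0 < CF" "\<forall>w \<in> H1D \<Omega> \<Gamma>. Lp_norm 2 \<Omega> w \<le> ennreal CF * Lp_norm 2 \<Omega> (weak_grad \<Omega> w)"
    and CG: "0 < CG" "\<forall>w \<in> H1 \<Omega>. Lp_norm p \<Omega> w \<le>
         ennreal CG * ennpowr (H1_norm \<Omega> w) \<theta> * ennpowr (Lp_norm 2 \<Omega> w) (1 - \<theta>)"
    and fu: "integrable (lebesgue_on \<Omega>) (\<lambda>x. flux u0 ui x \<bullet> weak_grad \<Omega> (ui - vi) x)"
    and fv: "integrable (lebesgue_on \<Omega>) (\<lambda>x. flux v0 vi x \<bullet> weak_grad \<Omega> (ui - vi) x)"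
    and F: "F \<in> H1D_dual \<Omega> \<Gamma>"
  shows "\<exists>g\<ge>0. (Lp_norm 2 \<Omega> (\<lambda>x. sqrt (v0 x) *\<^sub>R weak_grad \<Omega> (ui - vi) x))\<^sup>2 = ennreal g \<and>
    g \<le> 2 * ((1 - \<theta>) / 2 * (1 / (2 * (1 + \<theta>))) powr ((\<theta> + 1) / (\<theta> - 1)) *
          (CG * (1 + CF\<^sup>2) powr (\<theta> / 2) * enn2real (Lp_norm q \<Omega> (weak_grad \<Omega> u0)) / \<gamma> powr ((1 + \<theta>) / 2)) powr (2 / (1 - \<theta>)))
          * ip (ui - vi) (ui - vi)
      + 6 / \<gamma> * (K\<^sup>2 * (grad_norm ui)\<^sup>2 + (grad_norm (u0 - v0))\<^sup>2 + (dual_norm F)\<^sup>2)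
      - 2 * (F (ui - vi) - (flux_form u0 ui (ui - vi) - flux_form v0 vi (ui - vi)))"
proof -
  let ?M = "lebesgue_on \<Omega>"
  define w where "w = ui - vi"
  define dw where "dw = weak_grad \<Omega> w"
  define du where "du = weak_grad \<Omega> ui"
  define e where "e = weak_grad \<Omega> (u0 - v0)"
  define d0 where "d0 = weak_grad \<Omega> u0"
  have wD: "w \<in> H1D \<Omega> \<Gamma>" using W by (simp add: w_def)
  have wH: "w \<in> H1 \<Omega>" by (rule H1D_H1[OF wD])
  have L: "dw \<in> Lp_space 2 \<Omega>" "du \<in> Lp_space 2 \<Omega>" "e \<in> Lp_space 2 \<Omega>" "d0 \<in> Lp_space 2 \<Omega>"
    unfolding dw_def du_def e_def d0_def by (intro weak_grad wH H H1_diff)+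
  have [measurable]: "dw \<in> borel_measurable ?M" "du \<in> borel_measurable ?M" "e \<in> borel_measurable ?M"
    "d0 \<in> borel_measurable ?M" "w \<in> borel_measurable ?M" "v0 \<in> borel_measurable ?M"
    using L H1_L2[OF wH] H1_L2[OF H(4)] by (auto simp: Lp_space_def)
  define b where "b = grad_norm w"
  define l where "l = l2 w"
  define X where "X = enn2real (Lp_norm q \<Omega> d0)"
  have nn: "0 \<le> b" "0 \<le> l" "0 \<le> X" by (auto simp: b_def l_def X_def)
  have b2: "b = enn2real (Lp_norm 2 \<Omega> dw)" by (simp add: b_def dw_def H1D_norm_def)
  have d0q: "Lp_norm q \<Omega> d0 = ennreal X" using gq by (simp add: X_def d0_def Lp_space_def)
  \<comment> \<open>Q bounds the L^p norm of w by interpolation. With X the L^q norm of the gradient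
    of u0, Hoelder's inequality gives Q X for the product in the last flux term.\<close>
  define Q where "Q = CG * ((1 + CF\<^sup>2) powr (\<theta> / 2) * b powr \<theta>) * l powr (1 - \<theta>)"
  have Q0: "0 \<le> Q" using CG nn by (simp add: Q_def)
  have wp: "Lp_norm p \<Omega> w \<le> ennreal Q"
    unfolding Q_def b_def l_def
    by (rule Lp_norm_interpolation[OF wD \<theta> CF(1) _ CG(1)]) (use CF CG wD wH in auto)
  have prod: "Lp_norm 2 \<Omega> (\<lambda>x. w x *\<^sub>R d0 x) \<le> ennreal (Q * X)"
  proof -
    have "Lp_norm 2 \<Omega> (\<lambda>x. w x *\<^sub>R d0 x) \<le> Lp_norm p \<Omega> w * Lp_norm q \<Omega> d0"
      by (rule Lp_norm_mult_le[OF pq]) (use wp d0q in \<open>auto intro: le_less_trans\<close>)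
    also have "\<dots> \<le> ennreal Q * ennreal X" unfolding d0q by (intro mult_right_mono wp) simp
    finally show ?thesis using Q0 nn by (simp add: ennreal_mult)
  qed
  then have Lwd: "(\<lambda>x. w x *\<^sub>R d0 x) \<in> Lp_space 2 \<Omega>" by (auto simp: Lp_space_def intro: le_less_trans)
  have prod': "enn2real (Lp_norm 2 \<Omega> (\<lambda>x. w x *\<^sub>R d0 x)) \<le> Q * X"
    using enn2real_mono[OF prod] Q0 nn by simp
  have dwi: "integrable ?M (\<lambda>x. (norm (dw x))\<^sup>2)"
    using L2_inner_integrable(1)[OF L(1) L(1)] by (simp add: power2_norm_eq_inner)
  define g where "g = (LINT x|?M. v0 x * (norm (dw x))\<^sup>2)"
  have gi: "integrable ?M (\<lambda>x. v0 x * (norm (dw x))\<^sup>2)"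
  proof (rule Bochner_Integration.integrable_bound[OF dwi])
    show "AE x in ?M. norm (v0 x * (norm (dw x))\<^sup>2) \<le> norm ((norm (dw x))\<^sup>2)"
      using v0 by eventually_elim (use \<gamma> in \<open>auto simp: abs_mult intro!: mult_left_le_one_le\<close>)
  qed measurable
  have g0: "0 \<le> g" unfolding g_def
    by (rule integral_nonneg_AE) (use v0 \<gamma> in \<open>auto elim!: eventually_mono\<close>)
  have lhs: "(Lp_norm 2 \<Omega> (\<lambda>x. sqrt (v0 x) *\<^sub>R dw x))\<^sup>2 = ennreal g"
  proof -
    have "(Lp_norm 2 \<Omega> (\<lambda>x. sqrt (v0 x) *\<^sub>R dw x))\<^sup>2 = (\<integral>\<^sup>+ x. ennreal (v0 x * (norm (dw x))\<^sup>2) \<partial>?M)"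
      unfolding Lp_norm_2_square
      by (rule nn_integral_cong_AE)
         (use v0 \<gamma> in \<open>auto simp: power_mult_distrib elim!: eventually_mono\<close>)
    also have "\<dots> = ennreal g" unfolding g_def
      by (rule nn_integral_eq_integral[OF gi]) (use v0 \<gamma> in \<open>auto elim!: eventually_mono\<close>)
    finally show ?thesis .
  qed
  \<comment> \<open>G is the square root of the dissipation. As v0 > \<gamma>, the plain gradient
    norm b is at most G / sqrt \<gamma>, which is how powers of \<gamma> enter.\<close>
  define G where "G = sqrt g"
  have G: "0 \<le> G" "G\<^sup>2 = g" using g0 by (auto simp: G_def)
  have "(LINT x|?M. \<gamma> * (norm (dw x))\<^sup>2) \<le> g" unfolding g_def
    by (rule integral_mono_AE) (use dwi gi v0 in \<open>auto elim!: eventually_mono intro!: mult_right_mono\<close>)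
  moreover have "(LINT x|?M. (norm (dw x))\<^sup>2) = b\<^sup>2"
  proof -
    have "ennreal (LINT x|?M. dw x \<bullet> dw x) = (ennreal b)\<^sup>2"
      using L2_norm_square_integral[OF L(1)] L(1) by (simp add: b2 Lp_space_def)
    moreover have "0 \<le> (LINT x|?M. dw x \<bullet> dw x)" by simp
    ultimately show ?thesis using nn by (simp add: power2_norm_eq_inner ennreal_power)
  qed
  ultimately have "\<gamma> * b\<^sup>2 \<le> G\<^sup>2" using dwi by (simp add: G)
  then have "b\<^sup>2 \<le> (G / sqrt \<gamma>)\<^sup>2" using \<gamma> by (simp add: power_divide pos_le_divide_eq mult.commute)
  then have bG: "b \<le> G / sqrt \<gamma>" by (rule power2_le_imp_le) (use G \<gamma> in auto)
  have dW: "AE x in ?M. dw x = du x - weak_grad \<Omega> vi x"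
    using H1_diff(2)[OF H(1) H(3)] by (simp add: dw_def du_def w_def)
  have eE: "AE x in ?M. e x = d0 x - weak_grad \<Omega> v0 x"
    using H1_diff(2)[OF H(2) H(4)] by (simp add: e_def d0_def)
  have pt: "AE x in ?M. v0 x * (norm (dw x))\<^sup>2 \<le> (flux u0 ui x \<bullet> dw x - flux v0 vi x \<bullet> dw x)
      + K * (norm (du x) * norm (dw x)) + norm (e x) * norm (dw x) + norm (w x *\<^sub>R d0 x) * norm (dw x)"
    using dW eE vi K(2)
  proof eventually_elim
    case (elim x)
    \<comment> \<open>This splitting puts v0 and vi, for which pointwise bounds are known, in front
      of gradients of differences. No such bounds are at hand for ui and u0, which enter through
      their gradients and through the differences u0 - v0 and w.\<close>
    have fl: "flux u0 ui x - flux v0 vi x = v0 x *\<^sub>R dw x + (u0 x - v0 x) *\<^sub>R du x - vi x *\<^sub>R e x - w x *\<^sub>R d0 x"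
    proof -
      have "weak_grad \<Omega> vi x = du x - dw x" "weak_grad \<Omega> v0 x = d0 x - e x" using elim by auto
      then show ?thesis
        by (simp add: flux_def w_def flip: du_def d0_def) (simp add: algebra_simps)
    qed
    have "flux u0 ui x \<bullet> dw x - flux v0 vi x \<bullet> dw x =
        v0 x * (norm (dw x))\<^sup>2 + (u0 x - v0 x) * (du x \<bullet> dw x) - vi x * (e x \<bullet> dw x) - (w x *\<^sub>R d0 x) \<bullet> dw x"
      unfolding inner_diff_left[symmetric] fl by (simp add: inner_simps power2_norm_eq_inner)
    moreover have "- ((u0 x - v0 x) * (du x \<bullet> dw x)) \<le> K * (norm (du x) * norm (dw x))"
    proof -
      have "- ((u0 x - v0 x) * (du x \<bullet> dw x)) \<le> \<bar>(u0 x - v0 x) * (du x \<bullet> dw x)\<bar>" by simp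
      also have "\<dots> \<le> \<bar>v0 x - u0 x\<bar> * (norm (du x) * norm (dw x))"
        unfolding abs_mult abs_minus_commute[of "u0 x"] by (intro mult_left_mono Cauchy_Schwarz_ineq2) simp
      also have "\<dots> \<le> K * norm (du x) * norm (dw x)"
        using mult_right_mono[OF elim(4), of "norm (dw x)"] by (simp add: du_def mult.assoc)
      finally show ?thesis by (simp add: mult.assoc)
    qed
    moreover have "vi x * (e x \<bullet> dw x) \<le> norm (e x) * norm (dw x)"
    proof -
      have "vi x * (e x \<bullet> dw x) \<le> vi x * (norm (e x) * norm (dw x))"
        using elim(3) by (intro mult_left_mono norm_cauchy_schwarz) auto
      also have "\<dots> \<le> norm (e x) * norm (dw x)" using elim(3) by (intro mult_left_le_one_le) auto
      finally show ?thesis .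
    qed
    moreover have "(w x *\<^sub>R d0 x) \<bullet> dw x \<le> norm (w x *\<^sub>R d0 x) * norm (dw x)" by (rule norm_cauchy_schwarz)
    ultimately show ?case by linarith
  qed
  define D where "D = flux_form u0 ui w - flux_form v0 vi w"
  define A where "A = grad_norm ui"
  define B where "B = grad_norm (u0 - v0)"
  define C where "C = dual_norm F"
  have ABC: "0 \<le> A" "0 \<le> B" "0 \<le> C" by (auto simp: A_def B_def C_def)
  have fi: "integrable ?M (\<lambda>x. flux u0 ui x \<bullet> dw x)" "integrable ?M (\<lambda>x. flux v0 vi x \<bullet> dw x)"
    using fu fv by (simp_all add: dw_def w_def)
  note mi = L2_inner_integrable(3)[OF L(2) L(1)] L2_inner_integrable(3)[OF L(3) L(1)] L2_inner_integrable(3)[OF Lwd L(1)]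
  have "g \<le> (LINT x|?M. (flux u0 ui x \<bullet> dw x - flux v0 vi x \<bullet> dw x)
      + K * (norm (du x) * norm (dw x)) + norm (e x) * norm (dw x) + norm (w x *\<^sub>R d0 x) * norm (dw x))"
    unfolding g_def
    by (rule integral_mono_AE[OF gi _ pt]) (intro Bochner_Integration.integrable_add Bochner_Integration.integrable_diff integrable_mult_right fi mi)
  also have "\<dots> = D + K * (LINT x|?M. norm (du x) * norm (dw x)) + (LINT x|?M. norm (e x) * norm (dw x))
      + (LINT x|?M. norm (w x *\<^sub>R d0 x) * norm (dw x))"
  proof -
    have i1: "integrable ?M (\<lambda>x. flux u0 ui x \<bullet> dw x - flux v0 vi x \<bullet> dw x)" using fi by simp
    have i2: "integrable ?M (\<lambda>x. K * (norm (du x) * norm (dw x)))" using mi by (intro integrable_mult_right)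
    have "D = (LINT x|?M. flux u0 ui x \<bullet> dw x - flux v0 vi x \<bullet> dw x)"
      using fi by (simp add: D_def flux_form_def dw_def)
    moreover have "(LINT x|?M. K * (norm (du x) * norm (dw x))) = K * (LINT x|?M. norm (du x) * norm (dw x))"
      by (rule integral_mult_right_zero)
    ultimately show ?thesis
      using Bochner_Integration.integral_add[OF Bochner_Integration.integrable_add[OF Bochner_Integration.integrable_add[OF i1 i2] mi(2)] mi(3)]
        Bochner_Integration.integral_add[OF Bochner_Integration.integrable_add[OF i1 i2] mi(2)]
        Bochner_Integration.integral_add[OF i1 i2] by simp
  qed
  also have "\<dots> \<le> D + K * (A * b) + B * b + (Q * X) * b"
  proof -
    have "(LINT x|?M. norm (du x) * norm (dw x)) \<le> A * b"
      using L2_norm_mult_integral[OF L(2) L(1)] by (simp add: A_def b2 du_def H1D_norm_def)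
    moreover have "(LINT x|?M. norm (e x) * norm (dw x)) \<le> B * b"
      using L2_norm_mult_integral[OF L(3) L(1)] by (simp add: B_def b2 e_def H1D_norm_def)
    moreover have "(LINT x|?M. norm (w x *\<^sub>R d0 x) * norm (dw x)) \<le> (Q * X) * b"
      using L2_norm_mult_integral[OF Lwd L(1)] mult_right_mono[OF prod' nn(1)] unfolding b2 by linarith
    ultimately show ?thesis using K(1) by (intro add_mono mult_left_mono order_refl)
  qed
  finally have main: "g \<le> D + K * (A * b) + B * b + (Q * X) * b" .
  have Fb: "\<bar>F w\<bar> \<le> C * b" using H1D_dual_bound[OF F wD] by (simp add: C_def b_def)
  \<comment> \<open>Collected before Young's inequality is applied, the three terms linear in b cost
    a single quarter of the dissipation.\<close>
  define S where "S = K * A + B + C"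
  have S0: "0 \<le> S" using ABC K by (simp add: S_def)
  have S2: "S\<^sup>2 \<le> 3 * (K\<^sup>2 * A\<^sup>2 + B\<^sup>2 + C\<^sup>2)"
  proof -
    have "0 \<le> (K * A - B)\<^sup>2 + (K * A - C)\<^sup>2 + (B - C)\<^sup>2" by simp
    then show ?thesis by (simp add: S_def power2_eq_square algebra_simps)
  qed
  have Sb: "S * b \<le> g / 4 + S\<^sup>2 / \<gamma>"
  proof -
    have "S * b \<le> S * (G / sqrt \<gamma>)" using bG S0 by (intro mult_left_mono)
    moreover have "0 \<le> (G / 2 - S / sqrt \<gamma>)\<^sup>2" by simp
    moreover have "(G / 2 - S / sqrt \<gamma>)\<^sup>2 = g / 4 - S * (G / sqrt \<gamma>) + S\<^sup>2 / \<gamma>"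
      using G \<gamma> by (simp add: power2_diff power_divide)
    ultimately show ?thesis by linarith
  qed
  \<comment> \<open>a gathers all that multiplies G^(1+\<theta>) l^(1-\<theta>): the factor b from
    the gradient of w joins b^\<theta> from the interpolation, and b \<le> G / sqrt \<gamma> raised
    to the power 1 + \<theta> gives the power of \<gamma>.\<close>
  define a where "a = CG * (1 + CF\<^sup>2) powr (\<theta> / 2) * X / \<gamma> powr ((1 + \<theta>) / 2)"
  have a0: "0 \<le> a" using CG nn \<gamma> by (simp add: a_def)
  define k where "k = (1 - \<theta>) / 2 * (1 / (2 * (1 + \<theta>))) powr ((\<theta> + 1) / (\<theta> - 1)) * a powr (2 / (1 - \<theta>))"
  have QXb: "(Q * X) * b \<le> g / 4 + k * l\<^sup>2"
  proof -
    have "(Q * X) * b = (CG * (1 + CF\<^sup>2) powr (\<theta> / 2) * X) * b powr (1 + \<theta>) * l powr (1 - \<theta>)"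
      using nn \<theta> by (simp add: Q_def powr_add mult_ac)
    also have "\<dots> \<le> (CG * (1 + CF\<^sup>2) powr (\<theta> / 2) * X) * (G / sqrt \<gamma>) powr (1 + \<theta>) * l powr (1 - \<theta>)"
      using bG nn \<theta> CG by (intro mult_right_mono mult_left_mono powr_mono2) auto
    also have "(G / sqrt \<gamma>) powr (1 + \<theta>) = G powr (1 + \<theta>) / \<gamma> powr ((1 + \<theta>) / 2)"
      using G \<gamma> by (simp add: powr_divide powr_powr flip: powr_half_sqrt)
    also have "(CG * (1 + CF\<^sup>2) powr (\<theta> / 2) * X) * (G powr (1 + \<theta>) / \<gamma> powr ((1 + \<theta>) / 2)) * l powr (1 - \<theta>) =
        a * G powr (1 + \<theta>) * l powr (1 - \<theta>)" by (simp add: a_def)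
    also have "\<dots> \<le> G\<^sup>2 / 4 + k * l\<^sup>2"
      unfolding k_def by (rule young_interpolation[OF \<theta> a0 G(1) nn(2)])
    finally show ?thesis by (simp add: G)
  qed
  have "g + F w - D \<le> g / 2 + k * l\<^sup>2 + S\<^sup>2 / \<gamma>"
  proof -
    have "K * (A * b) + B * b + C * b = S * b" by (simp add: S_def algebra_simps)
    then show ?thesis using main Fb Sb QXb by linarith
  qed
  moreover define E where "E = (K\<^sup>2 * A\<^sup>2 + B\<^sup>2 + C\<^sup>2) / \<gamma>"
  have "S\<^sup>2 / \<gamma> \<le> 3 * E"
    using divide_right_mono[OF S2, of \<gamma>] \<gamma> by (simp add: E_def)
  \<comment> \<open>Absorption: half of r moves to the left and the inequality is doubled, so that 3
    becomes 6.\<close>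
  moreover have "r \<le> 2 * z + 6 * c - 2 * (y - d)" if "r + y - d \<le> r / 2 + z + x" "x \<le> 3 * c"
    for r y d z x c :: real
    using that by argo
  ultimately have "g \<le> 2 * (k * l\<^sup>2) + 6 * E - 2 * (F w - D)" by blast
  then have "g \<le> 2 * (k * l\<^sup>2) + 6 / \<gamma> * (K\<^sup>2 * A\<^sup>2 + B\<^sup>2 + C\<^sup>2) - 2 * (F w - D)"
    by (simp add: E_def)
  moreover have "l\<^sup>2 = ip w w" unfolding l_def by (rule l2_square[OF H1_L2[OF wH]])
  ultimately have fin: "g \<le> 2 * k * ip w w + 6 / \<gamma> * (K\<^sup>2 * A\<^sup>2 + B\<^sup>2 + C\<^sup>2) - 2 * (F w - D)" by simp
  show ?thesis
    using g0 lhs fin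
    unfolding k_def a_def X_def A_def B_def C_def D_def d0_def dw_def w_def by blast
qed

end

text \<open>The Neumann part is relatively open, so the Dirichlet part is the boundary minus an open
  set, hence closed and in particular Borel.\<close>

lemma dirichlet_domain_of_mixed:
  assumes "mixed_boundary_domain \<Omega> \<Gamma>\<^sub>D \<Gamma>\<^sub>N"
  shows "dirichlet_domain \<Omega> \<Gamma>\<^sub>D"
proof
  have b: "\<Gamma>\<^sub>D \<inter> \<Gamma>\<^sub>N = {}" "frontier \<Omega> = \<Gamma>\<^sub>D \<union> \<Gamma>\<^sub>N" "openin (top_of_set (frontier \<Omega>)) \<Gamma>\<^sub>N"
    using assms by (auto simp: mixed_boundary_domain_def)
  show "open \<Omega>" "bounded \<Omega>" using assms by (auto simp: mixed_boundary_domain_def)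
  obtain U where U: "open U" "\<Gamma>\<^sub>N = frontier \<Omega> \<inter> U" using b(3) by (auto simp: openin_open)
  then have "\<Gamma>\<^sub>D = frontier \<Omega> - U" using b by blast
  then have "closed \<Gamma>\<^sub>D" using U by (simp add: closed_Diff)
  then show "\<Gamma>\<^sub>D \<in> sets borel" by simp
  show "\<Gamma>\<^sub>D \<subseteq> closure \<Omega>" using b(2) by (auto simp: frontier_def)
qed

lemma integral_truncate:
  fixes f g :: "real \<Rightarrow> real"
  assumes f: "integrable (lebesgue_on {0..T}) f" and g: "integrable (lebesgue_on {0..T}) g"
    and eq: "AE t in lebesgue_on {0..T}. g t = (if t \<le> s then f t else 0)" and s: "0 \<le> s" "s \<le> T"
  shows "(LINT t|lebesgue_on {0..T}. g t) = (LINT t|lebesgue_on {0..s}. f t)"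
proof -
  have [measurable]: "{t \<in> space (lebesgue_on {0..T}). t \<le> s} \<in> sets (lebesgue_on {0..T})"
  proof -
    have "{t \<in> space (lebesgue_on {0..T}). t \<le> s} = {0..s}" using s by auto
    then show ?thesis using s by (simp add: sets_restrict_space_iff)
  qed
  have [measurable]: "f \<in> borel_measurable (lebesgue_on {0..T})" using f by simp
  have "(LINT t|lebesgue_on {0..T}. g t) = (LINT t|lebesgue_on {0..T}. (if t \<le> s then f t else 0))"
  proof (rule integral_cong_AE)
    show "g \<in> borel_measurable (lebesgue_on {0..T})" using g by simp
    show "(\<lambda>t. if t \<le> s then f t else 0) \<in> borel_measurable (lebesgue_on {0..T})" by measurable
  qed (rule eq)
  also have "\<dots> = (LINT t|lebesgue. indicator {0..T} t * (if t \<le> s then f t else 0))"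
    by (simp add: integral_restrict_space)
  also have "\<dots> = (LINT t|lebesgue. indicator {0..s} t * f t)"
    by (rule Bochner_Integration.integral_cong) (use s in \<open>auto simp: indicator_def\<close>)
  finally show ?thesis by (simp add: integral_restrict_space)
qed

section \<open>Integration in time and Gronwall's inequality\<close>

context dirichlet_domain
begin

lemma weak_solutionE:
  assumes "weak_solution T \<Omega> \<Gamma> n wD wI R w"
  obtains w' where "\<And>i. i \<le> n \<Longrightarrow> w' i \<in> L2_H1D_dual T \<Omega> \<Gamma>"
    "\<And>i. i \<le> n \<Longrightarrow> has_weak_time_derivative T \<Omega> \<Gamma> (w i) (w' i)"
    "\<And>i \<phi>. i \<in> {1..n} \<Longrightarrow> \<phi> \<in> L2_H1D T \<Omega> \<Gamma> \<Longrightarrow>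
       AE t in lebesgue_on {0..T}. integrable (lebesgue_on \<Omega>) (\<lambda>x. flux (w 0 t) (w i t) x \<bullet> weak_grad \<Omega> (\<phi> t) x)"
    "\<And>i \<phi>. i \<in> {1..n} \<Longrightarrow> \<phi> \<in> L2_H1D T \<Omega> \<Gamma> \<Longrightarrow>
       integrable (lebesgue_on {0..T}) (\<lambda>t. flux_form (w 0 t) (w i t) (\<phi> t))"
    "\<And>i \<phi>. i \<in> {1..n} \<Longrightarrow> \<phi> \<in> L2_H1D T \<Omega> \<Gamma> \<Longrightarrow>
       (LINT t|lebesgue_on {0..T}. w' i t (\<phi> t)) + (LINT t|lebesgue_on {0..T}. flux_form (w 0 t) (w i t) (\<phi> t)) =
       (LINT t|lebesgue_on {0..T}. R i t (\<phi> t))"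
  using assms unfolding weak_solution_def Let_def flux_form_def flux_def by blast

text \<open>The weak formulation is an identity over all of [0,T]; testing with \<phi> cut off after
  s restricts it to [0,s], because every term vanishes on the zero function. For the flux this uses
  that the weak gradient of 0 vanishes almost everywhere.\<close>

lemma tested_equation:
  assumes w': "w' \<in> L2_H1D_dual T \<Omega> \<Gamma>" and R: "R \<in> L2_H1D_dual T \<Omega> \<Gamma>"
    and fl: "\<And>\<phi>. \<phi> \<in> L2_H1D T \<Omega> \<Gamma> \<Longrightarrow> integrable (lebesgue_on {0..T}) (\<lambda>t. flux_form (w0 t) (wi t) (\<phi> t))"
    and eq: "\<And>\<phi>. \<phi> \<in> L2_H1D T \<Omega> \<Gamma> \<Longrightarrow> 
       (LINT t|lebesgue_on {0..T}. w' t (\<phi> t)) + (LINT t|lebesgue_on {0..T}. flux_form (w0 t) (wi t) (\<phi> t)) =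
       (LINT t|lebesgue_on {0..T}. R t (\<phi> t))"
    and \<phi>: "\<phi> \<in> L2_H1D T \<Omega> \<Gamma>" and s: "0 \<le> s" "s \<le> T"
  shows "(LINT t|lebesgue_on {0..s}. w' t (\<phi> t)) + (LINT t|lebesgue_on {0..s}. flux_form (w0 t) (wi t) (\<phi> t)) =
       (LINT t|lebesgue_on {0..s}. R t (\<phi> t))"
proof -
  interpret U: seminormed "H1D \<Omega> \<Gamma>" "H1D_norm \<Omega>" by (rule seminormed_H1D)
  interpret D: seminormed "H1D_dual \<Omega> \<Gamma>" "H1D_dual_norm \<Omega> \<Gamma>" by (rule seminormed_H1D_dual)
  let ?M = "lebesgue_on {0..T}"
  define \<psi> where "\<psi> t = (if t \<le> s then \<phi> t else 0)" for t
  have "Measurable.pred ?M (\<lambda>t. t \<le> s)"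
  proof -
    have "{t \<in> space ?M. t \<le> s} = {0..s}" using s by auto
    then show ?thesis unfolding pred_def using s by (simp add: sets_restrict_space_iff)
  qed
  then have \<psi>: "\<psi> \<in> L2_H1D T \<Omega> \<Gamma>" unfolding \<psi>_def[abs_def] by (rule U.bochner_2_restrict[OF \<phi>])
  have tr: "(LINT t|?M. F t (\<psi> t)) = (LINT t|lebesgue_on {0..s}. F t (\<phi> t))" if F: "F \<in> L2_H1D_dual T \<Omega> \<Gamma>" for F
  proof (rule integral_truncate[OF dual_pairing(1)[OF F \<phi>] dual_pairing(1)[OF F \<psi>] _ s])
    have "AE t in ?M. F t \<in> H1D_dual \<Omega> \<Gamma>" using F by (simp add: D.bochner_2_iff)
    then show "AE t in ?M. F t (\<psi> t) = (if t \<le> s then F t (\<phi> t) else 0)"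
      by eventually_elim (simp add: \<psi>_def H1D_dual_0)
  qed
  have "flux_form (w0 t) (wi t) (\<psi> t) = (if t \<le> s then flux_form (w0 t) (wi t) (\<phi> t) else 0)" for t
  proof (cases "t \<le> s")
    case False
    have "AE x in lebesgue_on \<Omega>. flux (w0 t) (wi t) x \<bullet> weak_grad \<Omega> 0 x = 0"
      using weak_grad_0 by eventually_elim simp
    then have "flux_form (w0 t) (wi t) 0 = 0" unfolding flux_form_def by (rule integral_eq_zero_AE)
    then show ?thesis using False by (simp add: \<psi>_def)
  qed (simp add: \<psi>_def)
  then have "(LINT t|?M. flux_form (w0 t) (wi t) (\<psi> t)) = (LINT t|lebesgue_on {0..s}. flux_form (w0 t) (wi t) (\<phi> t))"
    by (intro integral_truncate fl \<phi> \<psi> s) simp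
  then show ?thesis using eq[OF \<psi>] tr[OF w'] tr[OF R] by simp
qed

lemma Lp_2_bochner_norm:
  "bochner_norm 2 T (Lp_norm 2 \<Omega>) (\<lambda>t. weak_grad \<Omega> (f t)) = bochner_norm 2 T (H1D_norm \<Omega>) f"
  by (simp add: bochner_norm_def H1D_norm_def)

lemma zero_in_L2_H1D_dual: "(\<lambda>t \<phi>. 0) \<in> L2_H1D_dual T \<Omega> \<Gamma>"
  using seminormed.simple_in_bochner_2[OF seminormed_H1D_dual, of T "\<lambda>_. 0"] H1D_dual_zero(1)
  by (simp add: zero_fun_def)

text \<open>Both conclusions come from one inequality for y(s) plus the integral of a majorant of
  the dissipation, by dropping one nonnegative summand each time. So C contains the initial value
  once and the factor 6/\<gamma>.\<close>

lemma stability_estimate: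
  fixes ui u0 vi v0 :: "real \<Rightarrow> 'a \<Rightarrow> real"
  assumes T: "0 < T"
    and reg: "ui \<in> L2_H1 T \<Omega>" "u0 \<in> L2_H1 T \<Omega>" "vi \<in> L2_H1 T \<Omega>" "v0 \<in> L2_H1 T \<Omega>"
    and cont: "continuous_L2 T \<Omega> ui" "continuous_L2 T \<Omega> vi"
    and W: "AE t in lebesgue_on {0..T}. ui t - vi t \<in> H1D \<Omega> \<Gamma>"
    and \<gamma>: "0 < \<gamma>" and v0: "AE t in lebesgue_on {0..T}. AE x in lebesgue_on \<Omega>. \<gamma> < v0 t x \<and> v0 t x \<le> 1"
    and vi: "AE t in lebesgue_on {0..T}. AE x in lebesgue_on \<Omega>. 0 \<le> vi t x \<and> vi t x \<le> 1"
    and K: "0 \<le> K" "AE t in lebesgue_on {0..T}. AE x in lebesgue_on \<Omega>.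
      \<bar>v0 t x - u0 t x\<bar> * norm (weak_grad \<Omega> (ui t) x) \<le> K * norm (weak_grad \<Omega> (ui t) x)"
    and pq: "2 < p" "2 < q" "1 / p + 1 / q = 1 / 2" and \<theta>: "0 < \<theta>" "\<theta> < 1"
    and gq: "(\<lambda>t. weak_grad \<Omega> (u0 t)) \<in> bochner_space (2 / (1 - \<theta>)) T (Lp_space q \<Omega>) (Lp_norm q \<Omega>)"
    and CF: "0 < CF" "\<forall>w \<in> H1D \<Omega> \<Gamma>. Lp_norm 2 \<Omega> w \<le> ennreal CF * Lp_norm 2 \<Omega> (weak_grad \<Omega> w)"
    and CG: "0 < CG" "\<forall>w \<in> H1 \<Omega>. Lp_norm p \<Omega> w \<le>
         ennreal CG * ennpowr (H1_norm \<Omega> w) \<theta> * ennpowr (Lp_norm 2 \<Omega> w) (1 - \<theta>)"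
    and R: "R \<in> L2_H1D_dual T \<Omega> \<Gamma>"
    and u': "u' \<in> L2_H1D_dual T \<Omega> \<Gamma>" "has_weak_time_derivative T \<Omega> \<Gamma> ui u'"
    and v': "v' \<in> L2_H1D_dual T \<Omega> \<Gamma>" "has_weak_time_derivative T \<Omega> \<Gamma> vi v'"
    and fu: "\<And>\<phi>. \<phi> \<in> L2_H1D T \<Omega> \<Gamma> \<Longrightarrow> AE t in lebesgue_on {0..T}.
        integrable (lebesgue_on \<Omega>) (\<lambda>x. flux (u0 t) (ui t) x \<bullet> weak_grad \<Omega> (\<phi> t) x)"
      "\<And>\<phi>. \<phi> \<in> L2_H1D T \<Omega> \<Gamma> \<Longrightarrow> integrable (lebesgue_on {0..T}) (\<lambda>t. flux_form (u0 t) (ui t) (\<phi> t))"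
    and fv: "\<And>\<phi>. \<phi> \<in> L2_H1D T \<Omega> \<Gamma> \<Longrightarrow> AE t in lebesgue_on {0..T}.
        integrable (lebesgue_on \<Omega>) (\<lambda>x. flux (v0 t) (vi t) x \<bullet> weak_grad \<Omega> (\<phi> t) x)"
      "\<And>\<phi>. \<phi> \<in> L2_H1D T \<Omega> \<Gamma> \<Longrightarrow> integrable (lebesgue_on {0..T}) (\<lambda>t. flux_form (v0 t) (vi t) (\<phi> t))"
    and equ: "\<And>\<phi>. \<phi> \<in> L2_H1D T \<Omega> \<Gamma> \<Longrightarrow>
       (LINT t|lebesgue_on {0..T}. u' t (\<phi> t)) + (LINT t|lebesgue_on {0..T}. flux_form (u0 t) (ui t) (\<phi> t)) =
       (LINT t|lebesgue_on {0..T}. R t (\<phi> t))"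
    and eqv: "\<And>\<phi>. \<phi> \<in> L2_H1D T \<Omega> \<Gamma> \<Longrightarrow>
       (LINT t|lebesgue_on {0..T}. v' t (\<phi> t)) + (LINT t|lebesgue_on {0..T}. flux_form (v0 t) (vi t) (\<phi> t)) = 0"
  defines "C \<equiv> (ip (ui 0 - vi 0) (ui 0 - vi 0) + 6 / \<gamma> *
        (K\<^sup>2 * (LINT t|lebesgue_on {0..T}. (grad_norm (ui t))\<^sup>2)
         + (LINT t|lebesgue_on {0..T}. (grad_norm (u0 t - v0 t))\<^sup>2)
         + (LINT t|lebesgue_on {0..T}. (dual_norm (R t))\<^sup>2))) *
      exp (2 * CG powr (2 / (1 - \<theta>)) * (1 + CF\<^sup>2) powr (\<theta> / (1 - \<theta>)) *
        ((1 - \<theta>) / 2 * (1 / (2 * (1 + \<theta>))) powr ((\<theta> + 1) / (\<theta> - 1)) / \<gamma> powr ((1 + \<theta>) / (1 - \<theta>))) *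
        enn2real (bochner_norm (2 / (1 - \<theta>)) T (Lp_norm q \<Omega>) (\<lambda>t. weak_grad \<Omega> (u0 t))) powr (2 / (1 - \<theta>)))"
  shows "\<forall>t\<in>{0..T}. ip (ui t - vi t) (ui t - vi t) \<le> C"
    and "(\<integral>\<^sup>+ t. (Lp_norm 2 \<Omega> (\<lambda>x. sqrt (v0 t x) *\<^sub>R weak_grad \<Omega> (ui t - vi t) x))\<^sup>2 \<partial>lebesgue_on {0..T}) \<le> ennreal C"
proof -
  interpret G: seminormed "H1 \<Omega>" "H1D_norm \<Omega>" by (rule seminormed_H1_grad)
  interpret D: seminormed "H1D_dual \<Omega> \<Gamma>" "H1D_dual_norm \<Omega> \<Gamma>" by (rule seminormed_H1D_dual)
  interpret Q: seminormed "Lp_space q \<Omega> :: ('a \<Rightarrow> 'a) set" "Lp_norm q \<Omega>" by (rule seminormed_Lp) (use pq in simp)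
  let ?M = "lebesgue_on {0..T}"
  have T0: "0 \<le> T" using T by simp
  define w where "w t = ui t - vi t" for t
  define w' where "w' t = u' t - v' t" for t
  define y where "y t = ip (w t) (w t)" for t
  have wV: "w \<in> L2_H1D T \<Omega> \<Gamma>" unfolding w_def[abs_def] by (rule L2_H1_diff_L2_H1D[OF reg(1,3) W])
  have wc: "continuous_L2 T \<Omega> w" unfolding w_def[abs_def] by (rule continuous_L2_diff[OF cont])
  have w'V: "w' \<in> L2_H1D_dual T \<Omega> \<Gamma>" unfolding w'_def[abs_def] by (rule D.bochner_2_diff[OF u'(1) v'(1)])
  have wd: "has_weak_time_derivative T \<Omega> \<Gamma> w w'"
    unfolding w_def[abs_def] w'_def[abs_def] by (rule has_weak_time_derivative_diff[OF cont(1) u' cont(2) v'])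
  have yc: "continuous_on {0..T} y" unfolding y_def[abs_def] by (rule continuous_on_ip_self[OF wc])
  have y0: "0 \<le> y t" for t unfolding y_def by (rule ip_self)
  define m where "m = (1 - \<theta>) / 2 * (1 / (2 * (1 + \<theta>))) powr ((\<theta> + 1) / (\<theta> - 1))"
  define r where "r = 2 / (1 - \<theta>)"
  have r: "0 < r" using \<theta> by (simp add: r_def)
  define X where "X t = enn2real (Lp_norm q \<Omega> (weak_grad \<Omega> (u0 t)))" for t
  define c1 where "c1 = 2 * CG powr r * (1 + CF\<^sup>2) powr (\<theta> / (1 - \<theta>)) * (m / \<gamma> powr ((1 + \<theta>) / (1 - \<theta>)))"
  define \<kappa> where "\<kappa> t = c1 * X t powr r" for t
  have m0: "0 \<le> m" using \<theta> by (simp add: m_def)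
  have c10: "0 \<le> c1" using m0 by (simp add: c1_def)
  have \<kappa>0: "0 \<le> \<kappa> t" for t using c10 by (simp add: \<kappa>_def)
  have Xp: "integrable ?M (\<lambda>t. X t powr r)"
     "(LINT t|?M. X t powr r) = enn2real (bochner_norm r T (Lp_norm q \<Omega>) (\<lambda>t. weak_grad \<Omega> (u0 t))) powr r"
    unfolding X_def by (rule Q.bochner_powr[OF r gq[folded r_def]])+
  have \<kappa>i: "integrable ?M \<kappa>" unfolding \<kappa>_def[abs_def] using Xp(1) by simp
  have \<kappa>int: "(LINT t|?M. \<kappa> t) = c1 * enn2real (bochner_norm r T (Lp_norm q \<Omega>) (\<lambda>t. weak_grad \<Omega> (u0 t))) powr r"
    unfolding \<kappa>_def[abs_def] using Xp(2) by simp
  \<comment> \<open>Raising the spatial constant to the power r = 2/(1-\<theta>) turns the exponents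
    \<theta>/2 and (1+\<theta>)/2 into \<theta>/(1-\<theta>) and (1+\<theta>)/(1-\<theta>). The
    result is the time density of the exponent in the claim.\<close>
  have \<kappa>_eq: "2 * (m * (CG * (1 + CF\<^sup>2) powr (\<theta> / 2) * X t / \<gamma> powr ((1 + \<theta>) / 2)) powr r) = \<kappa> t" for t
  proof -
    have e: "\<theta> / 2 * r = \<theta> / (1 - \<theta>)" "(1 + \<theta>) / 2 * r = (1 + \<theta>) / (1 - \<theta>)"
      using \<theta> by (simp_all add: r_def divide_simps) (simp add: algebra_simps)
    have "0 \<le> X t" by (simp add: X_def)
    then have "(CG * (1 + CF\<^sup>2) powr (\<theta> / 2) * X t / \<gamma> powr ((1 + \<theta>) / 2)) powr r =
        CG powr r * ((1 + CF\<^sup>2) powr (\<theta> / 2)) powr r * X t powr r / (\<gamma> powr ((1 + \<theta>) / 2)) powr r"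
      using CG(1) \<gamma> by (simp add: powr_mult powr_divide)
    also have "\<dots> = CG powr r * (1 + CF\<^sup>2) powr (\<theta> / (1 - \<theta>)) * X t powr r / \<gamma> powr ((1 + \<theta>) / (1 - \<theta>))"
      by (simp only: powr_powr e)
    finally show ?thesis by (simp add: \<kappa>_def c1_def)
  qed
  define A where "A = (LINT t|?M. (grad_norm (ui t))\<^sup>2)"
  define B where "B = (LINT t|?M. (grad_norm (u0 t - v0 t))\<^sup>2)"
  define E where "E = (LINT t|?M. (dual_norm (R t))\<^sup>2)"
  have ABi: "integrable ?M (\<lambda>t. (grad_norm (ui t))\<^sup>2)" "integrable ?M (\<lambda>t. (grad_norm (u0 t - v0 t))\<^sup>2)"
    "integrable ?M (\<lambda>t. (dual_norm (R t))\<^sup>2)"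
    using L2_H1_grad[OF reg(1)] G.bochner_2_diff[OF L2_H1_grad[OF reg(2)] L2_H1_grad[OF reg(4)]] R
    by (auto simp: G.bochner_2_iff D.bochner_2_iff)
  define \<Sigma> where "\<Sigma> t = 6 / \<gamma> * (K\<^sup>2 * (grad_norm (ui t))\<^sup>2 + (grad_norm (u0 t - v0 t))\<^sup>2 + (dual_norm (R t))\<^sup>2)" for t
  have \<Sigma>i: "integrable ?M \<Sigma>" unfolding \<Sigma>_def[abs_def] using ABi by simp
  have \<Sigma>0: "0 \<le> \<Sigma> t" for t using \<gamma> by (simp add: \<Sigma>_def)
  have \<Sigma>int: "(LINT t|?M. \<Sigma> t) = 6 / \<gamma> * (K\<^sup>2 * A + B + E)"
    unfolding \<Sigma>_def[abs_def] A_def B_def E_def using ABi by simp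
  define Z where "Z t = R t (w t) - (flux_form (u0 t) (ui t) (w t) - flux_form (v0 t) (vi t) (w t))" for t
  note pair = dual_pairing(1)[OF R wV] fu(2)[OF wV] fv(2)[OF wV]
  have Zi: "integrable ?M Z" unfolding Z_def[abs_def] using pair by simp
  \<comment> \<open>\<open>g\<close> is an integrable majorant of the dissipation, whose own measurability in \<open>t\<close> is thus not needed.\<close>
  define g where "g t = \<kappa> t * y t + \<Sigma> t - 2 * Z t" for t
  have \<kappa>yi: "integrable ?M (\<lambda>t. \<kappa> t * y t)" by (rule integrable_mult_continuous[OF \<kappa>i yc])
  have gi: "integrable ?M g" unfolding g_def[abs_def] using \<kappa>yi \<Sigma>i Zi by simp
  let ?N = "\<lambda>t. (Lp_norm 2 \<Omega> (\<lambda>x. sqrt (v0 t x) *\<^sub>R weak_grad \<Omega> (ui t - vi t) x))\<^sup>2"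
  have est: "AE t in ?M. \<exists>h\<ge>0. ?N t = ennreal h \<and> h \<le> g t"
  proof -
    have mem: "AE t in ?M. ui t \<in> H1 \<Omega>" "AE t in ?M. u0 t \<in> H1 \<Omega>" "AE t in ?M. vi t \<in> H1 \<Omega>"
      "AE t in ?M. v0 t \<in> H1 \<Omega>" "AE t in ?M. weak_grad \<Omega> (u0 t) \<in> Lp_space q \<Omega>" "AE t in ?M. R t \<in> H1D_dual \<Omega> \<Gamma>"
      using reg gq R by (auto simp: bochner_space_def)
    from mem W v0 vi K(2) fu(1)[OF wV] fv(1)[OF wV] show ?thesis
    proof eventually_elim
      case (elim t)
      have "2 * (m * (CG * (1 + CF\<^sup>2) powr (\<theta> / 2) * X t / \<gamma> powr ((1 + \<theta>) / 2)) powr r) * ip (w t) (w t)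
          + 6 / \<gamma> * (K\<^sup>2 * (grad_norm (ui t))\<^sup>2 + (grad_norm (u0 t - v0 t))\<^sup>2 + (dual_norm (R t))\<^sup>2)
          - 2 * (R t (w t) - (flux_form (u0 t) (ui t) (w t) - flux_form (v0 t) (vi t) (w t))) = g t"
        unfolding \<kappa>_eq by (simp only: g_def \<Sigma>_def Z_def y_def)
      then show ?case
        using spatial_estimate[OF elim(1-4) elim(7) \<gamma> elim(8,9) K(1) elim(10) pq \<theta> elim(5) CF CG
          elim(11)[unfolded w_def] elim(12)[unfolded w_def] elim(6)]
        unfolding w_def m_def r_def X_def by simp
    qed
  qed
  have g0: "AE t in ?M. 0 \<le> g t" using est by eventually_elim auto
  \<comment> \<open>The equations tested with w on [0,s] identify the integral of Z with that of
    \<open>w' t (w t)\<close>. The energy inequality then removes Z, whose sign is unknown.\<close>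
  have en: "y s + (LINT t|lebesgue_on {0..s}. g t) \<le> y 0 + (LINT t|lebesgue_on {0..s}. \<Sigma> t) + (LINT t|lebesgue_on {0..s}. \<kappa> t * y t)"
    if s: "0 \<le> s" "s \<le> T" for s
  proof -
    let ?S = "lebesgue_on {0..s}"
    have sub: "integrable ?S f" if "integrable ?M f" for f :: "real \<Rightarrow> real"
      by (rule integrable_subinterval[OF that]) (use s in auto)
    note si = sub[OF dual_pairing(1)[OF u'(1) wV]] sub[OF dual_pairing(1)[OF v'(1) wV]] sub[OF pair(1)] sub[OF pair(2)] sub[OF pair(3)]
    have "y s - y 0 \<le> 2 * (LINT t|?S. w' t (w t))"
      unfolding y_def by (rule energy_inequality[OF T wc wV w'V wd s])
    also have "(LINT t|?S. w' t (w t)) = (LINT t|?S. u' t (w t)) - (LINT t|?S. v' t (w t))"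
      using si by (simp add: w'_def)
    also have "\<dots> = (LINT t|?S. R t (w t)) - (LINT t|?S. flux_form (u0 t) (ui t) (w t)) + (LINT t|?S. flux_form (v0 t) (vi t) (w t))"
      using tested_equation[OF u'(1) R fu(2) equ wV s] tested_equation[OF v'(1) zero_in_L2_H1D_dual fv(2) _ wV s] eqv by simp
    also have "\<dots> = (LINT t|?S. Z t)" unfolding Z_def[abs_def] using si by simp
    finally have "y s - y 0 \<le> 2 * (LINT t|?S. Z t)" .
    moreover have "(LINT t|?S. g t) = (LINT t|?S. \<kappa> t * y t) + (LINT t|?S. \<Sigma> t) - 2 * (LINT t|?S. Z t)"
      unfolding g_def[abs_def] using sub[OF \<kappa>yi] sub[OF \<Sigma>i] sub[OF Zi] by simp
    ultimately show ?thesis by linarith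
  qed
  define c where "c = y 0 + 6 / \<gamma> * (K\<^sup>2 * A + B + E)"
  have \<Sigma>le: "(LINT t|lebesgue_on {0..s}. \<Sigma> t) \<le> 6 / \<gamma> * (K\<^sup>2 * A + B + E)" if "0 \<le> s" "s \<le> T" for s
    using indefinite_integral_properties(2)[OF \<Sigma>i \<Sigma>0 T0, of s T] that \<Sigma>int by simp
  have gpos: "0 \<le> (LINT t|lebesgue_on {0..s}. g t)" if "0 \<le> s" "s \<le> T" for s
  proof (rule integral_nonneg_AE)
    show "AE t in lebesgue_on {0..s}. 0 \<le> g t"
      using g0 that by (simp add: AE_restrict_space_iff) (auto elim!: eventually_mono)
  qed
  have yb: "y s \<le> c + (LINT t|lebesgue_on {0..s}. \<kappa> t * y t)" if "0 \<le> s" "s \<le> T" for s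
    using en[OF that] \<Sigma>le[OF that] gpos[OF that] unfolding c_def by linarith
  have c0: "0 \<le> c"
  proof -
    have "0 \<le> 6 / \<gamma> * (K\<^sup>2 * A + B + E)" using \<Sigma>0 unfolding \<Sigma>int[symmetric] by simp
    then show ?thesis using y0[of 0] by (simp add: c_def)
  qed
  have C: "C = c * exp (LINT t|?M. \<kappa> t)"
    unfolding C_def c_def \<kappa>int c1_def r_def m_def A_def B_def E_def y_def w_def by (simp only: mult.assoc)
  have gr: "c + (LINT t|?M. \<kappa> t * y t) \<le> C" unfolding C by (rule Gronwall[OF \<kappa>i \<kappa>0 yc y0 c0 T0 yb])
  have \<kappa>y0: "0 \<le> \<kappa> t * y t" for t using \<kappa>0 y0 by simp
  have "y t \<le> C" if "t \<in> {0..T}" for t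
    using yb[of t] gr indefinite_integral_properties(2)[OF \<kappa>yi \<kappa>y0 T0, of t T] that by simp
  then show "\<forall>t\<in>{0..T}. ip (ui t - vi t) (ui t - vi t) \<le> C" by (simp add: y_def w_def)
  have gC: "(LINT t|?M. g t) \<le> C"
    using en[of T] \<Sigma>le[of T] T0 gr y0[of T] unfolding c_def by linarith
  have "(\<integral>\<^sup>+ t. ?N t \<partial>?M) \<le> (\<integral>\<^sup>+ t. ennreal (g t) \<partial>?M)"
    by (rule nn_integral_mono_AE) (use est in \<open>auto elim!: eventually_mono intro: ennreal_leI\<close>)
  also have "\<dots> = ennreal (LINT t|?M. g t)"
    by (rule nn_integral_eq_integral[OF gi g0])
  also have "\<dots> \<le> ennreal C" by (rule ennreal_leI[OF gC])
  finally show "(\<integral>\<^sup>+ t. ?N t \<partial>?M) \<le> ennreal C" .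
qed

end

theorem theorem5p3:
  fixes \<Omega> \<Gamma>\<^sub>D \<Gamma>\<^sub>N :: "(real ^ 'd) set"
    and n :: nat
    and T \<gamma> p q \<theta> \<mu> C\<^sub>F C\<^sub>G :: real
    and vD vI uI :: "nat \<Rightarrow> real ^ 'd \<Rightarrow> real"
    and v u :: "nat \<Rightarrow> real \<Rightarrow> real ^ 'd \<Rightarrow> real"
    and R :: "nat \<Rightarrow> real \<Rightarrow> (real ^ 'd \<Rightarrow> real) \<Rightarrow> real"
  assumes dim: "CARD('d) \<in> {2, 3}"
    and T: "0 < T"
    and domain: "mixed_boundary_domain \<Omega> \<Gamma>\<^sub>D \<Gamma>\<^sub>N"
    and vI_reg: "\<forall>i\<le>n. vI i \<in> Linf_space \<Omega> \<inter> H1 \<Omega>"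
    and vI_pos: "\<forall>i\<in>{1..n}. AE x in lebesgue_on \<Omega>. 0 < vI i x"
    and vI_sum: "AE x in lebesgue_on \<Omega>. (\<Sum>i\<le>n. vI i x) = 1"
    and vD_const: "\<forall>i\<le>n. \<forall>C \<in> components \<Gamma>\<^sub>D. vD i constant_on C"
    and \<gamma>: "0 < \<gamma>"
    and vI_0: "AE x in lebesgue_on \<Omega>. \<gamma> < vI 0 x \<and> vI 0 x \<le> 1"
    and v_0: "AE (t, x) in lebesgue_on ({0..T} \<times> \<Omega>). \<gamma> < v 0 t x \<and> v 0 t x \<le> 1"
    and v_sol: "weak_solution T \<Omega> \<Gamma>\<^sub>D n vD vI (\<lambda>i t \<phi>. 0) v"
    and v_range: "\<forall>i\<le>n. AE (t, x) in lebesgue_on ({0..T} \<times> \<Omega>). 0 \<le> v i t x \<and> v i t x \<le> 1"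
    and R: "\<forall>i\<in>{1..n}. R i \<in> L2_H1D_dual T \<Omega> \<Gamma>\<^sub>D"
    and u_sol: "weak_solution T \<Omega> \<Gamma>\<^sub>D n vD uI R u"
    and q: "real CARD('d) < q"
    and grad_u0: "(\<lambda>t. weak_grad \<Omega> (u 0 t)) \<in> Xq_space q T \<Omega>"
    and p: "1 / p + 1 / q = 1 / 2"
    and \<theta>: "\<theta> = real CARD('d) / 2 - real CARD('d) / p"
    and \<mu>: "\<mu> = (1 - \<theta>) / 2 * (1 / (2 * (1 + \<theta>))) powr ((\<theta> + 1) / (\<theta> - 1))"
    and C\<^sub>F: "0 < C\<^sub>F"
      "\<forall>w \<in> H1D \<Omega> \<Gamma>\<^sub>D. Lp_norm 2 \<Omega> w \<le> ennreal C\<^sub>F * Lp_norm 2 \<Omega> (weak_grad \<Omega> w)"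
    and C\<^sub>G: "0 < C\<^sub>G"
      "\<forall>w \<in> H1 \<Omega>. Lp_norm p \<Omega> w \<le>
         ennreal C\<^sub>G * ennpowr (H1_norm \<Omega> w) \<theta> * ennpowr (Lp_norm 2 \<Omega> w) (1 - \<theta>)"
  shows "\<forall>i\<in>{1..n}. \<exists>\<tau>\<in>{0..T}.
     (\<forall>t\<in>{0..T}. (Lp_norm 2 \<Omega> (u i t - v i t))\<^sup>2 \<le> (Lp_norm 2 \<Omega> (u i \<tau> - v i \<tau>))\<^sup>2) \<and>
     (Lp_norm 2 \<Omega> (u i \<tau> - v i \<tau>))\<^sup>2 +
     (\<integral>\<^sup>+ t. (Lp_norm 2 \<Omega> (\<lambda>x. sqrt (v 0 t x) *\<^sub>R weak_grad \<Omega> (u i t - v i t) x))\<^sup>2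
        \<partial>lebesgue_on {0..T})
     \<le> (2 * (Lp_norm 2 \<Omega> (uI i - vI i))\<^sup>2
        + ennreal (12 / \<gamma>) * (Linf_norm ({0..T} \<times> \<Omega>) (\<lambda>(t, x). v 0 t x - u 0 t x))\<^sup>2
            * (L2_L2_norm T \<Omega> (\<lambda>t. weak_grad \<Omega> (u i t)))\<^sup>2
        + ennreal (12 / \<gamma>) * (L2_L2_norm T \<Omega> (\<lambda>t. weak_grad \<Omega> (u 0 t - v 0 t)))\<^sup>2
        + ennreal (12 / \<gamma>) * (bochner_norm 2 T (H1D_dual_norm \<Omega> \<Gamma>\<^sub>D) (R i))\<^sup>2)
       * ennreal (exp (2 * C\<^sub>G powr (2 / (1 - \<theta>)) * (1 + C\<^sub>F\<^sup>2) powr (\<theta> / (1 - \<theta>))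
           * (\<mu> / \<gamma> powr ((1 + \<theta>) / (1 - \<theta>)))
           * enn2real (Xq_norm q T \<Omega> (\<lambda>t. weak_grad \<Omega> (u 0 t))) powr (2 / (1 - \<theta>))))"
proof
  fix i assume i: "i \<in> {1..n}"
  then have i0: "i \<le> n" "0 \<le> n" by auto
  interpret dirichlet_domain \<Omega> \<Gamma>\<^sub>D by (rule dirichlet_domain_of_mixed[OF domain])
  interpret G: seminormed "H1 \<Omega>" "H1D_norm \<Omega>" by (rule seminormed_H1_grad)
  interpret D: seminormed "H1D_dual \<Omega> \<Gamma>\<^sub>D" "H1D_dual_norm \<Omega> \<Gamma>\<^sub>D" by (rule seminormed_H1D_dual)
  let ?M = "lebesgue_on {0..T}"
  let ?L = "Linf_norm ({0..T} \<times> \<Omega>) (\<lambda>(t, x). v 0 t x - u 0 t x)"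
  have d2: "2 \<le> real CARD('d)" using dim by auto
  have pq: "2 < p" "2 < q"
  proof -
    show q2: "2 < q" using d2 q by linarith
    then have iq: "0 < 1 / q" "1 / q < 1 / 2" by (auto simp: field_simps)
    then have ip: "0 < 1 / p" "1 / p < 1 / 2" using p by linarith+
    then have "0 < p" by (simp add: zero_less_divide_iff)
    then show "2 < p" using ip(2) by (simp add: field_simps)
  qed
  \<comment> \<open>Expressed through q, the interpolation exponent is d/q, so that q > d amounts to
    \<theta> < 1.\<close>
  have \<theta>q: "\<theta> = real CARD('d) / q"
  proof -
    have "\<theta> = real CARD('d) * (1 / 2 - 1 / p)" by (simp add: \<theta> right_diff_distrib)
    also have "1 / 2 - 1 / p = 1 / q" using p by linarith
    finally show ?thesis by simp
  qed
  have \<theta>01: "0 < \<theta>" "\<theta> < 1" using d2 q pq by (auto simp: \<theta>q)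
  \<comment> \<open>The time exponent of X(q) is the power that Young's inequality puts on the
    gradient of \<open>u 0\<close>, which is why this space makes the Gronwall coefficient
    integrable.\<close>
  have expo: "2 * q / (q - real DIM(real ^ 'd)) = 2 / (1 - \<theta>)"
    using q pq by (simp add: \<theta>q field_simps)
  have gq: "(\<lambda>t. weak_grad \<Omega> (u 0 t)) \<in> bochner_space (2 / (1 - \<theta>)) T (Lp_space q \<Omega>) (Lp_norm q \<Omega>)"
    using grad_u0 unfolding Xq_space_def expo .
  have Xq: "Xq_norm q T \<Omega> (\<lambda>t. weak_grad \<Omega> (u 0 t)) =
      bochner_norm (2 / (1 - \<theta>)) T (Lp_norm q \<Omega>) (\<lambda>t. weak_grad \<Omega> (u 0 t))"
    unfolding Xq_norm_def expo ..
  have sol: "w j \<in> L2_H1 T \<Omega>" "continuous_L2 T \<Omega> (w j)" "AE x in lebesgue_on \<Omega>. w j 0 x = wI j x"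
      "AE t in ?M. has_trace \<Omega> \<Gamma>\<^sub>D (w j t) (vD j)"
    if "weak_solution T \<Omega> \<Gamma>\<^sub>D n vD wI S w" "j \<le> n" for w wI S j
    using that unfolding weak_solution_def by blast+
  note reg = sol(1)[OF u_sol i0(1)] sol(1)[OF u_sol i0(2)] sol(1)[OF v_sol i0(1)] sol(1)[OF v_sol i0(2)]
  note cont = sol(2)[OF u_sol i0(1)] sol(2)[OF v_sol i0(1)]
  have W: "AE t in ?M. u i t - v i t \<in> H1D \<Omega> \<Gamma>\<^sub>D"
    using sol(4)[OF u_sol i0(1)] sol(4)[OF v_sol i0(1)] by eventually_elim (rule has_trace_diff)
  have \<Omega>b: "{0..T} \<in> sets borel" "\<Omega> \<in> sets borel" using open_domain by auto
  have v0: "AE t in ?M. AE x in lebesgue_on \<Omega>. \<gamma> < v 0 t x \<and> v 0 t x \<le> 1"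
    by (rule AE_lebesgue_on_Times[OF \<Omega>b v_0])
  have vi: "AE t in ?M. AE x in lebesgue_on \<Omega>. 0 \<le> v i t x \<and> v i t x \<le> 1"
    by (rule AE_lebesgue_on_Times[OF \<Omega>b]) (use v_range i0 in blast)
  define y where "y t = ip (u i t - v i t) (u i t - v i t)" for t
  have yN: "(Lp_norm 2 \<Omega> (u i t - v i t))\<^sup>2 = ennreal (y t)" if "t \<in> {0..T}" for t
    unfolding y_def
    by (rule Lp_norm_2_square_ip[OF continuous_L2D(1)[OF continuous_L2_diff[OF cont] that]])
  have y0: "0 \<le> y t" for t unfolding y_def by (rule ip_self)
  have yc: "continuous_on {0..T} y"
    unfolding y_def by (rule continuous_on_ip_self[OF continuous_L2_diff[OF cont]])
  \<comment> \<open>The maximum over [0,T] is attained because the squared norm of the difference is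
    continuous in time.\<close>
  obtain \<tau> where \<tau>: "\<tau> \<in> {0..T}" "\<forall>t\<in>{0..T}. y t \<le> y \<tau>"
    using continuous_attains_sup[OF compact_Icc _ yc] T by auto
  \<comment> \<open>The prescribed initial functions agree with the values at time 0 only almost
    everywhere, which the norm does not see.\<close>
  have init: "(Lp_norm 2 \<Omega> (uI i - vI i))\<^sup>2 = ennreal (y 0)"
  proof -
    have "Lp_norm 2 \<Omega> (uI i - vI i) = Lp_norm 2 \<Omega> (u i 0 - v i 0)"
      by (rule Lp_norm_cong_AE)
        (use sol(3)[OF u_sol i0(1)] sol(3)[OF v_sol i0(1)] in \<open>eventually_elim, simp\<close>)
    then show ?thesis using yN[of 0] T by simp
  qed
  define A where "A = (LINT t|?M. (grad_norm (u i t))\<^sup>2)"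
  define B where "B = (LINT t|?M. (grad_norm (u 0 t - v 0 t))\<^sup>2)"
  define E where "E = (LINT t|?M. (dual_norm (R i t))\<^sup>2)"
  have ABE: "0 \<le> A" "0 \<le> B" "0 \<le> E" by (simp_all add: A_def B_def E_def)
  have Ri: "R i \<in> L2_H1D_dual T \<Omega> \<Gamma>\<^sub>D" using R i by blast
  have A: "(L2_L2_norm T \<Omega> (\<lambda>t. weak_grad \<Omega> (u i t)))\<^sup>2 = ennreal A"
    unfolding Lp_2_bochner_norm A_def by (rule G.bochner_norm_2_square[OF L2_H1_grad[OF reg(1)]])
  have B: "(L2_L2_norm T \<Omega> (\<lambda>t. weak_grad \<Omega> (u 0 t - v 0 t)))\<^sup>2 = ennreal B"
    unfolding Lp_2_bochner_norm B_def
    by (rule G.bochner_norm_2_square[OF G.bochner_2_diff[OF L2_H1_grad[OF reg(2)] L2_H1_grad[OF reg(4)]]])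
  have E: "(bochner_norm 2 T (H1D_dual_norm \<Omega> \<Gamma>\<^sub>D) (R i))\<^sup>2 = ennreal E"
    unfolding E_def by (rule D.bochner_norm_2_square[OF Ri])
  define \<epsilon> where "\<epsilon> = exp (2 * C\<^sub>G powr (2 / (1 - \<theta>)) * (1 + C\<^sub>F\<^sup>2) powr (\<theta> / (1 - \<theta>))
           * (\<mu> / \<gamma> powr ((1 + \<theta>) / (1 - \<theta>)))
           * enn2real (Xq_norm q T \<Omega> (\<lambda>t. weak_grad \<Omega> (u 0 t))) powr (2 / (1 - \<theta>)))"
  let ?I = "\<integral>\<^sup>+ t. (Lp_norm 2 \<Omega> (\<lambda>x. sqrt (v 0 t x) *\<^sub>R weak_grad \<Omega> (u i t - v i t) x))\<^sup>2 \<partial>?M"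
  have main: "ennreal (y \<tau>) + ?I \<le> (2 * ennreal (y 0) + ennreal (12 / \<gamma>) * ?L\<^sup>2 * ennreal A
      + ennreal (12 / \<gamma>) * ennreal B + ennreal (12 / \<gamma>) * ennreal E) * ennreal \<epsilon>"
  \<comment> \<open>If \<open>u 0\<close> is unbounded and \<open>\<nabla>(u i) = 0\<close>, the corresponding term on the right is \<open>\<infinity> * 0 = 0\<close>, which is still
    correct since \<open>K = 0\<close> is then admissible.\<close>
  proof (cases "?L = top \<and> A \<noteq> 0")
    case True
    then have "ennreal (12 / \<gamma>) * ?L\<^sup>2 * ennreal A = top"
      using \<gamma> ABE by (simp add: ennreal_mult_top ennreal_top_mult)
    then show ?thesis by (simp add: \<epsilon>_def ennreal_top_mult)
  next
    case False
    \<comment> \<open>A real number K takes the place of the supremum norm in the estimates; only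
      its product with A is compared with the right-hand side.\<close>
    have "\<exists>K\<ge>0. (AE t in ?M. AE x in lebesgue_on \<Omega>.
        \<bar>v 0 t x - u 0 t x\<bar> * norm (weak_grad \<Omega> (u i t) x) \<le> K * norm (weak_grad \<Omega> (u i t) x)) \<and>
        ennreal (12 / \<gamma> * (K\<^sup>2 * A)) \<le> ennreal (12 / \<gamma>) * ?L\<^sup>2 * ennreal A"
    proof (cases "?L = top")
      case True
      then have "A = 0" using False by simp
      then have "AE t in ?M. (grad_norm (u i t))\<^sup>2 = 0"
        using L2_H1_grad[OF reg(1)] unfolding A_def
        by (subst (asm) integral_nonneg_eq_0_iff_AE) (auto simp: G.bochner_2_iff)
      moreover have "AE t in ?M. u i t \<in> H1 \<Omega>" using reg(1) by (simp add: bochner_space_def)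
      ultimately have "AE t in ?M. AE x in lebesgue_on \<Omega>. weak_grad \<Omega> (u i t) x = 0"
      proof eventually_elim
        case (elim t)
        then have "H1D_norm \<Omega> (u i t) = 0" using H1D_norm_finite[of "u i t"] by (auto simp: enn2real_eq_0_iff)
        then show ?case
          using Lp_space_measurable[OF weak_grad(1)[OF elim(2)]] unfolding H1D_norm_def
          by (subst (asm) Lp_norm_eq_0_iff) auto
      qed
      then have "AE t in ?M. AE x in lebesgue_on \<Omega>.
        \<bar>v 0 t x - u 0 t x\<bar> * norm (weak_grad \<Omega> (u i t) x) \<le> 0 * norm (weak_grad \<Omega> (u i t) x)"
        by (rule eventually_mono) (auto elim: eventually_mono)
      then show ?thesis by (intro exI[of _ 0]) simp
    next
      case False
      define K where "K = enn2real ?L"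
      have K: "?L = ennreal K" "0 \<le> K" using False by (simp_all add: K_def less_top)
      have "AE z in lebesgue_on ({0..T} \<times> \<Omega>). ennreal (norm ((\<lambda>(t, x). v 0 t x - u 0 t x) z)) \<le> ennreal K"
        unfolding K(1)[symmetric] Linf_norm_def by (rule esssup_AE)
      then have "AE (t, x) in lebesgue_on ({0..T} \<times> \<Omega>). \<bar>v 0 t x - u 0 t x\<bar> \<le> K"
        using K(2) by (auto elim!: eventually_mono)
      from AE_lebesgue_on_Times[OF \<Omega>b this]
      have "AE t in ?M. AE x in lebesgue_on \<Omega>.
        \<bar>v 0 t x - u 0 t x\<bar> * norm (weak_grad \<Omega> (u i t) x) \<le> K * norm (weak_grad \<Omega> (u i t) x)"
        by (rule eventually_mono) (auto elim!: eventually_mono intro: mult_right_mono)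
      moreover have "ennreal (12 / \<gamma> * (K\<^sup>2 * A)) = ennreal (12 / \<gamma>) * ?L\<^sup>2 * ennreal A"
        unfolding K(1) using K(2) \<gamma> ABE by (simp add: ennreal_mult'' ennreal_power mult.assoc del: times_divide_eq_left)
      ultimately show ?thesis using K(2) by auto
    qed
    then obtain K where K: "0 \<le> K" "AE t in ?M. AE x in lebesgue_on \<Omega>.
        \<bar>v 0 t x - u 0 t x\<bar> * norm (weak_grad \<Omega> (u i t) x) \<le> K * norm (weak_grad \<Omega> (u i t) x)"
        "ennreal (12 / \<gamma> * (K\<^sup>2 * A)) \<le> ennreal (12 / \<gamma>) * ?L\<^sup>2 * ennreal A" by blast
    obtain u' where u': "\<And>i. i \<le> n \<Longrightarrow> u' i \<in> L2_H1D_dual T \<Omega> \<Gamma>\<^sub>D"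
      "\<And>i. i \<le> n \<Longrightarrow> has_weak_time_derivative T \<Omega> \<Gamma>\<^sub>D (u i) (u' i)"
      "\<And>i \<phi>. i \<in> {1..n} \<Longrightarrow> \<phi> \<in> L2_H1D T \<Omega> \<Gamma>\<^sub>D \<Longrightarrow>
         AE t in ?M. integrable (lebesgue_on \<Omega>) (\<lambda>x. flux (u 0 t) (u i t) x \<bullet> weak_grad \<Omega> (\<phi> t) x)"
      "\<And>i \<phi>. i \<in> {1..n} \<Longrightarrow> \<phi> \<in> L2_H1D T \<Omega> \<Gamma>\<^sub>D \<Longrightarrow> integrable ?M (\<lambda>t. flux_form (u 0 t) (u i t) (\<phi> t))"
      "\<And>i \<phi>. i \<in> {1..n} \<Longrightarrow> \<phi> \<in> L2_H1D T \<Omega> \<Gamma>\<^sub>D \<Longrightarrow>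
         (LINT t|?M. u' i t (\<phi> t)) + (LINT t|?M. flux_form (u 0 t) (u i t) (\<phi> t)) = (LINT t|?M. R i t (\<phi> t))"
      using weak_solutionE[OF u_sol] by blast
    obtain v' where v': "\<And>i. i \<le> n \<Longrightarrow> v' i \<in> L2_H1D_dual T \<Omega> \<Gamma>\<^sub>D"
      "\<And>i. i \<le> n \<Longrightarrow> has_weak_time_derivative T \<Omega> \<Gamma>\<^sub>D (v i) (v' i)"
      "\<And>i \<phi>. i \<in> {1..n} \<Longrightarrow> \<phi> \<in> L2_H1D T \<Omega> \<Gamma>\<^sub>D \<Longrightarrow>
         AE t in ?M. integrable (lebesgue_on \<Omega>) (\<lambda>x. flux (v 0 t) (v i t) x \<bullet> weak_grad \<Omega> (\<phi> t) x)"
      "\<And>i \<phi>. i \<in> {1..n} \<Longrightarrow> \<phi> \<in> L2_H1D T \<Omega> \<Gamma>\<^sub>D \<Longrightarrow> integrable ?M (\<lambda>t. flux_form (v 0 t) (v i t) (\<phi> t))"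
      "\<And>i \<phi>. i \<in> {1..n} \<Longrightarrow> \<phi> \<in> L2_H1D T \<Omega> \<Gamma>\<^sub>D \<Longrightarrow>
         (LINT t|?M. v' i t (\<phi> t)) + (LINT t|?M. flux_form (v 0 t) (v i t) (\<phi> t)) = (LINT t|?M. 0)"
      using weak_solutionE[OF v_sol] by blast
    have eqv: "(LINT t|?M. v' i t (\<phi> t)) + (LINT t|?M. flux_form (v 0 t) (v i t) (\<phi> t)) = 0"
      if "\<phi> \<in> L2_H1D T \<Omega> \<Gamma>\<^sub>D" for \<phi>
      using v'(5)[OF i that] by simp
    \<comment> \<open>c bounds the maximum and the integrated dissipation separately; their sum is
      therefore estimated by c + c.\<close>
    define c where "c = (y 0 + 6 / \<gamma> * (K\<^sup>2 * A + B + E)) * \<epsilon>"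
    note est = stability_estimate[OF T reg cont W \<gamma> v0 vi K(1,2) pq p \<theta>01 gq C\<^sub>F C\<^sub>G Ri
        u'(1,2)[OF i0(1)] v'(1,2)[OF i0(1)] u'(3,4)[OF i] v'(3,4)[OF i] u'(5)[OF i] eqv,
        folded \<mu> Xq y_def A_def B_def E_def, folded \<epsilon>_def, folded c_def]
    have c0: "0 \<le> c" using ABE y0 \<gamma> by (simp add: c_def \<epsilon>_def)
    have "y \<tau> \<le> c" using est(1) \<tau>(1) by blast
    from add_mono[OF ennreal_leI[OF this] est(2)]
    have "ennreal (y \<tau>) + ?I \<le> ennreal c + ennreal c" .
    also have "\<dots> = ennreal (c + c)" by (rule ennreal_plus[OF c0 c0, symmetric])
    also have "c + c = (2 * y 0 + 12 / \<gamma> * (K\<^sup>2 * A) + 12 / \<gamma> * B + 12 / \<gamma> * E) * \<epsilon>"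
      by (simp add: c_def algebra_simps)
    also have "ennreal \<dots> = (2 * ennreal (y 0) + ennreal (12 / \<gamma> * (K\<^sup>2 * A)) + ennreal (12 / \<gamma>) * ennreal B
        + ennreal (12 / \<gamma>) * ennreal E) * ennreal \<epsilon>"
    proof -
      have n: "0 \<le> 2 * y 0" "0 \<le> 12 / \<gamma> * (K\<^sup>2 * A)" "0 \<le> 12 / \<gamma> * B" "0 \<le> 12 / \<gamma> * E" "0 \<le> 12 / \<gamma>" "0 \<le> \<epsilon>"
        using y0[of 0] \<gamma> ABE by (simp_all add: \<epsilon>_def)
      have "ennreal (2 * y 0) = 2 * ennreal (y 0)" using y0[of 0] by (simp add: ennreal_mult)
      then show ?thesis
        using n ennreal_mult[OF n(5) ABE(2)] ennreal_mult[OF n(5) ABE(3)]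
        by (simp only: ennreal_mult[of "_ + _"] ennreal_plus add_nonneg_nonneg)
    qed
    also have "\<dots> \<le> (2 * ennreal (y 0) + ennreal (12 / \<gamma>) * ?L\<^sup>2 * ennreal A + ennreal (12 / \<gamma>) * ennreal B
        + ennreal (12 / \<gamma>) * ennreal E) * ennreal \<epsilon>"
      by (intro mult_right_mono add_mono order_refl K(3)) simp
    finally show ?thesis .
  qed
  show "\<exists>\<tau>\<in>{0..T}.
     (\<forall>t\<in>{0..T}. (Lp_norm 2 \<Omega> (u i t - v i t))\<^sup>2 \<le> (Lp_norm 2 \<Omega> (u i \<tau> - v i \<tau>))\<^sup>2) \<and>
     (Lp_norm 2 \<Omega> (u i \<tau> - v i \<tau>))\<^sup>2 + ?I
     \<le> (2 * (Lp_norm 2 \<Omega> (uI i - vI i))\<^sup>2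
        + ennreal (12 / \<gamma>) * ?L\<^sup>2 * (L2_L2_norm T \<Omega> (\<lambda>t. weak_grad \<Omega> (u i t)))\<^sup>2
        + ennreal (12 / \<gamma>) * (L2_L2_norm T \<Omega> (\<lambda>t. weak_grad \<Omega> (u 0 t - v 0 t)))\<^sup>2
        + ennreal (12 / \<gamma>) * (bochner_norm 2 T (H1D_dual_norm \<Omega> \<Gamma>\<^sub>D) (R i))\<^sup>2)
       * ennreal (exp (2 * C\<^sub>G powr (2 / (1 - \<theta>)) * (1 + C\<^sub>F\<^sup>2) powr (\<theta> / (1 - \<theta>))
           * (\<mu> / \<gamma> powr ((1 + \<theta>) / (1 - \<theta>)))
           * enn2real (Xq_norm q T \<Omega> (\<lambda>t. weak_grad \<Omega> (u 0 t))) powr (2 / (1 - \<theta>))))"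
  proof (intro bexI[OF _ \<tau>(1)] conjI ballI)
    show "(Lp_norm 2 \<Omega> (u i t - v i t))\<^sup>2 \<le> (Lp_norm 2 \<Omega> (u i \<tau> - v i \<tau>))\<^sup>2" if "t \<in> {0..T}" for t
      using \<tau> that by (simp add: yN ennreal_leI)
  qed (use main in \<open>simp only: yN[OF \<tau>(1)] init A B E \<epsilon>_def\<close>)
qed

end
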